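(* Let $(A_n)_{n\ge1}$ be a sequence of diffusion generators defining regular diffusions $(X^n)_{n\ge1}$, with $X^n_0\sim\nu^n=\delta_0$, on compact intervals $I_n=[0,r_n]$, where $0$ is assumed to be reflecting or entrance for all $n$, and all right boundary points $r_n$ are assumed to be reflecting. Let $0<\lambda_{n,1}<\lambda_{n,2}<\cdots$ be the nonzero eigenvalues of $-A_n$, let $W_{n,j}\sim\mathrm{Exp}(\lambda_{n,j})$ (rate $\lambda_{n,j}$), $j\ge1$, be independent, and let $W_n=\sum_{j=1}^\infty W_{n,j}$, so $\mathbb{E}W_n=\sum_j\lambda_{n,j}^{-1}<\infty$. Then this sequence of diffusions exhibits a separation cut-off if and only if $$\lim_{n\to\infty}\lambda_{n,1}\,\mathbb{E}W_n=\infty,$$ in which case there is a separation cut-off at $(t_n)$ with $t_n:=\mathbb{E}W_n$. Further, for any $c>0$ the following separation bounds hold for any sequence $(t_n)$, where $c\le1$ is required in the second bound: $$\mathrm{sep}(\nu^n_{(1+c)t_n},\pi^n)\le\frac{1}{1+c^2\lambda_{n,1}t_n},\qquad \mathrm{sep}(\nu^n_{(1-c)t_n},\pi^n)\ge1-\frac{1}{1+c^2\lambda_{n,1}t_n}.$$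
   Context: Each $A_n=\frac12 b_n\frac{d^2}{dx^2}+a_n\frac{d}{dx}$ on $I_n^\circ=(0,r_n)$ with $a_n\in C(I_n^\circ)$, $b_n\in C^1(I_n^\circ)$, $b_n>0$; $X^n$ is a regular diffusion (each interior point is reached with positive probability from each interior point) with generator $A_n$. Each $X^n$ has a strong stationary dual diffusion $X^{n,*}$ (as defined below). For a diffusion on an interval $[0,r]$ with coefficients $a,b$: scale function $S'=s=\exp\{-\int^x 2a/b\}$, speed measure $M(dx)$ with density $m=1/(sb)$; with interior $x$ fixed, $N(0)=\int_{(0,x]}[S(x)-S(\eta)]M(d\eta)$, $\Sigma(0)=\int_{(0,x]}[M(x)-M(\eta)]dS(\eta)$, and analogously at $r$. A boundary is entrance if $N<\infty,\Sigma=\infty$ and regular if $N<\infty,\Sigma<\infty$; a regular boundary is (instantaneously) reflecting if functions $f$ in the domain of the generator satisfy $\frac{df}{dS}=\lim f'(x)/s(x)=0$ there. The domain $\mathcal{D}_A$ is the set of $f\in C[0,r]\cap C^2(0,r)$ with $Af\in C[0,r]$ and $\frac{df}{dS}=0$ at each reflecting boundary. The stationary distribution is $M$ normalized; $\pi$ denotes its density, $\Pi(x)=\int_0^x\pi$; $\pi^n$ denotes the stationary distribution of $X^n$. Eigenvalues: $\lambda_{n,j}$ are the $\lambda>0$ for which $A_nv+\lambda v=0$ on $I_n^\circ$ has a nontrivial solution with $\frac{dv}{dS_n}^+(0)=0=\frac{dv}{dS_n}^-(r_n)$ ($S_n$ the scale function of $X^n$). Strong stationary dual (on $[0,r]$):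 with $(\Lambda f)(x)=\int_0^x\frac{\pi(y)}{\Pi(x)}f(y)dy$ for $x>0$, $(\Lambda f)(0)=f(0)$, a Feller diffusion $X^*$ with generator $A^*$, domain $\mathcal{D}_{A^*}$, initial law $\Pi_0^*$ is a strong stationary dual of $X$ (generator $A$, initial law $\Pi_0$) if $\Lambda\mathcal{D}_A\subset\mathcal{D}_{A^*}$, $\Lambda A=A^*\Lambda$ on $\mathcal{D}_A$, and $\int f\,d\Pi_0=\int\Lambda f\,d\Pi_0^*$ for all bounded measurable $f$. Separation: $\nu^n_t$ is the law of $X^n_t$; for $t>0$, $\nu_t^n\ll\pi^n$ and $\mathrm{sep}(\nu^n_t,\pi^n)=1-\operatorname{ess\,inf}\frac{d\nu^n_t}{d\pi^n}$, the essential infimum being with respect to $\pi^n$ (and $\mathrm{sep}=1$ at $t=0$, where the law is $\delta_0$). Cut-off: the sequence exhibits a separation cut-off at $(t_n)$ if for every $\varepsilon\in(0,1)$, $\lim_n\mathrm{sep}(\nu^n_{(1+\varepsilon)t_n},\pi^n)=0$ and $\lim_n\mathrm{sep}(\nu^n_{(1-\varepsilon)t_n},\pi^n)=1$; it exhibits a separation cut-off if it does so at some sequence $(t_n)$.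
   Formalization: The separation bounds are stated for t_n = E W_n (for every n, without assuming a cut-off), not for an arbitrary sequence (t_n), for which they fail: with (1+c)t_n = T fixed and c large, the first right-hand side tends to 0 while the separation at T is positive. *)

theory Defs
  imports "HOL-Probability.Probability"
begin

section \<open>Coefficients, scale, speed, boundary classification\<close>

text \<open>
  State space \<open>{0..r}\<close>. Functions on the state space are functions \<open>real \<Rightarrow> real\<close> whose values
  outside \<open>{0..r}\<close> are irrelevant. All primitives are based at the interior point \<open>r / 2\<close>; a
  different interior base point only rescales \<open>s\<close> and \<open>m\<close> by reciprocal constants, shifts \<open>S\<close> and
  \<open>M\<close> by constants, and does not affect finiteness in the boundary criteria.
\<close>

definition diffusion_coeffs :: "real \<Rightarrow> (real \<Rightarrow> real) \<Rightarrow> (real \<Rightarrow> real) \<Rightarrow> bool" where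
  "diffusion_coeffs r a b \<longleftrightarrow>
     0 < r \<and> continuous_on {0<..<r} a \<and> b C1_differentiable_on {0<..<r} \<and>
     (\<forall>x\<in>{0<..<r}. 0 < b x)"

definition C2_on :: "(real \<Rightarrow> real) \<Rightarrow> real set \<Rightarrow> bool" where
  "C2_on f U \<longleftrightarrow> f C1_differentiable_on U \<and> deriv f C1_differentiable_on U"

definition diff_op :: "(real \<Rightarrow> real) \<Rightarrow> (real \<Rightarrow> real) \<Rightarrow> (real \<Rightarrow> real) \<Rightarrow> real \<Rightarrow> real" where
  "diff_op a b f x = 1 / 2 * b x * deriv (deriv f) x + a x * deriv f x"

definition scale_dens :: "real \<Rightarrow> (real \<Rightarrow> real) \<Rightarrow> (real \<Rightarrow> real) \<Rightarrow> real \<Rightarrow> real" where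
  "scale_dens r a b x = exp (- (LBINT y=ereal (r / 2)..ereal x. 2 * a y / b y))"

definition scale_fun :: "real \<Rightarrow> (real \<Rightarrow> real) \<Rightarrow> (real \<Rightarrow> real) \<Rightarrow> real \<Rightarrow> real" where
  "scale_fun r a b x = (LBINT y=ereal (r / 2)..ereal x. scale_dens r a b y)"

definition speed_dens :: "real \<Rightarrow> (real \<Rightarrow> real) \<Rightarrow> (real \<Rightarrow> real) \<Rightarrow> real \<Rightarrow> real" where
  "speed_dens r a b x = 1 / (scale_dens r a b x * b x)"

definition speed_fun :: "real \<Rightarrow> (real \<Rightarrow> real) \<Rightarrow> (real \<Rightarrow> real) \<Rightarrow> real \<Rightarrow> real" where
  "speed_fun r a b x = (LBINT y=ereal (r / 2)..ereal x. speed_dens r a b y)"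

definition N_left :: "real \<Rightarrow> (real \<Rightarrow> real) \<Rightarrow> (real \<Rightarrow> real) \<Rightarrow> ennreal" where
  "N_left r a b =
     (\<integral>\<^sup>+\<eta>\<in>{0<..r / 2}. ennreal ((scale_fun r a b (r / 2) - scale_fun r a b \<eta>) * speed_dens r a b \<eta>) \<partial>lborel)"

definition Sigma_left :: "real \<Rightarrow> (real \<Rightarrow> real) \<Rightarrow> (real \<Rightarrow> real) \<Rightarrow> ennreal" where
  "Sigma_left r a b =
     (\<integral>\<^sup>+\<eta>\<in>{0<..r / 2}. ennreal ((speed_fun r a b (r / 2) - speed_fun r a b \<eta>) * scale_dens r a b \<eta>) \<partial>lborel)"

definition N_right :: "real \<Rightarrow> (real \<Rightarrow> real) \<Rightarrow> (real \<Rightarrow> real) \<Rightarrow> ennreal" where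
  "N_right r a b =
     (\<integral>\<^sup>+\<eta>\<in>{r / 2..<r}. ennreal ((scale_fun r a b \<eta> - scale_fun r a b (r / 2)) * speed_dens r a b \<eta>) \<partial>lborel)"

definition Sigma_right :: "real \<Rightarrow> (real \<Rightarrow> real) \<Rightarrow> (real \<Rightarrow> real) \<Rightarrow> ennreal" where
  "Sigma_right r a b =
     (\<integral>\<^sup>+\<eta>\<in>{r / 2..<r}. ennreal ((speed_fun r a b \<eta> - speed_fun r a b (r / 2)) * scale_dens r a b \<eta>) \<partial>lborel)"

definition entrance_left :: "real \<Rightarrow> (real \<Rightarrow> real) \<Rightarrow> (real \<Rightarrow> real) \<Rightarrow> bool" where
  "entrance_left r a b \<longleftrightarrow> N_left r a b < \<infinity> \<and> Sigma_left r a b = \<infinity>"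

definition regular_left :: "real \<Rightarrow> (real \<Rightarrow> real) \<Rightarrow> (real \<Rightarrow> real) \<Rightarrow> bool" where
  "regular_left r a b \<longleftrightarrow> N_left r a b < \<infinity> \<and> Sigma_left r a b < \<infinity>"

definition regular_right :: "real \<Rightarrow> (real \<Rightarrow> real) \<Rightarrow> (real \<Rightarrow> real) \<Rightarrow> bool" where
  "regular_right r a b \<longleftrightarrow> N_right r a b < \<infinity> \<and> Sigma_right r a b < \<infinity>"

definition zero_flux_left :: "real \<Rightarrow> (real \<Rightarrow> real) \<Rightarrow> (real \<Rightarrow> real) \<Rightarrow> (real \<Rightarrow> real) \<Rightarrow> bool" where
  "zero_flux_left r a b f \<longleftrightarrow> ((\<lambda>x. deriv f x / scale_dens r a b x) \<longlongrightarrow> 0) (at_right 0)"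

definition zero_flux_right :: "real \<Rightarrow> (real \<Rightarrow> real) \<Rightarrow> (real \<Rightarrow> real) \<Rightarrow> (real \<Rightarrow> real) \<Rightarrow> bool" where
  "zero_flux_right r a b f \<longleftrightarrow> ((\<lambda>x. deriv f x / scale_dens r a b x) \<longlongrightarrow> 0) (at_left r)"

section \<open>Feller diffusions and their generators\<close>

text \<open>
  A process is given by its family of laws \<open>P x\<close> (the process started at \<open>x \<in> {0..r}\<close>), all on one
  measurable space, together with coordinate maps \<open>X t\<close>, \<open>t \<ge> 0\<close>.
\<close>

definition transition :: "(real \<Rightarrow> 'w measure) \<Rightarrow> (real \<Rightarrow> 'w \<Rightarrow> real) \<Rightarrow> real \<Rightarrow> real \<Rightarrow> real measure" where
  "transition P X t x = distr (P x) borel (X t)"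

definition semigroup_op :: "(real \<Rightarrow> 'w measure) \<Rightarrow> (real \<Rightarrow> 'w \<Rightarrow> real) \<Rightarrow> real \<Rightarrow> (real \<Rightarrow> real) \<Rightarrow> real \<Rightarrow> real" where
  "semigroup_op P X t f x = (\<integral>\<omega>. f (X t \<omega>) \<partial>P x)"

definition past_events :: "'w set \<Rightarrow> (real \<Rightarrow> 'w \<Rightarrow> real) \<Rightarrow> real \<Rightarrow> 'w set set" where
  "past_events Om X s = sigma_sets Om {X u -` B \<inter> Om |u B. 0 \<le> u \<and> u \<le> s \<and> B \<in> sets borel}"

definition feller_diffusion :: "real \<Rightarrow> (real \<Rightarrow> 'w measure) \<Rightarrow> (real \<Rightarrow> 'w \<Rightarrow> real) \<Rightarrow> bool" where
  "feller_diffusion r P X \<longleftrightarrow>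
     (\<forall>x\<in>{0..r}. prob_space (P x) \<and> sets (P x) = sets (P 0)) \<and>
     (\<forall>t\<ge>0. X t \<in> P 0 \<rightarrow>\<^sub>M borel) \<and>
     (\<forall>t\<ge>0. \<forall>\<omega>\<in>space (P 0). X t \<omega> \<in> {0..r}) \<and>
     (\<forall>\<omega>\<in>space (P 0). continuous_on {0..} (\<lambda>t. X t \<omega>)) \<and>
     (\<forall>x\<in>{0..r}. AE \<omega> in P x. X 0 \<omega> = x) \<and>
     (\<forall>t\<ge>0. transition P X t \<in> restrict_space borel {0..r} \<rightarrow>\<^sub>M prob_algebra borel) \<and>
     (\<forall>x\<in>{0..r}. \<forall>s\<ge>0. \<forall>t\<ge>0. \<forall>E\<in>past_events (space (P 0)) X s. \<forall>B\<in>sets borel.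
        measure (P x) (E \<inter> {\<omega>\<in>space (P 0). X (s + t) \<omega> \<in> B}) =
        (\<integral>\<omega>\<in>E. measure (transition P X t (X s \<omega>)) B \<partial>P x)) \<and>
     (\<forall>f. continuous_on {0..r} f \<longrightarrow>
        (\<forall>t\<ge>0. continuous_on {0..r} (semigroup_op P X t f)) \<and>
        uniform_limit {0..r} (\<lambda>t. semigroup_op P X t f) f (at_right 0))"

text \<open>
  Generators are handled as graphs: \<open>inf_generator r P X f g\<close> says that \<open>f\<close> is in the domain and
  that the generator maps \<open>f\<close> to \<open>g\<close> (as elements of \<open>C[0,r]\<close> with the supremum norm).
\<close>

definition inf_generator :: "real \<Rightarrow> (real \<Rightarrow> 'w measure) \<Rightarrow> (real \<Rightarrow> 'w \<Rightarrow> real) \<Rightarrow>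
    (real \<Rightarrow> real) \<Rightarrow> (real \<Rightarrow> real) \<Rightarrow> bool" where
  "inf_generator r P X f g \<longleftrightarrow>
     continuous_on {0..r} f \<and> continuous_on {0..r} g \<and>
     uniform_limit {0..r} (\<lambda>t x. (semigroup_op P X t f x - f x) / t) g (at_right 0)"

definition reflecting_left :: "real \<Rightarrow> (real \<Rightarrow> real) \<Rightarrow> (real \<Rightarrow> real) \<Rightarrow>
    (real \<Rightarrow> 'w measure) \<Rightarrow> (real \<Rightarrow> 'w \<Rightarrow> real) \<Rightarrow> bool" where
  "reflecting_left r a b P X \<longleftrightarrow>
     regular_left r a b \<and> (\<forall>f g. inf_generator r P X f g \<longrightarrow> zero_flux_left r a b f)"

definition reflecting_right :: "real \<Rightarrow> (real \<Rightarrow> real) \<Rightarrow> (real \<Rightarrow> real) \<Rightarrow>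
    (real \<Rightarrow> 'w measure) \<Rightarrow> (real \<Rightarrow> 'w \<Rightarrow> real) \<Rightarrow> bool" where
  "reflecting_right r a b P X \<longleftrightarrow>
     regular_right r a b \<and> (\<forall>f g. inf_generator r P X f g \<longrightarrow> zero_flux_right r a b f)"

text \<open>
  The graph of \<open>(A, D\<^sub>A)\<close>, with \<open>g\<close> the continuous extension of \<open>A f\<close> from the open interval to
  \<open>{0..r}\<close>; the two flags say which boundaries are reflecting.
\<close>

definition diffusion_graph :: "real \<Rightarrow> (real \<Rightarrow> real) \<Rightarrow> (real \<Rightarrow> real) \<Rightarrow> bool \<Rightarrow> bool \<Rightarrow>
    (real \<Rightarrow> real) \<Rightarrow> (real \<Rightarrow> real) \<Rightarrow> bool" where
  "diffusion_graph r a b refl0 reflr f g \<longleftrightarrow>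
     continuous_on {0..r} f \<and> C2_on f {0<..<r} \<and>
     continuous_on {0..r} g \<and> (\<forall>x\<in>{0<..<r}. g x = diff_op a b f x) \<and>
     (refl0 \<longrightarrow> zero_flux_left r a b f) \<and> (reflr \<longrightarrow> zero_flux_right r a b f)"

definition regular_diffusion :: "real \<Rightarrow> (real \<Rightarrow> real) \<Rightarrow> (real \<Rightarrow> real) \<Rightarrow>
    (real \<Rightarrow> 'w measure) \<Rightarrow> (real \<Rightarrow> 'w \<Rightarrow> real) \<Rightarrow> bool" where
  "regular_diffusion r a b P X \<longleftrightarrow>
     diffusion_coeffs r a b \<and> feller_diffusion r P X \<and>
     (\<forall>f g. inf_generator r P X f g \<longleftrightarrow>
        diffusion_graph r a b (reflecting_left r a b P X) (reflecting_right r a b P X) f g) \<and>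
     (\<forall>x\<in>{0<..<r}. \<forall>y\<in>{0<..<r}. 0 < measure (P x) {\<omega>\<in>space (P x). \<exists>t\<ge>0. X t \<omega> = y})"

section \<open>Stationary distribution, strong stationary dual, eigenvalues\<close>

definition stat_dens :: "real \<Rightarrow> (real \<Rightarrow> real) \<Rightarrow> (real \<Rightarrow> real) \<Rightarrow> real \<Rightarrow> real" where
  "stat_dens r a b x =
     indicator {0<..<r} x * speed_dens r a b x / (LBINT y:{0<..<r}. speed_dens r a b y)"

definition stat_measure :: "real \<Rightarrow> (real \<Rightarrow> real) \<Rightarrow> (real \<Rightarrow> real) \<Rightarrow> real measure" where
  "stat_measure r a b = density lborel (\<lambda>x. ennreal (stat_dens r a b x))"

definition stat_cdf :: "real \<Rightarrow> (real \<Rightarrow> real) \<Rightarrow> (real \<Rightarrow> real) \<Rightarrow> real \<Rightarrow> real" where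
  "stat_cdf r a b x = (LBINT y:{0..x}. stat_dens r a b y)"

definition dual_link :: "real \<Rightarrow> (real \<Rightarrow> real) \<Rightarrow> (real \<Rightarrow> real) \<Rightarrow> (real \<Rightarrow> real) \<Rightarrow> real \<Rightarrow> real" where
  "dual_link r a b f x =
     (if x = 0 then f 0 else (LBINT y:{0..x}. stat_dens r a b y / stat_cdf r a b x * f y))"

text \<open>
  \<open>(P, X)\<close> with initial law \<open>Pi0\<close> is the primal diffusion with coefficients \<open>a, b\<close>;
  \<open>(Pd, Xd)\<close> with initial law \<open>Pi0d\<close> is the dual. In terms of graphs, the condition on generators
  says \<open>\<Lambda> D\<^sub>A \<subseteq> D\<close> and \<open>\<Lambda> A = A\<^sup>* \<Lambda>\<close> on \<open>D\<^sub>A\<close>, where \<open>D\<close> is the domain of the dual generator \<open>A\<^sup>*\<close>.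
\<close>

definition strong_stationary_dual :: "real \<Rightarrow> (real \<Rightarrow> real) \<Rightarrow> (real \<Rightarrow> real) \<Rightarrow>
    (real \<Rightarrow> 'w measure) \<Rightarrow> (real \<Rightarrow> 'w \<Rightarrow> real) \<Rightarrow> real measure \<Rightarrow>
    (real \<Rightarrow> 'd measure) \<Rightarrow> (real \<Rightarrow> 'd \<Rightarrow> real) \<Rightarrow> real measure \<Rightarrow> bool" where
  "strong_stationary_dual r a b P X Pi0 Pd Xd Pi0d \<longleftrightarrow>
     feller_diffusion r Pd Xd \<and>
     prob_space Pi0d \<and> sets Pi0d = sets borel \<and> measure Pi0d {0..r} = 1 \<and>
     (\<forall>f g. inf_generator r P X f g \<longrightarrow>
        inf_generator r Pd Xd (dual_link r a b f) (dual_link r a b g)) \<and>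
     (\<forall>f\<in>borel_measurable borel. bounded (range f) \<longrightarrow>
        (\<integral>x. f x \<partial>Pi0) = (\<integral>x\<in>{0..r}. dual_link r a b f x \<partial>Pi0d))"

definition is_eigenvalue :: "real \<Rightarrow> (real \<Rightarrow> real) \<Rightarrow> (real \<Rightarrow> real) \<Rightarrow> real \<Rightarrow> bool" where
  "is_eigenvalue r a b l \<longleftrightarrow>
     (\<exists>v. C2_on v {0<..<r} \<and> (\<forall>x\<in>{0<..<r}. diff_op a b v x + l * v x = 0) \<and>
        (\<exists>x\<in>{0<..<r}. v x \<noteq> 0) \<and> zero_flux_left r a b v \<and> zero_flux_right r a b v)"

section \<open>Separation and cut-off\<close>

text \<open>
  \<open>Liminf (ae_filter \<pi>)\<close> is the essential infimum with respect to \<open>\<pi>\<close> (dual to \<^const>\<open>esssup\<close>).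
  If \<open>\<nu>\<close> has no density with respect to \<open>\<pi>\<close>, then \<^const>\<open>RN_deriv\<close> is \<open>0\<close> and the separation is \<open>1\<close>;
  this is the intended value for \<open>\<nu> = \<delta>\<^sub>0\<close> at time \<open>0\<close>.
\<close>

definition separation :: "real measure \<Rightarrow> real measure \<Rightarrow> real" where
  "separation \<nu> \<pi> = 1 - enn2real (Liminf (ae_filter \<pi>) (RN_deriv \<pi> \<nu>))"

definition cutoff_at :: "(nat \<Rightarrow> real \<Rightarrow> real) \<Rightarrow> (nat \<Rightarrow> real) \<Rightarrow> bool" where
  "cutoff_at sep t \<longleftrightarrow>
     (\<forall>n. 0 \<le> t n) \<and>
     (\<forall>\<epsilon>\<in>{0<..<1}. (\<lambda>n. sep n ((1 + \<epsilon>) * t n)) \<longlonglongrightarrow> 0 \<and> (\<lambda>n. sep n ((1 - \<epsilon>) * t n)) \<longlonglongrightarrow> 1)"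

text \<open>Families \<open>W j\<close> are indexed by \<open>j \<ge> 1\<close>.\<close>

definition series_sum :: "(nat \<Rightarrow> 'q \<Rightarrow> real) \<Rightarrow> 'q \<Rightarrow> real" where
  "series_sum W \<omega> = (\<Sum>j. W (Suc j) \<omega>)"

end

theory Submission
  imports Defs "HOL-Complex_Analysis.Complex_Analysis"
begin

text \<open>
  Intertwining with the dual and Laplace inversion show that the law of \<open>X\<^sub>t\<close> started at \<open>0\<close> has a
  decreasing density with respect to \<open>\<pi>\<close> whose essential infimum is \<open>F t = P\<^sup>*\<^sub>t(0, {r})\<close>, so the
  separation is \<open>1 - F t\<close>. The resolvent equation of \<open>X\<close> is that of a string, with entire
  characteristic function \<open>D\<close>, and the Laplace transform of \<open>F\<close> at \<open>\<mu>\<close> is \<open>1 / (\<mu> * D \<mu>)\<close>. The zeros of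
  \<open>D\<close> are the \<open>- \<lambda>\<^sub>j\<close>, and \<open>D\<close> has minimal exponential type, so \<open>D \<mu>\<close> is the product of the
  \<open>1 + \<mu> / \<lambda>\<^sub>j\<close>. Hence \<open>F\<close> and the distribution function of \<open>W\<close> are monotone with the same Laplace
  transform, the separation is a tail probability of \<open>W\<close> up to an arbitrarily small shift of time,
  and Cantelli's inequality with \<open>Var W \<le> E W / \<lambda>\<^sub>1\<close> gives the bounds.
\<close>

section \<open>Exponential laws and Laplace transforms\<close>

text \<open>At an entrance boundary the scale density \<open>s\<close> is not integrable at 0. What
  the boundary hypothesis supplies is integrability of \<open>s M\<close>, so every estimate near 0
  runs through its primitive \<open>U\<close>, and iterated integrals are bounded by
  \<open>U^k / k!\<close>. Reality and simplicity of the zeros of \<open>D\<close> both come from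
  one estimate, a lower bound of |D z| by a multiple of |Im z| on each disc. Minimal type comes from
  cutting the interval where \<open>U\<close> is small: the exponent is \<mu> times that small value
  before the cut and of order sqrt \<mu> after it. The density formula for the law of X requires the
  dual to leave 0 immediately, which is not part of the definition of a dual; it is derived from
  stationarity and the resolvent equation. \<open>F\<close> is only known to be monotone, so
  equality of transforms is exploited through the fact that a function with zero transform cannot be
  positive on an interval. The resulting shift of time disappears because the final bounds are
  continuous in \<open>c\<close>.\<close>

lemma borel_measurable_caratheodory:
  fixes \<phi> :: "real \<Rightarrow> 'b \<Rightarrow> real"
  assumes m: "\<And>t. \<phi> t \<in> borel_measurable N" and c: "\<And>y. y \<in> space N \<Longrightarrow> continuous_on UNIV (\<lambda>t. \<phi> t y)"
  shows "(\<lambda>p. \<phi> (fst p) (snd p)) \<in> borel_measurable (borel \<Otimes>\<^sub>M N)"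
proof (rule borel_measurable_LIMSEQ_real[where u="\<lambda>n p. \<phi> (real_of_int \<lfloor>real (Suc n) * fst p\<rfloor> / real (Suc n)) (snd p)"])
  fix n :: nat
  show "(\<lambda>p. \<phi> (real_of_int \<lfloor>real (Suc n) * fst p\<rfloor> / real (Suc n)) (snd p)) \<in> borel_measurable (borel \<Otimes>\<^sub>M N)"
  \<comment> \<open>The time is rounded down to a grid. It then takes countably many values, and for
    each of them the function is measurable in the second variable; continuity in time gives the
    limit.\<close>
  proof (rule measurable_compose_countable[where f="\<lambda>i p. \<phi> (real_of_int i / real (Suc n)) (snd p)" and g="\<lambda>p. \<lfloor>real (Suc n) * fst p\<rfloor>"])
    show "(\<lambda>p. \<lfloor>real (Suc n) * fst p\<rfloor>) \<in> borel \<Otimes>\<^sub>M N \<rightarrow>\<^sub>M count_space UNIV" by measurable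
    fix i :: int
    show "(\<lambda>p. \<phi> (real_of_int i / real (Suc n)) (snd p)) \<in> borel_measurable (borel \<Otimes>\<^sub>M N)"
      using m by measurable
  qed
next
  fix p assume p: "p \<in> space (borel \<Otimes>\<^sub>M N :: (real \<times> 'b) measure)"
  have lim: "(\<lambda>n. real_of_int \<lfloor>real (Suc n) * fst p\<rfloor> / real (Suc n)) \<longlonglongrightarrow> fst p"
  proof (rule tendsto_sandwich[where f="\<lambda>n. fst p - 1 / real (Suc n)" and h="\<lambda>n. fst p"])
    show "(\<lambda>n. fst p - 1 / real (Suc n)) \<longlonglongrightarrow> fst p"
      using tendsto_diff[OF tendsto_const lim_1_over_n[THEN LIMSEQ_Suc]] by force
    show "(\<lambda>n. fst p) \<longlonglongrightarrow> fst p" by simp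
    show "\<forall>\<^sub>F n in sequentially. fst p - 1 / real (Suc n) \<le> real_of_int \<lfloor>real (Suc n) * fst p\<rfloor> / real (Suc n)"
    proof (intro always_eventually allI)
      fix n
      have "real (Suc n) * fst p - 1 \<le> real_of_int \<lfloor>real (Suc n) * fst p\<rfloor>" by linarith
      then have "(real (Suc n) * fst p - 1) / real (Suc n) \<le> real_of_int \<lfloor>real (Suc n) * fst p\<rfloor> / real (Suc n)"
        by (rule divide_right_mono) simp
      then show "fst p - 1 / real (Suc n) \<le> real_of_int \<lfloor>real (Suc n) * fst p\<rfloor> / real (Suc n)"
        by (simp add: diff_divide_distrib)
    qed
    show "\<forall>\<^sub>F n in sequentially. real_of_int \<lfloor>real (Suc n) * fst p\<rfloor> / real (Suc n) \<le> fst p"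
    proof (intro always_eventually allI)
      fix n
      have "real_of_int \<lfloor>real (Suc n) * fst p\<rfloor> \<le> fst p * real (Suc n)" by (simp add: mult.commute)
      then show "real_of_int \<lfloor>real (Suc n) * fst p\<rfloor> / real (Suc n) \<le> fst p"
        by (subst pos_divide_le_eq) auto
    qed
  qed
  have "isCont (\<lambda>t. \<phi> t (snd p)) (fst p)"
    using c[of "snd p"] p by (simp add: space_pair_measure continuous_on_eq_continuous_at mem_Times_iff)
  then show "(\<lambda>n. \<phi> (real_of_int \<lfloor>real (Suc n) * fst p\<rfloor> / real (Suc n)) (snd p)) \<longlonglongrightarrow> \<phi> (fst p) (snd p)"
    by (rule isCont_tendsto_compose[OF _ lim])
qed

text \<open>Integrating against \<open>exp_law \<mu>\<close> is \<mu> times the Laplace transform at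
  \<mu>. In this normalisation the transform of a bounded function is an average under a probability
  measure, and constants are their own transforms.\<close>

abbreviation exp_law :: "real \<Rightarrow> real measure" where
  "exp_law \<mu> \<equiv> density lborel (exponential_density \<mu>)"

lemma exp_law_prob: "0 < \<mu> \<Longrightarrow> prob_space (exp_law \<mu>)"
  by (rule prob_space_exponential_density)

lemma integral_exp_law:
  fixes \<phi> :: "real \<Rightarrow> real"
  assumes "0 < \<mu>" "\<phi> \<in> borel_measurable borel"
  shows "(\<integral>t. \<phi> t \<partial>exp_law \<mu>) = (\<integral>t. exponential_density \<mu> t * \<phi> t \<partial>lborel)"
    "integrable (exp_law \<mu>) \<phi> \<longleftrightarrow> integrable lborel (\<lambda>t. exponential_density \<mu> t * \<phi> t)"
  using assms exponential_density_nonneg[OF assms(1)]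
  by (simp_all add: integral_real_density integrable_real_density)

lemma exp_law_bounded_integrable:
  fixes \<phi> :: "real \<Rightarrow> real"
  assumes "0 < \<mu>" "\<phi> \<in> borel_measurable borel" "\<And>t. 0 \<le> t \<Longrightarrow> \<bar>\<phi> t\<bar> \<le> B"
  shows "integrable (exp_law \<mu>) \<phi>"
proof -
  interpret prob_space "exp_law \<mu>" by (rule exp_law_prob[OF assms(1)])
  have "AE t in exp_law \<mu>. 0 \<le> t"
    by (subst AE_density) (auto simp: exponential_density_def)
  then show ?thesis
    by (intro integrable_const_bound[where B=B]) (use assms in auto)
qed

lemma exp_law_AE: "AE t in exp_law \<mu>. 0 \<le> t"
  by (subst AE_density) (auto simp: exponential_density_def)

text \<open>This is the memoryless property: an exponential time that exceeds \<open>h\<close> is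
  distributed as \<open>t + h\<close>, and it does so with probability
  \<open>exp (- \<mu> * h)\<close>.\<close>

lemma exp_law_shift:
  fixes \<phi> :: "real \<Rightarrow> real"
  assumes \<mu>: "0 < \<mu>" and m: "\<phi> \<in> borel_measurable borel" and B: "\<And>t. 0 \<le> t \<Longrightarrow> \<bar>\<phi> t\<bar> \<le> B" and h: "0 \<le> h"
  shows "(\<integral>t. \<phi> (t + h) \<partial>exp_law \<mu>) = exp (\<mu> * h) * ((\<integral>t. \<phi> t \<partial>exp_law \<mu>) - (\<integral>t. indicator {..<h} t * \<phi> t \<partial>exp_law \<mu>))"
proof -
  note [measurable] = m
  have i1: "integrable (exp_law \<mu>) \<phi>" by (rule exp_law_bounded_integrable[OF \<mu> m B])
  have i2: "integrable (exp_law \<mu>) (\<lambda>t. indicator {..<h} t * \<phi> t)"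
    by (rule exp_law_bounded_integrable[OF \<mu>, where B=B]) (use B in \<open>auto simp: indicator_def intro: order_trans[OF abs_ge_zero]\<close>)
  have "(\<integral>t. \<phi> (t + h) \<partial>exp_law \<mu>) = (\<integral>t. exponential_density \<mu> t * \<phi> (t + h) \<partial>lborel)"
    by (rule integral_exp_law[OF \<mu>]) measurable
  also have "\<dots> = (\<integral>t. exponential_density \<mu> (t - h) * \<phi> t \<partial>lborel)"
    using lborel_integral_real_affine[of 1 "\<lambda>t. exponential_density \<mu> (t - h) * \<phi> t" h] by (simp add: add.commute)
  also have "\<dots> = (\<integral>t. exp (\<mu> * h) * (exponential_density \<mu> t * (\<phi> t - indicator {..<h} t * \<phi> t)) \<partial>lborel)"
    using h by (intro Bochner_Integration.integral_cong)
      (auto simp: exponential_density_def indicator_def mult_exp_exp algebra_simps)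
  also have "\<dots> = exp (\<mu> * h) * (\<integral>t. exponential_density \<mu> t * (\<phi> t - indicator {..<h} t * \<phi> t) \<partial>lborel)"
    by simp
  also have "(\<integral>t. exponential_density \<mu> t * (\<phi> t - indicator {..<h} t * \<phi> t) \<partial>lborel) = (\<integral>t. \<phi> t - indicator {..<h} t * \<phi> t \<partial>exp_law \<mu>)"
    by (rule integral_exp_law(1)[OF \<mu>, symmetric]) measurable
  also have "\<dots> = (\<integral>t. \<phi> t \<partial>exp_law \<mu>) - (\<integral>t. indicator {..<h} t * \<phi> t \<partial>exp_law \<mu>)"
    by (rule Bochner_Integration.integral_diff[OF i1 i2])
  finally show ?thesis .
qed

lemma exp_law_indicator:
  assumes \<mu>: "0 < \<mu>" and h: "0 \<le> h"
  shows "(\<integral>t. indicator {..<h} t \<partial>exp_law \<mu>) = 1 - exp (- (\<mu> * h))"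
proof -
  interpret prob_space "exp_law \<mu>" by (rule exp_law_prob[OF \<mu>])
  have "1 = exp (\<mu> * h) * (1 - (\<integral>t. indicator {..<h} t \<partial>exp_law \<mu>))"
    using exp_law_shift[OF \<mu> borel_measurable_const[of 1 borel], of 1 h] h prob_space
    by (simp del: integral_indicator)
  then have "exp (- (\<mu> * h)) * 1 = exp (- (\<mu> * h)) * (exp (\<mu> * h) * (1 - (\<integral>t. indicator {..<h} t \<partial>exp_law \<mu>)))"
    by (rule arg_cong)
  then show ?thesis by (simp add: mult.assoc[symmetric] exp_add[symmetric])
qed

text \<open>After the substitution x = exp (-t) the transforms at integers are moments, so
  \<open>q\<close> is orthogonal to all polynomials in exp (-t), hence by Weierstrass to every
  continuous function of it. Testing with a nonnegative bump supported on \<open>{a..b}\<close>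
  contradicts positivity there. Asking for positivity on an interval makes the lemma usable for
  functions that are monotone but perhaps discontinuous.\<close>

lemma laplace_transform_zero:
  fixes q :: "real \<Rightarrow> real"
  assumes q[measurable]: "q \<in> borel_measurable borel" and B: "\<And>t. 0 \<le> t \<Longrightarrow> \<bar>q t\<bar> \<le> B"
    and zero: "\<And>\<mu>. 0 < \<mu> \<Longrightarrow> (\<integral>t. q t \<partial>exp_law \<mu>) = 0"
    and ab: "0 \<le> a" "a < b" and pos: "\<And>t. a \<le> t \<Longrightarrow> t \<le> b \<Longrightarrow> 0 < q t"
  shows False
proof -
  interpret E: prob_space "exp_law 1" by (rule exp_law_prob) simp
  have B0: "0 \<le> B" using B[of 0] by auto
  have int: "integrable (exp_law 1) (\<lambda>t. f t * q t)" if [measurable]: "f \<in> borel_measurable borel" and "\<And>t. 0 \<le> t \<Longrightarrow> \<bar>f t\<bar> \<le> C" for f :: "real \<Rightarrow> real" and C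
  proof (rule exp_law_bounded_integrable[where B="C * B"])
    show "\<bar>f t * q t\<bar> \<le> C * B" if "0 \<le> t" for t
      unfolding abs_mult using \<open>\<And>t. 0 \<le> t \<Longrightarrow> \<bar>f t\<bar> \<le> C\<close>[OF that] B[OF that] by (intro mult_mono) auto
  qed auto
  have e1: "0 \<le> exp (- t) \<and> exp (- t) \<le> 1" if "0 \<le> t" for t :: real using that by simp
  have pw: "(\<integral>t. exp (- t) ^ n * q t \<partial>exp_law 1) = 0" for n :: nat
  proof -
    have "(\<integral>t. exp (- t) ^ n * q t \<partial>exp_law 1) = (\<integral>t. exponential_density 1 t * (exp (- t) ^ n * q t) \<partial>lborel)"
      by (rule integral_exp_law) auto
    also have "\<dots> = (\<integral>t. (1 / real (Suc n)) * (exponential_density (real (Suc n)) t * q t) \<partial>lborel)"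
      by (intro Bochner_Integration.integral_cong)
        (auto simp: exponential_density_def exp_of_nat_mult[symmetric] exp_add[symmetric] field_simps)
    also have "\<dots> = (1 / real (Suc n)) * (\<integral>t. q t \<partial>exp_law (real (Suc n)))"
      by (subst integral_exp_law) auto
    finally show ?thesis using zero[of "real (Suc n)"] by simp
  qed
  \<comment> \<open>At x = exp (-t) this is positive exactly for a < t < b, and it is continuous, as
    the approximation by polynomials on the unit interval demands.\<close>
  define \<psi> :: "real \<Rightarrow> real" where "\<psi> x = max 0 ((x - exp (- b)) * (exp (- a) - x))" for x
  have c\<psi>: "continuous_on A \<psi>" for A unfolding \<psi>_def by (intro continuous_intros)
  have m\<psi>[measurable]: "\<psi> \<in> borel_measurable borel" by (intro borel_measurable_continuous_onI c\<psi>)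
  define I where "I = (\<integral>t. \<psi> (exp (- t)) * q t \<partial>exp_law 1)"
  have b\<psi>: "\<bar>\<psi> (exp (- t))\<bar> \<le> 1" if t: "0 \<le> t" for t
  proof -
    have "(exp (- t) - exp (- b)) * (exp (- a) - exp (- t)) \<le> 1"
    proof (cases "a \<le> t \<and> t \<le> b")
      case True
      have "exp (- t) - exp (- b) \<le> 1" "exp (- a) - exp (- t) \<le> 1" using e1[OF t] e1[of a] ab exp_ge_zero[of "-b"] by linarith+
      then show ?thesis using True mult_le_one[of "exp (- t) - exp (- b)" "exp (- a) - exp (- t)"] by simp
    next
      case False
      then have "(exp (- t) - exp (- b)) * (exp (- a) - exp (- t)) \<le> 0"
        using ab by (auto simp: mult_le_0_iff)
      then show ?thesis by simp
    qed
    then show ?thesis by (simp add: \<psi>_def)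
  qed
  have i\<psi>: "integrable (exp_law 1) (\<lambda>t. \<psi> (exp (- t)) * q t)"
    by (rule int[of "\<lambda>t. \<psi> (exp (- t))" 1]) (use b\<psi> in auto)
  have "\<bar>I\<bar> \<le> e * B" if e: "0 < e" for e
  proof -
    obtain g where g: "real_polynomial_function g" "\<And>x. x \<in> {0..1} \<Longrightarrow> \<bar>\<psi> x - g x\<bar> < e"
      using Stone_Weierstrass_real_polynomial_function[OF compact_Icc c\<psi> e, of 0 1] by metis
    obtain c n where gs: "g = (\<lambda>x. \<Sum>i\<le>n. c i * x ^ i)" using g(1) real_polynomial_function_iff_sum by auto
    have mg[measurable]: "g \<in> borel_measurable borel" unfolding gs by measurable
    have ii: "integrable (exp_law 1) (\<lambda>t. exp (- t) ^ i * q t)" for i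
      by (rule int[of "\<lambda>t. exp (- t) ^ i" 1]) (auto intro: power_le_one)
    have "(\<integral>t. g (exp (- t)) * q t \<partial>exp_law 1) = (\<integral>t. (\<Sum>i\<le>n. c i * (exp (- t) ^ i * q t)) \<partial>exp_law 1)"
      by (simp add: gs sum_distrib_right mult.assoc)
    also have "\<dots> = (\<Sum>i\<le>n. c i * (\<integral>t. exp (- t) ^ i * q t \<partial>exp_law 1))"
      using ii by (subst Bochner_Integration.integral_sum) auto
    also have "\<dots> = 0" using pw by simp
    finally have g0: "(\<integral>t. g (exp (- t)) * q t \<partial>exp_law 1) = 0" .
    have ig: "integrable (exp_law 1) (\<lambda>t. g (exp (- t)) * q t)"
      unfolding gs sum_distrib_right mult.assoc using ii by (intro Bochner_Integration.integrable_sum integrable_mult_right) auto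
    have "I = (\<integral>t. \<psi> (exp (- t)) * q t - g (exp (- t)) * q t \<partial>exp_law 1)"
      unfolding I_def by (simp add: Bochner_Integration.integral_diff[OF i\<psi> ig] g0)
    also have "\<bar>\<dots>\<bar> \<le> (\<integral>t. \<bar>\<psi> (exp (- t)) * q t - g (exp (- t)) * q t\<bar> \<partial>exp_law 1)"
      by (rule integral_abs_bound)
    also have "\<dots> \<le> (\<integral>t. e * B \<partial>exp_law 1)"
    proof (rule integral_mono_AE)
      show "AE t in exp_law 1. \<bar>\<psi> (exp (- t)) * q t - g (exp (- t)) * q t\<bar> \<le> e * B"
        using exp_law_AE
      proof eventually_elim
        case (elim t)
        have "exp (- t) \<in> {0..1}" using e1[OF elim] by simp
        from mult_mono[OF less_imp_le[OF g(2)[OF this]] B[OF elim] less_imp_le[OF e] abs_ge_zero]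
        have "\<bar>\<psi> (exp (- t)) - g (exp (- t))\<bar> * \<bar>q t\<bar> \<le> e * B" .
        then show ?case by (simp add: abs_mult[symmetric] left_diff_distrib)
      qed
    qed (use i\<psi> ig in auto)
    also have "\<dots> = e * B" using E.prob_space by simp
    finally show ?thesis .
  qed
  then have "\<bar>I\<bar> \<le> 0 + d" if "0 < d" for d
    using that[THEN divide_pos_pos, of "B + 1"] B0 mult_left_mono[of B "B + 1" "d / (B + 1)"]
    by (smt (verit) divide_nonneg_nonneg nonzero_eq_divide_eq)
  then have I0: "I = 0" using field_le_epsilon[of "\<bar>I\<bar>" 0] by auto
  have nn: "0 \<le> \<psi> (exp (- t)) * q t" for t
  proof (cases "a \<le> t \<and> t \<le> b")
    case True
    then show ?thesis using pos[of t] by (simp add: \<psi>_def)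
  next
    case False
    then have "(exp (- t) - exp (- b)) * (exp (- a) - exp (- t)) \<le> 0"
      using ab by (auto simp: mult_le_0_iff)
    then show ?thesis by (simp add: \<psi>_def)
  qed
  have "AE t in exp_law 1. \<psi> (exp (- t)) * q t = 0"
    using integral_nonneg_eq_0_iff_AE[OF i\<psi>] nn I0 by (simp add: I_def)
  then have "AE t in lborel. 0 < exponential_density 1 t \<longrightarrow> \<psi> (exp (- t)) * q t = 0"
    by (subst (asm) AE_density) auto
  then have "AE t in lborel. t \<notin> {a<..<b}"
  proof eventually_elim
    case (elim t)
    show ?case
    proof
      assume t: "t \<in> {a<..<b}"
      then have "0 < (exp (- t) - exp (- b)) * (exp (- a) - exp (- t))" by simp
      then have "0 < \<psi> (exp (- t)) * q t" using pos[of t] t by (simp add: \<psi>_def)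
      moreover have "0 < exponential_density 1 t" using t ab by (simp add: exponential_density_def)
      ultimately show False using elim by simp
    qed
  qed
  then have "emeasure lborel {a<..<b} = 0"
    by (subst (asm) AE_iff_measurable[of "{a<..<b}"]) auto
  then show False using ab by simp
qed

text \<open>By continuity a strict inequality at \<open>t\<close> persists on a short interval to
  the right of \<open>t\<close>, where \<open>laplace_transform_zero\<close> applies.\<close>

lemma laplace_transform_inj:
  fixes f g :: "real \<Rightarrow> real"
  assumes cf: "continuous_on UNIV f" and cg: "continuous_on UNIV g"
    and B: "\<And>t. 0 \<le> t \<Longrightarrow> \<bar>f t\<bar> \<le> B" "\<And>t. 0 \<le> t \<Longrightarrow> \<bar>g t\<bar> \<le> B"
    and eq: "\<And>\<mu>. 0 < \<mu> \<Longrightarrow> (\<integral>t. f t \<partial>exp_law \<mu>) = (\<integral>t. g t \<partial>exp_law \<mu>)"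
    and t: "0 \<le> t"
  shows "f t = g t"
proof -
  have aux: False if cf: "continuous_on UNIV f" and cg: "continuous_on UNIV g"
    and B: "\<And>t. 0 \<le> t \<Longrightarrow> \<bar>f t\<bar> \<le> B" "\<And>t. 0 \<le> t \<Longrightarrow> \<bar>g t\<bar> \<le> B"
    and eq: "\<And>\<mu>. 0 < \<mu> \<Longrightarrow> (\<integral>t. f t \<partial>exp_law \<mu>) = (\<integral>t. g t \<partial>exp_law \<mu>)"
    and less: "g t < f t" for f g :: "real \<Rightarrow> real"
  proof -
    have m[measurable]: "f \<in> borel_measurable borel" "g \<in> borel_measurable borel"
      using cf cg by (auto intro: borel_measurable_continuous_onI)
    have "continuous_on UNIV (\<lambda>x. f x - g x)" using cf cg by (intro continuous_intros)
    then have "isCont (\<lambda>x. f x - g x) t" by (simp add: continuous_on_eq_continuous_at)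
    then have "\<forall>\<^sub>F x in at t. 0 < f x - g x" using less unfolding isCont_def by (intro order_tendstoD) auto
    then obtain d where d: "d > 0" "\<And>x. x \<noteq> t \<Longrightarrow> dist x t < d \<Longrightarrow> 0 < f x - g x" by (auto simp: eventually_at)
    show False
    proof (rule laplace_transform_zero[of "\<lambda>x. f x - g x" "B + B" t "t + d / 2"])
      show "\<bar>f x - g x\<bar> \<le> B + B" if "0 \<le> x" for x using B(1)[OF that] B(2)[OF that] by linarith
      show "0 < f x - g x" if "t \<le> x" "x \<le> t + d / 2" for x
        using d(2)[of x] that less d(1) by (cases "x = t") (auto simp: dist_real_def)
      show "(\<integral>x. f x - g x \<partial>exp_law \<mu>) = 0" if "0 < \<mu>" for \<mu>
        using eq[OF that] exp_law_bounded_integrable[OF that m(1) B(1)] exp_law_bounded_integrable[OF that m(2) B(2)] by simp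
    qed (use t d(1) in auto)
  qed
  show ?thesis using aux[OF cf cg B eq] aux[OF cg cf B(2,1) eq[symmetric]] by (meson linorder_less_linear)
qed

section \<open>Entire functions of minimal exponential type\<close>

text \<open>The map w -> w / (2 K - w) sends the half plane Re w < K into the unit disc and fixes 0,
  so the Schwarz lemma bounds the composite with \<open>f\<close>. The lemma will turn a bound on
  the modulus of a zero-free function into a bound on its logarithm.\<close>

lemma borel_caratheodory:
  fixes f :: "complex \<Rightarrow> complex"
  assumes hol: "f holomorphic_on ball 0 \<rho>" and f0: "f 0 = 0" and K: "0 < K"
    and Re: "\<And>z. norm z < \<rho> \<Longrightarrow> Re (f z) < K" and z: "norm z < \<rho>"
  shows "norm (f z) * (\<rho> - norm z) \<le> 2 * K * norm z"
proof -
  have \<rho>: "0 < \<rho>" using z norm_ge_zero[of z] by linarith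
  define g where "g w = f (\<rho> * w) / (2 * K - f (\<rho> * w))" for w :: complex
  have inb: "norm (\<rho> * w) < \<rho>" if "norm w < 1" for w :: complex
    using that \<rho> by (simp add: norm_mult)
  have nz: "2 * K - f (\<rho> * w) \<noteq> 0" if "norm w < 1" for w :: complex
  proof
    assume "2 * K - f (\<rho> * w) = 0"
    then have "Re (f (\<rho> * w)) = 2 * K" by (metis Re_complex_of_real eq_iff_diff_eq_0 of_real_mult of_real_numeral)
    then show False using Re[OF inb[OF that]] K by simp
  qed
  have fh: "(\<lambda>w. f (\<rho> * w)) holomorphic_on ball 0 1"
    by (rule holomorphic_on_compose_gen[OF _ hol, unfolded o_def]) (auto intro!: holomorphic_intros inb simp: dist_norm)
  have gh: "g holomorphic_on ball 0 1"
    unfolding g_def using nz by (intro holomorphic_intros fh) (auto simp: dist_norm)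
  have lt: "norm (g w) < 1" if "norm w < 1" for w :: complex
  proof -
    define F where "F = f (\<rho> * w)"
    have "Re F < K" using Re[OF inb[OF that]] by (simp add: F_def)
    then have "0 < K * (K - Re F)" using K by simp
    then have "(norm F)\<^sup>2 < (norm (2 * K - F))\<^sup>2"
      by (simp add: cmod_power2) (simp add: power2_eq_square algebra_simps)
    then have "norm F < norm (2 * K - F)" by (rule power2_less_imp_less) simp
    then show ?thesis using nz[OF that] by (simp add: g_def F_def norm_divide)
  qed
  define w where "w = z / \<rho>"
  have nw: "norm w = norm z / \<rho>" using \<rho> by (simp add: w_def norm_divide)
  have w1: "norm w < 1" using z \<rho> by (simp add: nw)
  have zw: "\<rho> * w = z" using \<rho> by (simp add: w_def)
  have "norm (g w) \<le> norm w"
    by (rule Schwarz_Lemma(1)[OF gh _ lt w1]) (simp add: g_def f0)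
  then have "norm (f z) \<le> norm w * norm (2 * K - f z)"
    using nz[OF w1] unfolding g_def zw norm_divide by (simp add: divide_simps)
  also have "\<dots> \<le> norm w * (2 * K + norm (f z))"
    using norm_triangle_ineq4[of "2 * complex_of_real K" "f z"] K by (intro mult_left_mono) (auto simp: norm_mult)
  finally have "norm (f z) * \<rho> \<le> norm z * (2 * K + norm (f z))"
    using \<rho> by (simp add: nw field_simps)
  then show ?thesis by (simp add: algebra_simps)
qed

lemma entire_divide_zero:
  fixes f :: "complex \<Rightarrow> complex"
  assumes "f holomorphic_on UNIV" "f a = 0"
  obtains g where "g holomorphic_on UNIV" "\<And>z. f z = (z - a) * g z"
proof
  show "(\<lambda>z. if z = a then deriv f a else (f z - f a) / (z - a)) holomorphic_on UNIV"
    by (rule pole_lemma_open) (use assms in auto)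
qed (use assms in auto)

text \<open>Distinctness lets the zeros be split off one by one: the factors already removed do not
  vanish at the next zero, so the remaining quotient does.\<close>

lemma entire_divide_zeros:
  fixes f :: "complex \<Rightarrow> complex" and lam :: "nat \<Rightarrow> real"
  assumes hol: "f holomorphic_on UNIV" and pos: "\<And>j. 0 < lam j" and inj: "inj lam"
    and zero: "\<And>j. f (- lam j) = 0"
  shows "\<exists>g. g holomorphic_on UNIV \<and> (\<forall>z. f z = (\<Prod>j<n. 1 + z / lam j) * g z)"
proof (induction n)
  case 0
  show ?case using hol by auto
next
  case (Suc n)
  then obtain g where g: "g holomorphic_on UNIV" "\<And>z. f z = (\<Prod>j<n. 1 + z / lam j) * g z" by blast
  define w where "w = - complex_of_real (lam n)"
  have nz: "1 + w / complex_of_real (lam j) \<noteq> 0" if "j < n" for j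
  proof
    assume "1 + w / lam j = 0"
    then have "complex_of_real (lam n) = complex_of_real (lam j)"
      using pos[of j] by (simp add: w_def divide_simps)
    then show False using inj that by (simp add: inj_eq)
  qed
  have "f w = 0" using zero[of n] by (simp add: w_def)
  then have "g w = 0" using g(2)[of w] nz by (auto simp: prod_zero_iff)
  then obtain h where h: "h holomorphic_on UNIV" "\<And>z. g z = (z - w) * h z"
    using entire_divide_zero[OF g(1)] by metis
  have "f z = (\<Prod>j<Suc n. 1 + z / lam j) * (lam n * h z)" for z :: complex
    using pos[of n] by (simp add: g(2)[of z] h(2)[of z] w_def field_simps)
  then show ?case
    by (intro exI[of _ "\<lambda>z. lam n * h z"]) (auto intro!: holomorphic_intros h(1))
qed

text \<open>A bounded increasing sequence of zeros would accumulate, and the identity theorem would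
  make \<open>f\<close> vanish at 0.\<close>

lemma entire_zeros_at_top:
  fixes f :: "complex \<Rightarrow> complex" and lam :: "nat \<Rightarrow> real"
  assumes hol: "f holomorphic_on UNIV" and f0: "f 0 \<noteq> 0" and pos: "\<And>j. 0 < lam j"
    and mono: "strict_mono lam" and zero: "\<And>j. f (- lam j) = 0"
  shows "filterlim lam at_top sequentially"
proof (rule ccontr)
  assume "\<not> ?thesis"
  then obtain B where B: "\<And>j. lam j \<le> B"
    using mono unfolding filterlim_at_top_gt[of _ _ 0] eventually_sequentially strict_mono_def
    by (metis linorder_not_le order_le_less nle_le order_trans strict_mono_less_eq[OF mono])
  then have conv: "\<exists>l. lam \<longlonglongrightarrow> l"
    using mono by (meson incseq_convergent strict_mono_mono)
  then obtain l where l: "lam \<longlonglongrightarrow> l" by blast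
  have lt: "lam j < l" for j
    using mono l by (metis incseq_le lessI order_less_le_trans strict_mono_def strict_mono_mono)
  have "f 0 = 0"
  proof (rule analytic_continuation[OF hol open_UNIV connected_UNIV, of "range (\<lambda>j. complex_of_real (- lam j))" "- l"])
    show "complex_of_real (- l) islimpt range (\<lambda>j. complex_of_real (- lam j))"
      unfolding islimpt_sequential
    proof (intro exI conjI allI)
      show "(\<lambda>j. complex_of_real (- lam j)) \<longlonglongrightarrow> complex_of_real (- l)"
        by (intro tendsto_intros l)
      show "complex_of_real (- lam j) \<in> range (\<lambda>j. complex_of_real (- lam j)) - {complex_of_real (- l)}" for j
        using lt[of j] by auto
    qed
  qed (use zero in auto)
  with f0 show False by simp
qed

text \<open>Hadamard factorisation without an exponential factor. Write f = P_n Q_n with P_n the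
  partial product. On the circle of radius \<open>2 * lam n\<close> every factor of P_n has modulus
  at least 1, so the growth of \<open>f\<close> bounds Q_n inside it. On the disc of radius
  \<open>lam n\<close> the quotient has no zeros, so Q_n = exp g_n with Re g_n at most C + 2 e lam
  n. Borel-Caratheodory divides this by \<open>lam n\<close>, and since \<open>e\<close> is
  arbitrary, g_n tends to 0 pointwise.\<close>

theorem entire_product_minimal_type:
  fixes f :: "complex \<Rightarrow> complex" and lam :: "nat \<Rightarrow> real" and z :: complex
  assumes hol: "f holomorphic_on UNIV" and f0: "f 0 = 1"
    and growth: "\<And>e. e > 0 \<Longrightarrow> \<exists>C. \<forall>z. norm (f z) \<le> exp (C + e * norm z)"
    and pos: "\<And>j. 0 < lam j" and mono: "strict_mono lam"
    and zeros: "\<And>z. f z = 0 \<longleftrightarrow> (\<exists>j. z = - complex_of_real (lam j))"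
    and simple: "\<And>j. deriv f (- lam j) \<noteq> 0"
  shows "(\<lambda>n. \<Prod>j<n. 1 + z / lam j) \<longlonglongrightarrow> f z"
proof -
  have zero: "f (- lam j) = 0" for j using zeros by auto
  have "\<forall>n. \<exists>g. g holomorphic_on UNIV \<and> (\<forall>z. f z = (\<Prod>j<n. 1 + z / lam j) * g z)"
    using entire_divide_zeros[OF hol pos strict_mono_imp_inj_on[OF mono] zero] by blast
  then obtain Q where Qh: "\<And>n. Q n holomorphic_on UNIV"
    and Q: "\<And>n z. f z = (\<Prod>j<n. 1 + z / lam j) * Q n z" by metis
  define P where "P n z = (\<Prod>j<n. 1 + z / lam j)" for n and z :: complex
  have fPQ: "f z = P n z * Q n z" for n z using Q P_def by simp
  have Ph: "P n holomorphic_on UNIV" for n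
    unfolding P_def using pos by (intro holomorphic_intros) (auto simp: less_imp_neq[THEN not_sym])
  have Q0: "Q n 0 = 1" for n using fPQ[of 0 n] f0 by (simp add: P_def)
  have top: "filterlim lam at_top sequentially"
    by (rule entire_zeros_at_top[OF hol _ pos mono zero]) (simp add: f0)
  \<comment> \<open>A zero of Q_n in this disc is some \<open>- lam j\<close> with j < n, hence also
    a zero of P_n. It would then be a double zero of \<open>f\<close>, against
    \<open>simple\<close>.\<close>
  have Qnz: "Q n w \<noteq> 0" if w: "norm w < lam n" for n w
  proof
    assume Qw: "Q n w = 0"
    then have "f w = 0" by (simp add: fPQ[of w n])
    then obtain j where j: "w = - complex_of_real (lam j)" using zeros by auto
    then have "lam j < lam n" using w pos[of j] by simp
    then have "j < n" using mono by (simp add: strict_mono_less)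
    have Pw: "P n w = 0"
      unfolding P_def using \<open>j < n\<close> pos[of j] j by (auto intro!: bexI[of _ j] simp: prod_zero_iff)
    have dP: "(P n has_field_derivative deriv (P n) w) (at w)" "(Q n has_field_derivative deriv (Q n) w) (at w)"
      using Ph Qh by (auto intro!: holomorphic_derivI[of _ UNIV])
    have "((\<lambda>z. P n z * Q n z) has_field_derivative 0) (at w)"
      using DERIV_mult[OF dP] by (simp add: Pw Qw)
    then have "deriv f w = 0" unfolding fPQ[of _ n, symmetric] by (rule DERIV_imp_deriv)
    then show False using simple[of j] j by simp
  qed
  have Qle: "norm (Q n w) \<le> exp (C + e * (2 * lam n))"
    if C: "\<And>z. norm (f z) \<le> exp (C + e * norm z)" and w: "norm w \<le> 2 * lam n" for C e n w
  proof (rule maximum_modulus_frontier[of "Q n" "cball 0 (2 * lam n)"])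
    show "Q n holomorphic_on interior (cball 0 (2 * lam n))" using Qh holomorphic_on_subset by blast
    show "continuous_on (closure (cball 0 (2 * lam n))) (Q n)"
      using holomorphic_on_imp_continuous_on[OF Qh] continuous_on_subset by blast
    show "w \<in> cball 0 (2 * lam n)" using w by simp
    fix v :: complex assume "v \<in> frontier (cball 0 (2 * lam n))"
    then have v: "norm v = 2 * lam n" using pos[of n] by simp
    have "1 \<le> norm (1 + v / lam j)" if "j < n" for j
    proof -
      have "lam j < lam n" using mono that by (simp add: strict_mono_less)
      then have "2 \<le> norm (v / lam j)" using pos[of j] v by (simp add: norm_divide divide_simps)
      then show ?thesis using norm_triangle_ineq2[of "v / lam j" "-1"] by (simp add: add.commute)
    qed
    then have "1 \<le> norm (P n v)" unfolding P_def prod_norm[symmetric] by (intro prod_ge_1) auto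
    then have "norm (Q n v) \<le> norm (P n v) * norm (Q n v)"
      by (metis mult_right_mono mult_1 norm_ge_zero)
    also have "\<dots> \<le> exp (C + e * (2 * lam n))" using C[of v] by (simp add: fPQ[of v n] norm_mult v)
    finally show "norm (Q n v) \<le> exp (C + e * (2 * lam n))" .
  qed simp
  have "\<exists>g. g holomorphic_on ball 0 (lam n) \<and> (\<forall>w\<in>ball 0 (lam n). Q n w = exp (g w))" for n
  proof -
    have "Q n holomorphic_on ball 0 (lam n)" using Qh holomorphic_on_subset by blast
    moreover have "\<And>w. w \<in> ball 0 (lam n) \<Longrightarrow> Q n w \<noteq> 0" using Qnz by simp
    ultimately show ?thesis
      by (metis contractible_imp_holomorphic_log convex_ball convex_imp_contractible)
  qed
  then obtain g0 where g0h: "\<And>n. g0 n holomorphic_on ball 0 (lam n)"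
    and g0: "\<And>n w. w \<in> ball 0 (lam n) \<Longrightarrow> Q n w = exp (g0 n w)" by metis
  define g where "g n w = g0 n w - g0 n 0" for n w
  have gh: "g n holomorphic_on ball 0 (lam n)" for n unfolding g_def by (intro holomorphic_intros g0h)
  have Qg: "Q n w = exp (g n w)" if "norm w < lam n" for n w
    using g0[of 0 n] g0[of w n] that Q0[of n] pos[of n] by (simp add: g_def exp_diff)
  have "(\<lambda>n. g n z) \<longlonglongrightarrow> 0"
  proof (rule LIMSEQ_I)
    fix \<epsilon> :: real assume \<epsilon>: "0 < \<epsilon>"
    \<comment> \<open>The constants split the error: the term with \<open>e\<close> is at most
      \<epsilon> lam n / 4, the term with \<open>C\<close> below \<epsilon> lam n / 8, and
      \<open>lam n - norm z\<close> is at least \<open>lam n / 2\<close>.\<close>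
    define e where "e = \<epsilon> / (16 * (norm z + 1))"
    have nz1: "0 < norm z + 1" using norm_ge_zero[of z] by linarith
    have e: "0 < e" using \<epsilon> nz1 by (simp add: e_def)
    obtain C where C: "\<And>z. norm (f z) \<le> exp (C + e * norm z)" using growth[OF e] by blast
    have C0: "0 \<le> C" using C[of 0] f0 by simp
    obtain N where N: "\<And>n. n \<ge> N \<Longrightarrow> lam n \<ge> max (2 * norm z + 1) (1 + 16 * norm z * (C + 1) / \<epsilon>)"
      using top unfolding filterlim_at_top eventually_sequentially by metis
    show "\<exists>no. \<forall>n\<ge>no. norm (g n z - 0) < \<epsilon>"
    proof (intro exI[of _ N] allI impI)
      fix n assume "n \<ge> N"
      then have n: "2 * norm z + 1 \<le> lam n" "16 * norm z * (C + 1) / \<epsilon> < lam n" using N[of n] by auto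
      have K: "0 < C + 1 + 2 * e * lam n" using C0 e pos[of n] by (simp add: add_nonneg_pos)
      have "norm (g n z) * (lam n - norm z) \<le> 2 * (C + 1 + 2 * e * lam n) * norm z"
      proof (rule borel_caratheodory[OF gh _ K])
        fix w :: complex assume w: "norm w < lam n"
        have "exp (Re (g n w)) \<le> exp (C + e * (2 * lam n))"
          using Qle[OF C, of w n] w pos[of n] by (simp add: Qg[OF w])
        then show "Re (g n w) < C + 1 + 2 * e * lam n" by simp
      next
        show "norm z < lam n" using n(1) norm_ge_zero[of z] by linarith
      qed (simp add: g_def)
      moreover have "norm (g n z) * (lam n / 2) \<le> norm (g n z) * (lam n - norm z)"
        using n(1) by (intro mult_left_mono) auto
      ultimately have 1: "norm (g n z) * (lam n / 2) \<le> 2 * (norm z * (C + 1)) + 4 * (e * norm z * lam n)"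
        by (simp add: algebra_simps)
      have 2: "16 * (norm z * (C + 1)) < \<epsilon> * lam n" using n(2) \<epsilon> by (simp add: field_simps)
      have 3: "16 * (e * norm z) \<le> \<epsilon>"
        using \<epsilon> nz1 by (simp add: e_def divide_simps)
      have "16 * (e * norm z) * lam n \<le> \<epsilon> * lam n" using 3 pos[of n] by (intro mult_right_mono) auto
      then have "16 * (e * norm z * lam n) \<le> \<epsilon> * lam n" by (simp add: mult.assoc)
      then have "norm (g n z) * (lam n / 2) < \<epsilon> * lam n / 2" using 1 2 mult_pos_pos[OF \<epsilon> pos[of n]] by linarith
      then have "norm (g n z) * lam n < \<epsilon> * lam n" by simp
      then show "norm (g n z - 0) < \<epsilon>" using pos[of n] by simp
    qed
  qed
  then have lim: "(\<lambda>n. f z * exp (- g n z)) \<longlonglongrightarrow> f z * exp (- 0)" by (intro tendsto_intros)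
  have ev: "\<forall>\<^sub>F n in sequentially. f z * exp (- g n z) = P n z"
  proof -
    have "\<forall>\<^sub>F n in sequentially. norm z < lam n" using top by (simp add: filterlim_at_top_dense)
    then show ?thesis
    proof (rule eventually_mono)
      fix n assume "norm z < lam n"
      then show "f z * exp (- g n z) = P n z"
        using fPQ[of z n] Qg[of z n] by (simp add: exp_minus)
    qed
  qed
  show ?thesis using Lim_transform_eventually[OF lim ev] by (simp add: P_def)
qed

section \<open>Strings\<close>

text \<open>The coefficients may blow up at the ends of the interval, so derivatives are compared in
  its interior only. This comparison of increments takes the place of integral estimates for
  strings.\<close>

lemma deriv_le_imp_diff_le:
  fixes f g :: "real \<Rightarrow> real"
  assumes ab: "a \<le> b" and cf: "continuous_on {a..b} f" and cg: "continuous_on {a..b} g"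
    and df: "\<And>x. a < x \<Longrightarrow> x < b \<Longrightarrow> (f has_real_derivative f' x) (at x)"
    and dg: "\<And>x. a < x \<Longrightarrow> x < b \<Longrightarrow> (g has_real_derivative g' x) (at x)"
    and le: "\<And>x. a < x \<Longrightarrow> x < b \<Longrightarrow> f' x \<le> g' x"
  shows "f b - f a \<le> g b - g a"
proof -
  have "(\<lambda>x. g x - f x) a \<le> (\<lambda>x. g x - f x) b"
  proof (rule DERIV_nonneg_imp_increasing_open[OF ab])
    fix x assume "a < x" "x < b"
    then show "\<exists>y. ((\<lambda>x. g x - f x) has_real_derivative y) (at x) \<and> 0 \<le> y"
      using DERIV_diff[OF dg df] le by (metis diff_ge_0_iff_ge)
  qed (intro continuous_intros cf cg)
  then show ?thesis by simp
qed

lemma abs_deriv_le_imp_diff_le: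
  fixes f g :: "real \<Rightarrow> real"
  assumes ab: "a \<le> b" and cf: "continuous_on {a..b} f" and cg: "continuous_on {a..b} g"
    and df: "\<And>x. a < x \<Longrightarrow> x < b \<Longrightarrow> (f has_real_derivative f' x) (at x)"
    and dg: "\<And>x. a < x \<Longrightarrow> x < b \<Longrightarrow> (g has_real_derivative g' x) (at x)"
    and le: "\<And>x. a < x \<Longrightarrow> x < b \<Longrightarrow> \<bar>f' x\<bar> \<le> g' x"
  shows "\<bar>f b - f a\<bar> \<le> g b - g a"
proof -
  have "f b - f a \<le> g b - g a"
    by (rule deriv_le_imp_diff_le[OF ab cf cg df dg]) (use le in \<open>auto simp: abs_le_iff\<close>)
  moreover have "(- f b) - (- f a) \<le> g b - g a"
    by (rule deriv_le_imp_diff_le[OF ab _ cg DERIV_minus[OF df] dg]) (use le cf in \<open>auto simp: abs_le_iff intro: continuous_intros\<close>)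
  ultimately show ?thesis by simp
qed

text \<open>The improper integral from 0, encoded by its properties: convergence at both ends is the
  continuity of \<open>G\<close> on the closed interval.\<close>

definition antideriv_on :: "real \<Rightarrow> (real \<Rightarrow> real) \<Rightarrow> (real \<Rightarrow> real) \<Rightarrow> bool" where
  "antideriv_on r g G \<longleftrightarrow> continuous_on {0..r} G \<and> G 0 = 0 \<and>
     (\<forall>x. 0 < x \<longrightarrow> x < r \<longrightarrow> (G has_real_derivative g x) (at x))"

lemma antideriv_onD:
  assumes "antideriv_on r g G"
  shows "continuous_on {0..r} G" "G 0 = 0"
    "\<And>x. 0 < x \<Longrightarrow> x < r \<Longrightarrow> (G has_real_derivative g x) (at x)"
  using assms by (auto simp: antideriv_on_def)

lemma antideriv_on_cmult: "antideriv_on r g G \<Longrightarrow> antideriv_on r (\<lambda>x. c * g x) (\<lambda>x. c * G x)"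
  unfolding antideriv_on_def by (auto intro!: continuous_intros DERIV_cmult)

lemma antideriv_on_diff:
  "antideriv_on r f F \<Longrightarrow> antideriv_on r g G \<Longrightarrow> antideriv_on r (\<lambda>x. f x - g x) (\<lambda>x. F x - G x)"
  unfolding antideriv_on_def by (auto intro!: continuous_intros DERIV_diff)

lemma antideriv_on_abs_le:
  assumes F: "antideriv_on r f F" and G: "antideriv_on r g G"
    and le: "\<And>x. 0 < x \<Longrightarrow> x < r \<Longrightarrow> \<bar>f x\<bar> \<le> g x"
    and xy: "0 \<le> x" "x \<le> y" "y \<le> r"
  shows "\<bar>F y - F x\<bar> \<le> G y - G x"
proof (rule abs_deriv_le_imp_diff_le[OF xy(2)])
  show "continuous_on {x..y} F" "continuous_on {x..y} G"
    using F G xy by (auto simp: antideriv_on_def elim!: continuous_on_subset)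
  show "(F has_real_derivative f z) (at z)" "(G has_real_derivative g z) (at z)" "\<bar>f z\<bar> \<le> g z"
    if "x < z" "z < y" for z using F G xy that le by (auto simp: antideriv_on_def)
qed

lemma antideriv_on_le:
  assumes F: "antideriv_on r f F" and G: "antideriv_on r g G"
    and le: "\<And>x. 0 < x \<Longrightarrow> x < r \<Longrightarrow> f x \<le> g x"
    and xy: "0 \<le> x" "x \<le> y" "y \<le> r"
  shows "F y - F x \<le> G y - G x"
proof (rule deriv_le_imp_diff_le[OF xy(2)])
  show "continuous_on {x..y} F" "continuous_on {x..y} G"
    using F G xy by (auto simp: antideriv_on_def elim!: continuous_on_subset)
  show "(F has_real_derivative f z) (at z)" "(G has_real_derivative g z) (at z)" "f z \<le> g z"
    if "x < z" "z < y" for z using F G xy that le by (auto simp: antideriv_on_def)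
qed

lemma antideriv_on_zero: "antideriv_on r (\<lambda>_. 0) (\<lambda>_. 0)"
  by (auto simp: antideriv_on_def)

lemma antideriv_on_mono:
  assumes "antideriv_on r f F" "\<And>x. 0 < x \<Longrightarrow> x < r \<Longrightarrow> 0 \<le> f x" "0 \<le> x" "x \<le> y" "y \<le> r"
  shows "F x \<le> F y"
  using antideriv_on_le[OF antideriv_on_zero assms] by simp

lemma antideriv_on_nonneg:
  assumes "antideriv_on r f F" "\<And>x. 0 < x \<Longrightarrow> x < r \<Longrightarrow> 0 \<le> f x" "0 \<le> x" "x \<le> r"
  shows "0 \<le> F x"
  using antideriv_on_mono[OF assms(1,2) _ assms(3,4)] antideriv_onD(2)[OF assms(1)] by simp

lemma antideriv_on_unique:
  assumes F: "antideriv_on r f F" and G: "antideriv_on r g G"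
    and eq: "\<And>x. 0 < x \<Longrightarrow> x < r \<Longrightarrow> f x = g x" and x: "0 \<le> x" "x \<le> r"
  shows "F x = G x"
  using antideriv_on_le[OF F G _ _ x(1,2)] antideriv_on_le[OF G F _ _ x(1,2)]
    antideriv_onD(2)[OF F] antideriv_onD(2)[OF G] eq by force

text \<open>Increments of an interior antiderivative are dominated by increments of
  \<open>H\<close>, so it is uniformly continuous and extends to the closed interval.\<close>

lemma dominated_antideriv:
  assumes r: "0 < r" and g: "continuous_on {0<..<r} g" and H: "antideriv_on r h H"
    and le: "\<And>x. 0 < x \<Longrightarrow> x < r \<Longrightarrow> \<bar>g x\<bar> \<le> h x"
  shows "\<exists>G. antideriv_on r g G"
proof -
  have "\<exists>F. \<forall>x. ereal 0 < ereal x \<longrightarrow> ereal x < ereal r \<longrightarrow> (F has_vector_derivative g x) (at x)"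
    by (rule einterval_antiderivative) (use r g in \<open>auto simp: continuous_on_eq_continuous_at\<close>)
  then obtain F where F: "\<And>x. 0 < x \<Longrightarrow> x < r \<Longrightarrow> (F has_real_derivative g x) (at x)"
    by (auto simp: has_real_derivative_iff_has_vector_derivative)
  have FH: "\<bar>F y - F x\<bar> \<le> H y - H x" if "0 < x" "x \<le> y" "y < r" for x y
  proof (rule abs_deriv_le_imp_diff_le[where f'=g and g'=h, OF that(2)])
    show "continuous_on {x..y} F"
      by (rule DERIV_continuous_on[of _ _ g], rule has_field_derivative_at_within, rule F) (use that in auto)
    show "continuous_on {x..y} H" using H that by (auto simp: antideriv_on_def elim!: continuous_on_subset)
  qed (use F H le that in \<open>auto simp: antideriv_on_def\<close>)
  have "uniformly_continuous_on {0..r} H"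
    using H by (intro compact_uniformly_continuous) (auto simp: antideriv_on_def)
  then have UH: "uniformly_continuous_on {0<..<r} H" unfolding uniformly_continuous_on_def
    by (meson greaterThanLessThan_subseteq_atLeastAtMost_iff order_refl subsetD)
  have "uniformly_continuous_on {0<..<r} F"
    unfolding uniformly_continuous_on_def
  proof (intro allI impI)
    fix e :: real assume "0 < e"
    then obtain d where d: "d > 0" "\<And>x x'. x \<in> {0<..<r} \<Longrightarrow> x' \<in> {0<..<r} \<Longrightarrow> dist x' x < d \<Longrightarrow> dist (H x') (H x) < e"
      using UH unfolding uniformly_continuous_on_def by meson
    have "dist (F x') (F x) < e" if "x \<in> {0<..<r}" "x' \<in> {0<..<r}" "dist x' x < d" for x x'
      using d(2)[OF that] FH[of x x'] FH[of x' x] that by (cases "x \<le> x'") (auto simp: dist_real_def abs_minus_commute)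
    then show "\<exists>d>0. \<forall>x\<in>{0<..<r}. \<forall>x'\<in>{0<..<r}. dist x' x < d \<longrightarrow> dist (F x') (F x) < e"
      using d(1) by blast
  qed
  from uniformly_continuous_on_extension_on_closure[OF this]
  obtain G where G: "uniformly_continuous_on (closure {0<..<r}) G" "\<And>x. x \<in> {0<..<r} \<Longrightarrow> F x = G x" by metis
  have cG: "continuous_on {0..r} G" using uniformly_continuous_imp_continuous[OF G(1)] r by simp
  have dG: "(G has_real_derivative g x) (at x)" if "0 < x" "x < r" for x
  proof (rule has_field_derivative_transform_within_open[OF F[OF that], of "{0<..<r}"])
  qed (use that G(2) in auto)
  show ?thesis
    by (rule exI[of _ "\<lambda>x. G x - G 0"])
      (auto simp: antideriv_on_def intro!: continuous_intros cG derivative_eq_intros dG)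
qed

text \<open>A string with scale density \<open>s\<close> and mass distribution \<open>M\<close>. The
  left end may carry infinite scale; only the integral of \<open>s M\<close>, which is
  \<open>U\<close>, has to converge.\<close>

locale krein_string =
  fixes r :: real and s m M U :: "real \<Rightarrow> real"
  assumes r_pos: "0 < r"
    and s_cont: "continuous_on {0<..<r} s" and m_cont: "continuous_on {0<..<r} m"
    and s_pos: "\<And>x. 0 < x \<Longrightarrow> x < r \<Longrightarrow> 0 < s x"
    and m_pos: "\<And>x. 0 < x \<Longrightarrow> x < r \<Longrightarrow> 0 < m x"
    and M: "antideriv_on r m M"
    and U: "antideriv_on r (\<lambda>x. s x * M x) U"
begin

lemmas M_D = antideriv_onD[OF M] and U_D = antideriv_onD[OF U]

lemma M_mono: "0 \<le> x \<Longrightarrow> x \<le> y \<Longrightarrow> y \<le> r \<Longrightarrow> M x \<le> M y"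
  by (rule antideriv_on_mono[OF M]) (auto intro: less_imp_le m_pos)

lemma M_nonneg: "0 \<le> x \<Longrightarrow> x \<le> r \<Longrightarrow> 0 \<le> M x"
  using M_mono[of 0 x] M_D(2) by simp

lemma M_pos: assumes "0 < x" "x \<le> r" shows "0 < M x"
proof -
  have "M 0 < M x"
  proof (rule DERIV_pos_imp_increasing_open[OF assms(1)])
    show "\<exists>y'. (M has_real_derivative y') (at y) \<and> 0 < y'" if "0 < y" "y < x" for y
      using M_D(3)[of y] m_pos[of y] that assms by auto
    show "continuous_on {0..x} M" using M_D(1) assms by (auto elim!: continuous_on_subset)
  qed
  then show ?thesis using M_D(2) by simp
qed

lemma U_mono: "0 \<le> x \<Longrightarrow> x \<le> y \<Longrightarrow> y \<le> r \<Longrightarrow> U x \<le> U y"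
  by (rule antideriv_on_mono[OF U]) (auto intro!: mult_nonneg_nonneg less_imp_le[OF s_pos] M_nonneg)

lemma U_nonneg: "0 \<le> x \<Longrightarrow> x \<le> r \<Longrightarrow> 0 \<le> U x"
  using U_mono[of 0 x] U_D(2) by simp

lemma U_power_deriv:
  assumes "0 < x" "x < r"
  shows "((\<lambda>x. U x ^ j / fact j) has_real_derivative real j * (s x * M x * U x ^ (j - Suc 0)) / fact j) (at x)"
  by (rule DERIV_cdivide[OF DERIV_power[OF U_D(3)[OF assms]]])

text \<open>The product rule adds a nonnegative term to \<open>m * U ^ k / fact k\<close>. Hence
  \<open>M * U ^ k / fact k\<close> dominates the integral of \<open>U ^ k / fact k\<close> against
  the mass, which is how the factorial survives each integration.\<close>

lemma M_U_power:
  "antideriv_on r (\<lambda>x. m x * (U x ^ k / fact k) + real k * (s x * M x * U x ^ (k - Suc 0)) / fact k * M x)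
    (\<lambda>x. M x * (U x ^ k / fact k))"
  unfolding antideriv_on_def
  by (intro conjI allI impI DERIV_mult U_power_deriv M_D continuous_intros U_D) (auto simp: M_D(2))

lemma M_U_power_le:
  assumes "0 < y" "y < r"
  shows "m y * (U y ^ k / fact k) \<le> m y * (U y ^ k / fact k) + real k * (s y * M y * U y ^ (k - Suc 0)) / fact k * M y"
proof -
  have "0 \<le> real k * (s y * M y * U y ^ (k - Suc 0)) / fact k * M y"
    using U_nonneg[of y] M_nonneg[of y] s_pos[OF assms] assms by (intro mult_nonneg_nonneg divide_nonneg_nonneg) auto
  then show ?thesis by linarith
qed

lemma U_power: "antideriv_on r (\<lambda>x. s x * (M x * (U x ^ k / fact k))) (\<lambda>x. U x ^ Suc k / fact (Suc k))"
    unfolding antideriv_on_def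
  proof (intro conjI allI impI)
    fix x assume "0 < x" "x < r"
    from U_power_deriv[OF this, of "Suc k"]
    show "((\<lambda>x. U x ^ Suc k / fact (Suc k)) has_real_derivative s x * (M x * (U x ^ k / fact k))) (at x)"
    proof (rule back_subst[of "\<lambda>d. (_ has_real_derivative d) (at x)"])
      have "fact (Suc k) = real (Suc k) * fact k" by simp
      then show "real (Suc k) * (s x * M x * U x ^ (Suc k - Suc 0)) / fact (Suc k) = s x * (M x * (U x ^ k / fact k))"
        by (simp only: diff_Suc_Suc diff_zero) (simp only: times_divide_eq_right mult.assoc mult_divide_mult_cancel_left_if, simp)
    qed
  qed (auto intro!: continuous_intros U_D simp: U_D(2))

lemma ex_antideriv_m:
  assumes f: "continuous_on {0..r} f"
  shows "\<exists>G. antideriv_on r (\<lambda>x. m x * f x) G"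
proof -
  obtain B where B: "\<And>x. x \<in> {0..r} \<Longrightarrow> \<bar>f x\<bar> \<le> B"
    using compact_continuous_image[OF f compact_Icc] compact_imp_bounded
    by (metis bounded_iff image_eqI real_norm_def)
  show ?thesis
  proof (rule dominated_antideriv[OF r_pos])
    show "continuous_on {0<..<r} (\<lambda>x. m x * f x)"
      by (intro continuous_intros m_cont continuous_on_subset[OF f]) auto
    show "antideriv_on r (\<lambda>x. B * m x) (\<lambda>x. B * M x)" by (rule antideriv_on_cmult[OF M])
    show "\<bar>m x * f x\<bar> \<le> B * m x" if "0 < x" "x < r" for x
      using B[of x] m_pos[OF that] that by (simp add: abs_mult mult.commute mult_left_mono)
  qed
qed

text \<open>Integration from 0 against the mass, and below in \<open>sint\<close> against the scale.
  The second converges at 0 for functions bounded by a multiple of \<open>M\<close>, such as values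
  of the first.\<close>

definition mint :: "(real \<Rightarrow> real) \<Rightarrow> real \<Rightarrow> real" where
  "mint f = (SOME G. antideriv_on r (\<lambda>x. m x * f x) G)"

lemma mint: "continuous_on {0..r} f \<Longrightarrow> antideriv_on r (\<lambda>x. m x * f x) (mint f)"
  unfolding mint_def using ex_antideriv_m by (rule someI_ex)

definition sint :: "(real \<Rightarrow> real) \<Rightarrow> real \<Rightarrow> real" where
  "sint f = (SOME G. antideriv_on r (\<lambda>x. s x * f x) G)"

lemma sint:
  assumes f: "continuous_on {0..r} f" and le: "\<And>x. 0 \<le> x \<Longrightarrow> x \<le> r \<Longrightarrow> \<bar>f x\<bar> \<le> B * M x"
  shows "antideriv_on r (\<lambda>x. s x * f x) (sint f)"
  unfolding sint_def
proof (rule someI_ex[where P="antideriv_on r (\<lambda>x. s x * f x)"], rule dominated_antideriv[OF r_pos, of _ "\<lambda>x. B * (s x * M x)" "\<lambda>x. B * U x"])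
  show "continuous_on {0<..<r} (\<lambda>x. s x * f x)"
    by (intro continuous_intros s_cont continuous_on_subset[OF f]) auto
  show "antideriv_on r (\<lambda>x. B * (s x * M x)) (\<lambda>x. B * U x)" by (rule antideriv_on_cmult[OF U])
  show "\<bar>s x * f x\<bar> \<le> B * (s x * M x)" if "0 < x" "x < r" for x
    using mult_left_mono[OF le[of x], of "s x"] s_pos[OF that] that by (simp add: abs_mult mult_ac)
qed

text \<open>The coefficients in powers of \<mu> of the solution of (u' / s)' = \<mu> m u with u = 1
  and zero flux at 0. The function \<open>cc k\<close> below is the flux of
  \<open>uc (Suc k)\<close>.\<close>

fun uc :: "nat \<Rightarrow> real \<Rightarrow> real" where
  "uc 0 = (\<lambda>_. 1)"
| "uc (Suc k) = sint (mint (uc k))"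

definition cc :: "nat \<Rightarrow> real \<Rightarrow> real" where "cc k = mint (uc k)"

text \<open>Everything is proved in a single induction because the next scale integral is known to
  converge only through the bound on \<open>cc k\<close> by a multiple of \<open>M\<close>.\<close>

lemma uc_cc:
  shows "continuous_on {0..r} (uc k)"
    and "\<And>x. 0 \<le> x \<Longrightarrow> x \<le> r \<Longrightarrow> 0 \<le> uc k x"
    and "\<And>x. 0 \<le> x \<Longrightarrow> x \<le> r \<Longrightarrow> uc k x \<le> U x ^ k / fact k"
    and "antideriv_on r (\<lambda>x. m x * uc k x) (cc k)"
    and "\<And>x. 0 \<le> x \<Longrightarrow> x \<le> r \<Longrightarrow> 0 \<le> cc k x"
    and "\<And>x. 0 \<le> x \<Longrightarrow> x \<le> r \<Longrightarrow> cc k x \<le> M x * (U x ^ k / fact k)"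
    and "antideriv_on r (\<lambda>x. s x * cc k x) (uc (Suc k))"
proof -
  have step: "antideriv_on r (\<lambda>x. m x * uc k x) (cc k)
     \<and> (\<forall>x. 0 \<le> x \<longrightarrow> x \<le> r \<longrightarrow> 0 \<le> cc k x)
     \<and> (\<forall>x. 0 \<le> x \<longrightarrow> x \<le> r \<longrightarrow> cc k x \<le> M x * (U x ^ k / fact k))
     \<and> antideriv_on r (\<lambda>x. s x * cc k x) (uc (Suc k))
     \<and> (\<forall>x. 0 \<le> x \<longrightarrow> x \<le> r \<longrightarrow> 0 \<le> uc (Suc k) x)
     \<and> (\<forall>x. 0 \<le> x \<longrightarrow> x \<le> r \<longrightarrow> uc (Suc k) x \<le> U x ^ Suc k / fact (Suc k))"
    if k: "continuous_on {0..r} (uc k) \<and> (\<forall>x. 0 \<le> x \<longrightarrow> x \<le> r \<longrightarrow> 0 \<le> uc k x \<and> uc k x \<le> U x ^ k / fact k)" for k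
  proof (intro conjI allI impI)
    have u: "continuous_on {0..r} (uc k)" "\<And>x. 0 \<le> x \<Longrightarrow> x \<le> r \<Longrightarrow> 0 \<le> uc k x"
      "\<And>x. 0 \<le> x \<Longrightarrow> x \<le> r \<Longrightarrow> uc k x \<le> U x ^ k / fact k" using k by auto
    show c: "antideriv_on r (\<lambda>x. m x * uc k x) (cc k)" unfolding cc_def by (rule mint[OF u(1)])
    show c0: "0 \<le> cc k x" if "0 \<le> x" "x \<le> r" for x
      by (rule antideriv_on_nonneg[OF c _ that]) (auto intro!: mult_nonneg_nonneg less_imp_le[OF m_pos] u(2))
    show c1: "cc k x \<le> M x * (U x ^ k / fact k)" if x: "0 \<le> x" "x \<le> r" for x
    proof -
      have "cc k x - cc k 0 \<le> M x * (U x ^ k / fact k) - M 0 * (U 0 ^ k / fact k)"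
      proof (rule antideriv_on_le[OF c M_U_power _ _ x])
        fix y assume y: "0 < y" "y < r"
        have "m y * uc k y \<le> m y * (U y ^ k / fact k)" using u(3)[of y] m_pos[OF y] y by (intro mult_left_mono) auto
        also note M_U_power_le[OF y]
        finally show "m y * uc k y \<le> m y * (U y ^ k / fact k) + real k * (s y * M y * U y ^ (k - Suc 0)) / fact k * M y" .
      qed auto
      then show ?thesis using antideriv_onD(2)[OF c] M_D(2) by simp
    qed
    show d: "antideriv_on r (\<lambda>x. s x * cc k x) (uc (Suc k))"
      unfolding uc.simps cc_def[symmetric]
    proof (rule sint[where B="U r ^ k / fact k"])
      fix x assume x: "0 \<le> x" "x \<le> r"
      have "cc k x \<le> M x * (U x ^ k / fact k)" by (rule c1[OF x])
      also have "\<dots> \<le> M x * (U r ^ k / fact k)"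
        using U_mono[of x r] U_nonneg[of x] M_nonneg[of x] x by (intro mult_left_mono divide_right_mono power_mono) auto
      finally show "\<bar>cc k x\<bar> \<le> U r ^ k / fact k * M x" using c0[OF x] by (simp add: mult.commute)
    qed (use antideriv_onD[OF c] in simp)
    fix x assume x: "0 \<le> x" "x \<le> r"
    show "0 \<le> uc (Suc k) x"
      by (rule antideriv_on_nonneg[OF d _ x]) (auto intro!: mult_nonneg_nonneg less_imp_le[OF s_pos] c0)
    have "uc (Suc k) x - uc (Suc k) 0 \<le> U x ^ Suc k / fact (Suc k) - U 0 ^ Suc k / fact (Suc k)"
      by (rule antideriv_on_le[OF d U_power _ order_refl x]) (intro mult_left_mono c1 less_imp_le[OF s_pos]; simp)
    then show "uc (Suc k) x \<le> U x ^ Suc k / fact (Suc k)" using antideriv_onD(2)[OF d] U_D(2) by simp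
  qed
  have ind: "continuous_on {0..r} (uc k) \<and> (\<forall>x. 0 \<le> x \<longrightarrow> x \<le> r \<longrightarrow> 0 \<le> uc k x \<and> uc k x \<le> U x ^ k / fact k)" for k
  proof (induction k)
    case (Suc k)
    then show ?case using step[of k] antideriv_onD(1) by blast
  qed auto
  note st = step[OF ind]
  show "continuous_on {0..r} (uc k)" using ind by blast
  show "0 \<le> uc k x" if "0 \<le> x" "x \<le> r" for x using ind that by blast
  show "uc k x \<le> U x ^ k / fact k" if "0 \<le> x" "x \<le> r" for x using ind that by blast
  show "antideriv_on r (\<lambda>x. m x * uc k x) (cc k)" using st[of k] by (elim conjE)
  show "0 \<le> cc k x" if "0 \<le> x" "x \<le> r" for x using st[of k] that by (simp del: uc.simps)
  show "cc k x \<le> M x * (U x ^ k / fact k)" if "0 \<le> x" "x \<le> r" for x using st[of k] that by (simp del: uc.simps)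
  show "antideriv_on r (\<lambda>x. s x * cc k x) (uc (Suc k))" using st[of k] by (elim conjE)
qed

declare uc.simps(2)[simp del]

end

section \<open>Power series in the spectral parameter\<close>

context krein_string begin

text \<open>Coefficients of geometric growth cover the powers of a real parameter as well as the
  real and imaginary parts of the powers of a complex one, so real analysis suffices for complex
  parameters.\<close>

definition geo :: "real \<Rightarrow> real \<Rightarrow> (nat \<Rightarrow> real) \<Rightarrow> bool" where
  "geo K R w \<longleftrightarrow> 0 \<le> K \<and> 0 \<le> R \<and> (\<forall>k. \<bar>w k\<bar> \<le> K * R ^ k)"

lemma geo_Suc: "geo K R w \<Longrightarrow> geo (K * R) R (\<lambda>k. w (Suc k))"
  unfolding geo_def by (metis mult.assoc mult_nonneg_nonneg power_Suc)

definition useries :: "(nat \<Rightarrow> real) \<Rightarrow> real \<Rightarrow> real" where "useries w x = (\<Sum>k. w k * uc k x)"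
definition cseries :: "(nat \<Rightarrow> real) \<Rightarrow> real \<Rightarrow> real" where "cseries w x = (\<Sum>k. w k * cc k x)"

lemma uc_le_r: assumes "0 \<le> x" "x \<le> r" shows "uc k x \<le> U r ^ k / fact k"
proof -
  have "uc k x \<le> U x ^ k / fact k" by (rule uc_cc(3)[OF assms])
  also have "\<dots> \<le> U r ^ k / fact k" using U_mono[of x r] U_nonneg[of x] assms by (intro divide_right_mono power_mono) auto
  finally show ?thesis .
qed

lemma cc_le_r: assumes "0 \<le> x" "x \<le> r" shows "cc k x \<le> M r * (U r ^ k / fact k)"
proof -
  have "cc k x \<le> M x * (U x ^ k / fact k)" by (rule uc_cc(6)[OF assms])
  also have "\<dots> \<le> M r * (U r ^ k / fact k)"
    using U_mono[of x r] U_nonneg[of x] M_mono[of x r] M_nonneg[of r] assms r_pos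
    by (intro mult_mono divide_right_mono power_mono) auto
  finally show ?thesis .
qed

lemma abs_w_uc_le:
  assumes w: "geo K R w" and x: "0 \<le> x" "x \<le> r"
  shows "\<bar>w k * uc k x\<bar> \<le> K * ((R * U x) ^ k / fact k)" "\<bar>w k * uc k x\<bar> \<le> K * ((R * U r) ^ k / fact k)"
    "\<bar>w k * cc k x\<bar> \<le> M x * (K * ((R * U x) ^ k / fact k))" "\<bar>w k * cc k x\<bar> \<le> M r * K * ((R * U r) ^ k / fact k)"
proof -
  have k: "\<bar>w k\<bar> \<le> K * R ^ k" and K: "0 \<le> K" and R: "0 \<le> R" using w by (auto simp: geo_def)
  have "\<bar>w k * uc k x\<bar> \<le> (K * R ^ k) * (U x ^ k / fact k)"
    unfolding abs_mult using k uc_cc(2)[OF x, of k] uc_cc(3)[OF x, of k] K R by (intro mult_mono) auto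
  then show "\<bar>w k * uc k x\<bar> \<le> K * ((R * U x) ^ k / fact k)" by (simp add: power_mult_distrib)
  have "\<bar>w k * uc k x\<bar> \<le> (K * R ^ k) * (U r ^ k / fact k)"
    unfolding abs_mult using k uc_cc(2)[OF x, of k] uc_le_r[OF x, of k] K R by (intro mult_mono) auto
  then show "\<bar>w k * uc k x\<bar> \<le> K * ((R * U r) ^ k / fact k)" by (simp add: power_mult_distrib)
  have "\<bar>w k * cc k x\<bar> \<le> (K * R ^ k) * (M x * (U x ^ k / fact k))"
    unfolding abs_mult using k uc_cc(5)[OF x, of k] uc_cc(6)[OF x, of k] K R by (intro mult_mono) auto
  then show "\<bar>w k * cc k x\<bar> \<le> M x * (K * ((R * U x) ^ k / fact k))" by (simp add: power_mult_distrib mult_ac)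
  have "\<bar>w k * cc k x\<bar> \<le> (K * R ^ k) * (M r * (U r ^ k / fact k))"
    unfolding abs_mult using k uc_cc(5)[OF x, of k] cc_le_r[OF x, of k] K R by (intro mult_mono) auto
  then show "\<bar>w k * cc k x\<bar> \<le> M r * K * ((R * U r) ^ k / fact k)" by (simp add: power_mult_distrib mult_ac)
qed

lemma exp_real_sums: "(\<lambda>k. x ^ k / fact k) sums exp (x::real)"
  using exp_converges[of x] by (simp add: divide_inverse mult.commute)

lemma useries_summable:
  assumes w: "geo K R w" and x: "0 \<le> x" "x \<le> r"
  shows "summable (\<lambda>k. w k * uc k x)" "summable (\<lambda>k. w k * cc k x)"
proof -
  show "summable (\<lambda>k. w k * uc k x)"
    by (rule summable_comparison_test'[OF sums_summable[OF sums_mult[OF exp_real_sums]], where N=0])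
      (unfold real_norm_def, rule abs_w_uc_le(1)[OF w x])
  show "summable (\<lambda>k. w k * cc k x)"
    by (rule summable_comparison_test'[OF sums_summable[OF sums_mult[OF exp_real_sums]], where N=0])
      (unfold real_norm_def, rule abs_w_uc_le(4)[OF w x])
qed

lemma useries_le:
  assumes w: "geo K R w" and x: "0 \<le> x" "x \<le> r"
  shows "\<bar>useries w x\<bar> \<le> K * exp (R * U x)" "\<bar>cseries w x\<bar> \<le> M x * (K * exp (R * U x))"
    "\<bar>useries w x - w 0\<bar> \<le> K * (exp (R * U x) - 1)"
proof -
  have e: "(\<lambda>k. K * ((R * U x) ^ k / fact k)) sums (K * exp (R * U x))"
    by (intro sums_mult exp_real_sums)
  have e': "(\<lambda>k. K * ((R * U x) ^ Suc k / fact (Suc k))) sums (K * (exp (R * U x) - 1))"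
    using e unfolding sums_Suc_iff[of "\<lambda>k. K * ((R * U x) ^ k / fact k)"]
    by (simp add: right_diff_distrib del: power_Suc fact_Suc)
  have s: "(\<lambda>k. w k * uc k x) sums useries w x" "(\<lambda>k. w k * cc k x) sums cseries w x"
    using useries_summable[OF w x] by (simp_all add: useries_def cseries_def summable_sums)
  then have s': "(\<lambda>k. w (Suc k) * uc (Suc k) x) sums (useries w x - w 0)"
    unfolding sums_Suc_iff[of "\<lambda>k. w k * uc k x"] by simp
  have bound: "\<bar>l\<bar> \<le> L" if "f sums l" "g sums L" "\<And>k. \<bar>f k\<bar> \<le> g k" for f g :: "nat \<Rightarrow> real" and l L
  proof -
    have "f k \<le> g k" "- g k \<le> f k" for k using that(3)[of k] by auto
    then show ?thesis using sums_le[OF _ that(1,2)] sums_le[OF _ sums_minus[OF that(2)] that(1)] by (simp add: abs_le_iff)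
  qed
  show "\<bar>useries w x\<bar> \<le> K * exp (R * U x)" by (rule bound[OF s(1) e abs_w_uc_le(1)[OF w x]])
  show "\<bar>cseries w x\<bar> \<le> M x * (K * exp (R * U x))" by (rule bound[OF s(2) sums_mult[OF e] abs_w_uc_le(3)[OF w x]])
  show "\<bar>useries w x - w 0\<bar> \<le> K * (exp (R * U x) - 1)" by (rule bound[OF s' e' abs_w_uc_le(1)[OF w x]])
qed

lemma series_cont:
  assumes w: "geo K R w"
  shows "continuous_on {0..r} (useries w)" "continuous_on {0..r} (cseries w)"
proof -
  have u: "uniform_limit {0..r} (\<lambda>n x. \<Sum>k<n. w k * uc k x) (useries w) sequentially"
    unfolding useries_def by (rule Weierstrass_m_test[OF _ sums_summable[OF sums_mult[OF exp_real_sums]]])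
      (use abs_w_uc_le(2)[OF w] in auto)
  show "continuous_on {0..r} (useries w)"
    by (rule uniform_limit_theorem[OF _ u]) (auto intro!: always_eventually continuous_intros uc_cc)
  have c: "uniform_limit {0..r} (\<lambda>n x. \<Sum>k<n. w k * cc k x) (cseries w) sequentially"
    unfolding cseries_def by (rule Weierstrass_m_test[OF _ sums_summable[OF sums_mult[OF exp_real_sums]]])
      (use abs_w_uc_le(4)[OF w] in auto)
  show "continuous_on {0..r} (cseries w)"
    by (rule uniform_limit_theorem[OF _ c]) (auto intro!: always_eventually continuous_intros antideriv_onD(1)[OF uc_cc(4)])
qed

lemma bounded_near:
  assumes g: "continuous_on {0<..<r} g" and x: "0 < x" "x < r"
  obtains a b B :: real where "0 < a" "a < x" "x < b" "b < r" "\<And>y. a \<le> y \<Longrightarrow> y \<le> b \<Longrightarrow> \<bar>g y\<bar> \<le> B"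
proof -
  obtain a b where ab: "0 < a" "a < x" "x < b" "b < r" using x dense by meson
  have "bounded (g ` {a..b})"
    by (intro compact_imp_bounded compact_continuous_image continuous_on_subset[OF g]) (use ab in auto)
  then obtain B where "\<And>y. a \<le> y \<Longrightarrow> y \<le> b \<Longrightarrow> \<bar>g y\<bar> \<le> B" unfolding bounded_iff by fastforce
  with ab show thesis by (rule that)
qed

lemma cseries_deriv:
  assumes w: "geo K R w" and x: "0 < x" "x < r"
  shows "(cseries w has_real_derivative m x * useries w x) (at x)"
proof -
  obtain a b B where ab: "0 < a" "a < x" "x < b" "b < r" and B: "\<And>y. a \<le> y \<Longrightarrow> y \<le> b \<Longrightarrow> \<bar>m y\<bar> \<le> B"
    using bounded_near[OF m_cont x] by metis
  have B0: "0 \<le> B" using B[of x] ab by auto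
  have "((\<lambda>x. \<Sum>k. w k * cc k x) has_real_derivative (\<Sum>k. w k * (m x * uc k x))) (at x)"
  proof (rule has_field_derivative_series'(2)[of "{a..b}" _ _ x])
    show "((\<lambda>x. w n * cc n x) has_real_derivative w n * (m y * uc n y)) (at y within {a..b})" if "y \<in> {a..b}" for n y
      by (intro has_field_derivative_at_within[OF DERIV_cmult] antideriv_onD(3)[OF uc_cc(4)]) (use that ab in auto)
    show "uniformly_convergent_on {a..b} (\<lambda>n y. \<Sum>i<n. w i * (m y * uc i y))"
    proof (rule Weierstrass_m_test')
      show "summable (\<lambda>k. B * (K * ((R * U r) ^ k / fact k)))"
        by (intro summable_mult sums_summable[OF exp_real_sums])
      fix k y assume y: "y \<in> {a..b}"
      have "\<bar>m y\<bar> * \<bar>w k * uc k y\<bar> \<le> B * (K * ((R * U r) ^ k / fact k))"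
        using B[of y] B0 abs_w_uc_le(2)[OF w, of y k] y ab by (intro mult_mono) auto
      then show "norm (w k * (m y * uc k y)) \<le> B * (K * ((R * U r) ^ k / fact k))"
        by (simp add: abs_mult mult_ac)
    qed
    show "summable (\<lambda>n. w n * cc n x)" using useries_summable[OF w] x by auto
  qed (use ab in auto)
  also have "(\<Sum>k. w k * (m x * uc k x)) = m x * useries w x"
    using suminf_mult[OF useries_summable(1)[OF w, of x], of "m x"] x by (simp add: useries_def mult_ac)
  finally show ?thesis by (simp add: cseries_def[abs_def])
qed

text \<open>The constant term drops out and \<open>uc (Suc k)\<close> has flux \<open>cc k\<close>,
  which shifts the coefficients by one. Uniform convergence of the derivatives is used only on a
  compact neighbourhood of \<open>x\<close>, where \<open>s\<close> is bounded.\<close>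

lemma useries_deriv:
  assumes w: "geo K R w" and x: "0 < x" "x < r"
  shows "(useries w has_real_derivative s x * cseries (\<lambda>k. w (Suc k)) x) (at x)"
proof -
  note w' = geo_Suc[OF w]
  obtain a b B where ab: "0 < a" "a < x" "x < b" "b < r" and B: "\<And>y. a \<le> y \<Longrightarrow> y \<le> b \<Longrightarrow> \<bar>s y\<bar> \<le> B"
    using bounded_near[OF s_cont x] by metis
  have B0: "0 \<le> B" using B[of x] ab by auto
  have "((\<lambda>x. \<Sum>k. w (Suc k) * uc (Suc k) x) has_real_derivative (\<Sum>k. w (Suc k) * (s x * cc k x))) (at x)"
  proof (rule has_field_derivative_series'(2)[of "{a..b}" _ _ x])
    show "((\<lambda>x. w (Suc n) * uc (Suc n) x) has_real_derivative w (Suc n) * (s y * cc n y)) (at y within {a..b})" if "y \<in> {a..b}" for n y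
      by (intro has_field_derivative_at_within[OF DERIV_cmult] antideriv_onD(3)[OF uc_cc(7)]) (use that ab in auto)
    show "uniformly_convergent_on {a..b} (\<lambda>n y. \<Sum>i<n. w (Suc i) * (s y * cc i y))"
    proof (rule Weierstrass_m_test')
      show "summable (\<lambda>k. B * (M r * (K * R) * ((R * U r) ^ k / fact k)))"
        by (intro summable_mult sums_summable[OF exp_real_sums])
      fix k y assume y: "y \<in> {a..b}"
      have "\<bar>s y\<bar> * \<bar>w (Suc k) * cc k y\<bar> \<le> B * (M r * (K * R) * ((R * U r) ^ k / fact k))"
        using B[of y] B0 abs_w_uc_le(4)[OF w', of y k] y ab by (intro mult_mono) auto
      then show "norm (w (Suc k) * (s y * cc k y)) \<le> B * (M r * (K * R) * ((R * U r) ^ k / fact k))"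
        by (simp add: abs_mult mult_ac)
    qed
    have "summable (\<lambda>n. w n * uc n x)" using useries_summable[OF w] x by auto
    then show "summable (\<lambda>n. w (Suc n) * uc (Suc n) x)" by (subst summable_Suc_iff)
  qed (use ab in auto)
  also have "(\<Sum>k. w (Suc k) * (s x * cc k x)) = s x * cseries (\<lambda>k. w (Suc k)) x"
    using suminf_mult[OF useries_summable(2)[OF w', of x], of "s x"] x by (simp add: cseries_def mult_ac)
  finally have d: "((\<lambda>x. w 0 + (\<Sum>k. w (Suc k) * uc (Suc k) x)) has_real_derivative s x * cseries (\<lambda>k. w (Suc k)) x) (at x)"
    by (auto intro!: derivative_eq_intros)
  show ?thesis
  proof (rule has_field_derivative_transform_within_open[OF d, of "{0<..<r}"])
    fix y assume y: "y \<in> {0<..<r}"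
    show "w 0 + (\<Sum>k. w (Suc k) * uc (Suc k) y) = useries w y"
      unfolding useries_def using suminf_split_head[OF useries_summable(1)[OF w, of y]] y by simp
  qed (use x in auto)
qed

lemma useries_0: assumes "geo K R w" shows "useries w 0 = w 0" "cseries w 0 = 0"
  using useries_le(3)[OF assms, of 0] useries_le(2)[OF assms, of 0] r_pos U_D(2) M_D(2) by auto

end

section \<open>The fundamental solution and the characteristic function\<close>

context krein_string begin

lemma cseries_cmult: "geo K R w \<Longrightarrow> 0 \<le> x \<Longrightarrow> x \<le> r \<Longrightarrow> cseries (\<lambda>k. a * w k) x = a * cseries w x"
  unfolding cseries_def using suminf_mult[OF useries_summable(2)] by (simp add: mult.assoc)

lemma useries_cmult: "geo K R w \<Longrightarrow> 0 \<le> x \<Longrightarrow> x \<le> r \<Longrightarrow> useries (\<lambda>k. a * w k) x = a * useries w x"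
  unfolding useries_def using suminf_mult[OF useries_summable(1)] by (simp add: mult.assoc)

lemma useries_add:
  "geo K R w \<Longrightarrow> geo K' R' w' \<Longrightarrow> 0 \<le> x \<Longrightarrow> x \<le> r \<Longrightarrow> useries (\<lambda>k. w k + w' k) x = useries w x + useries w' x"
  unfolding useries_def using suminf_add[OF useries_summable(1) useries_summable(1)] by (simp add: distrib_right)

lemma geo_power: "geo 1 \<bar>\<mu>\<bar> (\<lambda>k. \<mu> ^ k)"
  by (auto simp: geo_def power_abs)

text \<open>The fundamental solution and its flux: they solve u' = s v, v' = \<mu> m u with u = 1
  and v = 0 at the left end.\<close>

definition uu :: "real \<Rightarrow> real \<Rightarrow> real" where "uu \<mu> = useries (\<lambda>k. \<mu> ^ k)"
definition vv :: "real \<Rightarrow> real \<Rightarrow> real" where "vv \<mu> x = \<mu> * cseries (\<lambda>k. \<mu> ^ k) x"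

lemma uu_cont: "continuous_on {0..r} (uu \<mu>)" and vv_cont: "continuous_on {0..r} (vv \<mu>)"
  unfolding uu_def vv_def[abs_def] by (auto intro!: continuous_intros series_cont[OF geo_power])

lemma uu_0: "uu \<mu> 0 = 1" and vv_0: "vv \<mu> 0 = 0"
  unfolding uu_def vv_def using useries_0[OF geo_power] by auto

lemma uu_deriv: "0 < x \<Longrightarrow> x < r \<Longrightarrow> (uu \<mu> has_real_derivative s x * vv \<mu> x) (at x)"
  using useries_deriv[OF geo_power, of x \<mu>] cseries_cmult[OF geo_power, of x \<mu> \<mu>] by (simp add: uu_def vv_def)

lemma vv_deriv: "0 < x \<Longrightarrow> x < r \<Longrightarrow> (vv \<mu> has_real_derivative m x * (\<mu> * uu \<mu> x)) (at x)"
  using DERIV_cmult[OF cseries_deriv[OF geo_power, of x \<mu>], of \<mu>] by (simp add: uu_def vv_def[abs_def] mult_ac)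

lemma vv_le: "0 \<le> x \<Longrightarrow> x \<le> r \<Longrightarrow> \<bar>vv \<mu> x\<bar> \<le> \<bar>\<mu>\<bar> * (M x * exp (\<bar>\<mu>\<bar> * U x))"
  unfolding vv_def abs_mult using useries_le(2)[OF geo_power, of x \<mu>] by (intro mult_left_mono) auto

lemma uu_le: "0 \<le> x \<Longrightarrow> x \<le> r \<Longrightarrow> \<bar>uu \<mu> x\<bar> \<le> exp (\<bar>\<mu>\<bar> * U x)"
  using useries_le(1)[OF geo_power, of x \<mu>] by (simp add: uu_def)

lemma cc_0: "0 \<le> x \<Longrightarrow> x \<le> r \<Longrightarrow> cc 0 x = M x"
  using antideriv_on_unique[OF uc_cc(4)[of 0] M] by simp

lemma vv_ge: assumes "0 \<le> \<mu>" "0 \<le> x" "x \<le> r" shows "\<mu> * M x \<le> vv \<mu> x"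
proof -
  have "(\<Sum>k\<in>{0}. \<mu> ^ k * cc k x) \<le> (\<Sum>k. \<mu> ^ k * cc k x)"
    using assms by (intro sum_le_suminf useries_summable(2)[OF geo_power] mult_nonneg_nonneg uc_cc(5)) auto
  then show ?thesis using assms by (simp add: vv_def cseries_def cc_0 mult_left_mono)
qed

lemma uu_ge: assumes "0 \<le> \<mu>" "0 \<le> x" "x \<le> r" shows "1 \<le> uu \<mu> x"
proof -
  have "(\<Sum>k\<in>{0}. \<mu> ^ k * uc k x) \<le> (\<Sum>k. \<mu> ^ k * uc k x)"
    using assms by (intro sum_le_suminf useries_summable(1)[OF geo_power] mult_nonneg_nonneg uc_cc(2)) auto
  then show ?thesis by (simp add: uu_def useries_def)
qed

text \<open>The flux \<open>vv \<mu> r\<close> at the right end, divided by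
  \<open>\<mu> * M r\<close>. This removes the zero at \<mu> = 0, which belongs to the constant
  eigenfunction, and makes the value at 0 equal to 1.\<close>

definition Dfun :: "complex \<Rightarrow> complex" where
  "Dfun z = (\<Sum>k. of_real (cc k r / M r) * z ^ k)"

lemma Mr: "0 < M r" using M_pos[of r] r_pos by simp

lemma d_coeff: "0 \<le> cc k r / M r" "cc k r / M r \<le> U r ^ k / fact k"
  using uc_cc(5)[of r k] cc_le_r[of r k] r_pos Mr by (auto simp: field_simps)

lemma Dfun_summable_norm: "summable (\<lambda>k. norm (of_real (cc k r / M r) * z ^ k :: complex))"
proof (rule summable_comparison_test'[OF sums_summable[OF exp_real_sums[of "U r * norm z"]], where N=0])
  fix k
  have "cc k r / M r * norm z ^ k \<le> U r ^ k / fact k * norm z ^ k"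
    by (intro mult_right_mono d_coeff) auto
  then show "norm (norm (of_real (cc k r / M r) * z ^ k :: complex)) \<le> (U r * norm z) ^ k / fact k"
    using uc_cc(5)[of r k] r_pos Mr by (simp add: norm_mult norm_divide norm_power power_mult_distrib)
qed

lemma Dfun_sums: "(\<lambda>k. of_real (cc k r / M r) * z ^ k) sums Dfun z"
  unfolding Dfun_def by (intro summable_sums summable_norm_cancel[OF Dfun_summable_norm])

lemma Dfun_holomorphic: "Dfun holomorphic_on UNIV"
proof -
  have "(Dfun has_field_derivative (\<Sum>k. diffs (\<lambda>k. of_real (cc k r / M r)) k * z ^ k)) (at z)" for z
    unfolding Dfun_def[abs_def]
    by (rule termdiffs_strong_converges_everywhere) (rule summable_norm_cancel[OF Dfun_summable_norm])
  then show ?thesis by (auto simp: holomorphic_on_def intro: field_differentiable_at_within simp: field_differentiable_def)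
qed

lemma Dfun_0: "Dfun 0 = 1"
  using powser_zero[of "\<lambda>k. complex_of_real (cc k r / M r)"] cc_0[of r] r_pos Mr by (simp add: Dfun_def)

lemma Dfun_scaled_sums: "(\<lambda>k. of_real (cc k r) * z ^ k) sums (M r * Dfun z)"
  using sums_mult[OF Dfun_sums[of z], of "of_real (M r)"] Mr by (simp add: mult.assoc[symmetric])

lemma Dfun_of_real: "Dfun (of_real \<mu>) = of_real (cseries (\<lambda>k. \<mu> ^ k) r / M r)"
proof -
  have "(\<lambda>k. complex_of_real (\<mu> ^ k * cc k r)) sums (of_real (cseries (\<lambda>k. \<mu> ^ k) r))"
    unfolding cseries_def using useries_summable(2)[OF geo_power, of r] r_pos by (intro sums_of_real summable_sums) auto
  then have "complex_of_real (cseries (\<lambda>k. \<mu> ^ k) r) = M r * Dfun \<mu>"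
    using sums_unique2[OF Dfun_scaled_sums[of \<mu>]] by (simp add: mult.commute)
  then show ?thesis using Mr by (simp add: field_simps)
qed

lemma Dfun_vv: "Re (Dfun (of_real \<mu>)) * (\<mu> * M r) = vv \<mu> r"
  using Mr by (simp add: Dfun_of_real vv_def)

lemma norm_Dfun_le: "norm (Dfun z) \<le> Re (Dfun (of_real (norm z)))"
proof -
  have "norm (Dfun z) \<le> (\<Sum>k. norm (of_real (cc k r / M r) * z ^ k))"
    unfolding Dfun_def by (rule summable_norm[OF Dfun_summable_norm])
  also have "\<dots> = Re (Dfun (of_real (norm z)))"
    using uc_cc(5)[of r] r_pos Mr
    by (simp add: Dfun_of_real cseries_def norm_mult norm_power norm_divide suminf_divide[OF useries_summable(2)[OF geo_power], of r, symmetric] less_imp_le mult.commute)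
  finally show ?thesis .
qed

lemma Dfun_real_mono: assumes "0 \<le> x" "x \<le> y" shows "Re (Dfun (of_real x)) \<le> Re (Dfun (of_real y))"
proof -
  have "cseries (\<lambda>k. x ^ k) r \<le> cseries (\<lambda>k. y ^ k) r"
    unfolding cseries_def using assms r_pos
    by (intro suminf_le useries_summable(2)[OF geo_power] mult_right_mono power_mono uc_cc(5)) auto
  then show ?thesis using Mr by (simp add: Dfun_of_real divide_right_mono)
qed

lemma ex_small_U: assumes "0 < e" obtains x where "0 < x" "x < r" "U x < e"
proof -
  have "continuous (at 0 within {0..r}) U" using U_D(1) r_pos by (simp add: continuous_on_eq_continuous_within)
  then obtain d where d: "d > 0" "\<And>x. x \<in> {0..r} \<Longrightarrow> dist x 0 < d \<Longrightarrow> dist (U x) (U 0) < e"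
    using assms unfolding continuous_within_eps_delta by meson
  define x where "x = min (d / 2) (r / 2)"
  have x: "0 < x" "x < d" "x < r" using d(1) r_pos by (auto simp: x_def)
  then show thesis using d(2)[of x] U_D(2) by (intro that[of x]) (auto simp: dist_real_def)
qed

text \<open>Green's identity for u and its conjugate: the imaginary part of flux times conj u has
  derivative Im z m |u|^2, because the scale term is real. Its value at \<open>r\<close> is
  controlled by |D z|, while near 0 the function u is close to 1, so the integral is bounded below
  uniformly on the disc.\<close>

lemma Dfun_ge_Im:
  assumes R: "0 < R"
  shows "\<exists>\<kappa>>0. \<forall>z. norm z \<le> R \<longrightarrow> \<kappa> * \<bar>Im z\<bar> \<le> norm (Dfun z)"
proof -
  \<comment> \<open>Then exp (R U x) is at most 3/2 on (0, x1), which keeps the real part of the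
    solution above 1/2 there.\<close>
  obtain x1 where x1: "0 < x1" "x1 < r" "U x1 < ln (3/2) / R" using ex_small_U[of "ln (3/2) / R"] R by auto
  define E where "E = exp (R * U r)"
  \<comment> \<open>Solves b^2 M x1 / 4 = 2 |b| R (M r) E |D z| for |D z| / |b|; the factor
    \<open>R\<close> enters because the flux at \<open>r\<close> is
    \<open>M r * Dfun z * z\<close>.\<close>
  define \<kappa> where "\<kappa> = M x1 / (8 * R * M r * E)"
  have \<kappa>: "0 < \<kappa>" unfolding \<kappa>_def E_def using R Mr M_pos[of x1] x1 by simp
  have "\<kappa> * \<bar>Im z\<bar> \<le> norm (Dfun z)" if z: "norm z \<le> R" for z
  proof -
    define a b where "a = Re z" and "b = Im z"
    define wr wi where "wr k = Re (z ^ k)" and "wi k = Im (z ^ k)" for k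
    have zR: "norm (z ^ k) \<le> R ^ k" for k using z by (simp add: norm_power power_mono)
    have gr: "geo 1 R wr" and gi: "geo 1 R wi" using R zR abs_Re_le_cmod abs_Im_le_cmod
      unfolding geo_def wr_def wi_def by (auto intro: order_trans)
    have wS: "wr (Suc k) = a * wr k + (- b) * wi k" "wi (Suc k) = a * wi k + b * wr k" for k
      by (auto simp: wr_def wi_def a_def b_def)
    define A B C D where "A = useries wr" and "B = useries wi"
      and "C = cseries (\<lambda>k. wr (Suc k))" and "D = cseries (\<lambda>k. wi (Suc k))"
    note gS = geo_Suc[OF gr] geo_Suc[OF gi]
    have geoc: "geo (\<bar>c\<bar> * 1) R (\<lambda>k. c * w k)" if "geo 1 R w" for c w
      using that by (auto simp: geo_def abs_mult intro!: mult_left_mono)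
    have u2: "useries (\<lambda>k. wr (Suc k)) x = a * A x - b * B x" "useries (\<lambda>k. wi (Suc k)) x = a * B x + b * A x"
      if "0 \<le> x" "x \<le> r" for x
      unfolding wS A_def B_def
      using useries_add[OF geoc[OF gr] geoc[OF gi] that] useries_add[OF geoc[OF gi] geoc[OF gr] that]
        useries_cmult[OF gr that] useries_cmult[OF gi that] by (auto simp only: diff_conv_add_uminus minus_mult_left)
    \<comment> \<open>With solution A + i B and flux C + i D this is Im z times the imaginary part
      of the flux times the conjugate solution. The extra factor \<open>b\<close> makes its
      derivative nonnegative for either sign of Im z.\<close>
    define \<Phi> where "\<Phi> x = b * (D x * A x - C x * B x)" for x
    have d\<Phi>: "(\<Phi> has_real_derivative b\<^sup>2 * (m x * ((A x)\<^sup>2 + (B x)\<^sup>2))) (at x)" if x: "0 < x" "x < r" for x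
      unfolding \<Phi>_def
      using useries_deriv[OF gr x] useries_deriv[OF gi x] cseries_deriv[OF gS(1) x] cseries_deriv[OF gS(2) x] u2[of x] x
      unfolding A_def[symmetric] B_def[symmetric] C_def[symmetric] D_def[symmetric]
      by (auto intro!: derivative_eq_intros simp: power2_eq_square algebra_simps)
    have c\<Phi>: "continuous_on {0..r} \<Phi>" unfolding \<Phi>_def A_def B_def C_def D_def
      by (intro continuous_intros series_cont[OF gr] series_cont[OF gi] series_cont[OF gS(1)] series_cont[OF gS(2)])
    have \<Phi>0: "\<Phi> 0 = 0" using useries_0(2)[OF gS(1)] useries_0(2)[OF gS(2)] by (simp add: \<Phi>_def C_def D_def)
    have a\<Phi>: "antideriv_on r (\<lambda>x. b\<^sup>2 * (m x * ((A x)\<^sup>2 + (B x)\<^sup>2))) \<Phi>"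
      using d\<Phi> c\<Phi> \<Phi>0 by (simp add: antideriv_on_def)
    have "\<Phi> x1 \<le> \<Phi> r"
      by (rule antideriv_on_mono[OF a\<Phi>]) (use x1 m_pos in \<open>auto simp: less_imp_le\<close>)
    moreover have "b\<^sup>2 / 4 * M x1 - b\<^sup>2 / 4 * M 0 \<le> \<Phi> x1 - \<Phi> 0"
    proof (rule deriv_le_imp_diff_le[where f'="\<lambda>x. b\<^sup>2 / 4 * m x" and g'="\<lambda>x. b\<^sup>2 * (m x * ((A x)\<^sup>2 + (B x)\<^sup>2))"])
      fix x assume x: "0 < x" "x < x1"
      have "U x \<le> U x1" using U_mono[of x x1] x x1 by auto
      then have "R * U x \<le> ln (3/2)" using x1(3) R by (simp add: field_simps) (smt (verit) mult_left_mono)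
      then have "exp (R * U x) \<le> 3 / 2" using exp_le_cancel_iff[of "R * U x" "ln (3/2)"] by simp
      then have "\<bar>A x - 1\<bar> \<le> 1 / 2" using useries_le(3)[OF gr, of x] x x1 by (simp add: A_def wr_def)
      then have "1 / 2 \<le> A x" by linarith
      then have "(1 / 2)\<^sup>2 \<le> (A x)\<^sup>2" by (intro power_mono) auto
      then have "1 / 4 \<le> (A x)\<^sup>2 + (B x)\<^sup>2" by (simp add: power2_eq_square add_increasing2)
      then have "b\<^sup>2 * (m x * (1 / 4)) \<le> b\<^sup>2 * (m x * ((A x)\<^sup>2 + (B x)\<^sup>2))"
        using m_pos[of x] x x1 by (intro mult_left_mono) auto
      then show "b\<^sup>2 / 4 * m x \<le> b\<^sup>2 * (m x * ((A x)\<^sup>2 + (B x)\<^sup>2))" by simp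
      show "((\<lambda>x. b\<^sup>2 / 4 * M x) has_real_derivative b\<^sup>2 / 4 * m x) (at x)"
        by (rule DERIV_cmult[OF M_D(3)]) (use x x1 in auto)
      show "(\<Phi> has_real_derivative b\<^sup>2 * (m x * ((A x)\<^sup>2 + (B x)\<^sup>2))) (at x)" by (rule d\<Phi>) (use x x1 in auto)
    next
      show "continuous_on {0..x1} (\<lambda>x. b\<^sup>2 / 4 * M x)" "continuous_on {0..x1} \<Phi>"
        by (intro continuous_intros continuous_on_subset[OF M_D(1)] continuous_on_subset[OF c\<Phi>]; use x1 in auto)+
    qed (use x1 in auto)
    ultimately have lower: "b\<^sup>2 / 4 * M x1 \<le> \<Phi> r" using \<Phi>0 M_D(2) by simp
    have zD: "(\<lambda>k. of_real (cc k r) * z ^ Suc k) sums (M r * Dfun z * z)"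
      using sums_mult[OF Dfun_scaled_sums[of z], of z] by (simp add: mult_ac)
    have "C r = Re (M r * Dfun z * z)" "D r = Im (M r * Dfun z * z)"
      using sums_Re[OF zD] sums_Im[OF zD] unfolding C_def D_def cseries_def wr_def wi_def
      by (auto simp: mult.commute dest!: sums_unique simp del: power_Suc)
    then have CD: "\<bar>C r\<bar> \<le> M r * norm (Dfun z) * R" "\<bar>D r\<bar> \<le> M r * norm (Dfun z) * R"
    proof -
      have "norm (M r * Dfun z * z) \<le> M r * norm (Dfun z) * R"
        using z Mr by (simp add: norm_mult mult_left_mono)
      then show "\<bar>C r\<bar> \<le> M r * norm (Dfun z) * R" "\<bar>D r\<bar> \<le> M r * norm (Dfun z) * R"
        using abs_Re_le_cmod[of "M r * Dfun z * z"] abs_Im_le_cmod[of "M r * Dfun z * z"] \<open>C r = _\<close> \<open>D r = _\<close> by linarith+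
    qed
    have AB: "\<bar>A r\<bar> \<le> E" "\<bar>B r\<bar> \<le> E" using useries_le(1)[OF gr, of r] useries_le(1)[OF gi, of r] r_pos
      by (auto simp: A_def B_def E_def)
    have DA: "\<bar>D r * A r\<bar> \<le> M r * norm (Dfun z) * R * E" "\<bar>C r * B r\<bar> \<le> M r * norm (Dfun z) * R * E"
      unfolding abs_mult by (intro mult_mono CD AB; use Mr R in \<open>auto intro: mult_nonneg_nonneg\<close>)+
    have "\<Phi> r \<le> \<bar>b\<bar> * \<bar>D r * A r - C r * B r\<bar>" unfolding \<Phi>_def abs_mult[symmetric] by (rule abs_ge_self)
    also have "\<dots> \<le> \<bar>b\<bar> * (2 * (M r * norm (Dfun z) * R * E))"
      by (rule mult_left_mono) (use DA in linarith, simp)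
    finally have le: "\<bar>b\<bar> * (\<bar>b\<bar> * M x1) \<le> \<bar>b\<bar> * (8 * R * M r * E * norm (Dfun z))"
      using lower by (simp add: power2_eq_square mult_ac)
    show ?thesis
    proof (cases "b = 0")
      case False
      then have "\<bar>b\<bar> * M x1 \<le> 8 * R * M r * E * norm (Dfun z)" using le by simp
      moreover have "0 < 8 * R * M r * E" using R Mr by (simp add: E_def)
      ultimately show ?thesis unfolding \<kappa>_def b_def by (simp add: pos_divide_le_eq mult_ac)
    qed (simp add: b_def)
  qed
  with \<kappa> show ?thesis by blast
qed

lemma Dfun_pos: assumes "0 \<le> x" shows "1 \<le> Re (Dfun (of_real x))"
  using Dfun_real_mono[of 0 x] assms Dfun_0 by simp

lemma Dfun_zero_real: assumes "Dfun z = 0" obtains x where "0 < x" "z = - of_real x"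
proof -
  obtain \<kappa> where "\<kappa> > 0" "\<forall>w. norm w \<le> norm z + 1 \<longrightarrow> \<kappa> * \<bar>Im w\<bar> \<le> norm (Dfun w)"
    using Dfun_ge_Im[of "norm z + 1"] norm_ge_zero[of z] by (auto simp del: norm_ge_zero)
  then have "\<kappa> * \<bar>Im z\<bar> \<le> 0" using assms by (metis le_add_same_cancel1 norm_zero zero_le_one)
  then have "Im z = 0" using \<open>\<kappa> > 0\<close> by (simp add: mult_le_0_iff)
  then have z: "z = of_real (Re z)" by (simp add: complex_eq_iff)
  have "Re z < 0" using Dfun_pos[of "Re z"] assms z by (metis not_less not_one_le_zero zero_complex.simps(1))
  then show thesis using z by (intro that[of "- Re z"]) auto
qed

text \<open>At a double zero the values at \<open>x + i e\<close> would be of smaller order than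
  \<open>e\<close>, against the linear lower bound in the imaginary part.\<close>

lemma Dfun_zero_simple: assumes "Dfun (of_real x) = 0" shows "deriv Dfun (of_real x) \<noteq> 0"
proof
  assume d0: "deriv Dfun (of_real x) = 0"
  have "(Dfun has_field_derivative 0) (at (of_real x))"
    using holomorphic_derivI[OF Dfun_holomorphic open_UNIV, of "of_real x"] d0 by simp
  then have lim: "((\<lambda>h. Dfun (of_real x + h) / h) \<longlongrightarrow> 0) (at 0)"
    using assms by (simp add: DERIV_def)
  obtain \<kappa> where \<kappa>: "\<kappa> > 0" "\<And>w. norm w \<le> \<bar>x\<bar> + 1 \<Longrightarrow> \<kappa> * \<bar>Im w\<bar> \<le> norm (Dfun w)"
    using Dfun_ge_Im[of "\<bar>x\<bar> + 1"] by (metis abs_ge_zero add_nonneg_pos zero_less_one)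
  from tendstoD[OF lim \<kappa>(1)] obtain d where d: "d > 0" "\<And>h. h \<noteq> 0 \<Longrightarrow> dist h 0 < d \<Longrightarrow> norm (Dfun (of_real x + h) / h) < \<kappa>"
    unfolding eventually_at by (auto simp: dist_norm)
  define e where "e = min (d / 2) 1"
  have e: "0 < e" "e < d" "e \<le> 1" using d(1) by (auto simp: e_def)
  have "norm (of_real x + \<i> * of_real e :: complex) \<le> \<bar>x\<bar> + 1"
    using norm_triangle_ineq[of "of_real x :: complex" "\<i> * of_real e"] e by (simp add: norm_mult)
  from \<kappa>(2)[OF this] have "\<kappa> * e \<le> norm (Dfun (of_real x + \<i> * of_real e))" using e by simp
  moreover have "norm (Dfun (of_real x + \<i> * of_real e) / (\<i> * of_real e)) < \<kappa>"
    by (rule d(2)) (use e in \<open>auto simp: norm_mult\<close>)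
  ultimately show False using e by (simp add: norm_divide norm_mult pos_divide_less_eq)
qed

end

section \<open>Growth of the characteristic function and uniqueness at a singular end\<close>

context krein_string begin

text \<open>Weighting the flux by 1 / sqrt \<mu> balances the system, so beyond \<open>x0\<close>
  the combination u + v / sqrt \<mu> grows with exponent of order sqrt \<mu> only. On (0, x0), where
  \<open>s\<close> need not be integrable, the power series bound with exponent
  \<open>\<mu> * U x0\<close> is used instead.\<close>

lemma uv_growth:
  assumes \<mu>: "1 \<le> \<mu>" and x0: "0 < x0" "x0 < r"
  shows "vv \<mu> r \<le> sqrt \<mu> * (exp (\<mu> * U x0) * (1 + sqrt \<mu> * M x0)) * exp (sqrt \<mu> * (U r / M x0 + M r))"
proof -
  define q where "q = sqrt \<mu>"
  have q: "1 \<le> q" "q * q = \<mu>" using \<mu> by (auto simp: q_def)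
  \<comment> \<open>Beyond \<open>x0\<close> its derivative is at least \<open>s + m\<close>, since
    \<open>M\<close> is at least \<open>M x0\<close> there; the scale is thus measured through
    \<open>U\<close>.\<close>
  define K where "K x = U x / M x0 + M x" for x
  define E where "E x = (uu \<mu> x + vv \<mu> x / q) * exp (- (q * K x))" for x
  have Mx0: "0 < M x0" using M_pos x0 by simp
  have "E r \<le> E x0"
  proof -
    have "- E x0 \<le> - E r"
    proof (rule DERIV_nonneg_imp_increasing_open[where f="\<lambda>x. - E x"])
      show "x0 \<le> r" using x0 by simp
      show "continuous_on {x0..r} (\<lambda>x. - E x)" unfolding E_def K_def
        by (intro continuous_intros continuous_on_subset[OF uu_cont] continuous_on_subset[OF vv_cont]
          continuous_on_subset[OF U_D(1)] continuous_on_subset[OF M_D(1)]) (use x0 Mx0 q in auto)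
      fix x assume x: "x0 < x" "x < r"
      have x': "0 < x" using x x0 by simp
      define k where "k = s x * M x / M x0 + m x"
      have dK: "(K has_real_derivative k) (at x)" unfolding K_def k_def
        by (intro DERIV_add DERIV_cdivide U_D(3) M_D(3) x' x)
      have dE: "(E has_real_derivative (s x * vv \<mu> x + m x * (\<mu> * uu \<mu> x) / q) * exp (- (q * K x)) + exp (- (q * K x)) * (- (q * k)) * (uu \<mu> x + vv \<mu> x / q)) (at x)"
        unfolding E_def
        using DERIV_mult[OF DERIV_add[OF uu_deriv[OF x' x(2)] DERIV_cdivide[OF vv_deriv[OF x' x(2)]]]
            DERIV_fun_exp[OF DERIV_minus[OF DERIV_cmult[OF dK]]], of \<mu> \<mu> q q] by simp
      have s: "0 < s x" "0 < m x" using s_pos m_pos x x' by auto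
      have sk: "s x + m x \<le> k"
      proof -
        have "s x * 1 \<le> s x * (M x / M x0)" using M_mono[of x0 x] x x0 Mx0 s by (intro mult_left_mono) auto
        then show ?thesis by (simp add: k_def)
      qed
      have uv: "0 \<le> uu \<mu> x" "0 \<le> vv \<mu> x" using uu_ge[of \<mu> x] vv_ge[of \<mu> x] M_nonneg[of x] \<mu> x x'
        mult_nonneg_nonneg[of \<mu> "M x"] by linarith+
      have eq: "m x * (\<mu> * uu \<mu> x) / q = q * (m x * uu \<mu> x)" unfolding q(2)[symmetric] using q(1) by simp
      have "s x * vv \<mu> x + q * (m x * uu \<mu> x) \<le> q * ((s x + m x) * (uu \<mu> x + vv \<mu> x / q))"
      proof -
        have "q * ((s x + m x) * (uu \<mu> x + vv \<mu> x / q)) = q * (s x * uu \<mu> x) + s x * vv \<mu> x + q * (m x * uu \<mu> x) + m x * vv \<mu> x"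
          using q(1) by (simp add: field_simps)
        moreover have "0 \<le> q * (s x * uu \<mu> x)" "0 \<le> m x * vv \<mu> x" using q(1) s uv by simp_all
        ultimately show ?thesis by linarith
      qed
      also have "\<dots> \<le> q * (k * (uu \<mu> x + vv \<mu> x / q))"
        using q uv sk by (intro mult_left_mono mult_right_mono) auto
      finally have "(s x * vv \<mu> x + m x * (\<mu> * uu \<mu> x) / q) * exp (- (q * K x)) \<le> q * (k * (uu \<mu> x + vv \<mu> x / q)) * exp (- (q * K x))"
        unfolding eq by (rule mult_right_mono) simp
      then have "0 \<le> - ((s x * vv \<mu> x + m x * (\<mu> * uu \<mu> x) / q) * exp (- (q * K x)) + exp (- (q * K x)) * (- (q * k)) * (uu \<mu> x + vv \<mu> x / q))"
        by (simp only: mult_minus_left mult_minus_right neg_0_le_iff_le minus_add_distrib mult.commute mult.left_commute)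
      with DERIV_minus[OF dE] show "\<exists>y. ((\<lambda>x. - E x) has_real_derivative y) (at x) \<and> 0 \<le> y" by blast
    qed
    then show ?thesis by simp
  qed
  also have "E x0 \<le> exp (\<mu> * U x0) * (1 + q * M x0)"
  proof -
    have "vv \<mu> x0 / q \<le> q * (M x0 * exp (\<mu> * U x0))"
      using vv_le[of x0 \<mu>] x0 \<mu> q by (simp add: pos_divide_le_eq mult_ac) (simp add: mult.assoc[symmetric])
    moreover have "uu \<mu> x0 \<le> exp (\<mu> * U x0)" using uu_le[of x0 \<mu>] x0 \<mu> by simp
    ultimately have "uu \<mu> x0 + vv \<mu> x0 / q \<le> exp (\<mu> * U x0) * (1 + q * M x0)" by (simp add: algebra_simps)
    moreover have "0 \<le> uu \<mu> x0" "0 \<le> vv \<mu> x0" using uu_ge[of \<mu> x0] vv_ge[of \<mu> x0] Mx0 \<mu> x0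
        mult_nonneg_nonneg[of \<mu> "M x0"] by linarith+
    then have "0 \<le> uu \<mu> x0 + vv \<mu> x0 / q" using q(1) by simp
    moreover have "exp (- (q * K x0)) \<le> 1" using q U_nonneg[of x0] x0 Mx0 by (simp add: K_def)
    ultimately show ?thesis unfolding E_def by (meson mult_left_le order_trans)
  qed
  finally have "E r \<le> exp (\<mu> * U x0) * (1 + q * M x0)" .
  then have "uu \<mu> r + vv \<mu> r / q \<le> exp (\<mu> * U x0) * (1 + q * M x0) * exp (q * K r)"
    by (simp add: E_def exp_minus field_simps)
  moreover have "0 \<le> uu \<mu> r" using uu_ge[of \<mu> r] \<mu> r_pos by simp
  ultimately have "vv \<mu> r / q \<le> exp (\<mu> * U x0) * (1 + q * M x0) * exp (q * K r)" by linarith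
  then show ?thesis using q by (simp add: pos_divide_le_eq K_def q_def mult_ac)
qed

text \<open>Nonnegative Taylor coefficients reduce the claim to the positive axis, and evaluating at
  \<open>norm z + 1\<close> supplies the condition \<open>1 \<le> \<mu>\<close> of
  \<open>uv_growth\<close>. Choosing \<open>x0\<close> with \<open>U x0 < e / 2\<close> spends half
  of the allowed exponent; the other half absorbs the sqrt \<mu> term.\<close>

lemma Dfun_growth:
  assumes e: "0 < e"
  shows "\<exists>C. \<forall>z. norm (Dfun z) \<le> exp (C + e * norm z)"
proof -
  obtain x0 where x0: "0 < x0" "x0 < r" "U x0 < e / 2" using ex_small_U[of "e / 2"] e by auto
  define b where "b = M x0 + (U r / M x0 + M r)"
  have Mx0: "0 < M x0" using M_pos x0 by simp
  have b: "0 \<le> b" using M_nonneg[of x0] Mr U_nonneg[of r] r_pos Mx0 x0 by (simp add: b_def)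
  \<comment> \<open>The summand \<open>e\<close> pays for the shift from R to R + 1, and
    \<open>b\<^sup>2 / (2 * e)\<close> is left over from bounding \<open>q * b\<close> by
    \<open>\<mu> * e / 2\<close> through the square of \<open>q * e - b\<close>.\<close>
  define C where "C = e + b\<^sup>2 / (2 * e) - ln (M r)"
  have "Re (Dfun (of_real (R + 1))) \<le> exp (C + e * R)" if R: "0 \<le> R" for R
  proof -
    define \<mu> where "\<mu> = R + 1"
    define q where "q = sqrt \<mu>"
    have q: "1 \<le> q" "q * q = \<mu>" using R by (auto simp: q_def \<mu>_def)
    have Rmu: "\<mu> * M r * Re (Dfun (of_real \<mu>)) = vv \<mu> r" using Dfun_vv[of \<mu>] by (simp add: mult_ac)
    have "vv \<mu> r \<le> q * (exp (\<mu> * U x0) * (1 + q * M x0)) * exp (q * (U r / M x0 + M r))"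
      using uv_growth[of \<mu> x0] R x0 by (simp add: \<mu>_def q_def)
    also have "\<dots> \<le> q * (exp (\<mu> * (e / 2)) * exp (q * M x0)) * exp (q * (U r / M x0 + M r))"
      using q x0 Mx0 R exp_ge_add_one_self[of "q * M x0"]
      by (intro mult_right_mono mult_left_mono mult_mono) (auto simp: \<mu>_def)
    also have "\<dots> = q * exp (\<mu> * (e / 2) + q * b)" by (simp add: b_def exp_add distrib_left)
    also have "\<dots> \<le> \<mu> * exp (\<mu> * e + b\<^sup>2 / (2 * e))"
    proof -
      have "0 \<le> (q * e - b)\<^sup>2" by simp
      then have "2 * (q * e * b) \<le> e * e * \<mu> + b\<^sup>2" by (simp add: power2_diff power_mult_distrib) (simp add: power2_eq_square q(2)[symmetric] mult_ac)
      then have "q * b \<le> \<mu> * (e / 2) + b\<^sup>2 / (2 * e)" using e by (simp add: field_simps)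
      moreover have "q \<le> \<mu>" using q by (metis mult_left_mono mult_1_right order_trans zero_le_one)
      ultimately show ?thesis using q by (intro mult_mono) auto
    qed
    finally have "M r * Re (Dfun (of_real \<mu>)) \<le> exp (\<mu> * e + b\<^sup>2 / (2 * e))"
      using R Rmu[symmetric] by (simp add: \<mu>_def mult.assoc)
    then have "Re (Dfun (of_real \<mu>)) \<le> exp (\<mu> * e + b\<^sup>2 / (2 * e)) / M r"
      using Mr by (simp add: field_simps)
    also have "\<dots> = exp (\<mu> * e + b\<^sup>2 / (2 * e) - ln (M r))" using Mr by (simp add: exp_diff)
    also have "\<mu> * e + b\<^sup>2 / (2 * e) - ln (M r) = C + e * R" by (simp add: C_def \<mu>_def algebra_simps)
    finally show ?thesis by (simp add: \<mu>_def)
  qed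
  then have "norm (Dfun z) \<le> exp (C + e * norm z)" for z
    using norm_Dfun_le[of z] Dfun_real_mono[of "norm z" "norm z + 1"] by (meson norm_ge_zero le_add_same_cancel1 order_trans zero_le_one)
  then show ?thesis by blast
qed

text \<open>Picard iteration from the crude bound \<open>B\<close>: each passage through the two
  equations gains a factor |\<mu>| U / n, so the solution vanishes. Measuring by \<open>U\<close>
  keeps the iteration convergent even where \<open>s\<close> is not integrable at 0.\<close>

lemma singular_ode_unique:
  assumes x1: "0 < x1" "x1 \<le> r"
    and h: "continuous_on {0..x1} h" "h 0 = 0" "\<And>x. 0 < x \<Longrightarrow> x < x1 \<Longrightarrow> (h has_real_derivative s x * g x) (at x)"
    and g: "continuous_on {0..x1} g" "g 0 = 0" "\<And>x. 0 < x \<Longrightarrow> x < x1 \<Longrightarrow> (g has_real_derivative m x * (\<mu> * h x)) (at x)"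
    and x: "0 \<le> x" "x \<le> x1"
  shows "h x = 0" "g x = 0"
proof -
  have sub: "antideriv_on x1 f F" if "antideriv_on r f F" for f F
    using that x1 by (auto simp: antideriv_on_def intro: continuous_on_subset)
  have ah: "antideriv_on x1 (\<lambda>x. s x * g x) h" and ag: "antideriv_on x1 (\<lambda>x. m x * (\<mu> * h x)) g"
    using h g by (auto simp: antideriv_on_def)
  obtain B where B: "\<And>x. x \<in> {0..x1} \<Longrightarrow> \<bar>h x\<bar> \<le> B"
    using compact_continuous_image[OF h(1) compact_Icc] compact_imp_bounded
    by (metis bounded_iff image_eqI real_norm_def)
  have B0: "0 \<le> B" using B[of 0] x1 by auto
  define c where "c n = B * \<bar>\<mu>\<bar> ^ n" for n :: nat
  have c0: "0 \<le> c n" for n using B0 by (simp add: c_def)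
  have main: "(\<forall>x. 0 \<le> x \<longrightarrow> x \<le> x1 \<longrightarrow> \<bar>h x\<bar> \<le> c n * (U x ^ n / fact n)) \<and>
      (\<forall>x. 0 \<le> x \<longrightarrow> x \<le> x1 \<longrightarrow> \<bar>g x\<bar> \<le> c (Suc n) * (M x * (U x ^ n / fact n)))" for n
  proof (induction n)
    have G: "\<bar>g x\<bar> \<le> c (Suc n) * (M x * (U x ^ n / fact n))"
      if hn: "\<And>x. 0 \<le> x \<Longrightarrow> x \<le> x1 \<Longrightarrow> \<bar>h x\<bar> \<le> c n * (U x ^ n / fact n)" and x: "0 \<le> x" "x \<le> x1" for n x
    proof -
      have "\<bar>g x - g 0\<bar> \<le> c (Suc n) * (M x * (U x ^ n / fact n)) - c (Suc n) * (M 0 * (U 0 ^ n / fact n))"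
      proof (rule antideriv_on_abs_le[OF ag antideriv_on_cmult[OF sub[OF M_U_power]]])
        fix y assume y: "0 < y" "y < x1"
        then have y': "y < r" using x1 by simp
        have "\<bar>m y * (\<mu> * h y)\<bar> \<le> m y * (\<bar>\<mu>\<bar> * (c n * (U y ^ n / fact n)))"
          using mult_left_mono[OF hn[of y], of "m y * \<bar>\<mu>\<bar>"] y m_pos[OF y(1) y'] by (simp add: abs_mult mult.assoc)
        also have "\<dots> = c (Suc n) * (m y * (U y ^ n / fact n))" by (simp add: c_def)
        also have "\<dots> \<le> c (Suc n) * (m y * (U y ^ n / fact n) + real n * (s y * M y * U y ^ (n - Suc 0)) / fact n * M y)"
          by (rule mult_left_mono[OF M_U_power_le[OF y(1) y'] c0])
        finally show "\<bar>m y * (\<mu> * h y)\<bar> \<le> c (Suc n) * (m y * (U y ^ n / fact n) + real n * (s y * M y * U y ^ (n - Suc 0)) / fact n * M y)" .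
      qed (use x in auto)
      then show ?thesis using g(2) M_D(2) by simp
    qed
    {
      case 0
      show ?case using G[of 0] B by (simp add: c_def)
    next
      case (Suc n)
      have H: "\<bar>h x\<bar> \<le> c (Suc n) * (U x ^ Suc n / fact (Suc n))" if x: "0 \<le> x" "x \<le> x1" for x
      proof -
        have "\<bar>h x - h 0\<bar> \<le> c (Suc n) * (U x ^ Suc n / fact (Suc n)) - c (Suc n) * (U 0 ^ Suc n / fact (Suc n))"
        proof (rule antideriv_on_abs_le[OF ah antideriv_on_cmult[OF sub[OF U_power]]])
          fix y assume y: "0 < y" "y < x1"
          have "s y * \<bar>g y\<bar> \<le> s y * (c (Suc n) * (M y * (U y ^ n / fact n)))"
            using Suc y s_pos[of y] x1 by (intro mult_left_mono) auto
          then show "\<bar>s y * g y\<bar> \<le> c (Suc n) * (s y * (M y * (U y ^ n / fact n)))"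
            using s_pos[of y] y x1 by (simp add: abs_mult mult_ac)
        qed (use x in auto)
        then show ?thesis using h(2) U_D(2) by simp
      qed
      with G[OF H] show ?case by blast
    }
  qed
  have lim: "(\<lambda>n. B * ((\<bar>\<mu>\<bar> * U x) ^ n / fact n)) \<longlonglongrightarrow> 0" for x
    using tendsto_mult_right_zero[OF summable_LIMSEQ_zero[OF sums_summable[OF exp_real_sums]], of B] .
  have h0: "h y = 0" if "0 \<le> y" "y \<le> x1" for y
  proof -
    have "\<bar>h y\<bar> \<le> B * ((\<bar>\<mu>\<bar> * U y) ^ n / fact n)" for n
      using main[of n] that by (simp add: c_def power_mult_distrib mult_ac)
    then have "\<bar>h y\<bar> \<le> 0" by (intro LIMSEQ_le_const[OF lim]) auto
    then show ?thesis by simp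
  qed
  then show "h x = 0" using x by simp
  have "g x = (\<lambda>_. 0) x"
    by (rule antideriv_on_unique[OF ag antideriv_on_zero _ x]) (simp add: h0)
  then show "g x = 0" .
qed

end

section \<open>Boundary value problems: eigenfunctions and the resolvent equation\<close>

context krein_string begin

lemma const_on_open_lim:
  fixes f :: "real \<Rightarrow> real"
  assumes d: "\<And>x. 0 < x \<Longrightarrow> x < r \<Longrightarrow> (f has_real_derivative 0) (at x)"
    and l: "(f \<longlongrightarrow> l) (at_right 0)" and x: "0 < x" "x < r"
  shows "f x = l"
proof -
  have "f y = f x" if "0 < y" "y < r" for y
    by (rule DERIV_isconst3[of 0 r]) (use that x d r_pos in auto)
  then have "\<forall>\<^sub>F y in at_right 0. f y = f x"
    unfolding eventually_at_right_field using r_pos by blast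
  then have "(f \<longlongrightarrow> f x) (at_right 0)" by (rule tendsto_eventually)
  then show ?thesis using tendsto_unique[OF trivial_limit_at_right_real] l by blast
qed

lemma cont_lim_0: "continuous_on {0..r} f \<Longrightarrow> (f \<longlongrightarrow> f 0) (at_right 0)"
  by (rule continuous_on_Icc_at_rightD[OF _ r_pos])

lemma cont_lim_r: "continuous_on {0..r} f \<Longrightarrow> (f \<longlongrightarrow> f r) (at_left r)"
  by (rule continuous_on_Icc_at_leftD[OF _ r_pos])

text \<open>The eigenfunction is not assumed bounded at 0. Its vanishing flux still forces M \<phi>
  to tend to 0, hence the Wronskian with the fundamental solution, which is constant, is zero. So
  \<phi> is a multiple of \<open>uu \<mu>\<close> near 0, by uniqueness everywhere, and its
  vanishing flux at \<open>r\<close> is a nonzero multiple of \<open>vv \<mu> r\<close>.\<close>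

lemma eigenfunction_imp_vv_zero:
  assumes d\<phi>: "\<And>x. 0 < x \<Longrightarrow> x < r \<Longrightarrow> (\<phi> has_real_derivative s x * \<psi> x) (at x)"
    and d\<psi>: "\<And>x. 0 < x \<Longrightarrow> x < r \<Longrightarrow> (\<psi> has_real_derivative m x * (\<mu> * \<phi> x)) (at x)"
    and l0: "(\<psi> \<longlongrightarrow> 0) (at_right 0)" and lr: "(\<psi> \<longlongrightarrow> 0) (at_left r)"
    and nz: "0 < y0" "y0 < r" "\<phi> y0 \<noteq> 0"
  shows "vv \<mu> r = 0"
proof -
  have "((\<lambda>x. M x * \<phi> x) \<longlongrightarrow> 0) (at_right 0)"
  proof (rule tendstoI)
    fix e :: real assume e: "0 < e"
    obtain x2 where x2: "0 < x2" "x2 < r" "U x2 < e / 2" using ex_small_U[of "e / 2"] e by auto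
    have "\<forall>\<^sub>F x in at_right 0. \<bar>\<psi> x\<bar> < 1" using tendstoD[OF l0, of 1] by simp
    then obtain b where b: "b > 0" "\<And>x. 0 < x \<Longrightarrow> x < b \<Longrightarrow> \<bar>\<psi> x\<bar> < 1"
      unfolding eventually_at_right_field by auto
    define x1 where "x1 = min x2 (b / 2)"
    have x1: "0 < x1" "x1 < r" "x1 < b" using x2 b by (auto simp: x1_def)
    have Ux1: "U x1 < e / 2" using U_mono[of x1 x2] x1 x2 by (auto simp: x1_def)
    have "((\<lambda>x. M x * \<bar>\<phi> x1\<bar>) \<longlongrightarrow> 0) (at_right 0)"
      using tendsto_mult_left_zero[OF cont_lim_0[OF M_D(1), unfolded M_D(2)]] .
    then have "\<forall>\<^sub>F x in at_right 0. \<bar>M x * \<bar>\<phi> x1\<bar>\<bar> < e / 2" using tendstoD[of _ 0 _ "e / 2"] e by force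
    moreover have "\<forall>\<^sub>F x in at_right 0. 0 < x \<and> x < x1" using x1(1) by (auto simp: eventually_at_right_field)
    ultimately show "\<forall>\<^sub>F x in at_right 0. dist (M x * \<phi> x) 0 < e"
    proof eventually_elim
      case (elim x)
      have Mx: "0 \<le> M x" using M_nonneg elim x1 by auto
      \<comment> \<open>Between \<open>x\<close> and \<open>x1\<close> the flux is below 1 and
        \<open>M x\<close> is at most \<open>M y\<close>, so \<open>U\<close> dominates the
        variation of \<phi> weighted by \<open>M x\<close>.\<close>
      have "\<bar>M x * \<phi> x1 - M x * \<phi> x\<bar> \<le> U x1 - U x"
      proof (rule abs_deriv_le_imp_diff_le[where f'="\<lambda>y. M x * (s y * \<psi> y)" and g'="\<lambda>y. s y * M y"])
        have "continuous_on {x..x1} \<phi>"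
          by (rule DERIV_continuous_on[of _ _ "\<lambda>y. s y * \<psi> y"], rule has_field_derivative_at_within, rule d\<phi>) (use elim x1 in auto)
        then show "continuous_on {x..x1} (\<lambda>y. M x * \<phi> y)" by (intro continuous_intros)
        show "continuous_on {x..x1} U" using elim x1 by (intro continuous_on_subset[OF U_D(1)]) auto
        fix y assume y: "x < y" "y < x1"
        show "((\<lambda>y. M x * \<phi> y) has_real_derivative M x * (s y * \<psi> y)) (at y)"
          by (intro DERIV_cmult d\<phi>) (use y elim x1 in auto)
        show "(U has_real_derivative s y * M y) (at y)" by (intro U_D(3)) (use y elim x1 in auto)
        have sy: "0 < s y" using s_pos y elim x1 by auto
        have "M x * (s y * \<bar>\<psi> y\<bar>) \<le> M y * (s y * 1)"
          using M_mono[of x y] b(2)[of y] Mx sy y elim x1 by (intro mult_mono) auto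
        then show "\<bar>M x * (s y * \<psi> y)\<bar> \<le> s y * M y" using Mx sy by (simp add: abs_mult mult.commute)
      qed (use elim in auto)
      moreover have "0 \<le> U x" using U_nonneg elim x1 by auto
      ultimately have "\<bar>M x * \<phi> x\<bar> \<le> U x1 + \<bar>M x * \<phi> x1\<bar>" by linarith
      also have "\<bar>M x * \<phi> x1\<bar> = \<bar>M x * \<bar>\<phi> x1\<bar>\<bar>" by (simp add: abs_mult)
      finally show ?case using elim Ux1 by simp
    qed
  qed
  then have lM: "((\<lambda>x. \<bar>M x * \<phi> x\<bar> * (\<bar>\<mu>\<bar> * exp (\<bar>\<mu>\<bar> * U r))) \<longlongrightarrow> 0) (at_right 0)"
    by (intro tendsto_mult_left_zero tendsto_rabs_zero)
  have "((\<lambda>x. \<phi> x * vv \<mu> x) \<longlongrightarrow> 0) (at_right 0)"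
  proof (rule Lim_null_comparison[OF _ lM])
    have "\<forall>\<^sub>F x in at_right 0. 0 < x \<and> x < r" using r_pos by (auto simp: eventually_at_right_field)
    then show "\<forall>\<^sub>F x in at_right 0. norm (\<phi> x * vv \<mu> x) \<le> \<bar>M x * \<phi> x\<bar> * (\<bar>\<mu>\<bar> * exp (\<bar>\<mu>\<bar> * U r))"
    proof eventually_elim
      case (elim x)
      have "\<bar>vv \<mu> x\<bar> \<le> \<bar>\<mu>\<bar> * (M x * exp (\<bar>\<mu>\<bar> * U x))" using vv_le[of x \<mu>] elim by auto
      also have "\<dots> \<le> \<bar>\<mu>\<bar> * (M x * exp (\<bar>\<mu>\<bar> * U r))"
        using elim U_mono[of x r] M_nonneg[of x] by (intro mult_left_mono) (auto intro: mult_left_mono)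
      finally have "\<bar>\<phi> x\<bar> * \<bar>vv \<mu> x\<bar> \<le> \<bar>\<phi> x\<bar> * (\<bar>\<mu>\<bar> * (M x * exp (\<bar>\<mu>\<bar> * U r)))" by (rule mult_left_mono) simp
      then show ?case using M_nonneg[of x] elim by (simp add: abs_mult mult_ac)
    qed
  qed
  moreover have "((\<lambda>x. \<psi> x * uu \<mu> x) \<longlongrightarrow> 0 * uu \<mu> 0) (at_right 0)"
    by (intro tendsto_mult l0 cont_lim_0 uu_cont)
  ultimately have lW: "((\<lambda>x. \<psi> x * uu \<mu> x - \<phi> x * vv \<mu> x) \<longlongrightarrow> 0) (at_right 0)"
    using tendsto_diff by fastforce
  have W: "\<psi> x * uu \<mu> x = \<phi> x * vv \<mu> x" if x: "0 < x" "x < r" for x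
  proof -
    have "\<psi> x * uu \<mu> x - \<phi> x * vv \<mu> x = 0"
    proof (rule const_on_open_lim[OF _ lW x])
      fix y assume y: "0 < y" "y < r"
      show "((\<lambda>x. \<psi> x * uu \<mu> x - \<phi> x * vv \<mu> x) has_real_derivative 0) (at y)"
        using DERIV_diff[OF DERIV_mult[OF d\<psi>[OF y] uu_deriv[OF y, of \<mu>]] DERIV_mult[OF d\<phi>[OF y] vv_deriv[OF y, of \<mu>]]]
        by (simp add: algebra_simps)
    qed
    then show ?thesis by simp
  qed
  have "\<forall>\<^sub>F x in at_right 0. 0 < uu \<mu> x"
    using order_tendstoD(1)[OF cont_lim_0[OF uu_cont], of 0 \<mu>] by (simp add: uu_0)
  then obtain b where b: "b > 0" "\<And>x. 0 < x \<Longrightarrow> x < b \<Longrightarrow> 0 < uu \<mu> x" unfolding eventually_at_right_field by auto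
  define x2 where "x2 = min b r"
  have x2: "0 < x2" "x2 \<le> r" "\<And>x. 0 < x \<Longrightarrow> x < x2 \<Longrightarrow> 0 < uu \<mu> x" using b r_pos by (auto simp: x2_def)
  define c where "c = \<phi> (x2 / 2) / uu \<mu> (x2 / 2)"
  have near: "\<phi> x = c * uu \<mu> x" "\<psi> x = c * vv \<mu> x" if x: "0 < x" "x < x2" for x
  proof -
    have "\<phi> x / uu \<mu> x = \<phi> (x2 / 2) / uu \<mu> (x2 / 2)"
    proof (rule DERIV_isconst3[of 0 x2 x "x2 / 2" "\<lambda>x. \<phi> x / uu \<mu> x"])
      fix y assume "y \<in> {0<..<x2}"
      then have y: "0 < y" "y < r" "0 < uu \<mu> y" using x2 by auto
      have eq0: "s y * \<psi> y * uu \<mu> y - \<phi> y * (s y * vv \<mu> y) = 0" using W[OF y(1,2)] by (simp add: algebra_simps)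
      show "((\<lambda>x. \<phi> x / uu \<mu> x) has_real_derivative 0) (at y)"
        using DERIV_divide[OF d\<phi>[OF y(1,2)] uu_deriv[OF y(1,2), of \<mu>], unfolded eq0] y(3) by simp
    qed (use x x2 in auto)
    then show 1: "\<phi> x = c * uu \<mu> x" using x2(3)[OF x] by (simp add: c_def field_simps)
    show "\<psi> x = c * vv \<mu> x" using W[of x] x x2 x2(3)[OF x] 1 by simp
  qed
  have all: "\<phi> x = c * uu \<mu> x" "\<psi> x = c * vv \<mu> x" if x: "0 < x" "x < r" for x
  proof -
    \<comment> \<open>The eigenfunction has no prescribed value at 0. Since the difference vanishes
      near 0, defining it as 0 there gives the continuity and initial values that the uniqueness
      lemma asks for.\<close>
    define h where "h x = (if x < x2 then 0 else \<phi> x - c * uu \<mu> x)" for x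
    define g where "g x = (if x < x2 then 0 else \<psi> x - c * vv \<mu> x)" for x
    have hg: "h y = \<phi> y - c * uu \<mu> y" "g y = \<psi> y - c * vv \<mu> y" if "y \<in> {0<..<r}" for y
      using near that by (auto simp: h_def g_def)
    have dh: "(h has_real_derivative s y * g y) (at y)" if y: "0 < y" "y < r" for y
    proof (rule has_field_derivative_transform_within_open[of "\<lambda>y. \<phi> y - c * uu \<mu> y" _ _ "{0<..<r}"])
      show "((\<lambda>y. \<phi> y - c * uu \<mu> y) has_real_derivative s y * g y) (at y)"
        using DERIV_diff[OF d\<phi>[OF y] DERIV_cmult[OF uu_deriv[OF y, of \<mu>], of c]] y by (simp add: hg algebra_simps)
    qed (use y hg in auto)
    have dg: "(g has_real_derivative m y * (\<mu> * h y)) (at y)" if y: "0 < y" "y < r" for y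
    proof (rule has_field_derivative_transform_within_open[of "\<lambda>y. \<psi> y - c * vv \<mu> y" _ _ "{0<..<r}"])
      show "((\<lambda>y. \<psi> y - c * vv \<mu> y) has_real_derivative m y * (\<mu> * h y)) (at y)"
        using DERIV_diff[OF d\<psi>[OF y] DERIV_cmult[OF vv_deriv[OF y, of \<mu>], of c]] y by (simp add: hg algebra_simps)
    qed (use y hg in auto)
    have c0: "continuous_on {0..x} f" if f: "\<And>y. y < x2 \<Longrightarrow> f y = 0" "\<And>y. 0 < y \<Longrightarrow> y < r \<Longrightarrow> \<exists>D. (f has_real_derivative D) (at y)"
      for f :: "real \<Rightarrow> real"
    proof (rule continuous_at_imp_continuous_on, rule ballI)
      fix y assume y: "y \<in> {0..x}"
      show "isCont f y"
      proof (cases "y = 0")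
        case True
        have "(f has_real_derivative 0) (at 0)"
          by (rule has_field_derivative_transform_within_open[OF DERIV_const, of "{..<x2}" _ 0]) (use f x2 in auto)
        then show ?thesis using True DERIV_isCont by blast
      next
        case False
        then obtain D where "(f has_real_derivative D) (at y)" using f(2)[of y] y x by auto
        then show ?thesis by (rule DERIV_isCont)
      qed
    qed
    have ch: "continuous_on {0..x} h" by (rule c0) (use dh in \<open>auto simp: h_def\<close>)
    have cg: "continuous_on {0..x} g" by (rule c0) (use dg in \<open>auto simp: g_def\<close>)
    have h0: "h 0 = 0" "g 0 = 0" using x2 by (auto simp: h_def g_def)
    have dh': "(h has_real_derivative s y * g y) (at y)" if "0 < y" "y < x" for y using dh that x by auto
    have dg': "(g has_real_derivative m y * (\<mu> * h y)) (at y)" if "0 < y" "y < x" for y using dg that x by auto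
    have "h x = 0" "g x = 0"
      using singular_ode_unique[OF x(1) less_imp_le[OF x(2)] ch h0(1) dh' cg h0(2) dg', of x] x(1) by auto
    then show "\<phi> x = c * uu \<mu> x" "\<psi> x = c * vv \<mu> x" using hg[of x] x by auto
  qed
  have "c \<noteq> 0" using all(1)[OF nz(1,2)] nz(3) by auto
  have "\<forall>\<^sub>F x in at_left r. c * vv \<mu> x = \<psi> x"
    unfolding eventually_at_left_field using all r_pos by auto
  then have "((\<lambda>x. \<psi> x) \<longlongrightarrow> c * vv \<mu> r) (at_left r)"
    by (rule Lim_transform_eventually[rotated]) (intro tendsto_mult_left cont_lim_r vv_cont)
  then have "c * vv \<mu> r = 0" using lr tendsto_unique[OF trivial_limit_at_left_real] by blast
  with \<open>c \<noteq> 0\<close> show ?thesis by simp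
qed

text \<open>The equation \<mu> g - A g = k with zero flux at both ends, integrated once: the flux of
  \<open>g\<close> at \<open>x\<close> is the mass integral of \<mu> g - k up to
  \<open>x\<close>.\<close>

definition resolvent_eq :: "real \<Rightarrow> (real \<Rightarrow> real) \<Rightarrow> (real \<Rightarrow> real) \<Rightarrow> bool" where
  "resolvent_eq \<mu> k g \<longleftrightarrow> continuous_on {0..r} k \<and> continuous_on {0..r} g \<and>
     (\<forall>x. 0 < x \<longrightarrow> x < r \<longrightarrow> (g has_real_derivative s x * mint (\<lambda>x. \<mu> * g x - k x) x) (at x)) \<and>
     mint (\<lambda>x. \<mu> * g x - k x) r = 0"

lemma resolvent_eqD:
  assumes "resolvent_eq \<mu> k g"
  shows "continuous_on {0..r} k" "continuous_on {0..r} g"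
    "\<And>x. 0 < x \<Longrightarrow> x < r \<Longrightarrow> (g has_real_derivative s x * mint (\<lambda>x. \<mu> * g x - k x) x) (at x)"
    "mint (\<lambda>x. \<mu> * g x - k x) r = 0" "continuous_on {0..r} (\<lambda>x. \<mu> * g x - k x)"
  using assms by (auto simp: resolvent_eq_def intro!: continuous_intros)

lemma mint_lincomb:
  assumes "continuous_on {0..r} k" "continuous_on {0..r} g" "0 \<le> x" "x \<le> r"
  shows "mint (\<lambda>x. \<mu> * g x - k x) x = \<mu> * mint g x - mint k x"
proof (rule antideriv_on_unique[OF mint _ _ assms(3,4)])
  show "antideriv_on r (\<lambda>x. \<mu> * (m x * g x) - m x * k x) (\<lambda>x. \<mu> * mint g x - mint k x)"
    by (intro antideriv_on_diff antideriv_on_cmult mint assms)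
qed (auto intro!: continuous_intros assms simp: algebra_simps)

lemma resolvent_eq_mass: "resolvent_eq \<mu> k g \<Longrightarrow> \<mu> * mint g r = mint k r"
  using mint_lincomb[of k g r \<mu>] resolvent_eqD[of \<mu> k g] r_pos by simp

text \<open>The flux is at most \<open>M\<close>, and integrating \<open>s M\<close> gives
  \<open>U\<close>. This controls \<open>g\<close> near 0 uniformly over all right hand sides under
  consideration.\<close>

lemma resolvent_eq_osc:
  assumes R: "resolvent_eq \<mu> k g" and le: "\<And>x. 0 \<le> x \<Longrightarrow> x \<le> r \<Longrightarrow> \<bar>\<mu> * g x - k x\<bar> \<le> 1" and x: "0 \<le> x" "x \<le> r"
  shows "\<bar>g x - g 0\<bar> \<le> U x"
proof -
  note D = resolvent_eqD[OF R]
  have ag: "antideriv_on r (\<lambda>x. s x * mint (\<lambda>x. \<mu> * g x - k x) x) (\<lambda>x. g x - g 0)"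
    unfolding antideriv_on_def using D by (auto intro!: continuous_intros derivative_eq_intros)
  have fl: "\<bar>mint (\<lambda>x. \<mu> * g x - k x) y\<bar> \<le> M y" if y: "0 \<le> y" "y \<le> r" for y
  proof -
    have "\<bar>mint (\<lambda>x. \<mu> * g x - k x) y - mint (\<lambda>x. \<mu> * g x - k x) 0\<bar> \<le> M y - M 0"
    proof (rule antideriv_on_abs_le[OF mint[OF D(5)] M])
      fix z assume z: "0 < z" "z < r"
      show "\<bar>m z * (\<mu> * g z - k z)\<bar> \<le> m z"
        using mult_left_mono[OF le[of z], of "m z"] m_pos[OF z] z by (simp add: abs_mult)
    qed (use y in auto)
    then show ?thesis using M_D(2) antideriv_onD(2)[OF mint[OF D(5)]] by simp
  qed
  have "\<bar>(g x - g 0) - (g 0 - g 0)\<bar> \<le> U x - U 0"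
  proof (rule antideriv_on_abs_le[OF ag U])
    fix y assume y: "0 < y" "y < r"
    show "\<bar>s y * mint (\<lambda>x. \<mu> * g x - k x) y\<bar> \<le> s y * M y"
      using mult_left_mono[OF fl[of y], of "s y"] s_pos[OF y] y by (simp add: abs_mult)
  qed (use x in auto)
  then show ?thesis using U_D(2) by simp
qed

lemma mint_mono: "continuous_on {0..r} k \<Longrightarrow> (\<And>x. 0 \<le> x \<Longrightarrow> x \<le> r \<Longrightarrow> 0 \<le> k x) \<Longrightarrow> 0 \<le> x \<Longrightarrow> x \<le> y \<Longrightarrow> y \<le> r
  \<Longrightarrow> mint k x \<le> mint k y"
  by (rule antideriv_on_mono[OF mint]) (auto intro!: mult_nonneg_nonneg less_imp_le[OF m_pos])

lemma mint_nonneg: "continuous_on {0..r} k \<Longrightarrow> (\<And>x. 0 \<le> x \<Longrightarrow> x \<le> r \<Longrightarrow> 0 \<le> k x) \<Longrightarrow> 0 \<le> x \<Longrightarrow> x \<le> r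
  \<Longrightarrow> 0 \<le> mint k x"
  by (rule antideriv_on_nonneg[OF mint]) (auto intro!: mult_nonneg_nonneg less_imp_le[OF m_pos])

text \<open>By the oscillation bound \<open>g\<close> stays above \<open>c / 2\<close> on
  \<open>{0..x0}\<close>, so it has mass there; the masses of \<open>k\<close> and \<mu> g agree.
  Read backwards: right hand sides of vanishing mass have resolvents that vanish at 0.\<close>

lemma resolvent_eq_mass_ge:
  assumes R: "resolvent_eq \<mu> k g" and le: "\<And>x. 0 \<le> x \<Longrightarrow> x \<le> r \<Longrightarrow> \<bar>\<mu> * g x - k x\<bar> \<le> 1"
    and \<mu>: "0 < \<mu>" and g: "\<And>x. 0 \<le> x \<Longrightarrow> x \<le> r \<Longrightarrow> 0 \<le> g x" and c: "c \<le> g 0" "U x0 \<le> c / 2" "0 < x0" "x0 \<le> r"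
  shows "\<mu> * (c / 2 * M x0) \<le> mint k r"
proof -
  note D = resolvent_eqD[OF R]
  have "c / 2 * M x0 - c / 2 * M 0 \<le> mint g x0 - mint g 0"
  proof (rule deriv_le_imp_diff_le[where f'="\<lambda>x. c / 2 * m x" and g'="\<lambda>x. m x * g x"])
    show "continuous_on {0..x0} (\<lambda>x. c / 2 * M x)" "continuous_on {0..x0} (mint g)"
      by (intro continuous_intros continuous_on_subset[OF M_D(1)] continuous_on_subset[OF antideriv_onD(1)[OF mint[OF D(2)]]]; use c in auto)+
    fix x assume x: "0 < x" "x < x0"
    then have x': "x < r" using c by simp
    show "((\<lambda>x. c / 2 * M x) has_real_derivative c / 2 * m x) (at x)" by (intro DERIV_cmult M_D(3) x x')
    show "(mint g has_real_derivative m x * g x) (at x)" by (rule antideriv_onD(3)[OF mint[OF D(2)] x(1) x'])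
    have "U x \<le> U x0" using U_mono x c by auto
    then have "c / 2 \<le> g x" using resolvent_eq_osc[OF R le, of x] x x' c by linarith
    then show "c / 2 * m x \<le> m x * g x" using m_pos[OF x(1) x'] by (simp add: mult.commute[of "m x"])
  qed (use c in auto)
  also have "\<dots> \<le> mint g r" using mint_mono[OF D(2) g, of x0 r] c antideriv_onD(2)[OF mint[OF D(2)]] by simp
  finally show ?thesis using \<mu> resolvent_eq_mass[OF R] M_D(2) by (metis diff_zero mult_left_mono mult_zero_right order_less_imp_le)
qed

text \<open>A source of total mass \<open>M r\<close> placed to the right of \<open>x1\<close>
  leaves the equation homogeneous on \<open>{0..x1}\<close>, where \<open>g\<close> is
  \<open>g 0\<close> times the fundamental solution. The flux at \<open>x1\<close> misses
  \<open>M r\<close> by \<mu> times the mass of \<open>g\<close> beyond \<open>x1\<close>. In the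
  limit x1 -> r this gives the Green function between 0 and \<open>r\<close>.\<close>

lemma resolvent_eq_delta:
  assumes \<mu>: "0 < \<mu>"
  shows "\<exists>K. \<forall>f g x1. resolvent_eq \<mu> f g \<longrightarrow> (\<forall>x. 0 \<le> x \<longrightarrow> x \<le> r \<longrightarrow> 0 \<le> f x \<and> 0 \<le> g x) \<longrightarrow> mint f r = M r \<longrightarrow>
    r / 2 \<le> x1 \<longrightarrow> x1 < r \<longrightarrow> (\<forall>x. 0 \<le> x \<longrightarrow> x \<le> x1 \<longrightarrow> f x = 0) \<longrightarrow>
    \<bar>g 0 * vv \<mu> x1 - M r\<bar> \<le> K * (M r - M x1)"
proof -
  \<comment> \<open>A bound for \<open>g\<close> on the right half that does not depend on the
    source. The first summand bounds \<open>g (r / 2)\<close>, because the flux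
    \<open>g 0 * vv \<mu> (r / 2)\<close> is at most \<open>M r\<close>; the second bounds the
    increase of \<open>g\<close> from there.\<close>
  define K where "K = M r / vv \<mu> (r / 2) * uu \<mu> (r / 2) + M r / M (r / 2) * U r"
  have r2: "0 < r / 2" "r / 2 < r" using r_pos by auto
  have Mr2: "0 < M (r / 2)" using M_pos[of "r / 2"] r2 by auto
  have vr2: "0 < vv \<mu> (r / 2)" using vv_ge[of \<mu> "r / 2"] mult_pos_pos[OF \<mu> Mr2] \<mu> r2 by auto
  have "\<bar>g 0 * vv \<mu> x1 - M r\<bar> \<le> \<mu> * K * (M r - M x1)"
    if R: "resolvent_eq \<mu> f g" and pos: "\<And>x. 0 \<le> x \<Longrightarrow> x \<le> r \<Longrightarrow> 0 \<le> f x" "\<And>x. 0 \<le> x \<Longrightarrow> x \<le> r \<Longrightarrow> 0 \<le> g x"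
      and mass: "mint f r = M r" and x1: "r / 2 \<le> x1" "x1 < r" and f0: "\<And>x. 0 \<le> x \<Longrightarrow> x \<le> x1 \<Longrightarrow> f x = 0" for f g x1
  proof -
    note D = resolvent_eqD[OF R]
    define F where "F = mint (\<lambda>x. \<mu> * g x - f x)"
    note aF = antideriv_onD[OF mint[OF D(5)], folded F_def]
    note mg = antideriv_onD[OF mint[OF D(2)]] and mf = antideriv_onD[OF mint[OF D(1)]]
    have x1': "0 < x1" using x1 r2 by simp
    have u: "g x - g 0 * uu \<mu> x = 0" "F x - g 0 * vv \<mu> x = 0" if x: "0 \<le> x" "x \<le> x1" for x
    proof -
      have c: "continuous_on {0..x1} (\<lambda>x. g x - g 0 * uu \<mu> x)" "continuous_on {0..x1} (\<lambda>x. F x - g 0 * vv \<mu> x)"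
        by (intro continuous_intros continuous_on_subset[OF D(2)] continuous_on_subset[OF uu_cont]
            continuous_on_subset[OF aF(1)] continuous_on_subset[OF vv_cont]; use x1 in auto)+
      have d: "((\<lambda>x. g x - g 0 * uu \<mu> x) has_real_derivative s y * (F y - g 0 * vv \<mu> y)) (at y)"
        "((\<lambda>x. F x - g 0 * vv \<mu> x) has_real_derivative m y * (\<mu> * (g y - g 0 * uu \<mu> y))) (at y)" if y: "0 < y" "y < x1" for y
      proof -
        have y': "y < r" using y x1 by simp
        show "((\<lambda>x. g x - g 0 * uu \<mu> x) has_real_derivative s y * (F y - g 0 * vv \<mu> y)) (at y)"
          using DERIV_diff[OF D(3)[OF y(1) y'] DERIV_cmult[OF uu_deriv[OF y(1) y', of \<mu>], of "g 0"]]
          by (simp add: F_def algebra_simps)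
        show "((\<lambda>x. F x - g 0 * vv \<mu> x) has_real_derivative m y * (\<mu> * (g y - g 0 * uu \<mu> y))) (at y)"
          using DERIV_diff[OF aF(3)[OF y(1) y'] DERIV_cmult[OF vv_deriv[OF y(1) y', of \<mu>], of "g 0"]] f0[of y] y
          by (simp add: algebra_simps)
      qed
      show "g x - g 0 * uu \<mu> x = 0"
        by (rule singular_ode_unique(1)[OF x1' less_imp_le[OF x1(2)] c(1) _ d(1) c(2) _ d(2) x]) (auto simp: uu_0 vv_0 aF(2))
      show "F x - g 0 * vv \<mu> x = 0"
        by (rule singular_ode_unique(2)[OF x1' less_imp_le[OF x1(2)] c(1) _ d(1) c(2) _ d(2) x]) (auto simp: uu_0 vv_0 aF(2))
    qed
    have FF: "F x = \<mu> * mint g x - mint f x" if "0 \<le> x" "x \<le> r" for x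
      unfolding F_def by (rule mint_lincomb[OF D(1,2) that])
    have "(mint f has_real_derivative 0) (at x)" if "0 < x" "x < x1" for x
      using mf(3)[of x] f0[of x] that x1 by simp
    then have "mint f x1 - mint f 0 \<le> 0 - 0"
      by (intro deriv_le_imp_diff_le[where f'="\<lambda>_. 0" and g'="\<lambda>_. 0" and f="mint f" and g="\<lambda>_. 0"])
        (use x1 x1' mf f0 in \<open>auto intro: continuous_on_subset\<close>)
    then have mfx1: "mint f x1 = 0" using mint_nonneg[OF D(1) pos(1), of x1] x1 x1' mf(2) by simp
    have gr: "\<mu> * mint g r = M r" using resolvent_eq_mass[OF R] mass by simp
    have gx1: "g 0 * vv \<mu> x1 = \<mu> * mint g x1" using u(2)[of x1] FF[of x1] mfx1 x1 x1' by simp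
    have FM: "F x \<le> M r" if x: "0 \<le> x" "x \<le> r" for x
    proof -
      have "\<mu> * mint g x \<le> \<mu> * mint g r" using mint_mono[OF D(2) pos(2), of x r] \<mu> x by simp
      then show ?thesis using FF[OF x] mint_nonneg[OF D(1) pos(1) x] gr by linarith
    qed
    have gK: "g y \<le> K" if y: "r / 2 \<le> y" "y \<le> r" for y
    proof -
      have "g y - g (r / 2) \<le> M r / M (r / 2) * U y - M r / M (r / 2) * U (r / 2)"
      proof (rule deriv_le_imp_diff_le[where f'="\<lambda>x. s x * F x" and g'="\<lambda>x. M r / M (r / 2) * (s x * M x)"])
        show "continuous_on {r / 2..y} g" "continuous_on {r / 2..y} (\<lambda>a. M r / M (r / 2) * U a)"
          by (intro continuous_intros continuous_on_subset[OF D(2)] continuous_on_subset[OF U_D(1)]; use y r2 in auto)+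
        fix x assume x: "r / 2 < x" "x < y"
        then have x': "0 < x" "x < r" using r2 y by auto
        show "(g has_real_derivative s x * F x) (at x)" unfolding F_def by (rule D(3)[OF x'])
        show "((\<lambda>a. M r / M (r / 2) * U a) has_real_derivative M r / M (r / 2) * (s x * M x)) (at x)"
          by (intro DERIV_cmult U_D(3) x')
        have "F x * M (r / 2) \<le> M r * M x"
          using FM[of x] M_mono[of "r / 2" x] x x' Mr2 Mr r2 by (intro mult_mono) auto
        then have "F x \<le> M r / M (r / 2) * M x" using Mr2 by (simp add: field_simps)
        then have "s x * F x \<le> s x * (M r / M (r / 2) * M x)" by (rule mult_left_mono) (use s_pos[OF x'] in simp)
        then show "s x * F x \<le> M r / M (r / 2) * (s x * M x)" by (simp add: mult_ac)
      qed (use y in auto)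
      also have "\<dots> \<le> M r / M (r / 2) * U r"
      proof -
        have "M r / M (r / 2) * U y \<le> M r / M (r / 2) * U r" using U_mono[of y r] y r2 Mr Mr2 by (intro mult_left_mono) auto
        moreover have "0 \<le> M r / M (r / 2) * U (r / 2)" using U_nonneg[of "r / 2"] r2 Mr Mr2 by simp
        ultimately show ?thesis by linarith
      qed
      finally have 1: "g y \<le> g (r / 2) + M r / M (r / 2) * U r" by simp
      have "g 0 * vv \<mu> (r / 2) \<le> M r" using FM[of "r / 2"] u(2)[of "r / 2"] x1 r2 by simp
      then have "g 0 \<le> M r / vv \<mu> (r / 2)" using vr2 by (simp add: field_simps)
      then have "g 0 * uu \<mu> (r / 2) \<le> M r / vv \<mu> (r / 2) * uu \<mu> (r / 2)"
        using uu_ge[of \<mu> "r / 2"] \<mu> r2 by (intro mult_right_mono) auto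
      then show ?thesis using 1 u(1)[of "r / 2"] x1 r2 by (simp add: K_def)
    qed
    have "mint g r - mint g x1 \<le> K * M r - K * M x1"
    proof (rule deriv_le_imp_diff_le[where f'="\<lambda>x. m x * g x" and g'="\<lambda>x. K * m x" and f="mint g" and g="\<lambda>x. K * M x"])
      show "continuous_on {x1..r} (mint g)" "continuous_on {x1..r} (\<lambda>x. K * M x)"
        by (intro continuous_intros continuous_on_subset[OF mg(1)] continuous_on_subset[OF M_D(1)]; use x1' in auto)+
      fix x assume x: "x1 < x" "x < r"
      then have x0: "0 < x" using x1' by simp
      show "(mint g has_real_derivative m x * g x) (at x)" by (rule mg(3)[OF x0 x(2)])
      show "((\<lambda>x. K * M x) has_real_derivative K * m x) (at x)" by (rule DERIV_cmult[OF M_D(3)[OF x0 x(2)]])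
      show "m x * g x \<le> K * m x"
        using mult_left_mono[OF gK[of x], of "m x"] m_pos[OF x0 x(2)] x x1 by (simp add: mult.commute)
    qed (use x1 in simp)
    moreover have "0 \<le> mint g r - mint g x1" using mint_mono[OF D(2) pos(2), of x1 r] x1 x1' by simp
    moreover have "g 0 * vv \<mu> x1 - M r = - (\<mu> * (mint g r - mint g x1))" using gx1 gr by (simp add: algebra_simps)
    ultimately have "\<bar>g 0 * vv \<mu> x1 - M r\<bar> = \<mu> * (mint g r - mint g x1)" "mint g r - mint g x1 \<le> K * (M r - M x1)"
      using \<mu> by (simp_all add: abs_mult right_diff_distrib)
    then show ?thesis using \<mu> by (simp add: mult.assoc mult_left_mono)
  qed
  then show ?thesis by blast
qed

end

section \<open>Feller semigroups and resolvents\<close>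

locale feller_process =
  fixes r :: real and P :: "real \<Rightarrow> 'w measure" and X :: "real \<Rightarrow> 'w \<Rightarrow> real"
  assumes r_pos: "0 < r" and feller: "feller_diffusion r P X"
begin

text \<open>The retraction of the line onto the state space. Functions matter only on
  \<open>{0..r}\<close>, and composing with it turns continuity there into continuity and Borel
  measurability on the line.\<close>

definition clip :: "real \<Rightarrow> real" where "clip x = max 0 (min r x)"

lemma clip_in: "clip x \<in> {0..r}" and clip_id: "0 \<le> x \<Longrightarrow> x \<le> r \<Longrightarrow> clip x = x"
  using r_pos by (auto simp: clip_def)

lemma clip_cont: "continuous_on UNIV clip" unfolding clip_def[abs_def] by (intro continuous_intros)

lemma cont_clip: "continuous_on {0..r} f \<Longrightarrow> continuous_on UNIV (\<lambda>x. f (clip x))"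
  by (rule continuous_on_compose2[OF _ clip_cont]) (use clip_in in auto)

lemma meas_clip: "continuous_on {0..r} f \<Longrightarrow> (\<lambda>x. f (clip x)) \<in> borel_measurable borel"
  by (intro borel_measurable_continuous_onI cont_clip)

lemma cont_bounded:
  assumes "continuous_on {0..r} f"
  obtains B :: real where "0 \<le> B" "\<And>x. 0 \<le> x \<Longrightarrow> x \<le> r \<Longrightarrow> \<bar>f x\<bar> \<le> B"
proof -
  have "bounded (f ` {0..r})" using assms by (intro compact_imp_bounded compact_continuous_image) auto
  then obtain B where B: "\<forall>x\<in>{0..r}. \<bar>f x\<bar> \<le> B" unfolding bounded_iff by auto
  show thesis by (rule that[of "max 0 B"]) (use B in \<open>auto simp: le_max_iff_disj\<close>)
qed

lemmas feller_D = feller[unfolded feller_diffusion_def, THEN conjunct1]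
  feller[unfolded feller_diffusion_def, THEN conjunct2, THEN conjunct1]
  feller[unfolded feller_diffusion_def, THEN conjunct2, THEN conjunct2, THEN conjunct1]
  feller[unfolded feller_diffusion_def, THEN conjunct2, THEN conjunct2, THEN conjunct2, THEN conjunct1]
  feller[unfolded feller_diffusion_def, THEN conjunct2, THEN conjunct2, THEN conjunct2, THEN conjunct2, THEN conjunct1]
  feller[unfolded feller_diffusion_def, THEN conjunct2, THEN conjunct2, THEN conjunct2, THEN conjunct2, THEN conjunct2, THEN conjunct1]
  feller[unfolded feller_diffusion_def, THEN conjunct2, THEN conjunct2, THEN conjunct2, THEN conjunct2, THEN conjunct2, THEN conjunct2, THEN conjunct1]
  feller[unfolded feller_diffusion_def, THEN conjunct2, THEN conjunct2, THEN conjunct2, THEN conjunct2, THEN conjunct2, THEN conjunct2, THEN conjunct2]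

lemma P_prob: "0 \<le> x \<Longrightarrow> x \<le> r \<Longrightarrow> prob_space (P x)"
  and P_sets: "0 \<le> x \<Longrightarrow> x \<le> r \<Longrightarrow> sets (P x) = sets (P 0)"
  using bspec[OF feller_D(1), of x] by (simp_all only: atLeastAtMost_iff)

lemma X_meas0: "0 \<le> t \<Longrightarrow> X t \<in> P 0 \<rightarrow>\<^sub>M borel"
  using feller_D(2) by auto

lemma X_range: "0 \<le> t \<Longrightarrow> \<omega> \<in> space (P 0) \<Longrightarrow> X t \<omega> \<in> {0..r}"
  using feller_D(3) by blast

lemma X_cont: "\<omega> \<in> space (P 0) \<Longrightarrow> continuous_on {0..} (\<lambda>t. X t \<omega>)"
  using feller_D(4) by blast

lemma X_0: "0 \<le> x \<Longrightarrow> x \<le> r \<Longrightarrow> AE \<omega> in P x. X 0 \<omega> = x"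
  using feller_D(5) by auto

lemma transition_meas: "0 \<le> t \<Longrightarrow> transition P X t \<in> restrict_space borel {0..r} \<rightarrow>\<^sub>M prob_algebra borel"
  using feller_D(6) by blast

lemma markov: "0 \<le> x \<Longrightarrow> x \<le> r \<Longrightarrow> 0 \<le> s \<Longrightarrow> 0 \<le> t \<Longrightarrow> E \<in> past_events (space (P 0)) X s \<Longrightarrow> B \<in> sets borel \<Longrightarrow>
    measure (P x) (E \<inter> {\<omega>\<in>space (P 0). X (s + t) \<omega> \<in> B}) =
    (\<integral>\<omega>\<in>E. measure (transition P X t (X s \<omega>)) B \<partial>P x)"
  using feller_D(7)[rule_format, of x s t E B] by simp

lemma feller_cont: "continuous_on {0..r} f \<Longrightarrow> 0 \<le> t \<Longrightarrow> continuous_on {0..r} (semigroup_op P X t f)"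
  using feller_D(8) by blast

lemma feller_lim: "continuous_on {0..r} f \<Longrightarrow> uniform_limit {0..r} (\<lambda>t. semigroup_op P X t f) f (at_right 0)"
  using feller_D(8) by blast

lemma P_space: "0 \<le> x \<Longrightarrow> x \<le> r \<Longrightarrow> space (P x) = space (P 0)"
  using P_sets by (rule sets_eq_imp_space_eq)

lemma X_meas: "0 \<le> x \<Longrightarrow> x \<le> r \<Longrightarrow> 0 \<le> t \<Longrightarrow> X t \<in> P x \<rightarrow>\<^sub>M borel"
  using X_meas0 measurable_cong_sets[OF P_sets refl] by blast

text \<open>The semigroup, made total: negative times count as 0 and the argument is clipped, so it
  depends on \<open>f\<close> on \<open>{0..r}\<close> alone and is continuous in \<open>t\<close>
  on the whole line.\<close>

definition T :: "real \<Rightarrow> (real \<Rightarrow> real) \<Rightarrow> real \<Rightarrow> real" where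
  "T t f x = (\<integral>\<omega>. f (clip (X (max 0 t) \<omega>)) \<partial>P x)"

lemma T_semigroup_op:
  assumes "0 \<le> t" "0 \<le> x" "x \<le> r" shows "T t f x = semigroup_op P X t f x"
  unfolding T_def semigroup_op_def
  by (intro Bochner_Integration.integral_cong) (use assms X_range[of t] P_space[OF assms(2,3)] in \<open>auto simp: clip_id\<close>)

definition bm :: "(real \<Rightarrow> real) \<Rightarrow> bool" where
  "bm f \<longleftrightarrow> (\<lambda>x. f (clip x)) \<in> borel_measurable borel \<and> (\<exists>B. \<forall>x\<in>{0..r}. \<bar>f x\<bar> \<le> B)"

lemma cont_bm: "continuous_on {0..r} f \<Longrightarrow> bm f"
  unfolding bm_def using meas_clip[of f] cont_bounded[of f] by (metis atLeastAtMost_iff)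

lemma bm_integrable:
  assumes "bm f" "0 \<le> x" "x \<le> r" shows "integrable (P x) (\<lambda>\<omega>. f (clip (X (max 0 t) \<omega>)))"
proof -
  interpret prob_space "P x" by (rule P_prob[OF assms(2,3)])
  have [measurable]: "X (max 0 t) \<in> P x \<rightarrow>\<^sub>M borel" by (rule X_meas) (use assms in auto)
  have [measurable]: "(\<lambda>x. f (clip x)) \<in> borel_measurable borel" using assms(1) by (simp add: bm_def)
  obtain B where B: "\<forall>x\<in>{0..r}. \<bar>f x\<bar> \<le> B" using assms(1) unfolding bm_def by blast
  show ?thesis
    by (intro integrable_const_bound[where B=B]) (use B clip_in in auto)
qed

lemma T_abs_le:
  assumes f: "bm f" and B: "\<And>y. 0 \<le> y \<Longrightarrow> y \<le> r \<Longrightarrow> \<bar>f y\<bar> \<le> B" and x: "0 \<le> x" "x \<le> r"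
  shows "\<bar>T t f x\<bar> \<le> B"
proof -
  interpret prob_space "P x" by (rule P_prob[OF x])
  have "\<bar>T t f x\<bar> \<le> (\<integral>\<omega>. \<bar>f (clip (X (max 0 t) \<omega>))\<bar> \<partial>P x)"
    unfolding T_def by (rule integral_abs_bound)
  also have "\<dots> \<le> (\<integral>\<omega>. B \<partial>P x)"
    by (rule integral_mono[OF integrable_abs[OF bm_integrable[OF f x]]]) (use B clip_in in auto)
  finally show ?thesis by (simp add: prob_space)
qed

lemma T_mono:
  assumes "bm f" "bm g" "\<And>y. 0 \<le> y \<Longrightarrow> y \<le> r \<Longrightarrow> f y \<le> g y" "0 \<le> x" "x \<le> r"
  shows "T t f x \<le> T t g x"
  unfolding T_def by (intro integral_mono bm_integrable assms) (use assms(3) clip_in in auto)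

lemma T_nonneg: "bm f \<Longrightarrow> (\<And>y. 0 \<le> y \<Longrightarrow> y \<le> r \<Longrightarrow> 0 \<le> f y) \<Longrightarrow> 0 \<le> T t f x"
  unfolding T_def by (rule Bochner_Integration.integral_nonneg) (use clip_in in auto)

lemma T_lincomb:
  assumes "bm f" "bm g" "0 \<le> x" "x \<le> r"
  shows "T t (\<lambda>y. a * f y - b * g y) x = a * T t f x - b * T t g x"
  unfolding T_def using bm_integrable[OF assms(1,3,4)] bm_integrable[OF assms(2,3,4)] by simp

lemma T_cong: "(\<And>y. 0 \<le> y \<Longrightarrow> y \<le> r \<Longrightarrow> f y = g y) \<Longrightarrow> T t f x = T t g x"
  unfolding T_def using clip_in by (auto intro!: Bochner_Integration.integral_cong)

lemma T_dominated:
  assumes x: "0 \<le> x" "x \<le> r" and f: "\<And>n. bm (f n)" and g: "(\<lambda>x. g (clip x)) \<in> borel_measurable borel"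
    and B: "\<And>n y. 0 \<le> y \<Longrightarrow> y \<le> r \<Longrightarrow> \<bar>f n y\<bar> \<le> B"
    and lim: "\<And>y. 0 \<le> y \<Longrightarrow> y \<le> r \<Longrightarrow> (\<lambda>n. f n y) \<longlonglongrightarrow> g y"
  shows "(\<lambda>n. T t (f n) x) \<longlonglongrightarrow> T t g x"
  unfolding T_def
proof (rule integral_dominated_convergence[where w="\<lambda>_. B"])
  interpret prob_space "P x" by (rule P_prob[OF x])
  note [measurable] = g
  have [measurable]: "X (max 0 t) \<in> P x \<rightarrow>\<^sub>M borel" by (rule X_meas) (use x in auto)
  have [measurable]: "(\<lambda>x. f n (clip x)) \<in> borel_measurable borel" for n using f by (auto simp: bm_def)
  show "integrable (P x) (\<lambda>_. B)" by simp
  show "(\<lambda>\<omega>. g (clip (X (max 0 t) \<omega>))) \<in> borel_measurable (P x)"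
    "\<And>n. (\<lambda>\<omega>. f n (clip (X (max 0 t) \<omega>))) \<in> borel_measurable (P x)" by measurable
qed (use B lim clip_in in auto)

lemma T_0: assumes "bm f" "0 \<le> x" "x \<le> r" shows "T 0 f x = f x"
proof -
  interpret prob_space "P x" by (rule P_prob[OF assms(2,3)])
  have "T 0 f x = (\<integral>\<omega>. f x \<partial>P x)" unfolding T_def
  proof (rule integral_cong_AE)
    show "AE \<omega> in P x. f (clip (X (max 0 0) \<omega>)) = f x" using X_0[OF assms(2,3)] by eventually_elim (use assms in \<open>simp add: clip_id\<close>)
  qed (use bm_integrable[OF assms, of 0] in \<open>auto dest: borel_measurable_integrable\<close>)
  then show ?thesis by (simp add: prob_space)
qed

lemma T_cont_x: "continuous_on {0..r} f \<Longrightarrow> continuous_on {0..r} (T t f)"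
proof -
  assume f: "continuous_on {0..r} f"
  have "T t f x = semigroup_op P X (max 0 t) f x" if "x \<in> {0..r}" for x
    using T_semigroup_op[of "max 0 t" x f] that by (simp add: T_def)
  then show "continuous_on {0..r} (T t f)"
    using continuous_on_eq[OF feller_cont[OF f, of "max 0 t"], of "T t f"] by simp
qed

lemma X_path_cont: "\<omega> \<in> space (P 0) \<Longrightarrow> continuous_on UNIV (\<lambda>t. X (max 0 t) \<omega>)"
  by (rule continuous_on_compose2[OF X_cont, of _ _ "\<lambda>t. max 0 t"]) (auto intro!: continuous_intros)

lemma T_cont_t:
  assumes f: "continuous_on {0..r} f" and x: "0 \<le> x" "x \<le> r"
  shows "continuous_on UNIV (\<lambda>t. T t f x)"
proof (rule continuous_on_sequentiallyI)
  fix u :: "nat \<Rightarrow> real" and a assume u: "u \<longlonglongrightarrow> a"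
  obtain B where B: "\<And>x. 0 \<le> x \<Longrightarrow> x \<le> r \<Longrightarrow> \<bar>f x\<bar> \<le> B" using cont_bounded[OF f] by metis
  interpret prob_space "P x" by (rule P_prob[OF x])
  have c: "continuous_on UNIV (\<lambda>t. f (clip (X (max 0 t) \<omega>)))" if "\<omega> \<in> space (P x)" for \<omega>
    by (rule continuous_on_compose2[OF cont_clip[OF f] X_path_cont]) (use that P_space[OF x] in auto)
  show "(\<lambda>n. T (u n) f x) \<longlonglongrightarrow> T a f x"
    unfolding T_def
  proof (rule integral_dominated_convergence[where w="\<lambda>_. B"])
    show "AE \<omega> in P x. (\<lambda>n. f (clip (X (max 0 (u n)) \<omega>))) \<longlonglongrightarrow> f (clip (X (max 0 a) \<omega>))"
    proof (rule AE_I2)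
      fix \<omega> assume "\<omega> \<in> space (P x)"
      then have "isCont (\<lambda>t. f (clip (X (max 0 t) \<omega>))) a" using c by (simp add: continuous_on_eq_continuous_at)
      then show "(\<lambda>n. f (clip (X (max 0 (u n)) \<omega>))) \<longlonglongrightarrow> f (clip (X (max 0 a) \<omega>))"
        by (rule isCont_tendsto_compose[OF _ u])
    qed
  qed (use bm_integrable[OF cont_bm[OF f] x] B clip_in in auto)
qed

lemma T_meas_t: "continuous_on {0..r} f \<Longrightarrow> 0 \<le> x \<Longrightarrow> x \<le> r \<Longrightarrow> (\<lambda>t. T t f x) \<in> borel_measurable borel"
  by (intro borel_measurable_continuous_onI T_cont_t)

lemma T_distr:
  assumes "0 \<le> t" "0 \<le> x" "x \<le> r" "(\<lambda>x. f (clip x)) \<in> borel_measurable borel"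
  shows "T t f x = (\<integral>y. f (clip y) \<partial>transition P X t x)"
  unfolding T_def transition_def using assms by (subst integral_distr) (auto intro: X_meas)

lemma transition_prob: "0 \<le> t \<Longrightarrow> 0 \<le> x \<Longrightarrow> x \<le> r \<Longrightarrow> prob_space (transition P X t x)"
  unfolding transition_def by (rule prob_space.prob_space_distr[OF P_prob]) (auto intro: X_meas)

lemma transition_sets [simp]: "sets (transition P X t x) = sets borel" "space (transition P X t x) = UNIV"
  by (auto simp: transition_def)

lemma transition_range:
  assumes "0 \<le> t" "0 \<le> x" "x \<le> r" shows "AE y in transition P X t x. 0 \<le> y \<and> y \<le> r"
  unfolding transition_def
  by (subst AE_distr_iff) (use assms X_meas[OF assms(2,3,1)] X_range[OF assms(1)] P_space[OF assms(2,3)] in \<open>auto intro!: AE_I2\<close>)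

text \<open>The Markov property is given for probabilities of Borel sets. Taken with the full space
  as past event it identifies the law at time s + t as a composition of kernels, which can then be
  integrated against \<open>f\<close>.\<close>

lemma T_add:
  assumes f: "continuous_on {0..r} f" and st: "0 \<le> s" "0 \<le> t" and x: "0 \<le> x" "x \<le> r"
  shows "T (s + t) f x = T s (T t f) x"
proof -
  define K where "K y = transition P X t (clip y)" for y
  have "clip \<in> borel \<rightarrow>\<^sub>M restrict_space borel {0..r}"
    by (rule measurable_restrict_space2) (use clip_in borel_measurable_continuous_onI[OF clip_cont] in auto)
  then have Kp: "K \<in> borel \<rightarrow>\<^sub>M prob_algebra borel"
    unfolding K_def by (rule measurable_compose[OF _ transition_meas[OF st(2)]])
  then have K: "K \<in> borel \<rightarrow>\<^sub>M subprob_algebra borel" by (rule measurable_prob_algebraD)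
  let ?\<nu> = "transition P X s x"
  interpret \<nu>: prob_space ?\<nu> by (rule transition_prob[OF st(1) x])
  interpret Px: prob_space "P x" by (rule P_prob[OF x])
  have K\<nu>: "K \<in> ?\<nu> \<rightarrow>\<^sub>M subprob_algebra borel" using K by (simp cong: measurable_cong_sets)
  have Kprob: "prob_space (K y)" for y unfolding K_def by (rule transition_prob) (use st clip_in in auto)
  have eq: "transition P X (s + t) x = ?\<nu> \<bind> K"
  proof (rule measure_eqI)
    show "sets (transition P X (s + t) x) = sets (?\<nu> \<bind> K)" by (subst sets_bind[where N=borel]) (auto simp: K_def)
    fix B assume "B \<in> sets (transition P X (s + t) x)"
    then have B[measurable]: "B \<in> sets borel" by simp
    have mB: "(\<lambda>y. measure (K y) B) \<in> borel_measurable borel"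
      using measurable_compose[OF K measurable_measure_subprob_algebra[OF B]] by simp
    have "space (P 0) \<in> past_events (space (P 0)) X s"
      unfolding past_events_def by (rule sigma_sets_top)
    from markov[OF x st this B]
    have "measure (P x) (space (P 0) \<inter> {\<omega> \<in> space (P 0). X (s + t) \<omega> \<in> B}) = (\<integral>\<omega>\<in>space (P 0). measure (transition P X t (X s \<omega>)) B \<partial>P x)" .
    also have "(\<integral>\<omega>\<in>space (P 0). measure (transition P X t (X s \<omega>)) B \<partial>P x) = (\<integral>\<omega>. measure (K (X s \<omega>)) B \<partial>P x)"
      unfolding set_lebesgue_integral_def K_def
      by (intro Bochner_Integration.integral_cong) (use X_range[OF st(1)] P_space[OF x] in \<open>auto simp: clip_id\<close>)
    also have "\<dots> = (\<integral>y. measure (K y) B \<partial>?\<nu>)"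
      unfolding transition_def by (rule integral_distr[symmetric]) (use X_meas[OF x st(1)] mB in auto)
    finally have 1: "measure (transition P X (s + t) x) B = (\<integral>y. measure (K y) B \<partial>?\<nu>)"
      unfolding transition_def using X_meas[OF x, of "s + t"] st P_space[OF x]
      by (subst measure_distr) (auto simp: vimage_def Int_def conj_commute intro!: arg_cong[of _ _ "measure (P x)"])
    have "emeasure (?\<nu> \<bind> K) B = (\<integral>\<^sup>+y. emeasure (K y) B \<partial>?\<nu>)"
      by (rule emeasure_bind[OF _ K\<nu> B]) simp
    also have "\<dots> = (\<integral>\<^sup>+y. ennreal (measure (K y) B) \<partial>?\<nu>)"
      by (intro nn_integral_cong) (simp add: finite_measure.emeasure_eq_measure[OF prob_space.finite_measure[OF Kprob]])
    also have "\<dots> = ennreal (\<integral>y. measure (K y) B \<partial>?\<nu>)"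
    proof (rule nn_integral_eq_integral)
      show "integrable ?\<nu> (\<lambda>y. measure (K y) B)"
        by (rule \<nu>.integrable_const_bound[where B=1]) (use mB prob_space.prob_le_1[OF Kprob] in \<open>auto cong: measurable_cong_sets\<close>)
    qed auto
    finally have 2: "emeasure (?\<nu> \<bind> K) B = ennreal (measure (transition P X (s + t) x) B)" by (simp add: 1)
    interpret st: prob_space "transition P X (s + t) x" by (rule transition_prob) (use st x in auto)
    show "emeasure (transition P X (s + t) x) B = emeasure (?\<nu> \<bind> K) B"
      by (simp add: 2 st.emeasure_eq_measure)
  qed
  obtain B where B: "\<And>x. 0 \<le> x \<Longrightarrow> x \<le> r \<Longrightarrow> \<bar>f x\<bar> \<le> B" using cont_bounded[OF f] by metis
  have "T (s + t) f x = (\<integral>y. f (clip y) \<partial>(?\<nu> \<bind> K))"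
    using T_distr[of "s + t" x f] st x meas_clip[OF f] eq by simp
  also have "\<dots> = (\<integral>y. (\<integral>z. f (clip z) \<partial>K y) \<partial>?\<nu>)"
  proof (rule integral_bind[OF _ _ K\<nu>, where B=B and B'=1])
    show "finite_measure ?\<nu>" by unfold_locales
    show "AE y in ?\<nu>. emeasure (K y) (space (K y)) \<le> ennreal 1"
      using prob_space.emeasure_space_1[OF Kprob] by simp
  qed (use meas_clip[OF f] B clip_in in auto)
  also have "\<dots> = (\<integral>y. T t f (clip y) \<partial>?\<nu>)"
    unfolding K_def by (intro Bochner_Integration.integral_cong T_distr[symmetric]) (use st clip_in meas_clip[OF f] in auto)
  also have "\<dots> = T s (T t f) x"
    using T_distr[of s x "T t f"] st x meas_clip[OF T_cont_x[OF f]] by simp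
  finally show ?thesis .
qed

end

section \<open>Resolvent and generator\<close>

context feller_process begin

text \<open>The semigroup at an independent exponential time, that is, \<mu> times the resolvent
  (\<mu> - A)^{-1}.\<close>

definition N :: "real \<Rightarrow> (real \<Rightarrow> real) \<Rightarrow> real \<Rightarrow> real" where
  "N \<mu> f x = (\<integral>t. T t f x \<partial>exp_law \<mu>)"

lemma T_joint_meas:
  assumes f: "continuous_on {0..r} f"
  shows "(\<lambda>p. T (fst p) f (clip (snd p))) \<in> borel_measurable (borel \<Otimes>\<^sub>M borel)"
proof (rule borel_measurable_caratheodory[where \<phi>="\<lambda>t y. T t f (clip y)"])
  show "(\<lambda>y. T t f (clip y)) \<in> borel_measurable borel" for t by (rule meas_clip[OF T_cont_x[OF f]])
  show "continuous_on UNIV (\<lambda>t. T t f (clip y))" for y by (rule T_cont_t[OF f]) (use clip_in in auto)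
qed

lemma T_exp_integrable:
  assumes \<mu>: "0 < \<mu>" and f: "continuous_on {0..r} f" and x: "0 \<le> x" "x \<le> r"
  shows "integrable (exp_law \<mu>) (\<lambda>t. T t f x)"
proof -
  obtain B where B: "\<And>x. 0 \<le> x \<Longrightarrow> x \<le> r \<Longrightarrow> \<bar>f x\<bar> \<le> B" using cont_bounded[OF f] by metis
  show ?thesis
    by (rule exp_law_bounded_integrable[OF \<mu> T_meas_t[OF f x] T_abs_le[OF cont_bm[OF f] B x]])
qed

lemma N_abs_le:
  assumes \<mu>: "0 < \<mu>" and f: "continuous_on {0..r} f" and x: "0 \<le> x" "x \<le> r"
    and B: "\<And>x. 0 \<le> x \<Longrightarrow> x \<le> r \<Longrightarrow> \<bar>f x\<bar> \<le> B"
  shows "\<bar>N \<mu> f x\<bar> \<le> B"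
proof -
  interpret prob_space "exp_law \<mu>" by (rule exp_law_prob[OF \<mu>])
  have "\<bar>N \<mu> f x\<bar> \<le> (\<integral>t. \<bar>T t f x\<bar> \<partial>exp_law \<mu>)" unfolding N_def by (rule integral_abs_bound)
  also have "\<dots> \<le> (\<integral>t. B \<partial>exp_law \<mu>)"
    by (intro integral_mono integrable_abs T_exp_integrable \<mu> f x T_abs_le cont_bm B) auto
  also have "\<dots> = B" using prob_space by simp
  finally show ?thesis .
qed

lemma N_nonneg: "continuous_on {0..r} f \<Longrightarrow> (\<And>y. 0 \<le> y \<Longrightarrow> y \<le> r \<Longrightarrow> 0 \<le> f y) \<Longrightarrow> 0 \<le> N \<mu> f x"
  unfolding N_def by (intro Bochner_Integration.integral_nonneg T_nonneg cont_bm)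

lemma N_lincomb:
  assumes "0 < \<mu>" "continuous_on {0..r} f" "continuous_on {0..r} g" "0 \<le> x" "x \<le> r"
  shows "N \<mu> (\<lambda>y. a * f y - b * g y) x = a * N \<mu> f x - b * N \<mu> g x"
  unfolding N_def using T_exp_integrable[OF assms(1,2,4,5)] T_exp_integrable[OF assms(1,3,4,5)]
  by (simp add: T_lincomb[OF cont_bm[OF assms(2)] cont_bm[OF assms(3)] assms(4,5)])

lemma N_cont:
  assumes \<mu>: "0 < \<mu>" and f: "continuous_on {0..r} f"
  shows "continuous_on {0..r} (N \<mu> f)"
proof (rule continuous_on_sequentiallyI)
  fix u :: "nat \<Rightarrow> real" and a assume u: "\<forall>n. u n \<in> {0..r}" "a \<in> {0..r}" "u \<longlonglongrightarrow> a"
  obtain B where B: "\<And>x. 0 \<le> x \<Longrightarrow> x \<le> r \<Longrightarrow> \<bar>f x\<bar> \<le> B" using cont_bounded[OF f] by metis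
  interpret prob_space "exp_law \<mu>" by (rule exp_law_prob[OF \<mu>])
  show "(\<lambda>n. N \<mu> f (u n)) \<longlonglongrightarrow> N \<mu> f a"
    unfolding N_def
  proof (rule integral_dominated_convergence[where w="\<lambda>_. B"])
    show "AE t in exp_law \<mu>. (\<lambda>n. T t f (u n)) \<longlonglongrightarrow> T t f a"
      using T_cont_x[OF f] u unfolding continuous_on_sequentially by (auto simp: o_def)
    show "(\<lambda>t. T t f a) \<in> borel_measurable (exp_law \<mu>)" using T_meas_t[OF f, of a] u by simp
    show "(\<lambda>t. T t f (u i)) \<in> borel_measurable (exp_law \<mu>)" for i using T_meas_t[OF f, of "u i"] u by simp
    show "AE t in exp_law \<mu>. norm (T t f (u n)) \<le> B" for n
      using T_abs_le[OF cont_bm[OF f] B, of "u n"] u by simp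
  qed simp
qed

lemma T_N:
  assumes \<mu>: "0 < \<mu>" and f: "continuous_on {0..r} f" and h: "0 \<le> h" and x: "0 \<le> x" "x \<le> r"
  shows "T h (N \<mu> f) x = (\<integral>t. T (t + h) f x \<partial>exp_law \<mu>)"
proof -
  interpret E: prob_space "exp_law \<mu>" by (rule exp_law_prob[OF \<mu>])
  let ?\<nu> = "transition P X h x"
  interpret \<nu>: prob_space ?\<nu> by (rule transition_prob[OF h x])
  interpret pair_sigma_finite "exp_law \<mu>" ?\<nu> by unfold_locales
  interpret EP: pair_prob_space "exp_law \<mu>" ?\<nu> by unfold_locales
  obtain B where B: "\<And>x. 0 \<le> x \<Longrightarrow> x \<le> r \<Longrightarrow> \<bar>f x\<bar> \<le> B" using cont_bounded[OF f] by metis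
  have m: "(\<lambda>(t, y). T t f (clip y)) \<in> borel_measurable (exp_law \<mu> \<Otimes>\<^sub>M ?\<nu>)"
    using T_joint_meas[OF f] by (simp add: case_prod_beta' cong: measurable_cong_sets sets_pair_measure_cong)
  have i: "integrable (exp_law \<mu> \<Otimes>\<^sub>M ?\<nu>) (\<lambda>(t, y). T t f (clip y))"
    by (rule EP.integrable_const_bound[where B=B])
      (use T_abs_le[OF cont_bm[OF f] B] clip_in m in \<open>auto intro!: AE_I2\<close>)
  have "T h (N \<mu> f) x = (\<integral>y. N \<mu> f (clip y) \<partial>?\<nu>)"
    by (rule T_distr[OF h x meas_clip[OF N_cont[OF \<mu> f]]])
  also have "\<dots> = (\<integral>t. (\<integral>y. T t f (clip y) \<partial>?\<nu>) \<partial>exp_law \<mu>)"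
    unfolding N_def by (rule Fubini_integral[OF i])
  also have "\<dots> = (\<integral>t. T (t + h) f x \<partial>exp_law \<mu>)"
  proof (rule integral_cong_AE)
    show "AE t in exp_law \<mu>. (\<integral>y. T t f (clip y) \<partial>?\<nu>) = T (t + h) f x"
      using exp_law_AE
    proof eventually_elim
      case (elim t)
      have "T (t + h) f x = T h (T t f) x" using T_add[OF f h elim x] by (simp add: add.commute)
      also have "\<dots> = (\<integral>y. T t f (clip y) \<partial>?\<nu>)" by (rule T_distr[OF h x meas_clip[OF T_cont_x[OF f]]])
      finally show ?case by simp
    qed
    show "(\<lambda>t. T (t + h) f x) \<in> borel_measurable (exp_law \<mu>)"
      using measurable_compose[OF _ T_meas_t[OF f x], of "\<lambda>t. t + h" borel] by simp
    show "(\<lambda>t. \<integral>y. T t f (clip y) \<partial>?\<nu>) \<in> borel_measurable (exp_law \<mu>)"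
      using \<nu>.borel_measurable_lebesgue_integral[OF m] by simp
  qed
  finally show ?thesis .
qed

lemma exp_quot_lim: "((\<lambda>h. (exp (\<mu> * h) - 1) / h) \<longlongrightarrow> (\<mu>::real)) (at_right 0)"
proof -
  have "((\<lambda>h. exp (\<mu> * h)) has_real_derivative \<mu>) (at 0)" by (auto intro!: derivative_eq_intros)
  then have "((\<lambda>h. (exp (\<mu> * h) - 1) / h) \<longlongrightarrow> \<mu>) (at 0)" by (simp add: DERIV_def)
  then show ?thesis by (rule tendsto_within_subset) simp
qed

lemma uniform_T_0:
  assumes f: "continuous_on {0..r} f" and e: "0 < e"
  shows "\<exists>d>0. \<forall>t x. 0 \<le> t \<longrightarrow> t < d \<longrightarrow> 0 \<le> x \<longrightarrow> x \<le> r \<longrightarrow> \<bar>T t f x - f x\<bar> \<le> e"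
proof -
  have "\<forall>\<^sub>F t in at_right 0. \<forall>x\<in>{0..r}. dist (semigroup_op P X t f x) (f x) < e"
    using feller_lim[OF f] e by (simp add: uniform_limit_iff)
  then obtain d where d: "d > 0" "\<And>t x. 0 < t \<Longrightarrow> t < d \<Longrightarrow> x \<in> {0..r} \<Longrightarrow> dist (semigroup_op P X t f x) (f x) < e"
    unfolding eventually_at_right_field by blast
  have "\<bar>T t f x - f x\<bar> \<le> e" if "0 \<le> t" "t < d" "0 \<le> x" "x \<le> r" for t x
  proof (cases "t = 0")
    case True
    then show ?thesis using T_0[OF cont_bm[OF f]] that e by simp
  next
    case False
    then show ?thesis using d(2)[of t x] T_semigroup_op[of t x f] that by (simp add: dist_real_def)
  qed
  with d(1) show ?thesis by blast
qed

text \<open>By the memoryless property the shifted average is exp (\<mu> h) times the resolvent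
  minus the part before \<open>h\<close>, and that part is about \<mu> h f. The average of
  \<open>T (t + h) f\<close> equals both T_h of the resolvent and the resolvent of T_h f, so this
  single limit serves \<open>generator_resolvent\<close> and
  \<open>resolvent_generator\<close>.\<close>

lemma shifted_resolvent_lim:
  assumes \<mu>: "0 < \<mu>" and f: "continuous_on {0..r} f"
  shows "uniform_limit {0..r} (\<lambda>h x. ((\<integral>t. T (t + h) f x \<partial>exp_law \<mu>) - N \<mu> f x) / h) (\<lambda>x. \<mu> * (N \<mu> f x - f x)) (at_right 0)"
proof (rule uniform_limitI)
  fix e :: real assume e: "0 < e"
  obtain B where B0: "0 \<le> B" and B: "\<And>x. 0 \<le> x \<Longrightarrow> x \<le> r \<Longrightarrow> \<bar>f x\<bar> \<le> B" using cont_bounded[OF f] by metis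
  define \<kappa> where "\<kappa> h = (exp (\<mu> * h) - 1) / h" for h
  \<comment> \<open>The error has three parts: two of size at most \<delta> B, each at most e / 8,
    and one of size \<eta> times the quotient \<kappa>, at most e / 4. The bound \<delta> \<le> 1
    keeps \<kappa> below \<mu> + 1.\<close>
  define \<eta> where "\<eta> = e / (4 * (\<mu> + 1))"
  have \<eta>: "0 < \<eta>" using e \<mu> by (simp add: \<eta>_def)
  obtain d where d: "d > 0" "\<And>t x. 0 \<le> t \<Longrightarrow> t < d \<Longrightarrow> 0 \<le> x \<Longrightarrow> x \<le> r \<Longrightarrow> \<bar>T t f x - f x\<bar> \<le> \<eta>"
    using uniform_T_0[OF f \<eta>] by blast
  define \<delta> where "\<delta> = min 1 (e / (8 * (B + 1)))"
  have \<delta>: "0 < \<delta>" using e B0 by (simp add: \<delta>_def)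
  have "\<forall>\<^sub>F h in at_right 0. dist (\<kappa> h) \<mu> < \<delta>" using tendstoD[OF exp_quot_lim \<delta>, of \<mu>] by (simp add: \<kappa>_def)
  moreover have "\<forall>\<^sub>F h in at_right 0. 0 < h \<and> h < d" using d(1) by (auto simp: eventually_at_right_field)
  ultimately show "\<forall>\<^sub>F h in at_right 0. \<forall>x\<in>{0..r}. dist (((\<integral>t. T (t + h) f x \<partial>exp_law \<mu>) - N \<mu> f x) / h) (\<mu> * (N \<mu> f x - f x)) < e"
  proof eventually_elim
    case (elim h)
    have h: "0 < h" "h < d" using elim by auto
    show ?case
    proof
      fix x assume "x \<in> {0..r}"
      then have x: "0 \<le> x" "x \<le> r" by auto
      define J where "J = (\<integral>t. indicator {..<h} t * T t f x \<partial>exp_law \<mu>)"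
      define c where "c = exp (\<mu> * h)"
      have c1: "1 \<le> c" using \<mu> h by (simp add: c_def)
      have sh: "(\<integral>t. T (t + h) f x \<partial>exp_law \<mu>) = c * (N \<mu> f x - J)"
        unfolding J_def c_def N_def
        by (rule exp_law_shift[OF \<mu> T_meas_t[OF f x] T_abs_le[OF cont_bm[OF f] B x]]) (use h in auto)
      have cJ: "c * (1 - exp (- (\<mu> * h))) = c - 1"
        by (simp add: c_def right_diff_distrib exp_minus)
      have "\<bar>J - f x * (1 - exp (- (\<mu> * h)))\<bar> \<le> \<eta> * (1 - exp (- (\<mu> * h)))"
      proof -
        have mi: "integrable (exp_law \<mu>) (indicator {..<h} :: real \<Rightarrow> real)"
          by (rule exp_law_bounded_integrable[OF \<mu>, where B=1]) auto
        have mi2: "integrable (exp_law \<mu>) (\<lambda>t. indicator {..<h} t * T t f x)"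
          by (rule exp_law_bounded_integrable[OF \<mu>, where B=B])
            (use T_meas_t[OF f x] T_abs_le[OF cont_bm[OF f] B x] B0 in \<open>auto simp: indicator_def\<close>)
        have mi3: "integrable (exp_law \<mu>) (\<lambda>t. indicator {..<h} t * f x)" by (intro integrable_mult_left mi)
        have "J - f x * (1 - exp (- (\<mu> * h))) = (\<integral>t. indicator {..<h} t * T t f x \<partial>exp_law \<mu>) - (\<integral>t. indicator {..<h} t * f x \<partial>exp_law \<mu>)"
          unfolding J_def integral_mult_left_zero exp_law_indicator[OF \<mu> less_imp_le[OF h(1)]] by (simp only: mult.commute)
        also have "\<dots> = (\<integral>t. indicator {..<h} t * T t f x - indicator {..<h} t * f x \<partial>exp_law \<mu>)"
          by (rule Bochner_Integration.integral_diff[OF mi2 mi3, symmetric])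
        finally have "\<bar>J - f x * (1 - exp (- (\<mu> * h)))\<bar> = \<bar>\<integral>t. indicator {..<h} t * T t f x - indicator {..<h} t * f x \<partial>exp_law \<mu>\<bar>"
          by (rule arg_cong)
        also have "\<dots> \<le> (\<integral>t. \<bar>indicator {..<h} t * T t f x - indicator {..<h} t * f x\<bar> \<partial>exp_law \<mu>)"
          by (rule integral_abs_bound)
        also have "\<dots> \<le> (\<integral>t. indicator {..<h} t * \<eta> \<partial>exp_law \<mu>)"
        proof (rule integral_mono_AE)
          show "AE t in exp_law \<mu>. \<bar>indicator {..<h} t * T t f x - indicator {..<h} t * f x\<bar> \<le> indicator {..<h} t * \<eta>"
            using exp_law_AE
          proof eventually_elim
            case (elim t)
            show ?case
            proof (cases "t < h")
              case True
              then show ?thesis using d(2)[of t x] elim x h by simp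
            next
              case False
              then show ?thesis by simp
            qed
          qed
        qed (intro integrable_abs Bochner_Integration.integrable_diff mi2 mi3 integrable_mult_left mi)+
        also have "\<dots> = \<eta> * (1 - exp (- (\<mu> * h)))"
          unfolding integral_mult_left_zero exp_law_indicator[OF \<mu> less_imp_le[OF h(1)]] by (simp only: mult.commute)
        finally show ?thesis .
      qed
      then have "c * \<bar>J - f x * (1 - exp (- (\<mu> * h)))\<bar> \<le> c * (\<eta> * (1 - exp (- (\<mu> * h))))"
        using c1 by (intro mult_left_mono) auto
      moreover have "c * \<bar>J - f x * (1 - exp (- (\<mu> * h)))\<bar> = \<bar>c * J - f x * (c - 1)\<bar>"
      proof -
        have "c * J - f x * (c - 1) = c * (J - f x * (1 - exp (- (\<mu> * h))))"
          unfolding cJ[symmetric] by (simp add: algebra_simps)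
        then show ?thesis using c1 by (simp add: abs_mult)
      qed
      moreover have "c * (\<eta> * (1 - exp (- (\<mu> * h)))) = \<eta> * (c - 1)" unfolding cJ[symmetric] by simp
      ultimately have est: "\<bar>c * J - f x * (c - 1)\<bar> \<le> \<eta> * (c - 1)" by simp
      have abs3: "\<bar>X\<bar> \<le> p + q + w" if "\<bar>u\<bar> \<le> w" "X = y - z - u" "\<bar>y\<bar> \<le> p" "\<bar>z\<bar> \<le> q" for X y z u p q w :: real
        using that by linarith
      have \<kappa>: "c - 1 = \<kappa> h * h" using h by (simp add: \<kappa>_def c_def)
      have "\<bar>c * J / h - f x * \<kappa> h\<bar> \<le> \<eta> * \<kappa> h"
      proof -
        have "c * J / h - f x * \<kappa> h = (c * J - f x * (c - 1)) / h" using h by (simp add: \<kappa> field_simps)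
        then have "\<bar>c * J / h - f x * \<kappa> h\<bar> = \<bar>c * J - f x * (c - 1)\<bar> / h" using h by simp
        also have "\<dots> \<le> \<eta> * (c - 1) / h" using est h by (intro divide_right_mono) auto
        also have "\<dots> = \<eta> * \<kappa> h" using h by (simp add: \<kappa>)
        finally show ?thesis .
      qed
      moreover have "(c * (N \<mu> f x - J) - N \<mu> f x) / h - \<mu> * (N \<mu> f x - f x) = (\<kappa> h - \<mu>) * N \<mu> f x - (\<kappa> h - \<mu>) * f x - (c * J / h - f x * \<kappa> h)"
      proof -
        have "(c * (N \<mu> f x - J) - N \<mu> f x) / h = (c - 1) * N \<mu> f x / h - c * J / h"
          using h by (simp add: field_simps)
        also have "(c - 1) * N \<mu> f x / h = \<kappa> h * N \<mu> f x" using h by (simp add: \<kappa>)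
        finally show ?thesis by (simp add: algebra_simps)
      qed
      moreover have "\<bar>(\<kappa> h - \<mu>) * N \<mu> f x\<bar> \<le> \<delta> * B" "\<bar>(\<kappa> h - \<mu>) * f x\<bar> \<le> \<delta> * B"
        unfolding abs_mult using elim(1) N_abs_le[OF \<mu> f x B] B[OF x] \<delta> by (auto intro!: mult_mono simp: dist_real_def)
      ultimately have "\<bar>(c * (N \<mu> f x - J) - N \<mu> f x) / h - \<mu> * (N \<mu> f x - f x)\<bar> \<le> \<delta> * B + \<delta> * B + \<eta> * \<kappa> h"
        by (rule abs3)
      also have "\<dots> < e"
      proof -
        have "\<delta> * B \<le> e / (8 * (B + 1)) * B" using B0 by (intro mult_right_mono) (auto simp: \<delta>_def)
        also have "\<dots> \<le> e / 8" using B0 e by (simp add: divide_simps)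
        finally have 1: "\<delta> * B \<le> e / 8" .
        have "\<kappa> h \<le> \<mu> + 1" using elim(1) by (simp add: dist_real_def \<delta>_def) linarith
        then have "\<eta> * \<kappa> h \<le> \<eta> * (\<mu> + 1)" using \<eta> by (intro mult_left_mono) auto
        also have "\<dots> = e / 4" using \<mu> unfolding \<eta>_def by (auto simp: divide_simps)
        finally show ?thesis using 1 e by linarith
      qed
      finally show "dist (((\<integral>t. T (t + h) f x \<partial>exp_law \<mu>) - N \<mu> f x) / h) (\<mu> * (N \<mu> f x - f x)) < e"
        by (simp add: dist_real_def sh)
    qed
  qed
qed

lemma generator_resolvent:
  assumes \<mu>: "0 < \<mu>" and f: "continuous_on {0..r} f"
  shows "inf_generator r P X (N \<mu> f) (\<lambda>x. \<mu> * (N \<mu> f x - f x))"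
  unfolding inf_generator_def
proof (intro conjI)
  show "continuous_on {0..r} (N \<mu> f)" by (rule N_cont[OF \<mu> f])
  then show "continuous_on {0..r} (\<lambda>x. \<mu> * (N \<mu> f x - f x))" using f by (intro continuous_intros)
  show "uniform_limit {0..r} (\<lambda>t x. (semigroup_op P X t (N \<mu> f) x - N \<mu> f x) / t) (\<lambda>x. \<mu> * (N \<mu> f x - f x)) (at_right 0)"
  proof (rule uniform_limit_cong[THEN iffD1, OF _ _ shifted_resolvent_lim[OF \<mu> f]])
    have "\<forall>\<^sub>F h in at_right (0::real). 0 < h" by (simp add: eventually_at_right_less)
    then show "\<forall>\<^sub>F h in at_right 0. \<forall>x\<in>{0..r}. ((\<integral>t. T (t + h) f x \<partial>exp_law \<mu>) - N \<mu> f x) / h = (semigroup_op P X h (N \<mu> f) x - N \<mu> f x) / h"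
      by eventually_elim (simp add: T_N[OF \<mu> f, symmetric] T_semigroup_op)
  qed simp
qed

text \<open>The difference quotients of \<open>f\<close> converge uniformly to \<open>k\<close>, so
  the contraction \<open>N \<mu>\<close> may be applied to them; the limit of the result is already
  known.\<close>

lemma resolvent_generator:
  assumes \<mu>: "0 < \<mu>" and g: "inf_generator r P X f k" and x: "0 \<le> x" "x \<le> r"
  shows "N \<mu> k x = \<mu> * (N \<mu> f x - f x)"
proof -
  have f: "continuous_on {0..r} f" and k: "continuous_on {0..r} k"
    and lim: "uniform_limit {0..r} (\<lambda>t x. (semigroup_op P X t f x - f x) / t) k (at_right 0)"
    using g by (auto simp: inf_generator_def)
  have 1: "((\<lambda>h. ((\<integral>t. T (t + h) f x \<partial>exp_law \<mu>) - N \<mu> f x) / h) \<longlongrightarrow> \<mu> * (N \<mu> f x - f x)) (at_right 0)"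
    by (rule tendsto_uniform_limitI[OF shifted_resolvent_lim[OF \<mu> f]]) (use x in auto)
  have "((\<lambda>h. ((\<integral>t. T (t + h) f x \<partial>exp_law \<mu>) - N \<mu> f x) / h) \<longlongrightarrow> N \<mu> k x) (at_right 0)"
  proof (rule tendstoI)
    fix e :: real assume e: "0 < e"
    have "\<forall>\<^sub>F h in at_right 0. \<forall>y\<in>{0..r}. dist ((semigroup_op P X h f y - f y) / h) (k y) < e / 2"
      using uniform_limitD[OF lim, of "e / 2"] e by simp
    moreover have "\<forall>\<^sub>F h in at_right (0::real). 0 < h" by (simp add: eventually_at_right_less)
    ultimately show "\<forall>\<^sub>F h in at_right 0. dist (((\<integral>t. T (t + h) f x \<partial>exp_law \<mu>) - N \<mu> f x) / h) (N \<mu> k x) < e"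
    proof eventually_elim
      case (elim h)
      define q where "q y = (1 / h) * (1 * T h f y - 1 * f y) - 1 * k y" for y
      have cT: "continuous_on {0..r} (\<lambda>y. 1 * T h f y - 1 * f y)" by (intro continuous_intros T_cont_x f)
      have "N \<mu> q x = (1 / h) * (1 * N \<mu> (T h f) x - 1 * N \<mu> f x) - 1 * N \<mu> k x"
        unfolding q_def by (subst N_lincomb[OF \<mu> cT k x], subst N_lincomb[OF \<mu> T_cont_x[OF f] f x]) simp
      moreover have "N \<mu> (T h f) x = (\<integral>t. T (t + h) f x \<partial>exp_law \<mu>)"
        unfolding N_def
      proof (rule integral_cong_AE)
        show "AE t in exp_law \<mu>. T t (T h f) x = T (t + h) f x"
          using exp_law_AE by eventually_elim (use T_add[OF f _ _ x] elim in auto)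
        show "(\<lambda>t. T (t + h) f x) \<in> borel_measurable (exp_law \<mu>)"
          using measurable_compose[OF _ T_meas_t[OF f x], of "\<lambda>t. t + h" borel] by simp
      qed (use T_meas_t[OF T_cont_x[OF f] x] in simp)
      moreover have "\<bar>N \<mu> q x\<bar> \<le> e / 2"
      proof (rule N_abs_le[OF \<mu> _ x])
        show "continuous_on {0..r} q" unfolding q_def by (intro continuous_intros T_cont_x f k)
        fix y assume y: "0 \<le> y" "y \<le> r"
        then show "\<bar>q y\<bar> \<le> e / 2"
          using elim(1)[rule_format, of y] elim(2) T_semigroup_op[of h y f] by (simp add: q_def dist_real_def)
      qed
      ultimately show ?case using e by (simp add: dist_real_def)
    qed
  qed
  then show ?thesis using 1 tendsto_unique[OF trivial_limit_at_right_real] by blast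
qed

end

section \<open>Diffusion coefficients as a string\<close>

text \<open>Away from the base point the weights in the boundary integrals are bounded below and may
  be dropped, which leaves integrability of the speed or scale density itself.\<close>

lemma nn_integral_weight_finite:
  fixes w h :: "real \<Rightarrow> real"
  assumes fin: "(\<integral>\<^sup>+x\<in>B. ennreal (h x * w x) \<partial>lborel) < \<infinity>" and AB: "A \<subseteq> B" and B: "B \<in> sets borel"
    and cont: "continuous_on B (\<lambda>x. h x * w x)" and c: "0 < c" "\<And>x. x \<in> A \<Longrightarrow> c \<le> h x" "\<And>x. x \<in> A \<Longrightarrow> 0 \<le> w x"
  shows "(\<integral>\<^sup>+x\<in>A. ennreal (w x) \<partial>lborel) < \<infinity>"
proof -
  have m: "(\<lambda>x. ennreal (h x * w x) * indicator B x) \<in> borel_measurable lborel"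
  proof -
    have "(\<lambda>x. ennreal (indicator B x *\<^sub>R (h x * w x))) \<in> borel_measurable lborel"
      using borel_measurable_continuous_on_indicator[OF B cont] by simp
    moreover have "ennreal (indicator B x *\<^sub>R (h x * w x)) = ennreal (h x * w x) * indicator B x" for x
      by (simp add: indicator_def)
    ultimately show ?thesis by simp
  qed
  have "(\<integral>\<^sup>+x\<in>A. ennreal (w x) \<partial>lborel) \<le> (\<integral>\<^sup>+x. ennreal (1 / c) * (ennreal (h x * w x) * indicator B x) \<partial>lborel)"
  proof (rule nn_integral_mono)
    fix x
    show "ennreal (w x) * indicator A x \<le> ennreal (1 / c) * (ennreal (h x * w x) * indicator B x)"
    proof (cases "x \<in> A")
      case True
      have "c * w x \<le> h x * w x" using c True by (intro mult_right_mono) auto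
      then have "w x \<le> 1 / c * (h x * w x)" using c by (simp add: field_simps)
      then have "ennreal (w x) \<le> ennreal (1 / c * (h x * w x))" by (rule ennreal_leI)
      also have "\<dots> = ennreal (1 / c) * ennreal (h x * w x)" using c by (intro ennreal_mult') auto
      finally show ?thesis using True AB by auto
    qed simp
  qed
  also have "\<dots> = ennreal (1 / c) * (\<integral>\<^sup>+x\<in>B. ennreal (h x * w x) \<partial>lborel)" by (rule nn_integral_cmult[OF m])
  also have "\<dots> < \<infinity>" using fin by (simp add: ennreal_mult_less_top)
  finally show ?thesis .
qed

lemma antideriv_on_LBINT:
  fixes g :: "real \<Rightarrow> real"
  assumes r: "0 < r" and c: "continuous_on {0<..<r} g" and i: "set_integrable lborel {0<..<r} g"
  shows "antideriv_on r g (\<lambda>x. LBINT y:{0<..<x}. g y)"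
proof -
  have gi: "g integrable_on {0..r}"
    using set_borel_integral_eq_integral(1)[OF i] by (simp add: integrable_on_open_interval_real)
  have eq: "(LBINT y:{0<..<x}. g y) = integral {0..x} g" if "x \<in> {0..r}" for x
  proof -
    have "set_integrable lborel {0<..<x} g" by (rule set_integrable_subset[OF i]) (use that in auto)
    from set_borel_integral_eq_integral(2)[OF this] show ?thesis by (simp add: integral_open_interval_real)
  qed
  have "continuous_on {0..r} (\<lambda>x. integral {0..x} g)" by (rule indefinite_integral_continuous_1[OF gi])
  then have 1: "continuous_on {0..r} (\<lambda>x. LBINT y:{0<..<x}. g y)" by (rule continuous_on_eq) (rule eq[symmetric])
  have 2: "((\<lambda>x. LBINT y:{0<..<x}. g y) has_real_derivative g x) (at x)" if x: "0 < x" "x < r" for x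
  proof -
    have "isCont g x" using c x by (simp add: continuous_on_eq_continuous_at)
    then have "continuous (at x within {0..r} - {}) g" by (simp add: continuous_at_imp_continuous_at_within)
    from integral_has_vector_derivative_continuous_at[OF gi _ _ this]
    have "((\<lambda>u. integral {0..u} g) has_vector_derivative g x) (at x within {0..r})" using x by simp
    then have "((\<lambda>u. integral {0..u} g) has_real_derivative g x) (at x)"
      using x at_within_interior[of x "{0..r}"] by (simp add: has_real_derivative_iff_has_vector_derivative)
    then show ?thesis
    proof (rule has_field_derivative_transform_within_open[of _ _ _ "{0<..<r}"])
      show "integral {0..y} g = (LBINT y:{0<..<y}. g y)" if "y \<in> {0<..<r}" for y
        by (rule eq[symmetric]) (use that in auto)
    qed (use x in auto)
  qed
  have "(LBINT y:{0<..<0}. g y) = 0" by (simp add: set_lebesgue_integral_def)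
  then show ?thesis using 1 2 by (simp add: antideriv_on_def)
qed

lemma LBINT_deriv:
  fixes f :: "real \<Rightarrow> real"
  assumes f: "continuous_on {0<..<r} f" and c: "0 < c" "c < r" and x: "0 < x" "x < r"
  shows "((\<lambda>u. LBINT y=ereal c..ereal u. f y) has_real_derivative f x) (at x)"
proof -
  define p q where "p = min c x / 2" and "q = (max c x + r) / 2"
  have pq: "0 < p" "p < c" "p < x" "c < q" "x < q" "q < r" using c x by (auto simp: p_def q_def)
  have "((\<lambda>u. LBINT y=c..u. f y) has_vector_derivative f x) (at x within {p..q})"
    by (rule interval_integral_FTC2) (use pq in \<open>auto intro: continuous_on_subset[OF f]\<close>)
  then show ?thesis using pq at_within_interior[of x "{p..q}"] by (simp add: has_real_derivative_iff_has_vector_derivative)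
qed

text \<open>Finiteness of \<open>N_left\<close> is what a reflecting and an entrance boundary at 0
  have in common.\<close>

locale diffusion_coefficients =
  fixes r :: real and a b :: "real \<Rightarrow> real"
  assumes coeffs: "diffusion_coeffs r a b" and N_l: "N_left r a b < \<infinity>" and reg_r: "regular_right r a b"
begin

abbreviation "s \<equiv> scale_dens r a b"
abbreviation "md \<equiv> speed_dens r a b"

lemma r_pos: "0 < r" and a_cont: "continuous_on {0<..<r} a" and b_pos: "0 < x \<Longrightarrow> x < r \<Longrightarrow> 0 < b x"
  using coeffs by (auto simp: diffusion_coeffs_def)

lemma b_cont: "continuous_on {0<..<r} b"
  using coeffs C1_differentiable_imp_continuous_on by (auto simp: diffusion_coeffs_def)

lemma ab_cont: "continuous_on {0<..<r} (\<lambda>y. 2 * a y / b y)"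
  using a_cont b_cont b_pos by (intro continuous_intros) (auto simp: less_imp_neq[THEN not_sym])

lemma s_pos: "0 < s x" by (simp add: scale_dens_def)

lemma s_deriv: assumes "0 < x" "x < r" shows "(s has_real_derivative - (2 * a x / b x) * s x) (at x)"
proof -
  have "((\<lambda>u. exp (- (LBINT y=ereal (r / 2)..ereal u. 2 * a y / b y))) has_real_derivative exp (- (LBINT y=ereal (r / 2)..ereal x. 2 * a y / b y)) * (- (2 * a x / b x))) (at x)"
    by (intro DERIV_fun_exp DERIV_minus LBINT_deriv[OF ab_cont]) (use assms in auto)
  then show ?thesis unfolding scale_dens_def by (simp add: mult.commute)
qed

lemma s_cont: "continuous_on {0<..<r} s"
  by (intro continuous_at_imp_continuous_on ballI DERIV_isCont[OF s_deriv]) auto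

lemma md_pos: "0 < x \<Longrightarrow> x < r \<Longrightarrow> 0 < md x"
  using s_pos b_pos by (simp add: speed_dens_def)

lemma md_cont: "continuous_on {0<..<r} md"
  unfolding speed_dens_def using b_pos s_pos
  by (intro continuous_intros s_cont b_cont) (auto simp: less_imp_neq[THEN not_sym])

lemma scale_fun_deriv: "0 < x \<Longrightarrow> x < r \<Longrightarrow> (scale_fun r a b has_real_derivative s x) (at x)"
  unfolding scale_fun_def[abs_def] by (rule LBINT_deriv[OF s_cont]) (use r_pos in auto)

lemma speed_fun_deriv: "0 < x \<Longrightarrow> x < r \<Longrightarrow> (speed_fun r a b has_real_derivative md x) (at x)"
  unfolding speed_fun_def[abs_def] by (rule LBINT_deriv[OF md_cont]) (use r_pos in auto)

lemma scale_fun_less: assumes "0 < x" "x < y" "y < r" shows "scale_fun r a b x < scale_fun r a b y"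
proof (rule DERIV_pos_imp_increasing[OF assms(2)])
  fix z assume "x \<le> z" "z \<le> y"
  then have z: "0 < z" "z < r" using assms by auto
  show "\<exists>d. (scale_fun r a b has_real_derivative d) (at z) \<and> 0 < d"
    using scale_fun_deriv[OF z] s_pos by blast
qed

lemma speed_fun_less: assumes "0 < x" "x < y" "y < r" shows "speed_fun r a b x < speed_fun r a b y"
proof (rule DERIV_pos_imp_increasing[OF assms(2)])
  fix z assume "x \<le> z" "z \<le> y"
  then have z: "0 < z" "z < r" using assms by auto
  show "\<exists>d. (speed_fun r a b has_real_derivative d) (at z) \<and> 0 < d"
    using speed_fun_deriv[OF z] md_pos[OF z] by blast
qed

lemma scale_fun_cont: "continuous_on {0<..<r} (scale_fun r a b)"
  by (intro continuous_at_imp_continuous_on ballI DERIV_isCont[OF scale_fun_deriv]) auto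

lemma speed_fun_cont: "continuous_on {0<..<r} (speed_fun r a b)"
  by (intro continuous_at_imp_continuous_on ballI DERIV_isCont[OF speed_fun_deriv]) auto

lemma scale_fun_le: "0 < x \<Longrightarrow> x \<le> y \<Longrightarrow> y < r \<Longrightarrow> scale_fun r a b x \<le> scale_fun r a b y"
  using scale_fun_less[of x y] by (cases "x = y") auto

lemma speed_fun_le: "0 < x \<Longrightarrow> x \<le> y \<Longrightarrow> y < r \<Longrightarrow> speed_fun r a b x \<le> speed_fun r a b y"
  using speed_fun_less[of x y] by (cases "x = y") auto

lemma ennreal_indicator_meas:
  assumes "continuous_on {0<..<r} w" "A \<subseteq> {0<..<r}" "A \<in> sets borel"
  shows "(\<lambda>x. ennreal (w x) * indicator A x) \<in> borel_measurable lborel"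
proof -
  have "(\<lambda>x. ennreal (indicator A x *\<^sub>R w x)) \<in> borel_measurable lborel"
    using borel_measurable_continuous_on_indicator[OF assms(3) continuous_on_subset[OF assms(1,2)]] by simp
  moreover have "ennreal (indicator A x *\<^sub>R w x) = ennreal (w x) * indicator A x" for x by (simp add: indicator_def)
  ultimately show ?thesis by simp
qed

lemma compact_part_finite:
  assumes w: "continuous_on {0<..<r} w" "\<And>x. 0 < x \<Longrightarrow> x < r \<Longrightarrow> 0 \<le> w x" and pq: "0 < p" "q < r"
  shows "(\<integral>\<^sup>+x\<in>{p..q}. ennreal (w x) \<partial>lborel) < \<infinity>"
proof -
  have i: "set_integrable lborel {p..q} w"
    by (rule borel_integrable_atLeastAtMost') (use pq in \<open>auto intro: continuous_on_subset[OF w(1)]\<close>)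
  have "(\<integral>\<^sup>+x\<in>{p..q}. ennreal (w x) \<partial>lborel) = (\<integral>\<^sup>+x. ennreal (indicator {p..q} x *\<^sub>R w x) \<partial>lborel)"
    by (intro nn_integral_cong) (auto simp: indicator_def)
  also have "\<dots> = ennreal (\<integral>x. indicator {p..q} x *\<^sub>R w x \<partial>lborel)"
    by (rule nn_integral_eq_integral[OF i[unfolded set_integrable_def]]) (use w pq in \<open>auto simp: indicator_def\<close>)
  also have "\<dots> < \<infinity>" by simp
  finally show ?thesis .
qed

lemma finite_imp_set_integrable:
  assumes w: "continuous_on A w" "A \<in> sets borel" "\<And>x. x \<in> A \<Longrightarrow> 0 \<le> w x"
    and fin: "(\<integral>\<^sup>+x\<in>A. ennreal (w x) \<partial>lborel) < \<infinity>"
  shows "set_integrable lborel A w"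
  unfolding set_integrable_def
proof (rule integrableI_nonneg)
  show "(\<lambda>x. indicator A x *\<^sub>R w x) \<in> borel_measurable lborel"
    using borel_measurable_continuous_on_indicator[OF w(2,1)] by simp
  show "AE x in lborel. 0 \<le> indicator A x *\<^sub>R w x" using w(3) by (auto simp: indicator_def)
  have "(\<integral>\<^sup>+x. ennreal (indicator A x *\<^sub>R w x) \<partial>lborel) = (\<integral>\<^sup>+x\<in>A. ennreal (w x) \<partial>lborel)"
    by (intro nn_integral_cong) (auto simp: indicator_def)
  then show "(\<integral>\<^sup>+x. ennreal (indicator A x *\<^sub>R w x) \<partial>lborel) < \<infinity>" using fin by simp
qed

lemma glue_finite:
  assumes "(\<integral>\<^sup>+x\<in>{0<..p}. ennreal (w x) \<partial>lborel) < \<infinity>" "(\<integral>\<^sup>+x\<in>{p..q}. ennreal (w x) \<partial>lborel) < \<infinity>"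
    "(\<integral>\<^sup>+x\<in>{q..<r}. ennreal (w x) \<partial>lborel) < \<infinity>"
    and w: "continuous_on {0<..<r} w" and pq: "0 < p" "p \<le> q" "q < r"
  shows "(\<integral>\<^sup>+x\<in>{0<..<r}. ennreal (w x) \<partial>lborel) < \<infinity>"
proof -
  note meas = ennreal_indicator_meas[OF w]
  have "(\<integral>\<^sup>+x\<in>{0<..<r}. ennreal (w x) \<partial>lborel) \<le> (\<integral>\<^sup>+x. (ennreal (w x) * indicator {0<..p} x + ennreal (w x) * indicator {p..q} x) + ennreal (w x) * indicator {q..<r} x \<partial>lborel)"
    by (rule nn_integral_mono) (use pq in \<open>auto simp: indicator_def intro: add_increasing add_increasing2\<close>)
  also have "\<dots> = (\<integral>\<^sup>+x\<in>{0<..p}. ennreal (w x) \<partial>lborel) + (\<integral>\<^sup>+x\<in>{p..q}. ennreal (w x) \<partial>lborel) + (\<integral>\<^sup>+x\<in>{q..<r}. ennreal (w x) \<partial>lborel)"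
  proof -
    have m1: "(\<lambda>x. ennreal (w x) * indicator {0<..p} x) \<in> borel_measurable lborel" by (rule meas) (use pq in auto)
    have m2: "(\<lambda>x. ennreal (w x) * indicator {p..q} x) \<in> borel_measurable lborel" by (rule meas) (use pq in auto)
    have m3: "(\<lambda>x. ennreal (w x) * indicator {q..<r} x) \<in> borel_measurable lborel" by (rule meas) (use pq in auto)
    show ?thesis
      by (simp only: nn_integral_add[OF borel_measurable_add[OF m1 m2] m3] nn_integral_add[OF m1 m2])
  qed
  also have "\<dots> < \<infinity>" using assms by simp
  finally show ?thesis .
qed

text \<open>The weights in \<open>N_left\<close> and \<open>N_right\<close> vanish at the base point
  \<open>r / 2\<close>, so they are discarded only on the outer quarters; the middle half is
  compact.\<close>

lemma md_integrable: "set_integrable lborel {0<..<r} md"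
proof (rule finite_imp_set_integrable[OF md_cont])
  have q: "0 < r / 4" "r / 4 < r / 2" "r / 2 < 3 * r / 4" "3 * r / 4 < r" using r_pos by auto
  show "(\<integral>\<^sup>+x\<in>{0<..<r}. ennreal (md x) \<partial>lborel) < \<infinity>"
  proof (rule glue_finite[where p="r / 4" and q="3 * r / 4"])
    show "(\<integral>\<^sup>+x\<in>{0<..r / 4}. ennreal (md x) \<partial>lborel) < \<infinity>"
    proof (rule nn_integral_weight_finite[OF N_l[unfolded N_left_def]])
      show "0 < scale_fun r a b (r / 2) - scale_fun r a b (r / 4)" using scale_fun_less[of "r / 4" "r / 2"] q by auto
      show "scale_fun r a b (r / 2) - scale_fun r a b (r / 4) \<le> scale_fun r a b (r / 2) - scale_fun r a b x"
        if "x \<in> {0<..r / 4}" for x using scale_fun_le[of x "r / 4"] that q by auto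
      show "continuous_on {0<..r / 2} (\<lambda>x. (scale_fun r a b (r / 2) - scale_fun r a b x) * md x)"
        by (intro continuous_intros continuous_on_subset[OF scale_fun_cont] continuous_on_subset[OF md_cont]) (use q in auto)
    qed (use q md_pos in \<open>auto simp: less_imp_le\<close>)
    have "N_right r a b < \<infinity>" using reg_r by (simp add: regular_right_def)
    then show "(\<integral>\<^sup>+x\<in>{3 * r / 4..<r}. ennreal (md x) \<partial>lborel) < \<infinity>"
      unfolding N_right_def
    proof (rule nn_integral_weight_finite)
      show "0 < scale_fun r a b (3 * r / 4) - scale_fun r a b (r / 2)" using scale_fun_less[of "r / 2" "3 * r / 4"] q by auto
      show "scale_fun r a b (3 * r / 4) - scale_fun r a b (r / 2) \<le> scale_fun r a b x - scale_fun r a b (r / 2)"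
        if "x \<in> {3 * r / 4..<r}" for x using scale_fun_le[of "3 * r / 4" x] that q by auto
      show "continuous_on {r / 2..<r} (\<lambda>x. (scale_fun r a b x - scale_fun r a b (r / 2)) * md x)"
        by (intro continuous_intros continuous_on_subset[OF scale_fun_cont] continuous_on_subset[OF md_cont]) (use q in auto)
    qed (use q md_pos in \<open>auto simp: less_imp_le\<close>)
    show "(\<integral>\<^sup>+x\<in>{r / 4..3 * r / 4}. ennreal (md x) \<partial>lborel) < \<infinity>"
      by (rule compact_part_finite[OF md_cont]) (use q md_pos in \<open>auto simp: less_imp_le\<close>)
  qed (use q md_cont in auto)
qed (use md_pos in \<open>auto simp: less_imp_le\<close>)

text \<open>The factor 2 compensates the 1/2 in the generator: with this mass density A f = (f' /
  s)' / m.\<close>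

definition m :: "real \<Rightarrow> real" where "m x = 2 * md x"
definition M :: "real \<Rightarrow> real" where "M x = (LBINT y:{0<..<x}. m y)"

lemma m_pos: "0 < x \<Longrightarrow> x < r \<Longrightarrow> 0 < m x" using md_pos by (simp add: m_def)
lemma m_cont: "continuous_on {0<..<r} m" unfolding m_def[abs_def] by (intro continuous_intros md_cont)
lemma m_integrable: "set_integrable lborel {0<..<r} m"
  unfolding m_def[abs_def] by (rule set_integrable_mult_right) (rule md_integrable)

lemma M_antideriv: "antideriv_on r m M"
  unfolding M_def[abs_def] by (rule antideriv_on_LBINT[OF r_pos m_cont m_integrable])

lemma M_ge: "0 \<le> x \<Longrightarrow> x \<le> r \<Longrightarrow> 0 \<le> M x"
  using antideriv_on_nonneg[OF M_antideriv] m_pos by (simp add: less_imp_le)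

lemma M_mono: "0 \<le> x \<Longrightarrow> x \<le> y \<Longrightarrow> y \<le> r \<Longrightarrow> M x \<le> M y"
  using antideriv_on_mono[OF M_antideriv] m_pos by (simp add: less_imp_le)

text \<open>Regularity makes the scale density itself integrable at \<open>r\<close>, hence also
  \<open>s M\<close> there, because \<open>M\<close> is bounded. At 0 only the product will be
  integrable.\<close>

lemma s_integrable_right: "(\<integral>\<^sup>+x\<in>{3 * r / 4..<r}. ennreal (s x) \<partial>lborel) < \<infinity>"
proof -
  have q: "0 < r / 4" "r / 4 < r / 2" "r / 2 < 3 * r / 4" "3 * r / 4 < r" using r_pos by auto
  have "Sigma_right r a b < \<infinity>" using reg_r by (simp add: regular_right_def)
  then show ?thesis unfolding Sigma_right_def
  proof (rule nn_integral_weight_finite)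
    show "0 < speed_fun r a b (3 * r / 4) - speed_fun r a b (r / 2)" using speed_fun_less[of "r / 2" "3 * r / 4"] q by auto
    show "speed_fun r a b (3 * r / 4) - speed_fun r a b (r / 2) \<le> speed_fun r a b x - speed_fun r a b (r / 2)"
      if "x \<in> {3 * r / 4..<r}" for x using speed_fun_le[of "3 * r / 4" x] that q by auto
    show "continuous_on {r / 2..<r} (\<lambda>x. (speed_fun r a b x - speed_fun r a b (r / 2)) * s x)"
      by (intro continuous_intros continuous_on_subset[OF speed_fun_cont] continuous_on_subset[OF s_cont]) (use q in auto)
  qed (use q s_pos in \<open>auto simp: less_imp_le\<close>)
qed

lemma M_nn: assumes "0 \<le> x" "x \<le> r" shows "(\<integral>\<^sup>+y. ennreal (m y) * indicator {0<..<x} y \<partial>lborel) = ennreal (M x)"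
proof -
  have i: "set_integrable lborel {0<..<x} m" by (rule set_integrable_subset[OF m_integrable]) (use assms in auto)
  have "(\<integral>\<^sup>+y. ennreal (m y) * indicator {0<..<x} y \<partial>lborel) = (\<integral>\<^sup>+y. ennreal (indicator {0<..<x} y *\<^sub>R m y) \<partial>lborel)"
    by (intro nn_integral_cong) (auto simp: indicator_def)
  also have "\<dots> = ennreal (\<integral>y. indicator {0<..<x} y *\<^sub>R m y \<partial>lborel)"
    by (rule nn_integral_eq_integral[OF i[unfolded set_integrable_def]]) (use m_pos assms in \<open>auto simp: indicator_def less_imp_le\<close>)
  finally show ?thesis by (simp add: M_def set_lebesgue_integral_def)
qed

text \<open>By Tonelli, the condition \<open>N_left < \<infinity>\<close> says that \<open>s M\<close> is integrable at \<open>0\<close>.\<close>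

lemma sM_integrable_left: "(\<integral>\<^sup>+y\<in>{0<..r / 2}. ennreal (s y * M y) \<partial>lborel) < \<infinity>"
proof -
  define s' where "s' x = indicator {0<..<r} x *\<^sub>R s x" for x
  define m' where "m' x = indicator {0<..<r} x *\<^sub>R m x" for x
  have [measurable]: "s' \<in> borel_measurable borel" "m' \<in> borel_measurable borel"
    unfolding s'_def[abs_def] m'_def[abs_def] by (intro borel_measurable_continuous_on_indicator s_cont m_cont; simp)+
  have nn: "0 \<le> s' x" "0 \<le> m' x" for x using s_pos m_pos by (auto simp: s'_def m'_def indicator_def less_imp_le)
  define h where "h x y = ennreal (m' x) * ennreal (s' y) * (if 0 < x \<and> x < y \<and> y \<le> r / 2 then 1 else 0)" for x y
  have hm: "case_prod h \<in> borel_measurable (lborel \<Otimes>\<^sub>M lborel)" unfolding h_def[abs_def] by measurable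
  have left: "(\<integral>\<^sup>+x. h x y \<partial>lborel) = ennreal (s y * M y) * indicator {0<..r / 2} y" for y
  proof (cases "0 < y \<and> y \<le> r / 2")
    case True
    have "(\<integral>\<^sup>+x. h x y \<partial>lborel) = (\<integral>\<^sup>+x. ennreal (s y) * (ennreal (m x) * indicator {0<..<y} x) \<partial>lborel)"
      by (intro nn_integral_cong) (use True r_pos in \<open>auto simp: h_def s'_def m'_def indicator_def mult.commute\<close>)
    also have "\<dots> = (\<integral>\<^sup>+x. ennreal (s y) * (ennreal (m' x) * indicator {0<..<y} x) \<partial>lborel)"
      by (intro nn_integral_cong) (use True r_pos in \<open>auto simp: m'_def indicator_def\<close>)
    also have "\<dots> = ennreal (s y) * (\<integral>\<^sup>+x. ennreal (m' x) * indicator {0<..<y} x \<partial>lborel)"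
      by (rule nn_integral_cmult) measurable
    also have "(\<integral>\<^sup>+x. ennreal (m' x) * indicator {0<..<y} x \<partial>lborel) = (\<integral>\<^sup>+x. ennreal (m x) * indicator {0<..<y} x \<partial>lborel)"
      by (intro nn_integral_cong) (use True r_pos in \<open>auto simp: m'_def indicator_def\<close>)
    also have "\<dots> = ennreal (M y)" by (rule M_nn) (use True r_pos in auto)
    finally show ?thesis using True M_ge[of y] s_pos[of y] r_pos by (simp add: ennreal_mult)
  next
    case False
    then have "h x y = 0" for x by (auto simp: h_def)
    then show ?thesis using False by (auto simp: indicator_def)
  qed
  have right: "(\<integral>\<^sup>+y. h x y \<partial>lborel) = 2 * (ennreal ((scale_fun r a b (r / 2) - scale_fun r a b x) * md x) * indicator {0<..r / 2} x)" for x
  proof (cases "0 < x \<and> x \<le> r / 2")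
    case True
    have x: "0 < x" "x < r" using True r_pos by auto
    \<comment> \<open>The diagonal is excluded from \<open>h\<close>, while the fundamental theorem
      is applied on the closed interval; the two differ by one point.\<close>
    have AEx: "AE y in lborel. y \<noteq> x" by (rule AE_lborel_singleton)
    have "(\<integral>\<^sup>+y. h x y \<partial>lborel) = (\<integral>\<^sup>+y. ennreal (m x) * (ennreal (s' y) * indicator {x..r / 2} y) \<partial>lborel)"
      by (rule nn_integral_cong_AE) (use AEx in eventually_elim, use True x in \<open>auto simp: h_def m'_def indicator_def mult.assoc\<close>)
    also have "\<dots> = ennreal (m x) * (\<integral>\<^sup>+y. ennreal (s' y) * indicator {x..r / 2} y \<partial>lborel)"
      by (rule nn_integral_cmult) measurable
    also have "(\<integral>\<^sup>+y. ennreal (s' y) * indicator {x..r / 2} y \<partial>lborel) = ennreal (scale_fun r a b (r / 2) - scale_fun r a b x)"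
    proof (rule nn_integral_FTC_Icc)
      show "(scale_fun r a b has_real_derivative s' y) (at y)" if "y \<in> {x..r / 2}" for y
        using scale_fun_deriv[of y] that x r_pos by (simp add: s'_def)
    qed (use nn True in auto)
    finally show ?thesis
      using True md_pos[OF x] m_pos[OF x] scale_fun_less[of x "r / 2"] x r_pos
      by (cases "x = r / 2") (auto simp: m_def ennreal_mult ennreal_mult' mult_ac)
  next
    case False
    then have "h x y = 0" for y by (auto simp: h_def)
    then show ?thesis using False by (auto simp: indicator_def)
  qed
  have m2: "(\<lambda>x. ennreal ((scale_fun r a b (r / 2) - scale_fun r a b x) * md x) * indicator {0<..r / 2} x) \<in> borel_measurable lborel"
    by (rule ennreal_indicator_meas) (use r_pos in \<open>auto intro!: continuous_intros scale_fun_cont md_cont\<close>)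
  have "(\<integral>\<^sup>+y\<in>{0<..r / 2}. ennreal (s y * M y) \<partial>lborel) = (\<integral>\<^sup>+y. (\<integral>\<^sup>+x. h x y \<partial>lborel) \<partial>lborel)" by (simp add: left)
  also have "\<dots> = (\<integral>\<^sup>+x. (\<integral>\<^sup>+y. h x y \<partial>lborel) \<partial>lborel)" by (rule lborel_pair.Fubini'[OF hm])
  also have "\<dots> = 2 * N_left r a b" unfolding right N_left_def by (rule nn_integral_cmult[OF m2])
  also have "\<dots> < \<infinity>" using N_l by (simp add: ennreal_mult_less_top)
  finally show ?thesis .
qed

lemma sM_integrable: "set_integrable lborel {0<..<r} (\<lambda>x. s x * M x)"
proof (rule finite_imp_set_integrable)
  have q: "0 < r / 4" "r / 4 < r / 2" "r / 2 < 3 * r / 4" "3 * r / 4 < r" using r_pos by auto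
  show c: "continuous_on {0<..<r} (\<lambda>x. s x * M x)"
    by (intro continuous_intros s_cont continuous_on_subset[OF antideriv_onD(1)[OF M_antideriv]]) auto
  show nn: "0 \<le> s x * M x" if "x \<in> {0<..<r}" for x using that M_ge[of x] s_pos[of x] by simp
  show "(\<integral>\<^sup>+x\<in>{0<..<r}. ennreal (s x * M x) \<partial>lborel) < \<infinity>"
  proof (rule glue_finite[OF sM_integrable_left _ _ c])
    show "(\<integral>\<^sup>+x\<in>{r / 2..3 * r / 4}. ennreal (s x * M x) \<partial>lborel) < \<infinity>"
      by (rule compact_part_finite[OF c]) (use q nn in auto)
    have ms: "(\<lambda>x. ennreal (s x) * indicator {3 * r / 4..<r} x) \<in> borel_measurable lborel"
      by (rule ennreal_indicator_meas[OF s_cont]) (use r_pos in auto)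
    have "(\<integral>\<^sup>+x\<in>{3 * r / 4..<r}. ennreal (s x * M x) \<partial>lborel) \<le> (\<integral>\<^sup>+x. ennreal (M r) * (ennreal (s x) * indicator {3 * r / 4..<r} x) \<partial>lborel)"
    proof (rule nn_integral_mono)
      fix x
      have "s x * M x \<le> M r * s x" if "3 * r / 4 \<le> x" "x < r"
        using M_mono[of x r] that q s_pos[of x] by (subst mult.commute, intro mult_right_mono) auto
      then show "ennreal (s x * M x) * indicator {3 * r / 4..<r} x \<le> ennreal (M r) * (ennreal (s x) * indicator {3 * r / 4..<r} x)"
        using M_ge[of r] q s_pos[of x] by (auto simp: indicator_def ennreal_mult[symmetric] intro!: ennreal_leI)
    qed
    also have "\<dots> = ennreal (M r) * (\<integral>\<^sup>+x\<in>{3 * r / 4..<r}. ennreal (s x) \<partial>lborel)" by (rule nn_integral_cmult[OF ms])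
    also have "\<dots> < \<infinity>" using s_integrable_right by (simp add: ennreal_mult_less_top)
    finally show "(\<integral>\<^sup>+x\<in>{3 * r / 4..<r}. ennreal (s x * M x) \<partial>lborel) < \<infinity>" .
  qed (use q in auto)
qed auto

definition U :: "real \<Rightarrow> real" where "U x = (LBINT y:{0<..<x}. s y * M y)"

lemma U_antideriv: "antideriv_on r (\<lambda>x. s x * M x) U"
  unfolding U_def[abs_def]
  by (rule antideriv_on_LBINT[OF r_pos _ sM_integrable])
    (intro continuous_intros s_cont continuous_on_subset[OF antideriv_onD(1)[OF M_antideriv]]; auto)

sublocale string: krein_string r s m M U
  by unfold_locales (use r_pos s_cont m_cont s_pos m_pos M_antideriv U_antideriv in auto)

end

section \<open>Eigenvalues as zeros of the characteristic function; flux at an entrance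
  boundary\<close>

context diffusion_coefficients begin

lemma m_eq: "0 < x \<Longrightarrow> x < r \<Longrightarrow> m x * b x * s x = 2"
  using s_pos[of x] b_pos[of x] by (simp add: m_def speed_dens_def)

lemma C2_onD:
  assumes "C2_on f {0<..<r}" "0 < x" "x < r"
  shows "(f has_real_derivative deriv f x) (at x)" "(deriv f has_real_derivative deriv (deriv f) x) (at x)"
proof -
  have "f differentiable at x" "deriv f differentiable at x"
    using assms unfolding C2_on_def by (auto simp: C1_differentiable_on_eq)
  then show "(f has_real_derivative deriv f x) (at x)" "(deriv f has_real_derivative deriv (deriv f) x) (at x)"
    by (auto simp: DERIV_deriv_iff_real_differentiable)
qed

text \<open>The derivative of \<open>s\<close> is \<open>- (2 * a / b) * s\<close>, so the
  integrating factor brings the generator into divergence form.\<close>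

lemma flux_deriv:
  assumes f: "C2_on f {0<..<r}" and x: "0 < x" "x < r"
  shows "((\<lambda>x. deriv f x / s x) has_real_derivative m x * diff_op a b f x) (at x)"
proof -
  have "((\<lambda>x. deriv f x / s x) has_real_derivative (deriv (deriv f) x * s x - deriv f x * (- (2 * a x / b x) * s x)) / (s x * s x)) (at x)"
    by (rule DERIV_divide[OF C2_onD(2)[OF f x] s_deriv[OF x]]) (use s_pos[of x] in simp)
  moreover have "(deriv (deriv f) x * s x - deriv f x * (- (2 * a x / b x) * s x)) / (s x * s x) = m x * diff_op a b f x"
    using s_pos[of x] b_pos[OF x] by (simp add: m_def speed_dens_def diff_op_def field_simps)
  ultimately show ?thesis by simp
qed

lemma eigenvalue_imp_Dfun_zero:
  assumes "is_eigenvalue r a b l" "0 < l"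
  shows "string.Dfun (- of_real l) = 0"
proof -
  obtain v y0 where v: "C2_on v {0<..<r}" "\<And>x. x \<in> {0<..<r} \<Longrightarrow> diff_op a b v x + l * v x = 0"
    "y0 \<in> {0<..<r}" "v y0 \<noteq> 0" "zero_flux_left r a b v" "zero_flux_right r a b v"
    using assms(1) unfolding is_eigenvalue_def by blast
  have "string.vv (- l) r = 0"
  proof (rule string.eigenfunction_imp_vv_zero[of v "\<lambda>x. deriv v x / s x" "- l" y0])
    show "(v has_real_derivative s x * (deriv v x / s x)) (at x)" if "0 < x" "x < r" for x
      using C2_onD(1)[OF v(1) that] s_pos[of x] by simp
    show "((\<lambda>x. deriv v x / s x) has_real_derivative m x * (- l * v x)) (at x)" if x: "0 < x" "x < r" for x
    proof -
      have "diff_op a b v x = - l * v x" using v(2)[of x] x by simp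
      then show ?thesis using flux_deriv[OF v(1) x] by simp
    qed
  qed (use v in \<open>auto simp: zero_flux_left_def zero_flux_right_def\<close>)
  then have "Re (string.Dfun (of_real (- l))) = 0"
    using string.Dfun_vv[of "- l"] assms(2) string.Mr by auto
  then show ?thesis using string.Dfun_of_real[of "- l"] by (simp add: complex_eq_iff)
qed

text \<open>The eigenfunction is \<open>uu (- l)\<close>: its flux vanishes at 0 by construction and
  at \<open>r\<close> because the characteristic function vanishes at \<open>- l\<close>. Second
  order smoothness follows from the first order system.\<close>

lemma Dfun_zero_imp_eigenvalue:
  assumes D0: "string.Dfun (- of_real l) = 0" and l: "0 < l"
  shows "is_eigenvalue r a b l"
proof -
  let ?u = "string.uu (- l)" and ?v = "string.vv (- l)"
  have vr: "?v r = 0" using string.Dfun_vv[of "- l"] D0 by simp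
  have du: "deriv ?u x = s x * ?v x" if "0 < x" "x < r" for x
    by (rule DERIV_imp_deriv[OF string.uu_deriv[OF that]])
  have d2: "(deriv ?u has_real_derivative - (2 * a x / b x) * s x * ?v x + s x * (m x * (- l * ?u x))) (at x)" if x: "0 < x" "x < r" for x
  proof (rule has_field_derivative_transform_within_open[of "\<lambda>x. s x * ?v x" _ _ "{0<..<r}"])
    show "((\<lambda>x. s x * ?v x) has_real_derivative - (2 * a x / b x) * s x * ?v x + s x * (m x * (- l * ?u x))) (at x)"
      using DERIV_mult[OF s_deriv[OF x] string.vv_deriv[OF x, of "- l"]] by (simp add: mult.commute[of "m x * _"] add.commute)
  qed (use x du in auto)
  have cu: "continuous_on {0<..<r} ?u" and cv: "continuous_on {0<..<r} ?v"
    using string.uu_cont[of "- l"] string.vv_cont[of "- l"] by (auto intro: continuous_on_subset)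
  have C1u: "?u C1_differentiable_on {0<..<r}"
    unfolding C1_differentiable_on_def has_real_derivative_iff_has_vector_derivative[symmetric]
  proof (intro exI conjI ballI)
    show "(?u has_real_derivative s x * ?v x) (at x)" if "x \<in> {0<..<r}" for x using string.uu_deriv that by simp
    show "continuous_on {0<..<r} (\<lambda>x. s x * ?v x)" by (intro continuous_on_mult s_cont cv)
  qed
  have C1d: "deriv ?u C1_differentiable_on {0<..<r}"
    unfolding C1_differentiable_on_def has_real_derivative_iff_has_vector_derivative[symmetric]
  proof (intro exI conjI ballI)
    show "(deriv ?u has_real_derivative - (2 * a x / b x) * s x * ?v x + s x * (m x * (- l * ?u x))) (at x)"
      if "x \<in> {0<..<r}" for x using d2 that by simp
    show "continuous_on {0<..<r} (\<lambda>x. - (2 * a x / b x) * s x * ?v x + s x * (m x * (- l * ?u x)))"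
      by (intro continuous_on_add continuous_on_mult continuous_on_minus continuous_on_const s_cont cv cu m_cont ab_cont)
  qed
  have eq: "diff_op a b ?u x + l * ?u x = 0" if x: "0 < x" "x < r" for x
  proof -
    have "diff_op a b ?u x = 1 / 2 * b x * (- (2 * a x / b x) * s x * ?v x + s x * (m x * (- l * ?u x))) + a x * (s x * ?v x)"
      using DERIV_imp_deriv[OF d2[OF x]] du[OF x] by (simp add: diff_op_def)
    also have "\<dots> = - (1 / 2 * (m x * b x * s x) * (l * ?u x))" using b_pos[OF x] by (simp add: field_simps)
    finally show ?thesis using m_eq[OF x] by simp
  qed
  have fl: "\<forall>x\<in>{0<..<r}. ?v x = deriv ?u x / s x" using du s_pos by (auto simp: less_imp_neq[THEN not_sym])
  have zl: "zero_flux_left r a b ?u" unfolding zero_flux_left_def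
  proof (rule Lim_transform_eventually)
    show "(?v \<longlongrightarrow> 0) (at_right 0)" using string.cont_lim_0[OF string.vv_cont, of "- l"] by (simp add: string.vv_0)
    show "\<forall>\<^sub>F x in at_right 0. ?v x = deriv ?u x / s x" using fl r_pos by (auto simp: eventually_at_right_field)
  qed
  have zr: "zero_flux_right r a b ?u" unfolding zero_flux_right_def
  proof (rule Lim_transform_eventually)
    show "(?v \<longlongrightarrow> 0) (at_left r)" using string.cont_lim_r[OF string.vv_cont, of "- l"] by (simp add: vr)
    show "\<forall>\<^sub>F x in at_left r. ?v x = deriv ?u x / s x" using fl r_pos by (auto simp: eventually_at_left_field)
  qed
  have "\<forall>\<^sub>F x in at_right 0. 0 < ?u x"
    using order_tendstoD(1)[OF string.cont_lim_0[OF string.uu_cont], of 0 "- l"] by (simp add: string.uu_0)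
  then obtain d where d: "d > 0" "\<And>x. 0 < x \<Longrightarrow> x < d \<Longrightarrow> 0 < ?u x" unfolding eventually_at_right_field by auto
  define y where "y = min d r / 2"
  have y0: "0 < y" "y < d" "y < r" using d(1) r_pos by (auto simp: y_def)
  then have y: "y \<in> {0<..<r}" "?u y \<noteq> 0" using d(2)[of y] by auto
  show ?thesis unfolding is_eigenvalue_def C2_on_def
    using C1u C1d eq y zl zr by (intro exI[of _ ?u]) auto
qed

lemma positive_eigenvalues:
  "{l. 0 < l \<and> is_eigenvalue r a b l} = {l. 0 < l \<and> string.Dfun (- of_real l) = 0}"
  using eigenvalue_imp_Dfun_zero Dfun_zero_imp_eigenvalue by blast

lemma eigenvalue_product:
  assumes mono: "strict_mono l" and ran: "range l = {x. 0 < x \<and> is_eigenvalue r a b x}"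
  shows "(\<lambda>n. \<Prod>j<n. 1 + \<mu> / l j) \<longlonglongrightarrow> Re (string.Dfun (of_real \<mu>))"
proof -
  have z: "string.Dfun z = 0 \<longleftrightarrow> (\<exists>j. z = - complex_of_real (l j))" for z
  proof
    assume "string.Dfun z = 0"
    then obtain x where x: "0 < x" "z = - of_real x" using string.Dfun_zero_real by metis
    then have "x \<in> range l" using \<open>string.Dfun z = 0\<close> ran positive_eigenvalues by auto
    then show "\<exists>j. z = - complex_of_real (l j)" using x by auto
  next
    assume "\<exists>j. z = - complex_of_real (l j)"
    then obtain j where "z = - complex_of_real (l j)" by blast
    moreover have "l j \<in> {x. 0 < x \<and> string.Dfun (- of_real x) = 0}" using ran positive_eigenvalues by blast
    ultimately show "string.Dfun z = 0" by simp
  qed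
  have "(\<lambda>n. \<Prod>j<n. 1 + complex_of_real \<mu> / l j) \<longlonglongrightarrow> string.Dfun (of_real \<mu>)"
  proof (rule entire_product_minimal_type[OF string.Dfun_holomorphic string.Dfun_0 _ _ mono z])
    show "\<exists>C. \<forall>z. norm (string.Dfun z) \<le> exp (C + e * norm z)" if "0 < e" for e by (rule string.Dfun_growth[OF that])
    show "0 < l j" for j using ran by blast
    show "deriv string.Dfun (complex_of_real (- l j)) \<noteq> 0" for j
      by (rule string.Dfun_zero_simple) (use z in auto)
  qed
  then have "(\<lambda>n. Re (\<Prod>j<n. 1 + complex_of_real \<mu> / l j)) \<longlonglongrightarrow> Re (string.Dfun (of_real \<mu>))" by (rule tendsto_Re)
  moreover have "(\<Prod>j<n. 1 + complex_of_real \<mu> / l j) = of_real (\<Prod>j<n. 1 + \<mu> / l j)" for n by simp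
  ultimately show ?thesis by (simp only: Re_complex_of_real)
qed

text \<open>For positive terms a partial sum is at most the product of the factors 1 + 1 / l j, and
  these products converge to the characteristic function at 1.\<close>

lemma eigenvalue_summable:
  assumes mono: "strict_mono l" and ran: "range l = {x. 0 < x \<and> is_eigenvalue r a b x}"
  shows "summable (\<lambda>j. 1 / l j)"
proof -
  have pos: "0 < l j" for j using ran by blast
  have "(\<lambda>n. \<Prod>j<n. 1 + 1 / l j) \<longlonglongrightarrow> Re (string.Dfun (of_real 1))"
    by (rule eigenvalue_product[OF assms])
  then have "convergent (\<lambda>n. \<Prod>j<n. 1 + 1 / l j)" by (rule convergentI)
  then have "Bseq (\<lambda>n. \<Prod>j<n. 1 + 1 / l j)" by (rule convergent_imp_Bseq)
  then obtain B where B: "\<And>n. \<bar>\<Prod>j<n. 1 + 1 / l j\<bar> \<le> B" unfolding Bseq_def real_norm_def by blast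
  have "(\<Sum>j<n. 1 / l j) \<le> (\<Prod>j<n. 1 + 1 / l j)" for n
  proof (induction n)
    case (Suc n)
    have "1 \<le> (\<Prod>j<n. 1 + 1 / l j)" using pos by (intro prod_ge_1) (simp add: less_imp_le)
    then have "1 / l n * 1 \<le> 1 / l n * (\<Prod>j<n. 1 + 1 / l j)" using pos[of n] by (intro mult_left_mono) auto
    then show ?case using Suc by (simp add: algebra_simps)
  qed simp
  then have le: "(\<Sum>j<n. 1 / l j) \<le> B" for n using B[of n] by (meson abs_le_D1 order_trans)
  show ?thesis
  proof (rule bounded_imp_summable[of _ B])
    show "(\<Sum>k\<le>n. 1 / l k) \<le> B" for n using le[of "Suc n"] by (simp only: lessThan_Suc_atMost)
  qed (use pos in \<open>simp add: less_imp_le\<close>)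
qed

text \<open>At an entrance boundary the scale function is unbounded, which rules out a nonzero flux of a bounded function.\<close>

lemma entrance_scale_unbounded:
  assumes ent: "Sigma_left r a b = \<infinity>" and x1: "0 < x1" "x1 < r"
    and K: "\<And>x. 0 < x \<Longrightarrow> x < x1 \<Longrightarrow> - K \<le> scale_fun r a b x"
  shows False
proof -
  define S where "S = scale_fun r a b"
  define q where "q = min x1 (r / 2)"
  have q: "0 < q" "q \<le> x1" "q \<le> r / 2" "q < r" using x1 r_pos by (auto simp: q_def)
  define A where "A n = {q / real (Suc n)..r / 2}" for n
  have qn: "0 < q / real (Suc n)" "q / real (Suc n) \<le> q" for n
    using q by (auto simp: divide_le_eq)
  have fin: "(\<integral>\<^sup>+x. ennreal (s x) * indicator (A n) x \<partial>lborel) \<le> ennreal (S (r / 2) + \<bar>K\<bar> + \<bar>S q\<bar>)" for n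
  proof -
    define s' where "s' x = indicator {0<..<r} x *\<^sub>R s x" for x
    have [measurable]: "s' \<in> borel_measurable borel"
      unfolding s'_def[abs_def] by (intro borel_measurable_continuous_on_indicator s_cont) simp
    have "(\<integral>\<^sup>+x. ennreal (s x) * indicator (A n) x \<partial>lborel) = (\<integral>\<^sup>+x. ennreal (s' x) * indicator {q / real (Suc n)..r / 2} x \<partial>lborel)"
    proof (intro nn_integral_cong)
      fix x
      have "s' x = s x" if "x \<in> A n" using that qn(1)[of n] r_pos unfolding A_def s'_def by (auto simp: indicator_def)
      then show "ennreal (s x) * indicator (A n) x = ennreal (s' x) * indicator {q / real (Suc n)..r / 2} x"
        by (cases "x \<in> A n") (simp_all add: A_def)
    qed
    also have "\<dots> = ennreal (S (r / 2) - S (q / real (Suc n)))"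
    proof (rule nn_integral_FTC_Icc)
      fix x assume x: "x \<in> {q / real (Suc n)..r / 2}"
      have x': "0 < x" "x < r" using x qn(1)[of n] r_pos by auto
      show "(S has_real_derivative s' x) (at x)" using scale_fun_deriv[OF x'] x' by (simp add: S_def s'_def)
      show "0 \<le> s' x" using s_pos[of x] x' by (simp add: s'_def)
    next
      show "q / real (Suc n) \<le> r / 2" using qn(2)[of n] q(3) by linarith
    qed simp
    also have "\<dots> \<le> ennreal (S (r / 2) + \<bar>K\<bar> + \<bar>S q\<bar>)"
    proof (rule ennreal_leI)
      have "- (\<bar>K\<bar> + \<bar>S q\<bar>) \<le> S (q / real (Suc n))"
      proof (cases "q / real (Suc n) < x1")
        case True
        then show ?thesis using K[of "q / real (Suc n)"] qn(1)[of n] by (simp add: S_def)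
      next
        case False
        then have "q / real (Suc n) = q" using qn(2)[of n] q by simp
        then show ?thesis by simp
      qed
      then show "S (r / 2) - S (q / real (Suc n)) \<le> S (r / 2) + \<bar>K\<bar> + \<bar>S q\<bar>" by simp
    qed
    finally show ?thesis .
  qed
  have meas: "(\<lambda>x. ennreal (s x) * indicator (A n) x) \<in> borel_measurable lborel" for n
    by (rule ennreal_indicator_meas[OF s_cont]) (use qn(1)[of n] r_pos in \<open>auto simp: A_def\<close>)
  have lim: "(\<lambda>n. ennreal (s x) * indicator (A n) x) \<longlonglongrightarrow> ennreal (s x) * indicator {0<..r / 2} x" for x
  proof (rule tendsto_eventually)
    have "\<forall>\<^sub>F n in sequentially. indicator (A n) x = (indicator {0<..r / 2} x :: ennreal)"
    proof (cases "0 < x")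
      case True
      have "(\<lambda>n. q / real (Suc n)) \<longlonglongrightarrow> 0"
        using tendsto_mult[OF tendsto_const LIMSEQ_inverse_real_of_nat, of q] by (simp add: divide_inverse)
      then have "\<forall>\<^sub>F n in sequentially. q / real (Suc n) < x" using True by (rule order_tendstoD)
      then show ?thesis by eventually_elim (use True in \<open>auto simp: A_def indicator_def\<close>)
    next
      case False
      then have "x \<notin> A n" for n using qn(1)[of n] by (auto simp: A_def)
      then show ?thesis using False by (simp add: indicator_def)
    qed
    then show "\<forall>\<^sub>F n in sequentially. ennreal (s x) * indicator (A n) x = ennreal (s x) * indicator {0<..r / 2} x"
      by eventually_elim simp
  qed
  have "(\<integral>\<^sup>+x\<in>{0<..r / 2}. ennreal (s x) \<partial>lborel) = (\<integral>\<^sup>+x. liminf (\<lambda>n. ennreal (s x) * indicator (A n) x) \<partial>lborel)"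
    by (intro nn_integral_cong lim_imp_Liminf[symmetric] lim) simp
  also have "\<dots> \<le> liminf (\<lambda>n. \<integral>\<^sup>+x. ennreal (s x) * indicator (A n) x \<partial>lborel)"
    by (rule nn_integral_liminf[OF meas])
  also have "\<dots> \<le> liminf (\<lambda>n::nat. ennreal (S (r / 2) + \<bar>K\<bar> + \<bar>S q\<bar>))"
    by (intro Liminf_mono always_eventually allI fin)
  also have "\<dots> < \<infinity>" by (simp add: Liminf_const)
  \<comment> \<open>A lower bound of the scale function bounds the integrals of \<open>s\<close>
    over the truncated intervals, and Fatou's lemma makes \<open>s\<close> integrable at 0. Since
    speed increments are at most \<open>M r\<close>, \<open>Sigma_left\<close> would be
    finite.\<close>
  finally have sfin: "(\<integral>\<^sup>+x\<in>{0<..r / 2}. ennreal (s x) \<partial>lborel) < \<infinity>" .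
  have bd: "speed_fun r a b (r / 2) - speed_fun r a b x \<le> M r" if x: "0 < x" "x \<le> r / 2" for x
  proof -
    have "speed_fun r a b (r / 2) - speed_fun r a b x \<le> M (r / 2) - M x"
    proof (rule deriv_le_imp_diff_le[where f'=md and g'=m])
      show "continuous_on {x..r / 2} (speed_fun r a b)" "continuous_on {x..r / 2} M"
        by (rule continuous_on_subset[OF speed_fun_cont], use x r_pos in auto)
          (rule continuous_on_subset[OF antideriv_onD(1)[OF M_antideriv]], use x r_pos in auto)
    qed (use x r_pos speed_fun_deriv antideriv_onD(3)[OF M_antideriv] md_pos in \<open>auto simp: m_def less_imp_le\<close>)
    also have "\<dots> \<le> M r" using M_mono[of "r / 2" r] M_ge[of x] x r_pos by simp
    finally show ?thesis .
  qed
  have "Sigma_left r a b \<le> (\<integral>\<^sup>+x. ennreal (M r) * (ennreal (s x) * indicator {0<..r / 2} x) \<partial>lborel)"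
    unfolding Sigma_left_def
  proof (rule nn_integral_mono)
    fix x
    show "ennreal ((speed_fun r a b (r / 2) - speed_fun r a b x) * s x) * indicator {0<..r / 2} x \<le> ennreal (M r) * (ennreal (s x) * indicator {0<..r / 2} x)"
    proof (cases "x \<in> {0<..r / 2}")
      case True
      then have "(speed_fun r a b (r / 2) - speed_fun r a b x) * s x \<le> M r * s x"
        using bd[of x] s_pos[of x] by (intro mult_right_mono) auto
      then have "ennreal ((speed_fun r a b (r / 2) - speed_fun r a b x) * s x) \<le> ennreal (M r) * ennreal (s x)"
        using M_ge[of r] s_pos[of x] r_pos by (simp add: ennreal_mult[symmetric] ennreal_leI)
      then show ?thesis using True by simp
    qed simp
  qed
  also have "\<dots> = ennreal (M r) * (\<integral>\<^sup>+x\<in>{0<..r / 2}. ennreal (s x) \<partial>lborel)"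
    by (rule nn_integral_cmult, rule ennreal_indicator_meas[OF s_cont]) (use r_pos in auto)
  also have "\<dots> < \<infinity>" using sfin by (simp add: ennreal_mult_less_top)
  finally show False using ent by simp
qed

lemma bounded_flux_zero:
  assumes ent: "Sigma_left r a b = \<infinity>"
    and g: "continuous_on {0..r} g" "\<And>x. 0 < x \<Longrightarrow> x < r \<Longrightarrow> (g has_real_derivative s x * \<psi> x) (at x)"
    and l: "(\<psi> \<longlongrightarrow> l) (at_right 0)"
  shows "l = 0"
proof (rule ccontr)
  assume l0: "l \<noteq> 0"
  have "\<forall>\<^sub>F x in at_right 0. dist (\<psi> x) l < \<bar>l\<bar> / 2" using tendstoD[OF l, of "\<bar>l\<bar> / 2"] l0 by simp
  then obtain d where d: "d > 0" "\<And>x. 0 < x \<Longrightarrow> x < d \<Longrightarrow> dist (\<psi> x) l < \<bar>l\<bar> / 2"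
    unfolding eventually_at_right_field by auto
  define x1 where "x1 = min d r / 2"
  have x1: "0 < x1" "x1 < r" "x1 < d" using d(1) r_pos by (auto simp: x1_def)
  obtain B where B: "\<And>x. x \<in> {0..r} \<Longrightarrow> \<bar>g x\<bar> \<le> B"
    using compact_continuous_image[OF g(1) compact_Icc] compact_imp_bounded by (metis bounded_iff image_eqI real_norm_def)
  define c where "c = sgn l"
  have c: "c * l = \<bar>l\<bar>" "\<bar>c\<bar> = 1" using l0 by (auto simp: c_def sgn_if)
  show False
  proof (rule entrance_scale_unbounded[OF ent x1(1,2)])
    fix x assume x: "0 < x" "x < x1"
    have "\<bar>l\<bar> / 2 * scale_fun r a b x1 - \<bar>l\<bar> / 2 * scale_fun r a b x \<le> c * g x1 - c * g x"
    proof (rule deriv_le_imp_diff_le[where f'="\<lambda>y. \<bar>l\<bar> / 2 * s y" and g'="\<lambda>y. c * (s y * \<psi> y)" and f="\<lambda>y. \<bar>l\<bar> / 2 * scale_fun r a b y" and g="\<lambda>y. c * g y"])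
      show "continuous_on {x..x1} (\<lambda>y. \<bar>l\<bar> / 2 * scale_fun r a b y)" "continuous_on {x..x1} (\<lambda>y. c * g y)"
        by (intro continuous_intros continuous_on_subset[OF scale_fun_cont] continuous_on_subset[OF g(1)]; use x x1 in auto)+
      fix y assume y: "x < y" "y < x1"
      then have y': "0 < y" "y < r" "y < d" using x x1 by auto
      show "((\<lambda>y. \<bar>l\<bar> / 2 * scale_fun r a b y) has_real_derivative \<bar>l\<bar> / 2 * s y) (at y)"
        by (intro DERIV_cmult scale_fun_deriv y')
      show "((\<lambda>y. c * g y) has_real_derivative c * (s y * \<psi> y)) (at y)" by (intro DERIV_cmult g(2) y')
      have "\<bar>c * \<psi> y - c * l\<bar> < \<bar>l\<bar> / 2"
        using d(2)[OF y'(1,3)] c(2) by (simp add: dist_real_def right_diff_distrib[symmetric] abs_mult)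
      then have "\<bar>l\<bar> / 2 \<le> c * \<psi> y" using c(1) by linarith
      then show "\<bar>l\<bar> / 2 * s y \<le> c * (s y * \<psi> y)" using mult_right_mono[of "\<bar>l\<bar> / 2" "c * \<psi> y" "s y"] s_pos[of y] by (simp add: mult_ac)
    qed (use x in simp)
    also have "\<dots> \<le> 2 * B"
    proof -
      have "\<bar>c * g x1\<bar> \<le> B" "\<bar>c * g x\<bar> \<le> B" using B[of x1] B[of x] x x1 c(2) by (auto simp: abs_mult)
      then show ?thesis by linarith
    qed
    finally have "\<bar>l\<bar> / 2 * (scale_fun r a b x1 - scale_fun r a b x) \<le> 2 * B" by (simp add: right_diff_distrib)
    then have "scale_fun r a b x1 - scale_fun r a b x \<le> 4 * B / \<bar>l\<bar>" using l0 by (simp add: field_simps)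
    then show "- (4 * B / \<bar>l\<bar> - scale_fun r a b x1) \<le> scale_fun r a b x" by linarith
  qed
qed

end

section \<open>The strong stationary dual\<close>

context diffusion_coefficients begin

lemma m_f_integrable:
  assumes f: "continuous_on {0..r} f" shows "set_integrable lborel {0<..<r} (\<lambda>y. m y * f y)"
proof -
  obtain B where B: "\<And>x. x \<in> {0..r} \<Longrightarrow> \<bar>f x\<bar> \<le> B"
    using compact_continuous_image[OF f compact_Icc] compact_imp_bounded by (metis bounded_iff image_eqI real_norm_def)
  have c: "continuous_on {0<..<r} (\<lambda>y. m y * f y)" by (intro continuous_intros m_cont continuous_on_subset[OF f]) auto
  have i: "integrable lborel (\<lambda>y. B * (indicator {0<..<r} y *\<^sub>R m y))"
    using m_integrable unfolding set_integrable_def by (rule integrable_mult_right)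
  show ?thesis unfolding set_integrable_def
  proof (rule Bochner_Integration.integrable_bound[OF i])
    show "(\<lambda>x. indicator {0<..<r} x *\<^sub>R (m x * f x)) \<in> borel_measurable lborel"
      using borel_measurable_continuous_on_indicator[OF _ c] by simp
    show "AE x in lborel. norm (indicator {0<..<r} x *\<^sub>R (m x * f x)) \<le> norm (B * (indicator {0<..<r} x *\<^sub>R m x))"
    proof (rule AE_I2)
      fix x
      have "\<bar>m x\<bar> * \<bar>f x\<bar> \<le> \<bar>m x\<bar> * \<bar>B\<bar>" if "x \<in> {0<..<r}" using B[of x] that by (intro mult_left_mono) auto
      then show "norm (indicator {0<..<r} x *\<^sub>R (m x * f x)) \<le> norm (B * (indicator {0<..<r} x *\<^sub>R m x))"
        by (cases "x \<in> {0<..<r}") (auto simp: abs_mult mult.commute)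
    qed
  qed
qed

lemma mint_LBINT:
  assumes f: "continuous_on {0..r} f" and x: "0 \<le> x" "x \<le> r"
  shows "string.mint f x = (LBINT y:{0<..<x}. m y * f y)"
proof (rule antideriv_on_unique[OF string.mint[OF f] _ _ x])
  show "antideriv_on r (\<lambda>y. m y * f y) (\<lambda>x. LBINT y:{0<..<x}. m y * f y)"
    by (rule antideriv_on_LBINT[OF r_pos _ m_f_integrable[OF f]])
      (intro continuous_intros m_cont continuous_on_subset[OF f]; auto)
qed simp

lemma stat_dens_eq: "stat_dens r a b x = indicator {0<..<r} x * m x / M r"
proof -
  have "M r = 2 * (LBINT y:{0<..<r}. md y)" unfolding M_def m_def by simp
  then show ?thesis by (simp add: stat_dens_def m_def)
qed

lemma stat_integral:
  assumes x: "0 < x" "x \<le> r"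
  shows "(LBINT y:{0..x}. stat_dens r a b y * h y) = (LBINT y:{0<..<x}. m y * h y) / M r"
proof -
  have "(LBINT y:{0..x}. stat_dens r a b y * h y) = (LBINT y:{0<..<x}. (m y * h y) / M r)"
    unfolding set_lebesgue_integral_def
  proof (rule integral_discrete_difference[where X="{0, x}"])
    show "indicator {0..x} y *\<^sub>R (stat_dens r a b y * h y) = indicator {0<..<x} y *\<^sub>R (m y * h y / M r)" if "y \<notin> {0, x}" for y
      using x that by (auto simp: stat_dens_eq indicator_def)
  qed auto
  then show ?thesis by simp
qed

lemma stat_cdf_eq: assumes "0 < x" "x \<le> r" shows "stat_cdf r a b x = M x / M r"
  using stat_integral[OF assms, of "\<lambda>_. 1"] by (simp add: stat_cdf_def M_def)

lemma dual_link_eq: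
  assumes f: "continuous_on {0..r} f" and x: "0 < x" "x \<le> r"
  shows "dual_link r a b f x = string.mint f x / M x"
proof -
  have "dual_link r a b f x = (LBINT y:{0..x}. stat_dens r a b y * (f y / stat_cdf r a b x))"
    using x by (simp add: dual_link_def)
  also have "\<dots> = (LBINT y:{0<..<x}. m y * (f y / stat_cdf r a b x)) / M r" by (rule stat_integral[OF x])
  also have "(LBINT y:{0<..<x}. m y * (f y / stat_cdf r a b x)) = (LBINT y:{0<..<x}. (m y * f y) / stat_cdf r a b x)" by simp
  also have "\<dots> = string.mint f x / stat_cdf r a b x"
    using mint_LBINT[OF f, of x] x by (simp only: set_integral_divide_zero)
  finally show ?thesis using string.Mr by (simp add: stat_cdf_eq[OF x])
qed

lemma dual_link_0: "dual_link r a b f 0 = f 0" by (simp add: dual_link_def)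

abbreviation "\<pi> \<equiv> stat_measure r a b"

lemma stat_dens_meas[measurable]: "stat_dens r a b \<in> borel_measurable borel"
proof -
  have "(\<lambda>x. indicator {0<..<r} x *\<^sub>R m x) \<in> borel_measurable borel"
    by (rule borel_measurable_continuous_on_indicator[OF _ m_cont]) simp
  then have "(\<lambda>x. (indicator {0<..<r} x *\<^sub>R m x) / M r) \<in> borel_measurable borel" by (rule borel_measurable_divide) simp
  then show ?thesis by (simp add: stat_dens_eq[abs_def])
qed

lemma stat_dens_nonneg: "0 \<le> stat_dens r a b x"
  using m_pos string.Mr by (simp add: stat_dens_eq indicator_def less_imp_le)

lemma stat_sets[simp]: "sets \<pi> = sets borel" "space \<pi> = UNIV" by (auto simp: stat_measure_def)

lemma stat_prob: "prob_space \<pi>"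
proof
  have "emeasure \<pi> (space \<pi>) = (\<integral>\<^sup>+x. ennreal (stat_dens r a b x) \<partial>lborel)"
    unfolding stat_measure_def by (subst emeasure_density) auto
  also have "\<dots> = (\<integral>\<^sup>+x. ennreal (1 / M r) * (ennreal (m x) * indicator {0<..<r} x) \<partial>lborel)"
    by (intro nn_integral_cong)
      (use m_pos string.Mr in \<open>auto simp: stat_dens_eq indicator_def ennreal_mult[symmetric] less_imp_le\<close>)
  also have "\<dots> = ennreal (1 / M r) * ennreal (M r)"
    using M_nn[of r] r_pos by (subst nn_integral_cmult[OF ennreal_indicator_meas[OF m_cont]]) auto
  also have "\<dots> = 1" using string.Mr by (simp add: ennreal_mult[symmetric] del: ennreal_1)
  finally show "emeasure \<pi> (space \<pi>) = 1" .
qed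

lemma stat_integral_mint:
  assumes f: "continuous_on {0..r} f" and h: "h \<in> borel_measurable borel" "\<And>x. 0 \<le> x \<Longrightarrow> x \<le> r \<Longrightarrow> h x = f x"
  shows "(\<integral>x. h x \<partial>\<pi>) = string.mint f r / M r"
proof -
  have "(\<integral>x. h x \<partial>\<pi>) = (\<integral>x. stat_dens r a b x * h x \<partial>lborel)"
    unfolding stat_measure_def by (subst integral_density) (use h stat_dens_nonneg in auto)
  also have "\<dots> = (\<integral>x. (indicator {0<..<r} x *\<^sub>R (m x * f x)) / M r \<partial>lborel)"
    by (intro Bochner_Integration.integral_cong) (auto simp: stat_dens_eq indicator_def h(2))
  also have "\<dots> = string.mint f r / M r"
    using mint_LBINT[OF f, of r] r_pos by (simp add: set_lebesgue_integral_def)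
  finally show ?thesis .
qed

end

locale dual_diffusion = diffusion_coefficients r a b + PX: feller_process r P X + PD: feller_process r Pd Xd
  for r a b and P :: "real \<Rightarrow> 'w measure" and X and Pd :: "real \<Rightarrow> 'd measure" and Xd +
  assumes gen: "\<And>f g. inf_generator r P X f g \<Longrightarrow>
      diffusion_graph r a b (reflecting_left r a b P X) (reflecting_right r a b P X) f g"
    and left: "reflecting_left r a b P X \<or> entrance_left r a b"
    and right: "reflecting_right r a b P X"
    and dual: "\<And>f g. inf_generator r P X f g \<Longrightarrow> inf_generator r Pd Xd (dual_link r a b f) (dual_link r a b g)"
begin

text \<open>The domain of the generator determines the flux of the resolvent up to a constant, its
  limit at 0. A reflecting boundary makes this limit zero by the domain condition, an entrance
  boundary because the resolvent is bounded. Reflection at \<open>r\<close> gives the remaining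
  condition.\<close>

lemma resolvent_eq_N:
  assumes \<mu>: "0 < \<mu>" and k: "continuous_on {0..r} k"
  shows "string.resolvent_eq \<mu> k (\<lambda>x. PX.N \<mu> k x / \<mu>)"
proof -
  define g where "g = PX.N \<mu> k"
  have gc: "continuous_on {0..r} g" unfolding g_def by (rule PX.N_cont[OF \<mu> k])
  have graph: "diffusion_graph r a b (reflecting_left r a b P X) (reflecting_right r a b P X) g (\<lambda>x. \<mu> * (g x - k x))"
    unfolding g_def by (rule gen[OF PX.generator_resolvent[OF \<mu> k]])
  then have C2: "C2_on g {0<..<r}" and op: "\<And>x. x \<in> {0<..<r} \<Longrightarrow> \<mu> * (g x - k x) = diff_op a b g x"
    and zl: "reflecting_left r a b P X \<Longrightarrow> zero_flux_left r a b g" and zr: "zero_flux_right r a b g"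
    using graph[unfolded diffusion_graph_def] right by (simp_all only: simp_thms)
  define \<psi> where "\<psi> x = deriv g x / s x / \<mu>" for x
  define q where "q x = \<mu> * (g x / \<mu>) - k x" for x
  have qc: "continuous_on {0..r} q" unfolding q_def using \<mu> by (intro continuous_intros gc k) auto
  have d\<psi>: "(\<psi> has_real_derivative m x * q x) (at x)" if x: "0 < x" "x < r" for x
  proof -
    have "(\<psi> has_real_derivative m x * diff_op a b g x / \<mu>) (at x)"
      unfolding \<psi>_def by (rule DERIV_cdivide[OF flux_deriv[OF C2 x]])
    moreover have "diff_op a b g x = \<mu> * (g x - k x)" using op[of x] x by simp
    ultimately show ?thesis using \<mu> by (simp add: q_def)
  qed
  have dg: "((\<lambda>x. g x / \<mu>) has_real_derivative s x * \<psi> x) (at x)" if x: "0 < x" "x < r" for x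
    using DERIV_cdivide[OF C2_onD(1)[OF C2 x], of \<mu>] s_pos[of x] by (simp add: \<psi>_def)
  note aq = antideriv_onD[OF string.mint[OF qc]]
  \<comment> \<open>The difference between the flux and its candidate is constant in the interior;
    this constant is the flux at 0.\<close>
  define l where "l = \<psi> (r / 2) - string.mint q (r / 2)"
  have \<psi>l: "\<psi> x = l + string.mint q x" if x: "0 < x" "x < r" for x
  proof -
    have "\<psi> x - string.mint q x = \<psi> (r / 2) - string.mint q (r / 2)"
    proof (rule DERIV_isconst3[of 0 r x "r / 2" "\<lambda>x. \<psi> x - string.mint q x"])
      show "((\<lambda>x. \<psi> x - string.mint q x) has_real_derivative 0) (at y)" if "y \<in> {0<..<r}" for y
        using DERIV_diff[OF d\<psi>[of y] aq(3)[of y]] that by simp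
    qed (use x r_pos in auto)
    then show ?thesis by (simp add: l_def)
  qed
  have liml: "(\<psi> \<longlongrightarrow> l) (at_right 0)"
  proof (rule Lim_transform_eventually)
    show "((\<lambda>x. l + string.mint q x) \<longlongrightarrow> l) (at_right 0)"
      using tendsto_add[OF tendsto_const string.cont_lim_0[OF aq(1)], of l] aq(2) by simp
    show "\<forall>\<^sub>F x in at_right 0. l + string.mint q x = \<psi> x"
      using \<psi>l r_pos by (auto simp: eventually_at_right_field)
  qed
  have l0: "l = 0"
    using left
  proof
    assume "reflecting_left r a b P X"
    then have "((\<lambda>x. deriv g x / s x) \<longlongrightarrow> 0) (at_right 0)" using zl by (simp add: zero_flux_left_def)
    then have "((\<lambda>x. deriv g x / s x / \<mu>) \<longlongrightarrow> 0 / \<mu>) (at_right 0)" by (intro tendsto_divide tendsto_const) (use \<mu> in auto)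
    then have "(\<psi> \<longlongrightarrow> 0) (at_right 0)" by (simp add: \<psi>_def[abs_def])
    then show ?thesis using tendsto_unique[OF trivial_limit_at_right_real liml] by simp
  next
    assume "entrance_left r a b"
    then have "Sigma_left r a b = \<infinity>" by (simp add: entrance_left_def)
    moreover have "continuous_on {0..r} (\<lambda>x. g x / \<mu>)" using \<mu> by (intro continuous_intros gc) auto
    ultimately show ?thesis using dg liml by (rule bounded_flux_zero)
  qed
  have "string.mint q r = 0"
  proof -
    have "((\<lambda>x. deriv g x / s x) \<longlongrightarrow> 0) (at_left r)" using zr by (simp add: zero_flux_right_def)
    then have "((\<lambda>x. deriv g x / s x / \<mu>) \<longlongrightarrow> 0 / \<mu>) (at_left r)" by (intro tendsto_divide tendsto_const) (use \<mu> in auto)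
    then have 1: "(\<psi> \<longlongrightarrow> 0) (at_left r)" by (simp add: \<psi>_def[abs_def])
    have "(\<psi> \<longlongrightarrow> string.mint q r) (at_left r)"
    proof (rule Lim_transform_eventually[OF string.cont_lim_r[OF aq(1)]])
      show "\<forall>\<^sub>F x in at_left r. string.mint q x = \<psi> x"
        using \<psi>l l0 r_pos by (auto simp: eventually_at_left_field)
    qed
    then show ?thesis using tendsto_unique[OF trivial_limit_at_left_real 1] by simp
  qed
  moreover have "((\<lambda>x. g x / \<mu>) has_real_derivative s x * string.mint q x) (at x)" if "0 < x" "x < r" for x
    using dg[OF that] \<psi>l[OF that] l0 by simp
  ultimately show ?thesis
    unfolding string.resolvent_eq_def using k gc \<mu> by (auto simp: q_def[abs_def] g_def intro!: continuous_intros)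
qed

abbreviation "\<Lambda> \<equiv> dual_link r a b"

text \<open>The dual hypothesis speaks of the domain of the generator only. Writing f = g - k /
  \<mu> with g the resolvent of f and k = A g extends continuity of \<Lambda> f to all continuous f.
  Intertwining of the generators becomes intertwining of the resolvents, read off at 0, where the
  link is evaluation.\<close>

lemma link_resolvent:
  assumes \<mu>: "0 < \<mu>" and f: "continuous_on {0..r} f"
  shows "continuous_on {0..r} (\<Lambda> f)" "PD.N \<mu> (\<Lambda> f) 0 = PX.N \<mu> f 0"
proof -
  define g where "g = PX.N \<mu> f"
  have gc: "continuous_on {0..r} g" unfolding g_def by (rule PX.N_cont[OF \<mu> f])
  define k where "k x = \<mu> * (g x - f x)" for x
  have kc: "continuous_on {0..r} k" unfolding k_def by (intro continuous_intros gc f)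
  have D: "inf_generator r Pd Xd (\<Lambda> g) (\<Lambda> k)"
    unfolding g_def k_def by (rule dual[OF PX.generator_resolvent[OF \<mu> f]])
  then have c: "continuous_on {0..r} (\<Lambda> g)" "continuous_on {0..r} (\<Lambda> k)" by (auto simp: inf_generator_def)
  have mk: "string.mint k x = \<mu> * (string.mint g x - string.mint f x)" if x: "0 \<le> x" "x \<le> r" for x
  proof (rule antideriv_on_unique[OF string.mint[OF kc] _ _ x])
    show "antideriv_on r (\<lambda>x. \<mu> * (m x * g x - m x * f x)) (\<lambda>x. \<mu> * (string.mint g x - string.mint f x))"
      by (intro antideriv_on_cmult antideriv_on_diff string.mint gc f)
  qed (simp add: k_def algebra_simps)
  have eq: "\<Lambda> k x = \<mu> * \<Lambda> g x - \<mu> * \<Lambda> f x" if "0 \<le> x" "x \<le> r" for x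
  proof (cases "x = 0")
    case True
    then show ?thesis by (simp add: dual_link_0 k_def right_diff_distrib)
  next
    case False
    then show ?thesis using that dual_link_eq[OF gc, of x] dual_link_eq[OF f, of x] dual_link_eq[OF kc, of x] mk[of x]
      by (simp add: diff_divide_distrib right_diff_distrib)
  qed
  have "continuous_on {0..r} (\<lambda>x. \<Lambda> g x - \<Lambda> k x / \<mu>)" using \<mu> by (intro continuous_intros c) auto
  then show cf: "continuous_on {0..r} (\<Lambda> f)"
    by (rule continuous_on_eq) (use eq \<mu> in \<open>auto simp: field_simps\<close>)
  have "PD.N \<mu> (\<Lambda> k) 0 = \<mu> * (PD.N \<mu> (\<Lambda> g) 0 - \<Lambda> g 0)"
    by (rule PD.resolvent_generator[OF \<mu> D]) (use r_pos in auto)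
  moreover have "PD.N \<mu> (\<Lambda> k) 0 = PD.N \<mu> (\<lambda>x. \<mu> * \<Lambda> g x - \<mu> * \<Lambda> f x) 0"
    unfolding PD.N_def by (intro Bochner_Integration.integral_cong refl PD.T_cong eq)
  moreover have "\<dots> = \<mu> * PD.N \<mu> (\<Lambda> g) 0 - \<mu> * PD.N \<mu> (\<Lambda> f) 0"
    by (rule PD.N_lincomb[OF \<mu> c(1) cf]) (use r_pos in auto)
  ultimately show "PD.N \<mu> (\<Lambda> f) 0 = PX.N \<mu> f 0" using \<mu> by (simp add: dual_link_0 g_def right_diff_distrib)
qed

lemma link_cont: "continuous_on {0..r} f \<Longrightarrow> continuous_on {0..r} (\<Lambda> f)"
  by (rule link_resolvent(1)[of 1]) auto

text \<open>Both sides are continuous in \<open>t\<close>, and their Laplace transforms are the two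
  resolvents at 0.\<close>

lemma T_link:
  assumes f: "continuous_on {0..r} f" and t: "0 \<le> t"
  shows "PX.T t f 0 = PD.T t (\<Lambda> f) 0"
proof -
  obtain B where B: "\<And>x. 0 \<le> x \<Longrightarrow> x \<le> r \<Longrightarrow> \<bar>f x\<bar> \<le> B" using PX.cont_bounded[OF f] by metis
  obtain B' where B': "\<And>x. 0 \<le> x \<Longrightarrow> x \<le> r \<Longrightarrow> \<bar>\<Lambda> f x\<bar> \<le> B'" using PX.cont_bounded[OF link_cont[OF f]] by metis
  have r0: "0 \<le> r" using r_pos by simp
  show ?thesis
  proof (rule laplace_transform_inj[where B="max B B'" and f="\<lambda>t. PX.T t f 0" and g="\<lambda>t. PD.T t (\<Lambda> f) 0"])
    show "continuous_on UNIV (\<lambda>t. PX.T t f 0)" by (rule PX.T_cont_t[OF f]) (use r0 in auto)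
    show "continuous_on UNIV (\<lambda>t. PD.T t (\<Lambda> f) 0)" by (rule PD.T_cont_t[OF link_cont[OF f]]) (use r0 in auto)
    show "\<bar>PX.T t f 0\<bar> \<le> max B B'" for t using PX.T_abs_le[OF PX.cont_bm[OF f] B, of 0 t] r0 by (simp add: le_max_iff_disj)
    show "\<bar>PD.T t (\<Lambda> f) 0\<bar> \<le> max B B'" for t using PD.T_abs_le[OF PD.cont_bm[OF link_cont[OF f]] B', of 0 t] r0 by (simp add: le_max_iff_disj)
    show "(\<integral>t. PX.T t f 0 \<partial>exp_law \<mu>) = (\<integral>t. PD.T t (\<Lambda> f) 0 \<partial>exp_law \<mu>)" if "0 < \<mu>" for \<mu>
      using link_resolvent(2)[OF that f] by (simp add: PX.N_def PD.N_def)
  qed (rule t)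
qed

text \<open>The resolvent equation preserves mass because the flux vanishes at both ends. So the
  mass of \<open>T t f\<close> has the transform of a constant, and it is continuous in
  \<open>t\<close>.\<close>

lemma stationary:
  assumes f: "continuous_on {0..r} f" and t: "0 \<le> t"
  shows "string.mint (PX.T t f) r = string.mint f r"
proof -
  interpret \<pi>: prob_space \<pi> by (rule stat_prob)
  obtain B where B0: "0 \<le> B" and B: "\<And>x. 0 \<le> x \<Longrightarrow> x \<le> r \<Longrightarrow> \<bar>f x\<bar> \<le> B" using PX.cont_bounded[OF f] by metis
  note Tc = PX.T_cont_x[OF f]
  have Tb: "\<bar>PX.T t f (PX.clip y)\<bar> \<le> B" for t y using PX.T_abs_le[OF PX.cont_bm[OF f] B, of "PX.clip y" t] PX.clip_in[of y] by simp
  have I: "(\<integral>y. h (PX.clip y) \<partial>\<pi>) = string.mint h r / M r" if "continuous_on {0..r} h" for h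
    by (rule stat_integral_mint[OF that PX.meas_clip[OF that]]) (simp add: PX.clip_id)
  have Ib: "\<bar>\<integral>y. PX.T t f (PX.clip y) \<partial>\<pi>\<bar> \<le> B" for t
  proof -
    have "\<bar>\<integral>y. PX.T t f (PX.clip y) \<partial>\<pi>\<bar> \<le> (\<integral>y. \<bar>PX.T t f (PX.clip y)\<bar> \<partial>\<pi>)" by (rule integral_abs_bound)
    also have "\<dots> \<le> (\<integral>y. B \<partial>\<pi>)"
      by (intro integral_mono integrable_abs \<pi>.integrable_const_bound[where B=B])
        (use Tb B0 PX.meas_clip[OF Tc] in \<open>auto simp: measurable_cong_sets[OF stat_sets(1) refl]\<close>)
    finally show ?thesis using \<pi>.prob_space by simp
  qed
  have "(\<integral>y. PX.T t f (PX.clip y) \<partial>\<pi>) = (\<lambda>_. string.mint f r / M r) t"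
  proof (rule laplace_transform_inj[where B="max B \<bar>string.mint f r / M r\<bar>" and f="\<lambda>t. \<integral>y. PX.T t f (PX.clip y) \<partial>\<pi>" and g="\<lambda>_. string.mint f r / M r"])
    show "continuous_on UNIV (\<lambda>t. \<integral>y. PX.T t f (PX.clip y) \<partial>\<pi>)"
    proof (rule continuous_on_sequentiallyI)
      fix u :: "nat \<Rightarrow> real" and c assume u: "u \<longlonglongrightarrow> c"
      show "(\<lambda>n. \<integral>y. PX.T (u n) f (PX.clip y) \<partial>\<pi>) \<longlonglongrightarrow> (\<integral>y. PX.T c f (PX.clip y) \<partial>\<pi>)"
      proof (rule integral_dominated_convergence[where w="\<lambda>_. B"])
        show "AE y in \<pi>. (\<lambda>n. PX.T (u n) f (PX.clip y)) \<longlonglongrightarrow> PX.T c f (PX.clip y)"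
        proof (rule AE_I2)
          fix y
          have "continuous_on UNIV (\<lambda>t. PX.T t f (PX.clip y))" by (rule PX.T_cont_t[OF f]) (use PX.clip_in in auto)
          then have "isCont (\<lambda>t. PX.T t f (PX.clip y)) c" by (simp add: continuous_on_eq_continuous_at)
          then show "(\<lambda>n. PX.T (u n) f (PX.clip y)) \<longlonglongrightarrow> PX.T c f (PX.clip y)" by (rule isCont_tendsto_compose[OF _ u])
        qed
      qed (use Tb PX.meas_clip[OF Tc] in \<open>auto simp: measurable_cong_sets[OF stat_sets(1) refl]\<close>)
    qed
    show "\<bar>\<integral>y. PX.T t f (PX.clip y) \<partial>\<pi>\<bar> \<le> max B \<bar>string.mint f r / M r\<bar>" for t using Ib[of t] by (simp add: le_max_iff_disj)
    fix \<mu> :: real assume \<mu>: "0 < \<mu>"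
    interpret E: prob_space "exp_law \<mu>" by (rule exp_law_prob[OF \<mu>])
    interpret pair_sigma_finite "exp_law \<mu>" \<pi> by unfold_locales
    interpret EP: pair_prob_space "exp_law \<mu>" \<pi> by unfold_locales
    have mm: "(\<lambda>(t, y). PX.T t f (PX.clip y)) \<in> borel_measurable (exp_law \<mu> \<Otimes>\<^sub>M \<pi>)"
      using PX.T_joint_meas[OF f] by (simp add: case_prod_beta' cong: measurable_cong_sets sets_pair_measure_cong)
    have ii: "integrable (exp_law \<mu> \<Otimes>\<^sub>M \<pi>) (\<lambda>(t, y). PX.T t f (PX.clip y))"
      by (rule EP.integrable_const_bound[where B=B]) (use Tb mm in \<open>auto intro!: AE_I2\<close>)
    have "(\<integral>t. (\<integral>y. PX.T t f (PX.clip y) \<partial>\<pi>) \<partial>exp_law \<mu>) = (\<integral>y. PX.N \<mu> f (PX.clip y) \<partial>\<pi>)"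
      unfolding PX.N_def by (rule Fubini_integral[OF ii, symmetric])
    also have "\<dots> = string.mint (PX.N \<mu> f) r / M r" by (rule I[OF PX.N_cont[OF \<mu> f]])
    also have "string.mint (PX.N \<mu> f) r = string.mint f r"
    proof -
      have c: "continuous_on {0..r} (\<lambda>x. PX.N \<mu> f x / \<mu>)" using \<mu> by (intro continuous_intros PX.N_cont f) auto
      have "string.mint (PX.N \<mu> f) r = \<mu> * string.mint (\<lambda>x. PX.N \<mu> f x / \<mu>) r"
      proof (rule antideriv_on_unique[OF string.mint[OF PX.N_cont[OF \<mu> f]] antideriv_on_cmult[OF string.mint[OF c]]])
      qed (use \<mu> r_pos in auto)
      then show ?thesis using string.resolvent_eq_mass[OF resolvent_eq_N[OF \<mu> f]] by simp
    qed
    finally show "(\<integral>t. (\<integral>y. PX.T t f (PX.clip y) \<partial>\<pi>) \<partial>exp_law \<mu>) = (\<integral>t. string.mint f r / M r \<partial>exp_law \<mu>)"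
      using E.prob_space by simp
  qed (use t in \<open>auto intro: continuous_intros\<close>)
  then show ?thesis using I[OF Tc, of t] string.Mr by simp
qed

end

section \<open>Series of independent exponential variables\<close>

locale exponential_series = prob_space M for M :: "'q measure" +
  fixes V :: "nat \<Rightarrow> 'q \<Rightarrow> real" and l :: "nat \<Rightarrow> real"
  assumes indep: "indep_vars (\<lambda>_. borel) V UNIV"
    and V_exp: "\<And>j. distributed M lborel (V j) (exponential_density (l j))"
    and l_pos: "\<And>j. 0 < l j" and l_min: "\<And>j. l 0 \<le> l j" and l_sum: "summable (\<lambda>j. 1 / l j)"
begin

definition S :: "'q \<Rightarrow> real" where "S \<omega> = (\<Sum>j. V j \<omega>)"
definition ES :: real where "ES = (\<Sum>j. 1 / l j)"

lemma V_meas[measurable]: "V j \<in> borel_measurable M"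
  using V_exp[of j] by (simp add: distributed_def)

lemma V_nonneg: "AE \<omega> in M. 0 \<le> V j \<omega>"
proof -
  have "AE x in distr M lborel (V j). 0 \<le> x"
    using V_exp[of j] exp_law_AE[of "l j"] unfolding distributed_def by (elim conjE) (simp only:)
  then show ?thesis by (subst (asm) AE_distr_iff) auto
qed

lemma V_all_nonneg: "AE \<omega> in M. \<forall>j. 0 \<le> V j \<omega>"
  using V_nonneg by (simp add: AE_all_countable)

lemma V_moments: "integrable M (\<lambda>\<omega>. V j \<omega> ^ i)" "expectation (V j) = 1 / l j" "variance (V j) = 1 / (l j)\<^sup>2"
  using erlang_ith_moment_integrable[OF l_pos V_exp, of j i]
    exponential_distributed_expectation[OF l_pos V_exp, of j] exponential_distributed_variance[OF l_pos V_exp, of j] by auto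

lemma V_int: "integrable M (V j)" using V_moments(1)[of j 1] by simp

lemma V_summable: "AE \<omega> in M. summable (\<lambda>j. V j \<omega>)"
proof -
  have "(\<integral>\<^sup>+\<omega>. (\<Sum>j. ennreal (V j \<omega>)) \<partial>M) = (\<Sum>j. \<integral>\<^sup>+\<omega>. ennreal (V j \<omega>) \<partial>M)"
    by (rule nn_integral_suminf) simp
  also have "\<dots> = (\<Sum>j. ennreal (1 / l j))"
    using V_moments(2) by (intro suminf_cong) (simp add: nn_integral_eq_integral[OF V_int V_nonneg])
  also have "\<dots> = ennreal ES" unfolding ES_def using l_pos l_sum by (intro suminf_ennreal2) (auto simp: less_imp_le)
  finally have "(\<integral>\<^sup>+\<omega>. (\<Sum>j. ennreal (V j \<omega>)) \<partial>M) \<noteq> \<infinity>" by simp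
  then have "AE \<omega> in M. (\<Sum>j. ennreal (V j \<omega>)) \<noteq> \<infinity>" by (intro nn_integral_PInf_AE) auto
  then show ?thesis using V_all_nonneg
    by eventually_elim (auto intro: summable_suminf_not_top)
qed

lemma S_meas[measurable]: "S \<in> borel_measurable M"
  unfolding S_def[abs_def] by measurable

lemma S_integral: "integrable M S" "expectation S = ES"
proof -
  have 1: "AE \<omega> in M. summable (\<lambda>j. norm (V j \<omega>))"
    using V_summable V_all_nonneg by eventually_elim (simp add: abs_of_nonneg)
  have "(\<integral>\<omega>. norm (V j \<omega>) \<partial>M) = 1 / l j" for j
  proof -
    have "(\<integral>\<omega>. norm (V j \<omega>) \<partial>M) = expectation (V j)"
    proof (rule integral_cong_AE)
      show "AE \<omega> in M. norm (V j \<omega>) = V j \<omega>" using V_nonneg[of j] by eventually_elim simp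
    qed auto
    then show ?thesis using V_moments(2) by simp
  qed
  then have 2: "summable (\<lambda>j. \<integral>\<omega>. norm (V j \<omega>) \<partial>M)" using l_sum by simp
  show "integrable M S" unfolding S_def[abs_def] by (rule integrable_suminf[OF V_int 1 2])
  show "expectation S = ES" unfolding S_def[abs_def] ES_def
    using integral_suminf[OF V_int 1 2] V_moments(2) by simp
qed

lemma S_ge: "AE \<omega> in M. V 0 \<omega> \<le> S \<omega>"
  using V_summable V_all_nonneg
proof eventually_elim
  case (elim \<omega>)
  then show ?case unfolding S_def using sum_le_suminf[of "\<lambda>j. V j \<omega>" "{0}"] by auto
qed

lemma S_nonneg: "AE \<omega> in M. 0 \<le> S \<omega>"
  using S_ge V_nonneg[of 0] by eventually_elim simp

lemma ES_pos: "0 < ES"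
  unfolding ES_def using l_pos by (intro suminf_pos l_sum) auto

lemma partial_variance:
  defines "Y \<equiv> \<lambda>j \<omega>. V j \<omega> - 1 / l j"
  shows "integrable M (\<lambda>\<omega>. (\<Sum>j<n. Y j \<omega>)\<^sup>2) \<and> expectation (\<lambda>\<omega>. (\<Sum>j<n. Y j \<omega>)\<^sup>2) = (\<Sum>j<n. 1 / (l j)\<^sup>2)"
proof (induction n)
  case 0
  show ?case by simp
next
  case (Suc n)
  have Ym[measurable]: "Y j \<in> borel_measurable M" for j unfolding Y_def by simp
  have Yi: "integrable M (Y j)" for j unfolding Y_def using V_int by simp
  have Y0: "expectation (Y j) = 0" for j unfolding Y_def using V_moments(2)[of j] V_int[of j] by (simp add: prob_space)
  have Y2: "integrable M (\<lambda>\<omega>. (Y j \<omega>)\<^sup>2)" for j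
    unfolding Y_def power2_diff using V_moments(1)[of j 2] V_int[of j] by simp
  have EY2: "expectation (\<lambda>\<omega>. (Y j \<omega>)\<^sup>2) = 1 / (l j)\<^sup>2" for j
    using V_moments(3)[of j] V_moments(2)[of j] by (simp add: Y_def)
  have iY: "indep_vars (\<lambda>_. borel) Y UNIV"
    unfolding Y_def by (rule indep_vars_compose2[OF indep]) simp
  have cross: "integrable M (\<lambda>\<omega>. Y j \<omega> * Y n \<omega>) \<and> expectation (\<lambda>\<omega>. Y j \<omega> * Y n \<omega>) = 0" if "j < n" for j
  proof -
    have i: "indep_vars (\<lambda>_. borel) Y {j, n}" by (rule indep_vars_subset[OF iY]) simp
    have "integrable M (\<lambda>\<omega>. \<Prod>i\<in>{j, n}. Y i \<omega>)" by (rule indep_vars_integrable[OF _ i]) (use Yi in auto)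
    moreover have "expectation (\<lambda>\<omega>. \<Prod>i\<in>{j, n}. Y i \<omega>) = (\<Prod>i\<in>{j, n}. expectation (Y i))"
      by (rule indep_vars_lebesgue_integral[OF _ i]) (use Yi in auto)
    ultimately show ?thesis using that Y0 by simp
  qed
  have eq: "(\<Sum>j<Suc n. Y j \<omega>)\<^sup>2 = (\<Sum>j<n. Y j \<omega>)\<^sup>2 + (2 * (\<Sum>j<n. Y j \<omega> * Y n \<omega>) + (Y n \<omega>)\<^sup>2)" for \<omega>
    by (simp add: power2_sum sum_distrib_right)
  have i1: "integrable M (\<lambda>\<omega>. \<Sum>j<n. Y j \<omega> * Y n \<omega>)" using cross by (intro Bochner_Integration.integrable_sum) auto
  have e1: "expectation (\<lambda>\<omega>. \<Sum>j<n. Y j \<omega> * Y n \<omega>) = 0"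
    using cross by (subst Bochner_Integration.integral_sum) auto
  show ?case unfolding eq using Suc i1 e1 Y2[of n] EY2[of n] by simp
qed

lemma sum_sq_le: "(\<Sum>j<n. 1 / (l j)\<^sup>2) \<le> ES / l 0"
proof -
  have "(\<Sum>j<n. 1 / (l j)\<^sup>2) \<le> (\<Sum>j<n. (1 / l j) * (1 / l 0))"
  proof (rule sum_mono)
    fix j
    have "(1 / l j) * (1 / l j) \<le> (1 / l j) * (1 / l 0)"
      using l_pos l_min by (intro mult_left_mono divide_left_mono) (auto simp: less_imp_le)
    then show "1 / (l j)\<^sup>2 \<le> (1 / l j) * (1 / l 0)" by (simp add: power2_eq_square)
  qed
  also have "\<dots> = (\<Sum>j<n. 1 / l j) * (1 / l 0)" by (rule sum_distrib_right[symmetric])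
  also have "\<dots> \<le> ES * (1 / l 0)"
    unfolding ES_def using l_pos by (intro mult_right_mono sum_le_suminf l_sum) (auto simp: less_imp_le)
  finally show ?thesis by simp
qed

text \<open>Fatou's lemma passes from the partial sums, whose variances are explicit, to the series;
  an upper bound is all that Cantelli's inequality asks for.\<close>

lemma S_variance: "integrable M (\<lambda>\<omega>. (S \<omega> - ES)\<^sup>2)" "expectation (\<lambda>\<omega>. (S \<omega> - ES)\<^sup>2) \<le> ES / l 0"
proof -
  define Z where "Z n \<omega> = (\<Sum>j<n. V j \<omega> - 1 / l j)\<^sup>2" for n \<omega>
  have Zm[measurable]: "Z n \<in> borel_measurable M" for n unfolding Z_def by measurable
  have "AE \<omega> in M. (\<lambda>n. ennreal (Z n \<omega>)) \<longlonglongrightarrow> ennreal ((S \<omega> - ES)\<^sup>2)"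
    using V_summable
  proof eventually_elim
    case (elim \<omega>)
    have "(\<lambda>n. \<Sum>j<n. V j \<omega> - 1 / l j) \<longlonglongrightarrow> S \<omega> - ES"
      using sums_diff[OF summable_sums[OF elim] summable_sums[OF l_sum]] by (simp add: sums_def S_def ES_def)
    then show ?case unfolding Z_def by (intro tendsto_ennrealI tendsto_power)
  qed
  then have "AE \<omega> in M. ennreal ((S \<omega> - ES)\<^sup>2) = liminf (\<lambda>n. ennreal (Z n \<omega>))"
    by eventually_elim (simp add: lim_imp_Liminf)
  then have "(\<integral>\<^sup>+\<omega>. ennreal ((S \<omega> - ES)\<^sup>2) \<partial>M) = (\<integral>\<^sup>+\<omega>. liminf (\<lambda>n. ennreal (Z n \<omega>)) \<partial>M)"
    by (rule nn_integral_cong_AE)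
  also have "\<dots> \<le> liminf (\<lambda>n. \<integral>\<^sup>+\<omega>. ennreal (Z n \<omega>) \<partial>M)"
    by (rule nn_integral_liminf) simp
  also have "\<dots> \<le> liminf (\<lambda>n::nat. ennreal (ES / l 0))"
  proof (rule Liminf_mono, rule always_eventually, rule allI)
    fix n
    have "(\<integral>\<^sup>+\<omega>. ennreal (Z n \<omega>) \<partial>M) = ennreal (expectation (Z n))"
      using partial_variance[of n] by (intro nn_integral_eq_integral) (auto simp: Z_def[abs_def])
    also have "\<dots> \<le> ennreal (ES / l 0)" using partial_variance[of n] sum_sq_le[of n] by (intro ennreal_leI) (simp add: Z_def[abs_def])
    finally show "(\<integral>\<^sup>+\<omega>. ennreal (Z n \<omega>) \<partial>M) \<le> ennreal (ES / l 0)" .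
  qed
  also have "\<dots> = ennreal (ES / l 0)" by (simp add: Liminf_const)
  finally have le: "(\<integral>\<^sup>+\<omega>. ennreal ((S \<omega> - ES)\<^sup>2) \<partial>M) \<le> ennreal (ES / l 0)" .
  then have "(\<integral>\<^sup>+\<omega>. ennreal ((S \<omega> - ES)\<^sup>2) \<partial>M) < \<infinity>" by (rule le_less_trans) simp
  then show i: "integrable M (\<lambda>\<omega>. (S \<omega> - ES)\<^sup>2)" by (intro integrableI_nonneg) auto
  have "ennreal (expectation (\<lambda>\<omega>. (S \<omega> - ES)\<^sup>2)) \<le> ennreal (ES / l 0)"
    using le nn_integral_eq_integral[OF i] by simp
  then show "expectation (\<lambda>\<omega>. (S \<omega> - ES)\<^sup>2) \<le> ES / l 0"
    using ES_pos l_pos[of 0] by (simp add: ennreal_le_iff)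
qed

lemma cantelli:
  fixes Z :: "'q \<Rightarrow> real"
  assumes Z: "integrable M Z" "expectation Z = 0" and Z2: "integrable M (\<lambda>\<omega>. (Z \<omega>)\<^sup>2)" "expectation (\<lambda>\<omega>. (Z \<omega>)\<^sup>2) \<le> v"
    and v: "0 < v" and a: "0 < a"
  shows "prob {\<omega>\<in>space M. a \<le> Z \<omega>} \<le> v / (v + a\<^sup>2)"
proof -
  \<comment> \<open>Markov's inequality is applied to the square of Z + b; this shift minimises (v +
    b^2) / (a + b)^2.\<close>
  define b where "b = v / a"
  have b: "0 < b" using v a by (simp add: b_def)
  have [measurable]: "Z \<in> borel_measurable M" using Z by auto
  have i: "integrable M (\<lambda>\<omega>. (Z \<omega> + b)\<^sup>2)" unfolding power2_sum using Z Z2 by simp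
  have "prob {\<omega>\<in>space M. (a + b)\<^sup>2 \<le> (Z \<omega> + b)\<^sup>2} \<le> expectation (\<lambda>\<omega>. (Z \<omega> + b)\<^sup>2) / (a + b)\<^sup>2"
    by (rule integral_Markov_inequality_measure[OF i, where A="space M"]) (use a b in auto)
  also have "expectation (\<lambda>\<omega>. (Z \<omega> + b)\<^sup>2) = expectation (\<lambda>\<omega>. (Z \<omega>)\<^sup>2) + b\<^sup>2"
    unfolding power2_sum using Z Z2 by (simp add: prob_space)
  also have "(expectation (\<lambda>\<omega>. (Z \<omega>)\<^sup>2) + b\<^sup>2) / (a + b)\<^sup>2 \<le> (v + b\<^sup>2) / (a + b)\<^sup>2"
    using Z2 by (intro divide_right_mono) auto
  also have "\<dots> = v / (v + a\<^sup>2)"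
  proof -
    have "v + b\<^sup>2 = v * (a\<^sup>2 + v) / a\<^sup>2" "(a + b)\<^sup>2 = (a\<^sup>2 + v)\<^sup>2 / a\<^sup>2"
      using a by (simp_all add: b_def field_simps power2_eq_square)
    moreover have "0 < a\<^sup>2 + v" using a v by (simp add: add_nonneg_pos)
    ultimately show ?thesis using a by (simp add: power2_eq_square add.commute)
  qed
  finally have 1: "prob {\<omega>\<in>space M. (a + b)\<^sup>2 \<le> (Z \<omega> + b)\<^sup>2} \<le> v / (v + a\<^sup>2)" .
  have "prob {\<omega>\<in>space M. a \<le> Z \<omega>} \<le> prob {\<omega>\<in>space M. (a + b)\<^sup>2 \<le> (Z \<omega> + b)\<^sup>2}"
    by (rule finite_measure_mono) (use a b in \<open>auto intro!: power_mono\<close>)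
  with 1 show ?thesis by simp
qed

lemma tail_ratio: "0 < c \<Longrightarrow> (ES / l 0) / (ES / l 0 + (c * ES)\<^sup>2) = 1 / (1 + c\<^sup>2 * l 0 * ES)"
proof -
  assume c: "0 < c"
  have "ES / l 0 + (c * ES)\<^sup>2 = (ES / l 0) * (1 + c\<^sup>2 * l 0 * ES)"
    using l_pos[of 0] by (simp add: field_simps power2_eq_square)
  then show ?thesis using ES_pos l_pos[of 0] by simp
qed

lemma upper_tail: assumes c: "0 < c" shows "prob {\<omega>\<in>space M. (1 + c) * ES \<le> S \<omega>} \<le> 1 / (1 + c\<^sup>2 * l 0 * ES)"
proof -
  have "prob {\<omega>\<in>space M. c * ES \<le> S \<omega> - ES} \<le> (ES / l 0) / (ES / l 0 + (c * ES)\<^sup>2)"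
    by (rule cantelli) (use S_integral S_variance ES_pos l_pos c in \<open>auto simp: prob_space\<close>)
  then show ?thesis using tail_ratio[OF c] by (simp add: algebra_simps)
qed

lemma lower_tail: assumes c: "0 < c" shows "prob {\<omega>\<in>space M. S \<omega> \<le> (1 - c) * ES} \<le> 1 / (1 + c\<^sup>2 * l 0 * ES)"
proof -
  have "prob {\<omega>\<in>space M. c * ES \<le> ES - S \<omega>} \<le> (ES / l 0) / (ES / l 0 + (c * ES)\<^sup>2)"
    by (rule cantelli) (use S_integral S_variance ES_pos l_pos c in \<open>auto simp: prob_space power2_commute[of ES]\<close>)
  then show ?thesis using tail_ratio[OF c] by (simp add: algebra_simps)
qed

lemma tail_ge: assumes "0 \<le> t" shows "exp (- (l 0 * t)) \<le> prob {\<omega>\<in>space M. t < S \<omega>}"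
proof -
  have "prob {\<omega>\<in>space M. t < V 0 \<omega>} = exp (- t * l 0)"
    by (rule exponential_distributedD_gt[OF V_exp assms l_pos]) 
  moreover have "prob {\<omega>\<in>space M. t < V 0 \<omega>} \<le> prob {\<omega>\<in>space M. t < S \<omega>}"
    by (rule finite_measure_mono_AE) (use S_ge in \<open>auto elim: eventually_mono\<close>)
  ultimately show ?thesis by (simp add: mult.commute)
qed

lemma markov_tail: assumes "0 < t" shows "prob {\<omega>\<in>space M. t \<le> S \<omega>} \<le> ES / t"
  using integral_Markov_inequality_measure[OF S_integral(1), of "space M" t] S_nonneg assms S_integral(2) by simp

lemma laplace_V: assumes "0 < \<mu>" shows "expectation (\<lambda>\<omega>. exp (- (\<mu> * V j \<omega>))) = 1 / (1 + \<mu> / l j)"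
proof -
  have "expectation (\<lambda>\<omega>. exp (- (\<mu> * V j \<omega>))) = (\<integral>x. exponential_density (l j) x * exp (- (\<mu> * x)) \<partial>lborel)"
    by (rule distributed_integral[OF V_exp, symmetric]) (use l_pos[of j] exponential_density_nonneg in auto)
  also have "\<dots> = (\<integral>x. (l j / (l j + \<mu>)) * (exponential_density (l j + \<mu>) x * 1) \<partial>lborel)"
    using l_pos[of j] assms
    by (intro Bochner_Integration.integral_cong) (auto simp: exponential_density_def mult_exp_exp field_simps)
  also have "\<dots> = (l j / (l j + \<mu>)) * (\<integral>x. 1 \<partial>exp_law (l j + \<mu>))"
    using l_pos[of j] assms by (subst integral_exp_law) auto
  also have "(\<integral>x. 1 \<partial>exp_law (l j + \<mu>)) = (1::real)"
    using prob_space.prob_space[OF exp_law_prob[of "l j + \<mu>"]] l_pos[of j] assms by simp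
  finally show ?thesis using l_pos[of j] assms by (simp add: field_simps)
qed

lemma laplace_S:
  assumes \<mu>: "0 < \<mu>"
  shows "(\<lambda>n. \<Prod>j<n. 1 / (1 + \<mu> / l j)) \<longlonglongrightarrow> expectation (\<lambda>\<omega>. exp (- (\<mu> * S \<omega>)))"
proof -
  have "(\<lambda>n. expectation (\<lambda>\<omega>. exp (- (\<mu> * (\<Sum>j<n. V j \<omega>))))) \<longlonglongrightarrow> expectation (\<lambda>\<omega>. exp (- (\<mu> * S \<omega>)))"
  proof (rule integral_dominated_convergence[where w="\<lambda>_. 1"])
    show "AE \<omega> in M. (\<lambda>n. exp (- (\<mu> * (\<Sum>j<n. V j \<omega>)))) \<longlonglongrightarrow> exp (- (\<mu> * S \<omega>))"
      using V_summable
    proof eventually_elim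
      case (elim \<omega>)
      then have "(\<lambda>n. \<Sum>j<n. V j \<omega>) \<longlonglongrightarrow> S \<omega>" using summable_LIMSEQ by (simp add: S_def)
      then show ?case by (intro tendsto_intros)
    qed
    show "AE \<omega> in M. norm (exp (- (\<mu> * (\<Sum>j<n. V j \<omega>)))) \<le> 1" for n
      using V_all_nonneg by eventually_elim (use \<mu> in \<open>auto intro!: mult_nonneg_nonneg sum_nonneg\<close>)
  qed auto
  moreover have "expectation (\<lambda>\<omega>. exp (- (\<mu> * (\<Sum>j<n. V j \<omega>)))) = (\<Prod>j<n. 1 / (1 + \<mu> / l j))" for n
  proof -
    have i: "indep_vars (\<lambda>_. borel) (\<lambda>j \<omega>. exp (- (\<mu> * V j \<omega>))) {..<n}"
      by (rule indep_vars_subset[OF indep_vars_compose2[OF indep]]) auto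
    have int: "integrable M (\<lambda>\<omega>. exp (- (\<mu> * V j \<omega>)))" for j
      by (rule integrable_const_bound[where B=1]) (use V_nonneg[of j] \<mu> in \<open>auto elim!: eventually_mono\<close>)
    have "expectation (\<lambda>\<omega>. exp (- (\<mu> * (\<Sum>j<n. V j \<omega>)))) = expectation (\<lambda>\<omega>. \<Prod>j<n. exp (- (\<mu> * V j \<omega>)))"
      by (simp add: exp_sum[symmetric] sum_distrib_left sum_negf)
    also have "\<dots> = (\<Prod>j<n. expectation (\<lambda>\<omega>. exp (- (\<mu> * V j \<omega>))))"
      by (rule indep_vars_lebesgue_integral[OF _ i int]) simp
    also have "\<dots> = (\<Prod>j<n. 1 / (1 + \<mu> / l j))" by (simp add: laplace_V[OF \<mu>])
    finally show ?thesis .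
  qed
  ultimately show ?thesis by simp
qed

definition cdfS :: "real \<Rightarrow> real" where "cdfS t = prob {\<omega>\<in>space M. S \<omega> \<le> t}"

lemma cdfS_mono: "s \<le> t \<Longrightarrow> cdfS s \<le> cdfS t"
  unfolding cdfS_def by (rule finite_measure_mono) auto

lemma cdfS_meas[measurable]: "cdfS \<in> borel_measurable borel"
  by (rule borel_measurable_mono) (simp add: mono_def cdfS_mono)

text \<open>Both sides are the probability that \<open>S\<close> does not exceed an independent
  exponential time, computed by conditioning on one or on the other.\<close>

lemma laplace_cdfS:
  assumes \<mu>: "0 < \<mu>"
  shows "(\<integral>t. cdfS t \<partial>exp_law \<mu>) = expectation (\<lambda>\<omega>. exp (- (\<mu> * S \<omega>)))"
proof -
  interpret E: prob_space "exp_law \<mu>" by (rule exp_law_prob[OF \<mu>])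
  interpret pair_sigma_finite M "exp_law \<mu>" by unfold_locales
  interpret EP: pair_prob_space M "exp_law \<mu>" by unfold_locales
  have m[measurable]: "(\<lambda>(\<omega>, t). indicator {S \<omega>..} t :: real) \<in> borel_measurable (M \<Otimes>\<^sub>M exp_law \<mu>)"
  proof -
    have "(\<lambda>(\<omega>, t). if S \<omega> \<le> t then 1 else 0 :: real) \<in> borel_measurable (M \<Otimes>\<^sub>M lborel)" by measurable
    then show ?thesis by (simp add: indicator_def[abs_def] case_prod_beta' cong: measurable_cong_sets sets_pair_measure_cong)
  qed
  have i: "integrable (M \<Otimes>\<^sub>M exp_law \<mu>) (\<lambda>(\<omega>, t). indicator {S \<omega>..} t :: real)"
    by (rule EP.integrable_const_bound[where B=1]) (use m in \<open>auto simp: indicator_def\<close>)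
  have "(\<integral>t. cdfS t \<partial>exp_law \<mu>) = (\<integral>t. (\<integral>\<omega>. indicator {S \<omega>..} t \<partial>M) \<partial>exp_law \<mu>)"
  proof (intro Bochner_Integration.integral_cong refl)
    fix t
    have "cdfS t = (\<integral>\<omega>. indicator {\<omega>\<in>space M. S \<omega> \<le> t} \<omega> \<partial>M)" by (simp add: cdfS_def)
    also have "\<dots> = (\<integral>\<omega>. indicator {S \<omega>..} t \<partial>M)"
      by (intro Bochner_Integration.integral_cong) (auto simp: indicator_def)
    finally show "cdfS t = (\<integral>\<omega>. indicator {S \<omega>..} t \<partial>M)" .
  qed
  also have "\<dots> = (\<integral>\<omega>. (\<integral>t. indicator {S \<omega>..} t \<partial>exp_law \<mu>) \<partial>M)"
    by (rule Fubini_integral[OF i])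
  also have "\<dots> = expectation (\<lambda>\<omega>. exp (- (\<mu> * S \<omega>)))"
  proof (rule integral_cong_AE)
    show "AE \<omega> in M. (\<integral>t. indicator {S \<omega>..} t \<partial>exp_law \<mu>) = exp (- (\<mu> * S \<omega>))"
      using S_nonneg
    proof eventually_elim
      case (elim \<omega>)
      have i1: "integrable (exp_law \<mu>) (indicator {..<S \<omega>} :: real \<Rightarrow> real)"
        by (rule exp_law_bounded_integrable[OF \<mu>, where B=1]) auto
      have "(\<integral>t. indicator {S \<omega>..} t \<partial>exp_law \<mu>) = (\<integral>t. (1 - indicator {..<S \<omega>} t :: real) \<partial>exp_law \<mu>)"
        by (intro Bochner_Integration.integral_cong) (auto simp: indicator_def)
      also have "\<dots> = (\<integral>t. 1 \<partial>exp_law \<mu>) - (\<integral>t. indicator {..<S \<omega>} t \<partial>exp_law \<mu>)"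
        by (rule Bochner_Integration.integral_diff[OF _ i1]) simp
      also have "\<dots> = exp (- (\<mu> * S \<omega>))"
        unfolding exp_law_indicator[OF \<mu> elim] using E.prob_space by simp
      finally show ?case .
    qed
    show "(\<lambda>\<omega>. \<integral>t. (indicator {S \<omega>..} t :: real) \<partial>exp_law \<mu>) \<in> borel_measurable M"
      by (rule E.borel_measurable_lebesgue_integral[OF m])
  qed simp
  finally show ?thesis .
qed

end

section \<open>The separation\<close>

context dual_diffusion begin

lemma r_ge: "0 \<le> r" using r_pos by simp

lemma T_max: "PX.T (max 0 t) f x = PX.T t f x" "PD.T (max 0 t) h x = PD.T t h x"
  by (simp_all add: PX.T_def PD.T_def)

lemma T_link': "continuous_on {0..r} f \<Longrightarrow> PX.T t f 0 = PD.T t (\<Lambda> f) 0"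
  using T_link[of f "max 0 t"] by (simp add: T_max)

lemma mint_le_M:
  assumes f: "continuous_on {0..r} f" "\<And>x. 0 \<le> x \<Longrightarrow> x \<le> r \<Longrightarrow> f x \<le> 1" and x: "0 \<le> x" "x \<le> r"
  shows "string.mint f x \<le> M x"
proof -
  have "string.mint f x - string.mint f 0 \<le> M x - M 0"
  proof (rule antideriv_on_le[OF string.mint[OF f(1)] M_antideriv])
    show "m y * f y \<le> m y" if "0 < y" "y < r" for y using f(2)[of y] m_pos[OF that] that by simp
  qed (use x in auto)
  then show ?thesis using antideriv_onD(2)[OF string.mint[OF f(1)]] antideriv_onD(2)[OF M_antideriv] by simp
qed

lemma link_nonneg:
  assumes f: "continuous_on {0..r} f" "\<And>x. 0 \<le> x \<Longrightarrow> x \<le> r \<Longrightarrow> 0 \<le> f x" and x: "0 \<le> x" "x \<le> r"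
  shows "0 \<le> \<Lambda> f x"
proof (cases "x = 0")
  case True
  then show ?thesis using f(2)[of 0] r_ge by (simp add: dual_link_0)
next
  case False
  then show ?thesis using dual_link_eq[OF f(1), of x] string.mint_nonneg[OF f x] M_ge[OF x] x by simp
qed

lemma link_le_1:
  assumes f: "continuous_on {0..r} f" "\<And>x. 0 \<le> x \<Longrightarrow> x \<le> r \<Longrightarrow> f x \<le> 1" and x: "0 \<le> x" "x \<le> r"
  shows "\<Lambda> f x \<le> 1"
proof (cases "x = 0")
  case True
  then show ?thesis using f(2)[of 0] r_ge by (simp add: dual_link_0)
next
  case False
  then show ?thesis using dual_link_eq[OF f(1), of x] mint_le_M[OF f x] string.M_pos[of x] x by (simp add: divide_le_eq)
qed

text \<open>Continuous functions decreasing to the indicator of 0. Their value at 0 stays 1 while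
  their stationary mass tends to 0, so they detect an atom of the dual at 0.\<close>

definition hat :: "nat \<Rightarrow> real \<Rightarrow> real" where "hat n x = max 0 (1 - real (Suc n) * x)"

lemma hat_props: "continuous_on A (hat n)" "0 \<le> hat n x" "0 \<le> x \<Longrightarrow> hat n x \<le> 1" "hat n 0 = 1"
  unfolding hat_def[abs_def] by (auto intro!: continuous_intros)

lemma hat_lim: assumes "0 < x" shows "(\<lambda>n. hat n x) \<longlonglongrightarrow> 0"
proof (rule tendsto_eventually)
  obtain N :: nat where N: "1 / x < real N" using reals_Archimedean2 by blast
  show "\<forall>\<^sub>F n in sequentially. hat n x = 0"
    unfolding eventually_sequentially
  proof (intro exI allI impI)
    fix n assume "N \<le> n"
    then have "1 / x < real (Suc n)" using N by (meson le_SucI less_le_trans of_nat_le_iff)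
    then have "1 < real (Suc n) * x" using assms by (simp add: divide_less_eq)
    then show "hat n x = 0" by (simp add: hat_def)
  qed
qed

lemma stat_AE: "AE y in \<pi>. 0 < y \<and> y < r"
proof -
  have "stat_dens r a b y = 0" if "\<not> (0 < y \<and> y < r)" for y
    using that by (auto simp: stat_dens_def indicator_def)
  then have "AE y in lborel. 0 < ennreal (stat_dens r a b y) \<longrightarrow> 0 < y \<and> y < r" by (intro AE_I2) (metis ennreal_0 less_irrefl)
  moreover have "(\<lambda>y. ennreal (stat_dens r a b y)) \<in> borel_measurable lborel"
    using stat_dens_meas by (intro measurable_compose[OF _ measurable_ennreal]) simp
  ultimately show ?thesis unfolding stat_measure_def by (simp only: AE_density)
qed

lemma hat_mint_lim: "(\<lambda>n. string.mint (hat n) r) \<longlonglongrightarrow> 0"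
proof -
  interpret \<pi>: prob_space \<pi> by (rule stat_prob)
  have "(\<lambda>n. \<integral>y. hat n (PX.clip y) \<partial>\<pi>) \<longlonglongrightarrow> (\<integral>y. 0 \<partial>\<pi>)"
  proof (rule integral_dominated_convergence[where w="\<lambda>_. 1"])
    show "AE y in \<pi>. (\<lambda>n. hat n (PX.clip y)) \<longlonglongrightarrow> 0"
      using stat_AE by eventually_elim (simp add: PX.clip_id hat_lim)
    show "(\<lambda>y. hat n (PX.clip y)) \<in> borel_measurable \<pi>" for n
      using PX.meas_clip[OF hat_props(1)] by (simp add: measurable_cong_sets[OF stat_sets(1) refl])
    show "AE y in \<pi>. norm (hat n (PX.clip y)) \<le> 1" for n
    proof (rule AE_I2)
      fix y
      have "0 \<le> PX.clip y" using PX.clip_in[of y] by simp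
      then show "norm (hat n (PX.clip y)) \<le> 1" using hat_props(2,3) by simp
    qed
  qed auto
  moreover have "(\<integral>y. hat n (PX.clip y) \<partial>\<pi>) = string.mint (hat n) r / M r" for n
    by (rule stat_integral_mint[OF hat_props(1) PX.meas_clip[OF hat_props(1)]]) (simp add: PX.clip_id)
  ultimately have "(\<lambda>n. string.mint (hat n) r / M r * M r) \<longlonglongrightarrow> 0 * M r" by (intro tendsto_mult tendsto_const) simp
  then show ?thesis using string.Mr by simp
qed

text \<open>The probability that the dual started at 0 is at 0 at time \<open>t\<close>. It has to
  be shown to vanish for positive \<open>t\<close>, since the link from 0 is a point mass and has no
  density with respect to the stationary law.\<close>

definition p0 :: "real \<Rightarrow> real" where "p0 t = PD.T t (\<lambda>x. if x = 0 then 1 else 0) 0"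

lemma clip_meas[measurable]: "PD.clip \<in> borel_measurable borel"
  by (rule borel_measurable_continuous_onI[OF PD.clip_cont])

lemma point_bm: "PD.bm (\<lambda>x. if x = c then d else 0)" and point_meas: "(\<lambda>x. if PD.clip x = c then d else (0::real)) \<in> borel_measurable borel"
proof -
  show m: "(\<lambda>x. if PD.clip x = c then d else (0::real)) \<in> borel_measurable borel" by measurable
  show "PD.bm (\<lambda>x. if x = c then d else 0)" unfolding PD.bm_def using m by (auto intro!: exI[of _ "\<bar>d\<bar>"])
qed

text \<open>For x > 0 the average \<Lambda> (h n) x is at most the total mass divided by
  \<open>M x\<close> and tends to 0, while at x = 0 it is \<open>h n 0\<close>. So \<Lambda> (h n)
  converges boundedly to \<open>c\<close> times the indicator of 0.\<close>

lemma T_concentrating: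
  assumes h: "\<And>n. continuous_on {0..r} (h n)" "\<And>n x. 0 \<le> x \<Longrightarrow> x \<le> r \<Longrightarrow> 0 \<le> h n x" "\<And>n x. 0 \<le> x \<Longrightarrow> x \<le> r \<Longrightarrow> h n x \<le> 1"
    and lim: "(\<lambda>n. string.mint (h n) r) \<longlonglongrightarrow> 0" "(\<lambda>n. h n 0) \<longlonglongrightarrow> c"
  shows "(\<lambda>n. PX.T t (h n) 0) \<longlonglongrightarrow> c * p0 t"
proof -
  have "(\<lambda>n. PD.T t (\<Lambda> (h n)) 0) \<longlonglongrightarrow> PD.T t (\<lambda>x. if x = 0 then c else 0) 0"
  proof (rule PD.T_dominated[OF _ _ PD.cont_bm[OF link_cont[OF h(1)]] point_meas, where B=1])
    show "\<bar>\<Lambda> (h n) x\<bar> \<le> 1" if "0 \<le> x" "x \<le> r" for n x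
      using link_nonneg[OF h(1,2) that] link_le_1[OF h(1,3) that] by simp
    show "(\<lambda>n. \<Lambda> (h n) x) \<longlonglongrightarrow> (if x = 0 then c else 0)" if x: "0 \<le> x" "x \<le> r" for x
    proof (cases "x = 0")
      case True
      then show ?thesis using lim(2) by (simp add: dual_link_0)
    next
      case False
      then have x0: "0 < x" using x by simp
      have "(\<lambda>n. \<Lambda> (h n) x) \<longlonglongrightarrow> 0"
      proof (rule tendsto_sandwich[where f="\<lambda>_. 0" and h="\<lambda>n. string.mint (h n) r / M x"])
        show "\<forall>\<^sub>F n in sequentially. 0 \<le> \<Lambda> (h n) x" using link_nonneg[OF h(1,2) x] by simp
        show "\<forall>\<^sub>F n in sequentially. \<Lambda> (h n) x \<le> string.mint (h n) r / M x"
        proof (rule always_eventually, rule allI)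
          fix n
          have "string.mint (h n) x \<le> string.mint (h n) r" by (rule string.mint_mono[OF h(1,2)]) (use x in auto)
          then show "\<Lambda> (h n) x \<le> string.mint (h n) r / M x"
            unfolding dual_link_eq[OF h(1) x0 x(2)] by (rule divide_right_mono) (rule M_ge[OF x])
        qed
        show "(\<lambda>n. string.mint (h n) r / M x) \<longlonglongrightarrow> 0" using tendsto_divide_zero[OF lim(1)] .
      qed simp
      then show ?thesis using False by simp
    qed
  qed (use r_ge in auto)
  moreover have "PD.T t (\<lambda>x. if x = 0 then c else 0) 0 = c * p0 t"
  proof -
    have "PD.T t (\<lambda>x. if x = 0 then c else 0) 0 = PD.T t (\<lambda>x. c * (if x = 0 then 1 else 0)) 0"
      by (rule PD.T_cong) simp
    then show ?thesis by (simp add: p0_def PD.T_def)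
  qed
  ultimately show ?thesis by (simp add: T_link'[OF h(1)])
qed

lemma T_hat_lim: "(\<lambda>n. PX.T t (hat n) 0) \<longlonglongrightarrow> p0 t"
  using T_concentrating[of hat 1 t] hat_props hat_mint_lim by simp

lemma p0_bounds: "0 \<le> p0 t" "p0 t \<le> 1"
proof -
  have "\<bar>p0 t\<bar> \<le> 1" unfolding p0_def by (rule PD.T_abs_le[OF point_bm]) (use r_ge in auto)
  then show "p0 t \<le> 1" by simp
  show "0 \<le> p0 t" unfolding p0_def by (rule PD.T_nonneg[OF point_bm]) simp
qed

text \<open>\<open>T_concentrating\<close> is applied to \<open>PX.T t (hat n)\<close>: stationarity
  keeps the mass of \<open>hat n\<close>, and the value at 0 tends to \<open>p0 t\<close>.\<close>

lemma p0_mult: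
  assumes "0 \<le> s'" "0 \<le> t" shows "p0 (s' + t) = p0 t * p0 s'"
proof -
  have "(\<lambda>n. PX.T s' (PX.T t (hat n)) 0) \<longlonglongrightarrow> p0 t * p0 s'"
  proof (rule T_concentrating)
    show "continuous_on {0..r} (PX.T t (hat n))" for n by (rule PX.T_cont_x[OF hat_props(1)])
    show "0 \<le> PX.T t (hat n) x" for n x by (rule PX.T_nonneg[OF PX.cont_bm[OF hat_props(1)]]) (rule hat_props(2))
    show "PX.T t (hat n) x \<le> 1" if x: "0 \<le> x" "x \<le> r" for n x
    proof -
      have "\<bar>PX.T t (hat n) x\<bar> \<le> 1" by (rule PX.T_abs_le[OF PX.cont_bm[OF hat_props(1)] _ x]) (use hat_props in auto)
      then show ?thesis by simp
    qed
    show "(\<lambda>n. string.mint (PX.T t (hat n)) r) \<longlonglongrightarrow> 0"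
      using hat_mint_lim stationary[OF hat_props(1) assms(2)] by simp
  qed (rule T_hat_lim)
  moreover have "PX.T s' (PX.T t (hat n)) 0 = PX.T (s' + t) (hat n) 0" for n
    using PX.T_add[OF hat_props(1) assms, of 0 n] r_ge by simp
  ultimately have "(\<lambda>n. PX.T (s' + t) (hat n) 0) \<longlonglongrightarrow> p0 t * p0 s'" by simp
  then show ?thesis using LIMSEQ_unique T_hat_lim by blast
qed

text \<open>If \<open>p0 t > 0\<close>, the resolvent at \<open>0\<close> of every hat function would be bounded below, hence by the
  resolvent equation so would its speed mass, which tends to \<open>0\<close>.\<close>

lemma p0_eq_0:
  assumes t: "0 < t" shows "p0 t = 0"
proof (rule ccontr)
  assume "p0 t \<noteq> 0"
  then have pt: "0 < p0 t" using p0_bounds(1)[of t] by simp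
  have ps: "p0 t \<le> p0 u" if "0 \<le> u" "u \<le> t" for u
  proof -
    have "p0 t = p0 (t - u) * p0 u" using p0_mult[of u "t - u"] that by simp
    also have "\<dots> \<le> 1 * p0 u" by (intro mult_right_mono p0_bounds)
    finally show ?thesis by simp
  qed
  \<comment> \<open>\<open>1 - exp (- t)\<close> is the probability that a rate one exponential time
    falls before \<open>t\<close>; up to then \<open>p0\<close> is at least
    \<open>p0 t\<close>.\<close>
  define c where "c = p0 t * (1 - exp (- t))"
  have c: "0 < c" using pt t by (simp add: c_def)
  have ge: "p0 u \<le> PX.T u (hat n) 0" for u n
    unfolding T_link'[OF hat_props(1)] p0_def
  proof (rule PD.T_mono[OF point_bm PD.cont_bm[OF link_cont[OF hat_props(1)]]])
    fix y assume "0 \<le> y" "y \<le> r"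
    then show "(if y = 0 then 1 else 0) \<le> \<Lambda> (hat n) y"
      using link_nonneg[of "hat n" y] hat_props by (auto simp: dual_link_0)
  qed (use r_ge in auto)
  have Nge: "c \<le> PX.N 1 (hat n) 0" for n
  proof -
    have i1: "integrable (exp_law 1) (\<lambda>u. indicator {..<t} u * p0 t)"
      by (rule exp_law_bounded_integrable[where B="p0 t"]) (use pt in \<open>auto simp: indicator_def\<close>)
    have "c = (\<integral>u. indicator {..<t} u * p0 t \<partial>exp_law 1)"
      using exp_law_indicator[of 1 t] t unfolding c_def integral_mult_left_zero by (simp add: mult.commute)
    also have "\<dots> \<le> (\<integral>u. PX.T u (hat n) 0 \<partial>exp_law 1)"
    proof (rule integral_mono_AE[OF i1 PX.T_exp_integrable[OF _ hat_props(1)]])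
      show "AE u in exp_law 1. indicator {..<t} u * p0 t \<le> PX.T u (hat n) 0"
        using exp_law_AE
      proof eventually_elim
        case (elim u)
        show ?case
        proof (cases "u < t")
          case True
          then show ?thesis using ge[of u n] ps[of u] elim by simp
        next
          case False
          then show ?thesis using ge[of u n] p0_bounds(1)[of u] by simp
        qed
      qed
    qed (use r_ge in auto)
    finally show ?thesis by (simp add: PX.N_def)
  qed
  obtain x0 where x0: "0 < x0" "x0 < r" "U x0 < c / 2" using string.ex_small_U[of "c / 2"] c by auto
  have "c / 2 * M x0 \<le> string.mint (hat n) r" for n
  proof -
    have R: "string.resolvent_eq 1 (hat n) (PX.N 1 (hat n))"
      using resolvent_eq_N[of 1 "hat n"] hat_props(1) by simp
    have N0: "0 \<le> PX.N 1 (hat n) x" for x by (rule PX.N_nonneg[OF hat_props(1)]) (rule hat_props(2))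
    have N1: "PX.N 1 (hat n) x \<le> 1" if "0 \<le> x" "x \<le> r" for x
    proof -
      have "\<bar>PX.N 1 (hat n) x\<bar> \<le> 1" by (rule PX.N_abs_le[OF _ hat_props(1) that]) (use hat_props in auto)
      then show ?thesis by simp
    qed
    have "1 * (c / 2 * M x0) \<le> string.mint (hat n) r"
    proof (rule string.resolvent_eq_mass_ge[OF R])
      show "\<bar>1 * PX.N 1 (hat n) x - hat n x\<bar> \<le> 1" if x: "0 \<le> x" "x \<le> r" for x
        using N0[of x] N1[OF x] hat_props(2)[of n x] hat_props(3)[OF x(1), of n] by (simp add: abs_le_iff)
    qed (use N0 Nge x0 in auto)
    then show ?thesis by simp
  qed
  then have "c / 2 * M x0 \<le> 0" by (intro LIMSEQ_le_const[OF hat_mint_lim]) auto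
  moreover have "0 < c / 2 * M x0" using c string.M_pos[of x0] x0 by simp
  ultimately show False by simp
qed

text \<open>Points approaching \<open>r\<close>; the offset 2 keeps them in the right half, as
  \<open>resolvent_eq_delta\<close> requires. The functions \<open>bump\<close> live beyond them and
  have mass \<open>M r\<close>, so they are probability densities with respect to the stationary law
  that concentrate at \<open>r\<close>.\<close>

definition bx :: "nat \<Rightarrow> real" where "bx n = r - r / real (n + 2)"
definition bump :: "nat \<Rightarrow> real \<Rightarrow> real" where
  "bump n x = M r / string.mint (\<lambda>x. max 0 (x - bx n)) r * max 0 (x - bx n)"

lemma bx: "r / 2 \<le> bx n" "bx n < r" "bx \<longlonglongrightarrow> r"
proof -
  have "r / real (n + 2) \<le> r / 2" using r_pos by (intro divide_left_mono) auto
  then show "r / 2 \<le> bx n" by (simp add: bx_def)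
  show "bx n < r" using r_pos by (simp add: bx_def)
  have "(\<lambda>n. r / real (n + 2)) \<longlonglongrightarrow> 0"
    using LIMSEQ_ignore_initial_segment[OF lim_const_over_n[of r], of 2] by simp
  from tendsto_diff[OF tendsto_const this, of r] show "bx \<longlonglongrightarrow> r" by (simp add: bx_def[abs_def])
qed

lemma ramp_cont: "continuous_on A (\<lambda>x. max 0 (x - bx n))" by (intro continuous_intros)

lemma ramp_mint_pos: "0 < string.mint (\<lambda>x. max 0 (x - bx n)) r"
proof -
  note a = antideriv_onD[OF string.mint[OF ramp_cont[of "{0..r}" n]]]
  have b0: "0 \<le> bx n" using bx(1)[of n] r_pos by simp
  have "string.mint (\<lambda>x. max 0 (x - bx n)) (bx n) < string.mint (\<lambda>x. max 0 (x - bx n)) r"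
  proof (rule DERIV_pos_imp_increasing_open[OF bx(2)])
    fix x assume x: "bx n < x" "x < r"
    have x0: "0 < x" using x b0 by simp
    have "0 < m x * max 0 (x - bx n)" using m_pos[OF x0 x(2)] x by simp
    then show "\<exists>y. (string.mint (\<lambda>x. max 0 (x - bx n)) has_real_derivative y) (at x) \<and> 0 < y"
      using a(3)[OF x0 x(2)] by blast
  next
    show "continuous_on {bx n..r} (string.mint (\<lambda>x. max 0 (x - bx n)))"
      using b0 by (intro continuous_on_subset[OF a(1)]) auto
  qed
  moreover have "0 \<le> string.mint (\<lambda>x. max 0 (x - bx n)) (bx n)"
    by (rule string.mint_nonneg[OF ramp_cont]) (use b0 bx(2)[of n] in auto)
  ultimately show ?thesis by simp
qed

lemma bump_props: "continuous_on A (bump n)" "0 \<le> bump n x" "x \<le> bx n \<Longrightarrow> bump n x = 0"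
  "string.mint (bump n) r = M r"
proof -
  show c: "continuous_on A (bump n)" for A unfolding bump_def[abs_def] by (intro continuous_intros)
  show "0 \<le> bump n x" using ramp_mint_pos[of n] string.Mr by (simp add: bump_def)
  show "x \<le> bx n \<Longrightarrow> bump n x = 0" by (simp add: bump_def)
  have "string.mint (bump n) r = M r / string.mint (\<lambda>x. max 0 (x - bx n)) r * string.mint (\<lambda>x. max 0 (x - bx n)) r"
    by (rule antideriv_on_unique[OF string.mint[OF c] antideriv_on_cmult[OF string.mint[OF ramp_cont]]])
      (use r_ge in \<open>auto simp: bump_def\<close>)
  then show "string.mint (bump n) r = M r" using ramp_mint_pos[of n] by simp
qed

lemma bump_mint_0: assumes "0 \<le> x" "x \<le> bx n" shows "string.mint (bump n) x = 0"
proof -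
  have xr: "x \<le> r" using assms bx(2)[of n] by simp
  note a = antideriv_onD[OF string.mint[OF bump_props(1)[of "{0..r}" n]]]
  have "\<bar>string.mint (bump n) x - string.mint (bump n) 0\<bar> \<le> (\<lambda>_. 0) x - (\<lambda>_. 0) 0"
  proof (rule abs_deriv_le_imp_diff_le[where f'="\<lambda>y. m y * bump n y" and g'="\<lambda>_. 0" and f="string.mint (bump n)" and g="\<lambda>_. 0"])
    show "continuous_on {0..x} (string.mint (bump n))" using xr by (intro continuous_on_subset[OF a(1)]) auto
    fix y assume y: "0 < y" "y < x"
    show "(string.mint (bump n) has_real_derivative m y * bump n y) (at y)" using a(3)[of y] y xr by simp
    show "\<bar>m y * bump n y\<bar> \<le> 0" using bump_props(3)[of y n] y assms by simp
  qed (use assms in auto)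
  then show ?thesis using a(2) by simp
qed

lemma link_bump:
  shows "0 \<le> x \<Longrightarrow> x \<le> bx n \<Longrightarrow> \<Lambda> (bump n) x = 0" and "\<Lambda> (bump n) r = 1"
    and "0 \<le> x \<Longrightarrow> x \<le> r \<Longrightarrow> \<bar>\<Lambda> (bump n) x\<bar> \<le> M r / M (r / 2)"
proof -
  show z: "\<Lambda> (bump n) x = 0" if "0 \<le> x" "x \<le> bx n" for x
  proof (cases "x = 0")
    case True
    then show ?thesis using bump_props(3)[of 0 n] that by (simp add: dual_link_0)
  next
    case False
    then show ?thesis using dual_link_eq[OF bump_props(1), of x n] bump_mint_0[OF that] that bx(2)[of n] by simp
  qed
  show "\<Lambda> (bump n) r = 1"
    using dual_link_eq[OF bump_props(1), of r n] bump_props(4)[of n] r_pos string.Mr by simp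
  have M2: "0 < M (r / 2)" using string.M_pos[of "r / 2"] r_pos by simp
  show "\<bar>\<Lambda> (bump n) x\<bar> \<le> M r / M (r / 2)" if x: "0 \<le> x" "x \<le> r"
  proof (cases "x \<le> bx n")
    case True
    then show ?thesis using z[OF x(1)] M2 string.Mr by simp
  next
    case False
    then have x2: "r / 2 \<le> x" "0 < x" using bx(1)[of n] r_pos by auto
    have "string.mint (bump n) x / M x \<le> M r / M (r / 2)"
    proof (rule frac_le)
      show "string.mint (bump n) x \<le> M r"
        using string.mint_mono[OF bump_props(1,2), of x r n] x bump_props(4)[of n] by simp
      show "M (r / 2) \<le> M x" using M_mono[of "r / 2" x] x2 x r_pos by simp
    qed (use M2 string.Mr in auto)
    moreover have "0 \<le> \<Lambda> (bump n) x" by (rule link_nonneg[OF bump_props(1,2) x])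
    ultimately show ?thesis using dual_link_eq[OF bump_props(1) x2(2) x(2), of n] by simp
  qed
qed

text \<open>The function \<open>F\<close> of the overview: the probability that the dual started at
  0 is at \<open>r\<close>.\<close>

definition Fd :: "real \<Rightarrow> real" where "Fd t = PD.T t (\<lambda>x. if x = r then 1 else 0) 0"

lemma Fd_bounds: "0 \<le> Fd t" "Fd t \<le> 1"
proof -
  have "\<bar>Fd t\<bar> \<le> 1" unfolding Fd_def by (rule PD.T_abs_le[OF point_bm]) (use r_ge in auto)
  then show "Fd t \<le> 1" by simp
  show "0 \<le> Fd t" unfolding Fd_def by (rule PD.T_nonneg[OF point_bm]) simp
qed

text \<open>The link sends \<open>bump n\<close> to a function that vanishes up to
  \<open>bx n\<close> and equals 1 at \<open>r\<close>, so it converges boundedly to the indicator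
  of \<open>r\<close>.\<close>

lemma T_bump_lim: "(\<lambda>n. PX.T t (bump n) 0) \<longlonglongrightarrow> Fd t"
proof -
  have "(\<lambda>n. PD.T t (\<Lambda> (bump n)) 0) \<longlonglongrightarrow> Fd t"
    unfolding Fd_def
  proof (rule PD.T_dominated[OF _ _ PD.cont_bm[OF link_cont[OF bump_props(1)]] point_meas link_bump(3)])
    fix x assume x: "0 \<le> x" "x \<le> r"
    show "(\<lambda>n. \<Lambda> (bump n) x) \<longlonglongrightarrow> (if x = r then 1 else 0)"
    proof (cases "x = r")
      case True
      then show ?thesis by (simp add: link_bump(2))
    next
      case False
      then have "\<forall>\<^sub>F n in sequentially. x < bx n" using order_tendstoD(1)[OF bx(3), of x] x by simp
      then have "\<forall>\<^sub>F n in sequentially. \<Lambda> (bump n) x = 0" by eventually_elim (use link_bump(1) x in auto)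
      then show ?thesis using False by (simp add: tendsto_eventually)
    qed
  qed (use r_ge in auto)
  then show ?thesis by (simp add: T_link'[OF bump_props(1)])
qed

lemma Fd_meas[measurable]: "Fd \<in> borel_measurable borel"
  by (rule borel_measurable_LIMSEQ_real[OF T_bump_lim]) (rule PX.T_meas_t[OF bump_props(1)], use r_ge in auto)

text \<open>This reflects that \<open>r\<close> is absorbing for the dual. It is obtained from the
  primal side: \<open>PX.T t (bump n)\<close> keeps mass \<open>M r\<close>, so its image under the
  link is still 1 at \<open>r\<close> and nonnegative elsewhere.\<close>

lemma Fd_mono: assumes "0 \<le> s'" "0 \<le> t" shows "Fd s' \<le> Fd (s' + t)"
proof (rule LIMSEQ_le_const[OF T_bump_lim], intro exI allI impI)
  fix n
  have c: "continuous_on {0..r} (PX.T t (bump n))" by (rule PX.T_cont_x[OF bump_props(1)])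
  have nn: "0 \<le> PX.T t (bump n) x" for x by (rule PX.T_nonneg[OF PX.cont_bm[OF bump_props(1)]]) (rule bump_props(2))
  have "PX.T (s' + t) (bump n) 0 = PX.T s' (PX.T t (bump n)) 0" by (rule PX.T_add[OF bump_props(1) assms]) (use r_ge in auto)
  also have "\<dots> = PD.T s' (\<Lambda> (PX.T t (bump n))) 0" by (rule T_link'[OF c])
  also have "\<dots> \<ge> PD.T s' (\<lambda>x. if x = r then 1 else 0) 0"
  proof (rule PD.T_mono[OF point_bm PD.cont_bm[OF link_cont[OF c]]])
    fix y assume y: "0 \<le> y" "y \<le> r"
    have "\<Lambda> (PX.T t (bump n)) r = 1"
      using dual_link_eq[OF c, of r] stationary[OF bump_props(1) assms(2), of n] bump_props(4)[of n] r_pos string.Mr by simp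
    then show "(if y = r then 1 else 0) \<le> \<Lambda> (PX.T t (bump n)) y" using link_nonneg[OF c nn y] by simp
  qed (use r_ge in auto)
  finally show "Fd s' \<le> PX.T (s' + t) (bump n) 0" by (simp add: Fd_def)
qed

text \<open>The resolvent of \<open>bump n\<close> at 0 tends to the Green function between 0 and
  \<open>r\<close>, which \<open>resolvent_eq_delta\<close> evaluates as
  \<open>M r / vv \<mu> r\<close>; by \<open>Dfun_vv\<close> this is 1 / (\<mu> D \<mu>).\<close>

lemma laplace_Fd:
  assumes \<mu>: "0 < \<mu>" shows "(\<integral>t. Fd t \<partial>exp_law \<mu>) = 1 / Re (string.Dfun (of_real \<mu>))"
proof -
  interpret E: prob_space "exp_law \<mu>" by (rule exp_law_prob[OF \<mu>])
  have 1: "(\<lambda>n. PX.N \<mu> (bump n) 0) \<longlonglongrightarrow> (\<integral>t. Fd t \<partial>exp_law \<mu>)"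
    unfolding PX.N_def
  proof (rule integral_dominated_convergence[where w="\<lambda>_. M r / M (r / 2)"])
    show "AE t in exp_law \<mu>. (\<lambda>n. PX.T t (bump n) 0) \<longlonglongrightarrow> Fd t" using T_bump_lim by simp
    show "AE t in exp_law \<mu>. norm (PX.T t (bump n) 0) \<le> M r / M (r / 2)" for n
    proof (rule AE_I2)
      fix t
      show "norm (PX.T t (bump n) 0) \<le> M r / M (r / 2)"
        unfolding T_link'[OF bump_props(1)] real_norm_def
        by (rule PD.T_abs_le[OF PD.cont_bm[OF link_cont[OF bump_props(1)]] link_bump(3)]) (use r_ge in auto)
    qed
    show "(\<lambda>t. PX.T t (bump n) 0) \<in> borel_measurable (exp_law \<mu>)" for n
      using PX.T_meas_t[OF bump_props(1), of 0 n] r_ge by simp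
  qed auto
  obtain K where K: "\<And>f g x1. string.resolvent_eq \<mu> f g \<Longrightarrow> (\<And>x. 0 \<le> x \<Longrightarrow> x \<le> r \<Longrightarrow> 0 \<le> f x \<and> 0 \<le> g x) \<Longrightarrow> string.mint f r = M r \<Longrightarrow>
    r / 2 \<le> x1 \<Longrightarrow> x1 < r \<Longrightarrow> (\<And>x. 0 \<le> x \<Longrightarrow> x \<le> x1 \<Longrightarrow> f x = 0) \<Longrightarrow> \<bar>g 0 * string.vv \<mu> x1 - M r\<bar> \<le> K * (M r - M x1)"
    using string.resolvent_eq_delta[OF \<mu>] by metis
  have est: "\<bar>PX.N \<mu> (bump n) 0 / \<mu> * string.vv \<mu> (bx n) - M r\<bar> \<le> K * (M r - M (bx n))" for n
  proof (rule K[OF resolvent_eq_N[OF \<mu> bump_props(1)]])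
    show "0 \<le> bump n x \<and> 0 \<le> PX.N \<mu> (bump n) x / \<mu>" for x
      using bump_props(2)[of n x] PX.N_nonneg[OF bump_props(1,2), of \<mu> n x] \<mu> by simp
  qed (use bump_props bx in auto)
  have at_bx: "(\<lambda>n. h (bx n)) \<longlonglongrightarrow> h r" if "continuous_on {0..r} h" for h :: "real \<Rightarrow> real"
    by (rule continuous_on_tendsto_compose[OF that bx(3)])
      (use r_ge bx(1,2) in \<open>auto intro!: always_eventually intro: order_trans[of 0 "r / 2"] less_imp_le\<close>)
  have vvlim: "(\<lambda>n. string.vv \<mu> (bx n)) \<longlonglongrightarrow> string.vv \<mu> r" by (rule at_bx[OF string.vv_cont])
  have Mlim: "(\<lambda>n. M (bx n)) \<longlonglongrightarrow> M r" by (rule at_bx[OF antideriv_onD(1)[OF M_antideriv]])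
  have "(\<lambda>n. K * (M r - M (bx n))) \<longlonglongrightarrow> K * (M r - M r)" by (rule tendsto_mult[OF tendsto_const tendsto_diff[OF tendsto_const Mlim]])
  then have "(\<lambda>n. PX.N \<mu> (bump n) 0 / \<mu> * string.vv \<mu> (bx n) - M r) \<longlonglongrightarrow> 0"
    by (intro Lim_null_comparison[where g="\<lambda>n. K * (M r - M (bx n))" and f="\<lambda>n. PX.N \<mu> (bump n) 0 / \<mu> * string.vv \<mu> (bx n) - M r"] always_eventually allI)
      (simp_all only: real_norm_def est diff_self mult_zero_right)
  then have lim: "(\<lambda>n. PX.N \<mu> (bump n) 0 / \<mu> * string.vv \<mu> (bx n)) \<longlonglongrightarrow> M r" by (simp add: LIM_zero_iff)
  have "(\<lambda>n. PX.N \<mu> (bump n) 0 / \<mu> * string.vv \<mu> (bx n)) \<longlonglongrightarrow> (\<integral>t. Fd t \<partial>exp_law \<mu>) / \<mu> * string.vv \<mu> r"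
    by (rule tendsto_mult[OF tendsto_divide[OF 1 tendsto_const] vvlim]) (use \<mu> in simp)
  then have "(\<integral>t. Fd t \<partial>exp_law \<mu>) / \<mu> * string.vv \<mu> r = M r" by (rule LIMSEQ_unique) (rule lim)
  note e = this
  have alg: "I * D = 1" if "I / \<mu> * v = c" "D * (\<mu> * c) = v" "0 < c" for I D v c :: real
  proof -
    have "I * D * c = c" using that(1) \<mu> unfolding that(2)[symmetric] by (simp add: mult_ac)
    then show ?thesis using that(3) by simp
  qed
  have "(\<integral>t. Fd t \<partial>exp_law \<mu>) * Re (string.Dfun (of_real \<mu>)) = 1"
    by (rule alg[OF e string.Dfun_vv string.Mr])
  moreover have "Re (string.Dfun (of_real \<mu>)) \<noteq> 0" using string.Dfun_pos[of \<mu>] \<mu> by auto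
  ultimately show ?thesis by (simp add: field_simps)
qed

end

text \<open>Half lines are increasing limits of continuous ramps. The test functions are clipped
  because the semigroup identities are available for clipped functions; on the common support this
  changes nothing.\<close>

lemma measure_eqI_continuous:
  fixes \<alpha> \<beta> :: "real measure" and r :: real
  assumes sets: "sets \<alpha> = sets borel" "sets \<beta> = sets borel" and fin: "finite_measure \<alpha>"
    and AE: "AE y in \<alpha>. 0 \<le> y \<and> y \<le> r" "AE y in \<beta>. 0 \<le> y \<and> y \<le> r"
    and eq: "\<And>g. continuous_on UNIV g \<Longrightarrow> (\<And>y. 0 \<le> g y) \<Longrightarrow> (\<integral>\<^sup>+y. ennreal (g (max 0 (min r y))) \<partial>\<alpha>) = (\<integral>\<^sup>+y. ennreal (g (max 0 (min r y))) \<partial>\<beta>)"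
  shows "\<alpha> = \<beta>"
proof (rule measure_eqI_lessThan[OF sets])
  fix a :: real
  interpret finite_measure \<alpha> by (rule fin)
  show "emeasure \<alpha> {a<..} < \<infinity>" using emeasure_finite[of "{a<..}"] by (simp only: infinity_ennreal_def less_top)
  define g where "g n y = min 1 (max 0 (real n * (y - a)))" for n y
  have g_cont: "continuous_on A (g n)" for A n unfolding g_def[abs_def] by (intro continuous_intros)
  have g_nn: "0 \<le> g n y" for n y by (simp add: g_def)
  have g_lim: "(\<lambda>n. g n y) \<longlonglongrightarrow> indicator {a<..} y" for y
  proof (cases "a < y")
    case True
    obtain N :: nat where N: "1 / (y - a) < real N" using reals_Archimedean2 by blast
    have "\<forall>\<^sub>F n in sequentially. g n y = 1"
      unfolding eventually_sequentially
    proof (intro exI allI impI)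
      fix n assume "N \<le> n"
      then have "1 / (y - a) < real n" using N by (simp add: less_le_trans)
      then have "1 < real n * (y - a)" using True by (simp add: divide_less_eq)
      then show "g n y = 1" by (simp add: g_def)
    qed
    then show ?thesis using True by (simp add: tendsto_eventually)
  next
    case False
    then have "g n y = 0" for n by (simp add: g_def mult_nonneg_nonpos)
    then show ?thesis using False by simp
  qed
  have g_inc: "incseq (\<lambda>n y. ennreal (g n (max 0 (min r y))))"
  proof (intro monoI le_funI ennreal_leI)
    fix i j :: nat and y :: real assume ij: "i \<le> j"
    show "g i (max 0 (min r y)) \<le> g j (max 0 (min r y))"
    proof (cases "a < max 0 (min r y)")
      case True
      then have "real i * (max 0 (min r y) - a) \<le> real j * (max 0 (min r y) - a)" using ij by (intro mult_right_mono) auto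
      then show ?thesis unfolding g_def by linarith
    next
      case False
      then have "real i * (max 0 (min r y) - a) \<le> 0" by (intro mult_nonneg_nonpos) linarith+
      then have "g i (max 0 (min r y)) = 0" unfolding g_def by linarith
      then show ?thesis using g_nn by simp
    qed
  qed
  have lim: "(\<lambda>n. \<integral>\<^sup>+y. ennreal (g n (max 0 (min r y))) \<partial>\<gamma>) \<longlonglongrightarrow> emeasure \<gamma> {a<..}"
    if s: "sets \<gamma> = sets borel" and A: "AE y in \<gamma>. 0 \<le> y \<and> y \<le> r" for \<gamma> :: "real measure"
  proof -
    have "(\<lambda>n. \<integral>\<^sup>+y. ennreal (g n (max 0 (min r y))) \<partial>\<gamma>) \<longlonglongrightarrow> (\<integral>\<^sup>+y. ennreal (indicator {a<..} (max 0 (min r y))) \<partial>\<gamma>)"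
    proof (rule nn_integral_LIMSEQ[OF g_inc])
      have "(\<lambda>y. g i (max 0 (min r y))) \<in> borel_measurable borel" for i
        by (intro borel_measurable_continuous_onI continuous_on_compose2[OF g_cont[of UNIV]] continuous_intros) auto
      then show "(\<lambda>y. ennreal (g i (max 0 (min r y)))) \<in> borel_measurable \<gamma>" for i
        by (simp add: measurable_cong_sets[OF s refl])
      show "(\<lambda>i. ennreal (g i (max 0 (min r y)))) \<longlonglongrightarrow> ennreal (indicator {a<..} (max 0 (min r y)))" for y
        by (rule tendsto_ennrealI[OF g_lim])
    qed
    also have "(\<integral>\<^sup>+y. ennreal (indicator {a<..} (max 0 (min r y))) \<partial>\<gamma>) = (\<integral>\<^sup>+y. indicator {a<..} y \<partial>\<gamma>)"
    proof (rule nn_integral_cong_AE)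
      show "AE y in \<gamma>. ennreal (indicator {a<..} (max 0 (min r y))) = indicator {a<..} y"
        using A by eventually_elim (simp add: indicator_def max_def)
    qed
    also have "\<dots> = emeasure \<gamma> {a<..}" using s by simp
    finally show ?thesis .
  qed
  show "emeasure \<alpha> {a<..} = emeasure \<beta> {a<..}"
    by (rule LIMSEQ_unique[OF lim[OF sets(1) AE(1)]]) (use lim[OF sets(2) AE(2)] eq[OF g_cont g_nn] in simp)
qed

section \<open>The density of the law at time t and its essential infimum\<close>

context dual_diffusion begin

text \<open>The density of the link at x > 0 with respect to the stationary law: the normalised
  indicator of (0, x). At x = 0 the link is a point mass, and the value 0 is a placeholder.\<close>

definition kern :: "real \<Rightarrow> real \<Rightarrow> real" where
  "kern y x = (if y < x \<and> 0 < x then M r / M x else 0)"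

text \<open>The kernel averaged over the law of the dual at time \<open>t\<close>.\<close>

definition dens :: "real \<Rightarrow> real \<Rightarrow> ennreal" where
  "dens t y = (\<integral>\<^sup>+x. ennreal (kern y (PD.clip x)) \<partial>transition Pd Xd t 0)"

lemma M_clip_meas[measurable]: "(\<lambda>x. M (PD.clip x)) \<in> borel_measurable borel"
  by (rule PD.meas_clip[OF antideriv_onD(1)[OF M_antideriv]])

lemma kern_meas: "(\<lambda>(y, x). ennreal (kern y (PD.clip x))) \<in> borel_measurable (borel \<Otimes>\<^sub>M borel)"
  unfolding kern_def by measurable

lemma kern_meas1: "(\<lambda>x. kern y (PD.clip x)) \<in> borel_measurable borel"
  unfolding kern_def by measurable

lemma kern_nonneg: "0 \<le> x \<Longrightarrow> x \<le> r \<Longrightarrow> 0 \<le> kern y x"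
  using M_ge[of x] string.Mr by (simp add: kern_def)

lemma kern_le:
  assumes y: "0 < y" "y < r" and x: "0 \<le> x" "x \<le> r" shows "\<bar>kern y x\<bar> \<le> M r / M y"
proof (cases "y < x \<and> 0 < x")
  case True
  have "M r / M x \<le> M r / M y"
    by (rule frac_le) (use True x y string.Mr string.M_pos[of y] M_mono[of y x] in auto)
  moreover have "0 \<le> M r / M x" using M_ge[OF x] string.Mr by simp
  ultimately show ?thesis using True by (simp add: kern_def)
next
  case False
  then show ?thesis using string.Mr string.M_pos[of y] y by (auto simp: kern_def)
qed

lemma kern_bm: "0 < y \<Longrightarrow> y < r \<Longrightarrow> PD.bm (kern y)"
  unfolding PD.bm_def using kern_meas1[of y] kern_le[of y] by (intro conjI exI[of _ "M r / M y"]) simp_all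

lemma kern_antimono: "0 \<le> x \<Longrightarrow> x \<le> r \<Longrightarrow> y \<le> z \<Longrightarrow> kern z x \<le> kern y x"
  using M_ge[of x] string.Mr by (auto simp: kern_def)

lemma dens_eq: assumes t: "0 \<le> t" and y: "0 < y" "y < r" shows "dens t y = ennreal (PD.T t (kern y) 0)"
proof -
  interpret \<rho>: prob_space "transition Pd Xd t 0" by (rule PD.transition_prob[OF t]) (use r_ge in auto)
  have "integrable (transition Pd Xd t 0) (\<lambda>x. kern y (PD.clip x))"
  proof (rule \<rho>.integrable_const_bound[where B="M r / M y"])
    show "AE x in transition Pd Xd t 0. norm (kern y (PD.clip x)) \<le> M r / M y"
      using kern_le[OF y] PD.clip_in by (intro AE_I2) auto
    show "(\<lambda>x. kern y (PD.clip x)) \<in> borel_measurable (transition Pd Xd t 0)"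
      using kern_meas1 by (simp add: measurable_cong_sets[OF PD.transition_sets(1) refl])
  qed
  then have "dens t y = ennreal (\<integral>x. kern y (PD.clip x) \<partial>transition Pd Xd t 0)"
    unfolding dens_def by (rule nn_integral_eq_integral) (use kern_nonneg PD.clip_in in \<open>auto intro!: AE_I2\<close>)
  then show ?thesis using PD.T_distr[OF t _ _ kern_meas1, of 0 y] r_ge by simp
qed

text \<open>For y < r the kernel takes the value 1 at x = r and is nonnegative elsewhere.\<close>

lemma dens_ge: assumes t: "0 \<le> t" and y: "0 < y" "y < r" shows "ennreal (Fd t) \<le> dens t y"
proof -
  have "Fd t \<le> PD.T t (kern y) 0" unfolding Fd_def
  proof (rule PD.T_mono[OF point_bm kern_bm[OF y]])
    fix x assume x: "0 \<le> x" "x \<le> r"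
    show "(if x = r then 1 else 0) \<le> kern y x"
      using kern_nonneg[OF x, of y] y string.Mr by (auto simp: kern_def)
  qed (use r_ge in auto)
  then show ?thesis by (simp add: dens_eq[OF t y] ennreal_leI)
qed

lemma dens_antimono: "0 \<le> t \<Longrightarrow> y \<le> z \<Longrightarrow> dens t z \<le> dens t y"
  unfolding dens_def using kern_antimono PD.clip_in by (intro nn_integral_mono ennreal_leI) auto

lemma bx_pos: "0 < bx n" using bx(1)[of n] r_pos by simp

text \<open>As y tends to \<open>r\<close> the kernel tends to the indicator of \<open>r\<close>,
  boundedly because \<open>M\<close> stays above \<open>M (r / 2)\<close>. Together with
  \<open>dens_ge\<close> and monotonicity in y this locates the infimum at the right end.\<close>

lemma dens_lim: assumes t: "0 \<le> t" shows "(\<lambda>n. dens t (bx n)) \<longlonglongrightarrow> ennreal (Fd t)"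
proof -
  have "(\<lambda>n. PD.T t (kern (bx n)) 0) \<longlonglongrightarrow> Fd t"
    unfolding Fd_def
  proof (rule PD.T_dominated[OF _ _ kern_bm[OF bx_pos bx(2)] point_meas, where B="M r / M (r / 2)"])
    show "\<bar>kern (bx n) x\<bar> \<le> M r / M (r / 2)" if x: "0 \<le> x" "x \<le> r" for n x
    proof -
      have "M r / M (bx n) \<le> M r / M (r / 2)"
        by (rule frac_le) (use bx(1,2)[of n] r_pos string.Mr string.M_pos[of "r / 2"] M_mono[of "r / 2" "bx n"] in auto)
      then show ?thesis using kern_le[OF bx_pos bx(2) x, of n] by simp
    qed
    show "(\<lambda>n. kern (bx n) x) \<longlonglongrightarrow> (if x = r then 1 else 0)" if x: "0 \<le> x" "x \<le> r" for x
    proof (cases "x = r")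
      case True
      then show ?thesis using bx(2) r_pos string.Mr by (simp add: kern_def)
    next
      case False
      then have "\<forall>\<^sub>F n in sequentially. x < bx n" using order_tendstoD(1)[OF bx(3), of x] x by simp
      then have "\<forall>\<^sub>F n in sequentially. kern (bx n) x = 0" by eventually_elim (simp add: kern_def)
      then show ?thesis using False by (simp add: tendsto_eventually)
    qed
  qed (use r_ge in auto)
  then show ?thesis unfolding dens_eq[OF t bx_pos bx(2)] by (rule tendsto_ennrealI)
qed

lemma dens_meas: assumes t: "0 \<le> t" shows "dens t \<in> borel_measurable borel"
proof -
  interpret \<rho>: prob_space "transition Pd Xd t 0" by (rule PD.transition_prob[OF t]) (use r_ge in auto)
  show ?thesis unfolding dens_def[abs_def]
  proof (rule \<rho>.borel_measurable_nn_integral)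
    show "(\<lambda>(y, x). ennreal (kern y (PD.clip x))) \<in> borel_measurable (borel \<Otimes>\<^sub>M transition Pd Xd t 0)"
      using kern_meas by (simp add: measurable_cong_sets[OF sets_pair_measure_cong[OF refl PD.transition_sets(1)] refl])
  qed
qed

lemma kern_link:
  assumes g: "continuous_on {0..r} g" "\<And>y. 0 \<le> y \<Longrightarrow> y \<le> r \<Longrightarrow> 0 \<le> g y" and x: "0 < x" "x \<le> r"
  shows "(\<integral>\<^sup>+y. ennreal (g (PX.clip y)) * ennreal (kern y x) \<partial>\<pi>) = ennreal (\<Lambda> g x)"
proof -
  have gm: "(\<lambda>y. ennreal (g (PX.clip y))) \<in> borel_measurable borel" using PX.meas_clip[OF g(1)] by measurable
  have dm: "(\<lambda>y. ennreal (stat_dens r a b y)) \<in> borel_measurable lborel"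
    using stat_dens_meas by (intro measurable_compose[OF _ measurable_ennreal]) simp
  have km: "(\<lambda>y. ennreal (kern y x)) \<in> borel_measurable borel" unfolding kern_def by measurable
  have Mx: "0 < M x" using string.M_pos[of x] x by simp
  have "(\<integral>\<^sup>+y. ennreal (g (PX.clip y)) * ennreal (kern y x) \<partial>\<pi>)
      = (\<integral>\<^sup>+y. ennreal (stat_dens r a b y) * (ennreal (g (PX.clip y)) * ennreal (kern y x)) \<partial>lborel)"
    unfolding stat_measure_def by (rule nn_integral_density[OF dm]) (use borel_measurable_times_ennreal[OF gm km] in simp)
  also have "\<dots> = (\<integral>\<^sup>+y. ennreal (indicator {0<..<x} y *\<^sub>R (m y * g y) / M x) \<partial>lborel)"
  proof (rule nn_integral_cong_AE, rule AE_mp[OF AE_lborel_singleton[of x]], rule AE_I2, rule impI)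
    fix y assume y: "y \<noteq> x"
    show "ennreal (stat_dens r a b y) * (ennreal (g (PX.clip y)) * ennreal (kern y x))
        = ennreal (indicator {0<..<x} y *\<^sub>R (m y * g y) / M x)"
    proof (cases "y \<in> {0<..<x}")
      case True
      have c: "PX.clip y = y" using True x by (intro PX.clip_id) auto
      have "0 \<le> g y" "0 \<le> kern y x" "0 \<le> m y" using g(2)[of y] kern_nonneg[of x y] m_pos[of y] True x by auto
      moreover have "stat_dens r a b y * (g y * kern y x) = m y * g y / M x"
        using True x Mx string.Mr by (simp add: stat_dens_eq kern_def)
      ultimately show ?thesis using True c stat_dens_nonneg[of y] by (simp add: ennreal_mult[symmetric] mult_nonneg_nonneg)
    next
      case False
      then show ?thesis using y x by (auto simp: kern_def stat_dens_eq)
    qed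
  qed
  also have "\<dots> = ennreal (\<integral>y. indicator {0<..<x} y *\<^sub>R (m y * g y) / M x \<partial>lborel)"
  proof (rule nn_integral_eq_integral)
    have "set_integrable lborel {0<..<x} (\<lambda>y. m y * g y)"
      by (rule set_integrable_subset[OF m_f_integrable[OF g(1)]]) (use x in auto)
    then show "integrable lborel (\<lambda>y. indicator {0<..<x} y *\<^sub>R (m y * g y) / M x)" by (simp add: set_integrable_def)
    show "AE y in lborel. 0 \<le> indicator {0<..<x} y *\<^sub>R (m y * g y) / M x"
    proof (rule AE_I2)
      fix y show "0 \<le> indicator {0<..<x} y *\<^sub>R (m y * g y) / M x"
        using m_pos[of y] g(2)[of y] x Mx by (cases "y \<in> {0<..<x}") (auto intro!: divide_nonneg_pos mult_nonneg_nonneg less_imp_le)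
    qed
  qed
  also have "\<dots> = ennreal (\<Lambda> g x)"
    using mint_LBINT[OF g(1), of x] x by (simp add: dual_link_eq[OF g(1) x] set_lebesgue_integral_def)
  finally show ?thesis .
qed

lemma dual_AE_pos: assumes t: "0 < t" shows "AE x in transition Pd Xd t 0. 0 < x \<and> x \<le> r"
proof -
  have t0: "0 \<le> t" using t by simp
  interpret \<rho>: prob_space "transition Pd Xd t 0" by (rule PD.transition_prob[OF t0]) (use r_ge in auto)
  have i: "integrable (transition Pd Xd t 0) (\<lambda>x. if PD.clip x = 0 then 1 else (0::real))"
  proof (rule \<rho>.integrable_const_bound[where B=1])
    show "(\<lambda>x. if PD.clip x = 0 then 1 else (0::real)) \<in> borel_measurable (transition Pd Xd t 0)"
      using point_meas[of 0 1] by (simp add: measurable_cong_sets[OF PD.transition_sets(1) refl])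
  qed auto
  have "(\<integral>x. (if PD.clip x = 0 then 1 else (0::real)) \<partial>transition Pd Xd t 0) = 0"
    using p0_eq_0[OF t] PD.T_distr[OF t0 _ _ point_meas[of 0 1], of 0] r_ge unfolding p0_def by simp
  then have "AE x in transition Pd Xd t 0. (if PD.clip x = 0 then 1 else (0::real)) = 0"
    using integral_nonneg_eq_0_iff_AE[OF i] by simp
  moreover have "AE x in transition Pd Xd t 0. 0 \<le> x \<and> x \<le> r" by (rule PD.transition_range[OF t0]) (use r_ge in auto)
  ultimately show ?thesis by eventually_elim (auto simp: PD.clip_id split: if_splits)
qed

text \<open>Tested against a continuous function, the law of X at \<open>t\<close> is the law of the
  dual applied to the link, and the link integrates the kernel. Positivity of \<open>t\<close>
  enters through the dual not being at 0, the one point where the kernel does not represent the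
  link.\<close>

lemma primal_law_density:
  assumes t: "0 < t" shows "density \<pi> (dens t) = transition P X t 0"
proof (rule measure_eqI_continuous[where r=r, symmetric])
  have t0: "0 \<le> t" using t by simp
  let ?\<rho> = "transition Pd Xd t 0" and ?\<nu> = "transition P X t 0"
  interpret \<rho>: prob_space ?\<rho> by (rule PD.transition_prob[OF t0]) (use r_ge in auto)
  interpret \<nu>: prob_space ?\<nu> by (rule PX.transition_prob[OF t0]) (use r_ge in auto)
  interpret \<pi>: prob_space \<pi> by (rule stat_prob)
  interpret pair_sigma_finite \<pi> ?\<rho> by unfold_locales
  have dm: "dens t \<in> borel_measurable \<pi>" using dens_meas[OF t0] by (simp add: measurable_cong_sets[OF stat_sets(1) refl])
  show "sets ?\<nu> = sets borel" "sets (density \<pi> (dens t)) = sets borel" by simp_all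
  show "finite_measure ?\<nu>" by unfold_locales
  show "AE y in ?\<nu>. 0 \<le> y \<and> y \<le> r" by (rule PX.transition_range[OF t0]) (use r_ge in auto)
  show "AE y in density \<pi> (dens t). 0 \<le> y \<and> y \<le> r"
    unfolding AE_density[OF dm] using stat_AE by eventually_elim simp
  fix g :: "real \<Rightarrow> real" assume g: "continuous_on UNIV g" "\<And>y. 0 \<le> g y"
  have gc: "continuous_on {0..r} g" using g(1) continuous_on_subset by blast
  have gm: "(\<lambda>y. g (PX.clip y)) \<in> borel_measurable borel" by (rule PX.meas_clip[OF gc])
  have eI: "(\<integral>\<^sup>+y. ennreal (h (PX.clip y)) \<partial>\<gamma>) = ennreal (\<integral>y. h (PX.clip y) \<partial>\<gamma>)"
    if p: "prob_space \<gamma>" and s: "sets \<gamma> = sets borel" and h: "continuous_on {0..r} h"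
      "\<And>x. 0 \<le> x \<Longrightarrow> x \<le> r \<Longrightarrow> 0 \<le> h x" for h :: "real \<Rightarrow> real" and \<gamma> :: "real measure"
  proof (rule nn_integral_eq_integral)
    interpret \<gamma>: prob_space \<gamma> by (rule p)
    obtain B where B: "\<And>x. 0 \<le> x \<Longrightarrow> x \<le> r \<Longrightarrow> \<bar>h x\<bar> \<le> B" using PX.cont_bounded[OF h(1)] by metis
    show "integrable \<gamma> (\<lambda>y. h (PX.clip y))"
    proof (rule \<gamma>.integrable_const_bound[where B=B])
      show "AE y in \<gamma>. norm (h (PX.clip y)) \<le> B" using B PX.clip_in by (intro AE_I2) auto
      show "(\<lambda>y. h (PX.clip y)) \<in> borel_measurable \<gamma>" using PX.meas_clip[OF h(1)] by (simp add: measurable_cong_sets[OF s refl])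
    qed
    show "AE y in \<gamma>. 0 \<le> h (PX.clip y)" using h(2) PX.clip_in by (intro AE_I2) auto
  qed
  have Lc: "continuous_on {0..r} (\<Lambda> g)" by (rule link_cont[OF gc])
  have "(\<integral>\<^sup>+y. ennreal (g (PX.clip y)) \<partial>?\<nu>) = ennreal (PX.T t g 0)"
    using eI[OF \<nu>.prob_space_axioms _ gc g(2)] PX.T_distr[OF t0 _ _ gm, of 0] r_ge by simp
  also have "\<dots> = ennreal (PD.T t (\<Lambda> g) 0)" by (simp add: T_link'[OF gc])
  also have "\<dots> = (\<integral>\<^sup>+x. ennreal (\<Lambda> g (PD.clip x)) \<partial>?\<rho>)"
    using eI[OF \<rho>.prob_space_axioms _ Lc link_nonneg[OF gc g(2)]] PD.T_distr[OF t0 _ _ PD.meas_clip[OF Lc], of 0] r_ge by simp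
  also have "\<dots> = (\<integral>\<^sup>+x. (\<integral>\<^sup>+y. ennreal (g (PX.clip y)) * ennreal (kern y (PD.clip x)) \<partial>\<pi>) \<partial>?\<rho>)"
  proof (rule nn_integral_cong_AE)
    show "AE x in ?\<rho>. ennreal (\<Lambda> g (PD.clip x)) = (\<integral>\<^sup>+y. ennreal (g (PX.clip y)) * ennreal (kern y (PD.clip x)) \<partial>\<pi>)"
      using dual_AE_pos[OF t]
    proof eventually_elim
      case (elim x)
      then have "PD.clip x = x" by (intro PD.clip_id) auto
      then show ?case using kern_link[OF gc g(2), of x] elim by simp
    qed
  qed
  also have "\<dots> = (\<integral>\<^sup>+y. (\<integral>\<^sup>+x. ennreal (g (PX.clip y)) * ennreal (kern y (PD.clip x)) \<partial>?\<rho>) \<partial>\<pi>)"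
  proof (rule Fubini')
    have "(\<lambda>p. ennreal (g (PX.clip (fst p)))) \<in> borel_measurable (borel \<Otimes>\<^sub>M borel)" using gm by measurable
    from borel_measurable_times_ennreal[OF this kern_meas]
    show "(\<lambda>(y, x). ennreal (g (PX.clip y)) * ennreal (kern y (PD.clip x))) \<in> borel_measurable (\<pi> \<Otimes>\<^sub>M ?\<rho>)"
      by (simp add: measurable_cong_sets[OF sets_pair_measure_cong[OF stat_sets(1) PD.transition_sets(1)] refl] case_prod_beta')
  qed
  also have "\<dots> = (\<integral>\<^sup>+y. dens t y * ennreal (g (PX.clip y)) \<partial>\<pi>)"
  proof (rule nn_integral_cong)
    fix y
    have "(\<lambda>x. ennreal (kern y (PD.clip x))) \<in> borel_measurable ?\<rho>"
      using measurable_compose[OF kern_meas1 measurable_ennreal] by (simp add: measurable_cong_sets[OF PD.transition_sets(1) refl])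
    then show "(\<integral>\<^sup>+x. ennreal (g (PX.clip y)) * ennreal (kern y (PD.clip x)) \<partial>?\<rho>) = dens t y * ennreal (g (PX.clip y))"
      by (simp add: nn_integral_cmult dens_def mult.commute)
  qed
  also have "\<dots> = (\<integral>\<^sup>+y. ennreal (g (PX.clip y)) \<partial>density \<pi> (dens t))"
    by (rule nn_integral_density[OF dm, symmetric])
      (use measurable_compose[OF gm measurable_ennreal] in \<open>simp add: measurable_cong_sets[OF stat_sets(1) refl]\<close>)
  finally show "(\<integral>\<^sup>+y. ennreal (g (max 0 (min r y))) \<partial>?\<nu>) = (\<integral>\<^sup>+y. ennreal (g (max 0 (min r y))) \<partial>density \<pi> (dens t))"
    unfolding PX.clip_def .
qed

lemma stat_interval_not_null: assumes "0 < c" "c < r" shows "\<not> (AE y in \<pi>. \<not> (c < y \<and> y < r))"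
proof
  assume A: "AE y in \<pi>. \<not> (c < y \<and> y < r)"
  have dm: "(\<lambda>y. ennreal (stat_dens r a b y)) \<in> borel_measurable lborel"
    using stat_dens_meas by (intro measurable_compose[OF _ measurable_ennreal]) simp
  have "AE y in lborel. 0 < ennreal (stat_dens r a b y) \<longrightarrow> \<not> (c < y \<and> y < r)"
    using A unfolding stat_measure_def by (simp only: AE_density[OF dm])
  then have "AE y in lborel. y \<notin> {c<..<r}"
  proof eventually_elim
    case (elim y)
    have "0 < stat_dens r a b y" if "c < y" "y < r"
      using m_pos[of y] that assms string.Mr by (simp add: stat_dens_eq)
    then show ?case using elim by auto
  qed
  then have "{c<..<r} \<in> null_sets lborel" by (subst AE_iff_null_sets) auto
  then show False using assms by (simp add: null_sets_def)
qed

theorem separation_eq: assumes t: "0 < t" shows "separation (transition P X t 0) \<pi> = 1 - Fd t"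
proof -
  have t0: "0 \<le> t" using t by simp
  interpret \<pi>: prob_space \<pi> by (rule stat_prob)
  have dm: "dens t \<in> borel_measurable \<pi>" using dens_meas[OF t0] by (simp add: measurable_cong_sets[OF stat_sets(1) refl])
  have "AE y in \<pi>. RN_deriv \<pi> (transition P X t 0) y = dens t y"
    using \<pi>.RN_deriv_unique[OF dm primal_law_density[OF t]] by eventually_elim simp
  then have "Liminf (ae_filter \<pi>) (RN_deriv \<pi> (transition P X t 0)) = Liminf (ae_filter \<pi>) (dens t)" by (rule Liminf_eq)
  also have "\<dots> = ennreal (Fd t)"
  proof (rule antisym)
    show "ennreal (Fd t) \<le> Liminf (ae_filter \<pi>) (dens t)"
      by (rule Liminf_bounded) (use stat_AE in eventually_elim, use dens_ge[OF t0] in auto)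
    show "Liminf (ae_filter \<pi>) (dens t) \<le> ennreal (Fd t)"
    proof (rule ccontr)
      assume "\<not> Liminf (ae_filter \<pi>) (dens t) \<le> ennreal (Fd t)"
      then obtain c where c: "ennreal (Fd t) < c" "c < Liminf (ae_filter \<pi>) (dens t)" using dense by (metis not_le)
      \<comment> \<open>The density decreases in y, so a value below \<open>c\<close> at
        \<open>bx n\<close> persists up to \<open>r\<close>, on a set of positive stationary
        mass.\<close>
      obtain n where n: "dens t (bx n) < c"
        using order_tendstoD(2)[OF dens_lim[OF t0] c(1)] by (auto simp: eventually_sequentially)
      have "AE y in \<pi>. \<not> (bx n < y \<and> y < r)"
        using less_LiminfD[OF c(2)]
      proof eventually_elim
        case (elim y)
        then show ?case using dens_antimono[OF t0, of "bx n" y] n by auto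
      qed
      then show False using stat_interval_not_null[OF bx_pos bx(2)] by blast
    qed
  qed
  finally show ?thesis using Fd_bounds(1)[of t] by (simp add: separation_def)
qed

text \<open>The point 0 is a null set of the stationary law, so no density exists and
  \<open>RN_deriv\<close> takes its default value 0.\<close>

theorem separation_0: "separation (transition P X 0 0) \<pi> = 1"
proof -
  interpret \<pi>: prob_space \<pi> by (rule stat_prob)
  have "RN_deriv \<pi> (transition P X 0 0) = (\<lambda>_. 0)"
  proof -
    have "density \<pi> f \<noteq> transition P X 0 0" if f: "f \<in> borel_measurable \<pi>" for f
    proof
      assume eq: "density \<pi> f = transition P X 0 0"
      have "AE y in density \<pi> f. y \<noteq> 0" unfolding AE_density[OF f] using stat_AE by eventually_elim simp
      then have 1: "AE y in transition P X 0 0. y \<noteq> 0" by (simp only: eq)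
      have "AE \<omega> in P 0. X 0 \<omega> \<noteq> 0"
        using 1 unfolding transition_def by (subst (asm) AE_distr_iff) (use PX.X_meas[of 0 0] r_ge in auto)
      moreover have "AE \<omega> in P 0. X 0 \<omega> = 0" by (rule PX.X_0) (use r_ge in auto)
      ultimately have "AE \<omega> in P 0. False" by eventually_elim simp
      then show False using prob_space.AE_False[OF PX.P_prob[of 0]] r_ge by simp
    qed
    then show ?thesis unfolding RN_deriv_def by (intro if_not_P) blast
  qed
  then show ?thesis using \<pi>.ae_filter_bot by (simp add: separation_def Liminf_const)
qed

end

section \<open>Cut-off\<close>

text \<open>If the inequality failed, monotonicity would make \<open>G - F\<close> positive on the
  whole interval from \<open>s\<close> to \<open>t\<close>. Used in both directions, it compares two
  monotone functions with equal transforms without any continuity.\<close>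

lemma laplace_monotone_sandwich:
  fixes F G :: "real \<Rightarrow> real"
  assumes meas: "F \<in> borel_measurable borel" "G \<in> borel_measurable borel"
    and bnd: "\<And>t. 0 \<le> F t \<and> F t \<le> 1" "\<And>t. 0 \<le> G t \<and> G t \<le> 1"
    and mono: "\<And>s t. 0 \<le> s \<Longrightarrow> s \<le> t \<Longrightarrow> F s \<le> F t" "\<And>s t. 0 \<le> s \<Longrightarrow> s \<le> t \<Longrightarrow> G s \<le> G t"
    and eq: "\<And>\<mu>. 0 < \<mu> \<Longrightarrow> (\<integral>t. F t \<partial>exp_law \<mu>) = (\<integral>t. G t \<partial>exp_law \<mu>)"
    and st: "0 \<le> s" "s < t"
  shows "G s \<le> F t"
proof (rule ccontr)
  assume "\<not> G s \<le> F t"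
  then have less: "F t < G s" by simp
  have int: "integrable (exp_law \<mu>) F" "integrable (exp_law \<mu>) G" if "0 < \<mu>" for \<mu>
    using exp_law_bounded_integrable[OF that meas(1), of 1] exp_law_bounded_integrable[OF that meas(2), of 1] bnd by simp_all
  show False
  proof (rule laplace_transform_zero[of "\<lambda>u. G u - F u" 2 s t])
    show "(\<lambda>u. G u - F u) \<in> borel_measurable borel" using meas by simp
    show "\<bar>G u - F u\<bar> \<le> 2" for u using bnd(1)[of u] bnd(2)[of u] by linarith
    show "(\<integral>u. G u - F u \<partial>exp_law \<mu>) = 0" if "0 < \<mu>" for \<mu> using int[OF that] eq[OF that] by simp
    show "0 < G u - F u" if "s \<le> u" "u \<le> t" for u
      using mono(1)[of u t] mono(2)[of s u] that st less by simp
  qed (use st in auto)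
qed

text \<open>One diffusion of the sequence: \<open>F\<close> and the distribution function of the sum
  interlace under strict shifts of time. Time 0 is kept apart because \<open>F\<close> describes the
  separation at positive times.\<close>

locale separation_profile = exponential_series M V l for M :: "'q measure" and V l +
  fixes F sp :: "real \<Rightarrow> real"
  assumes F_bounds: "0 \<le> F t" "F t \<le> 1"
    and F_le: "0 \<le> s \<Longrightarrow> s < t \<Longrightarrow> F s \<le> cdfS t"
    and F_ge: "0 \<le> s \<Longrightarrow> s < t \<Longrightarrow> cdfS s \<le> F t"
    and sp_0: "sp 0 = 1" and sp_eq: "0 < t \<Longrightarrow> sp t = 1 - F t"
begin

lemma sp_bounds: "0 \<le> t \<Longrightarrow> 0 \<le> sp t" "0 \<le> t \<Longrightarrow> sp t \<le> 1"
  using F_bounds[of t] sp_eq[of t] sp_0 by (cases "t = 0"; simp)+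

lemma tail_eq: "prob {\<omega>\<in>space M. t < S \<omega>} = 1 - cdfS t"
proof -
  have "{\<omega>\<in>space M. t < S \<omega>} = space M - {\<omega>\<in>space M. S \<omega> \<le> t}" by auto
  moreover have "{\<omega>\<in>space M. S \<omega> \<le> t} \<in> events" using S_integral(1) by measurable
  ultimately show ?thesis by (simp add: prob_compl cdfS_def)
qed

lemma tail_le: "1 - cdfS t \<le> prob {\<omega>\<in>space M. t \<le> S \<omega>}"
  unfolding tail_eq[symmetric] using S_integral(1) by (intro finite_measure_mono) (auto intro: less_imp_le)

text \<open>Cantelli's bound is taken at a slightly smaller \<open>c'\<close> to pay for the shift
  of time, and then \<open>c'\<close> increases to \<open>c\<close>; the bound is continuous in
  \<open>c'\<close>.\<close>

lemma sp_upper: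
  assumes c: "0 < c" shows "sp ((1 + c) * ES) \<le> 1 / (1 + c\<^sup>2 * l 0 * ES)"
proof (rule tendsto_lowerbound)
  have nn: "0 \<le> c'\<^sup>2 * l 0 * ES" for c' using l_pos[of 0] ES_pos by simp
  show "((\<lambda>c'. 1 / (1 + c'\<^sup>2 * l 0 * ES)) \<longlongrightarrow> 1 / (1 + c\<^sup>2 * l 0 * ES)) (at_left c)"
    using nn[of c] by (intro tendsto_intros) auto
  show "\<forall>\<^sub>F c' in at_left c. sp ((1 + c) * ES) \<le> 1 / (1 + c'\<^sup>2 * l 0 * ES)"
    using eventually_at_left_real[OF c]
  proof eventually_elim
    case (elim c')
    have "sp ((1 + c) * ES) = 1 - F ((1 + c) * ES)" using c ES_pos by (intro sp_eq) simp
    also have "\<dots> \<le> 1 - cdfS ((1 + c') * ES)" using F_ge[of "(1 + c') * ES" "(1 + c) * ES"] elim ES_pos by simp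
    also have "\<dots> \<le> prob {\<omega>\<in>space M. (1 + c') * ES \<le> S \<omega>}" by (rule tail_le)
    also have "\<dots> \<le> 1 / (1 + c'\<^sup>2 * l 0 * ES)" using elim by (intro upper_tail) simp
    finally show ?case .
  qed
qed simp

lemma sp_lower:
  assumes c: "0 < c" "c \<le> 1" shows "1 - 1 / (1 + c\<^sup>2 * l 0 * ES) \<le> sp ((1 - c) * ES)"
\<comment> \<open>For \<open>c = 1\<close> the time is 0 and the separation is 1 by
  \<open>sp_0\<close>; the comparison with \<open>F\<close> covers positive times.\<close>
proof (cases "c = 1")
  case True
  then show ?thesis using sp_0 l_pos[of 0] ES_pos by simp
next
  case False
  show ?thesis
  proof (rule tendsto_upperbound)
    have nn: "0 \<le> c'\<^sup>2 * l 0 * ES" for c' using l_pos[of 0] ES_pos by simp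
    show "((\<lambda>c'. 1 - 1 / (1 + c'\<^sup>2 * l 0 * ES)) \<longlongrightarrow> 1 - 1 / (1 + c\<^sup>2 * l 0 * ES)) (at_left c)"
      using nn[of c] by (intro tendsto_intros) auto
    show "\<forall>\<^sub>F c' in at_left c. 1 - 1 / (1 + c'\<^sup>2 * l 0 * ES) \<le> sp ((1 - c) * ES)"
      using eventually_at_left_real[OF c(1)]
    proof eventually_elim
      case (elim c')
      have "sp ((1 - c) * ES) = 1 - F ((1 - c) * ES)" using c False ES_pos by (intro sp_eq) simp
      moreover have "F ((1 - c) * ES) \<le> cdfS ((1 - c') * ES)" using elim c ES_pos by (intro F_le) auto
      moreover have "cdfS ((1 - c') * ES) \<le> 1 / (1 + c'\<^sup>2 * l 0 * ES)"
        unfolding cdfS_def using elim by (intro lower_tail) simp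
      ultimately show ?case by simp
    qed
  qed simp
qed

text \<open>The sum exceeds its slowest summand, which has an exponential tail. The times
  \<open>3 / 2 * t\<close> here and \<open>t / 2\<close> in \<open>sp_le_markov\<close> are those
  that a cut-off at \<open>t\<close> controls for \<epsilon> = 1/2; the gaps to \<open>2 * t\<close>
  and \<open>t / 4\<close> leave room for the shift.\<close>

lemma sp_ge_exp: assumes t: "0 \<le> t" shows "exp (- (2 * (l 0 * t))) \<le> sp (3 / 2 * t)"
proof (cases "t = 0")
  case False
  then have "sp (3 / 2 * t) = 1 - F (3 / 2 * t)" using t by (intro sp_eq) simp
  moreover have "F (3 / 2 * t) \<le> cdfS (2 * t)" using False t by (intro F_le) auto
  ultimately show ?thesis using tail_ge[of "2 * t"] tail_eq[of "2 * t"] t by (simp add: mult_ac)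
qed (simp add: sp_0)

lemma sp_le_markov: assumes t: "0 \<le> t" shows "t * sp (t / 2) \<le> 4 * ES"
proof (cases "t = 0")
  case False
  then have "sp (t / 2) = 1 - F (t / 2)" using t by (intro sp_eq) simp
  moreover have "cdfS (t / 4) \<le> F (t / 2)" using False t by (intro F_ge) auto
  ultimately have "sp (t / 2) \<le> ES / (t / 4)" using tail_le[of "t / 4"] markov_tail[of "t / 4"] False t by simp
  then show ?thesis using False t by (simp add: field_simps)
qed (use ES_pos in simp)

end

text \<open>Necessity combines two opposite facts at a cut-off time t: separation tending to 0
  shortly after t forces \<lambda> t to infinity by \<open>expo\<close>, while separation near 1
  shortly before t bounds t by a multiple of the mean by \<open>markov\<close>.\<close>

lemma cutoff_iff:
  fixes sp :: "nat \<Rightarrow> real \<Rightarrow> real" and l ES :: "nat \<Rightarrow> real"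
  assumes pos: "\<And>n. 0 < l n" "\<And>n. 0 < ES n"
    and bnd: "\<And>n t. 0 \<le> t \<Longrightarrow> 0 \<le> sp n t" "\<And>n t. 0 \<le> t \<Longrightarrow> sp n t \<le> 1"
    and upper: "\<And>n c. 0 < c \<Longrightarrow> sp n ((1 + c) * ES n) \<le> 1 / (1 + c\<^sup>2 * l n * ES n)"
    and lower: "\<And>n c. 0 < c \<Longrightarrow> c \<le> 1 \<Longrightarrow> 1 - 1 / (1 + c\<^sup>2 * l n * ES n) \<le> sp n ((1 - c) * ES n)"
    and expo: "\<And>n t. 0 \<le> t \<Longrightarrow> exp (- (2 * (l n * t))) \<le> sp n (3 / 2 * t)"
    and markov: "\<And>n t. 0 \<le> t \<Longrightarrow> t * sp n (t / 2) \<le> 4 * ES n"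
  shows "filterlim (\<lambda>n. l n * ES n) at_top sequentially \<Longrightarrow> cutoff_at sp ES"
    and "cutoff_at sp t \<Longrightarrow> filterlim (\<lambda>n. l n * ES n) at_top sequentially"
proof -
  assume lim: "filterlim (\<lambda>n. l n * ES n) at_top sequentially"
  show "cutoff_at sp ES"
    unfolding cutoff_at_def
  proof (intro conjI allI ballI)
    show "0 \<le> ES n" for n using pos(2)[of n] by simp
    fix \<epsilon> :: real assume e: "\<epsilon> \<in> {0<..<1}"
    have "filterlim (\<lambda>n. \<epsilon>\<^sup>2 * (l n * ES n)) at_top sequentially"
      by (rule filterlim_tendsto_pos_mult_at_top[OF tendsto_const _ lim]) (use e in auto)
    then have "filterlim (\<lambda>n. 1 + \<epsilon>\<^sup>2 * (l n * ES n)) at_top sequentially"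
      by (rule filterlim_tendsto_add_at_top[OF tendsto_const])
    then have z: "(\<lambda>n. 1 / (1 + \<epsilon>\<^sup>2 * l n * ES n)) \<longlonglongrightarrow> 0"
      by (intro tendsto_divide_0[OF tendsto_const] filterlim_at_top_imp_at_infinity) (simp add: mult.assoc)
    show "(\<lambda>n. sp n ((1 + \<epsilon>) * ES n)) \<longlonglongrightarrow> 0"
    proof (rule tendsto_sandwich[OF _ _ tendsto_const z])
      show "\<forall>\<^sub>F n in sequentially. 0 \<le> sp n ((1 + \<epsilon>) * ES n)" using bnd(1) pos(2) e by (simp add: less_imp_le)
      show "\<forall>\<^sub>F n in sequentially. sp n ((1 + \<epsilon>) * ES n) \<le> 1 / (1 + \<epsilon>\<^sup>2 * l n * ES n)" using upper e by simp
    qed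
    have o: "(\<lambda>n. 1 - 1 / (1 + \<epsilon>\<^sup>2 * l n * ES n)) \<longlonglongrightarrow> 1" using tendsto_diff[OF tendsto_const z, of 1] by simp
    show "(\<lambda>n. sp n ((1 - \<epsilon>) * ES n)) \<longlonglongrightarrow> 1"
    proof (rule tendsto_sandwich[OF _ _ o tendsto_const])
      show "\<forall>\<^sub>F n in sequentially. 1 - 1 / (1 + \<epsilon>\<^sup>2 * l n * ES n) \<le> sp n ((1 - \<epsilon>) * ES n)" using lower e by simp
      show "\<forall>\<^sub>F n in sequentially. sp n ((1 - \<epsilon>) * ES n) \<le> 1" using bnd(2) pos(2) e by (simp add: less_imp_le)
    qed
  qed
next
  assume cut: "cutoff_at sp t"
  have t: "0 \<le> t n" for n using cut by (simp add: cutoff_at_def)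
  have half: "(\<lambda>n. sp n ((1 + \<epsilon>) * t n)) \<longlonglongrightarrow> 0 \<and> (\<lambda>n. sp n ((1 - \<epsilon>) * t n)) \<longlonglongrightarrow> 1" if "\<epsilon> = 1/2" for \<epsilon>
    using cut that unfolding cutoff_at_def by simp
  have h: "(\<lambda>n. sp n (3 / 2 * t n)) \<longlonglongrightarrow> 0" "(\<lambda>n. sp n (t n / 2)) \<longlonglongrightarrow> 1" using half[OF refl] by simp_all
  have e0: "(\<lambda>n. exp (- (2 * (l n * t n)))) \<longlonglongrightarrow> 0"
    by (rule tendsto_sandwich[OF _ _ tendsto_const h(1)]) (use expo t in auto)
  show "filterlim (\<lambda>n. l n * ES n) at_top sequentially"
    unfolding filterlim_at_top
  proof
    \<comment> \<open>Separation above 1/2 at \<open>t n / 2\<close> turns \<open>markov\<close>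
      into \<open>t n \<le> 8 * ES n\<close>, hence the factor 8.\<close>
    fix Z :: real
    have "\<forall>\<^sub>F n in sequentially. exp (- (2 * (l n * t n))) < exp (- (2 * (8 * Z)))" by (rule order_tendstoD(2)[OF e0]) simp
    moreover have "\<forall>\<^sub>F n in sequentially. 1 / 2 < sp n (t n / 2)" by (rule order_tendstoD(1)[OF h(2)]) simp
    ultimately show "\<forall>\<^sub>F n in sequentially. Z \<le> l n * ES n"
    proof eventually_elim
      case (elim n)
      have "t n * (1 / 2) \<le> t n * sp n (t n / 2)" using elim(2) t[of n] by (intro mult_left_mono) auto
      then have "t n / 8 \<le> ES n" using markov[OF t[of n], of n] by simp
      then have "l n * (t n / 8) \<le> l n * ES n" using pos(1)[of n] by (intro mult_left_mono) auto
      moreover have "8 * Z < l n * t n" using elim(1) by simp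
      ultimately show ?case by simp
    qed
  qed
qed

lemma (in prob_space) indep_vars_shift:
  assumes "indep_vars (\<lambda>_. borel) W {1..}"
  shows "indep_vars (\<lambda>_. borel) (\<lambda>j. W (Suc j)) UNIV"
proof -
  have W: "\<And>i. i \<in> {1..} \<Longrightarrow> random_variable borel (W i)"
      "indep_sets (\<lambda>i. {W i -` A \<inter> space M | A. A \<in> sets borel}) {1..}"
    using assms unfolding indep_vars_def2 by auto
  show ?thesis
    unfolding indep_vars_def2
  proof (intro conjI ballI indep_setsI)
    show "random_variable borel (W (Suc i))" for i by (rule W(1)) simp
    show "{W (Suc i) -` A \<inter> space M |A. A \<in> sets borel} \<subseteq> events" for i
      using measurable_sets[OF W(1)[of "Suc i"]] by auto
    fix A :: "nat \<Rightarrow> 'a set" and J :: "nat set"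
    assume J: "J \<noteq> {}" "J \<subseteq> UNIV" "finite J" and A: "\<forall>j\<in>J. A j \<in> {W (Suc j) -` A \<inter> space M |A. A \<in> sets borel}"
    have "prob (\<Inter>j\<in>Suc ` J. A (j - 1)) = (\<Prod>j\<in>Suc ` J. prob (A (j - 1)))"
      by (rule indep_setsD[OF W(2)]) (use J A in auto)
    then show "prob (\<Inter>j\<in>J. A j) = (\<Prod>j\<in>J. prob (A j))" by (simp add: prod.reindex)
  qed
qed

theorem theorem6p4:
  fixes r :: "nat \<Rightarrow> real" and a b :: "nat \<Rightarrow> real \<Rightarrow> real"
    and P :: "nat \<Rightarrow> real \<Rightarrow> 'w measure" and X :: "nat \<Rightarrow> real \<Rightarrow> 'w \<Rightarrow> real"
    and Pd :: "nat \<Rightarrow> real \<Rightarrow> 'd measure" and Xd :: "nat \<Rightarrow> real \<Rightarrow> 'd \<Rightarrow> real"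
    and Pi0d :: "nat \<Rightarrow> real measure"
    and lam :: "nat \<Rightarrow> nat \<Rightarrow> real"
    and Q :: "nat \<Rightarrow> 'q measure" and W :: "nat \<Rightarrow> nat \<Rightarrow> 'q \<Rightarrow> real"
    and sep :: "nat \<Rightarrow> real \<Rightarrow> real" and EW :: "nat \<Rightarrow> real"
  assumes diffusion: "\<And>n. regular_diffusion (r n) (a n) (b n) (P n) (X n)"
    and left: "\<And>n. reflecting_left (r n) (a n) (b n) (P n) (X n) \<or> entrance_left (r n) (a n) (b n)"
    and right: "\<And>n. reflecting_right (r n) (a n) (b n) (P n) (X n)"
    and dual: "\<And>n. strong_stationary_dual (r n) (a n) (b n) (P n) (X n) (return borel 0)
                      (Pd n) (Xd n) (Pi0d n)"
    and lam_mono: "\<And>n. strict_mono_on {1..} (lam n)"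
    and lam_eigen: "\<And>n. lam n ` {1..} = {l. 0 < l \<and> is_eigenvalue (r n) (a n) (b n) l}"
    and Q_prob: "\<And>n. prob_space (Q n)"
    and W_indep: "\<And>n. prob_space.indep_vars (Q n) (\<lambda>_. borel) (W n) {1..}"
    and W_exp: "\<And>n j. 1 \<le> j \<Longrightarrow> distributed (Q n) lborel (W n j) (exponential_density (lam n j))"
  defines "sep \<equiv> \<lambda>n t. separation (transition (P n) (X n) t 0) (stat_measure (r n) (a n) (b n))"
    and "EW \<equiv> \<lambda>n. \<integral>\<omega>. series_sum (W n) \<omega> \<partial>Q n"
  shows
    "(\<forall>n. (AE \<omega> in Q n. summable (\<lambda>j. W n (Suc j) \<omega>)) \<and> integrable (Q n) (series_sum (W n)) \<and>
          (\<lambda>j. 1 / lam n (Suc j)) sums EW n) \<and>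
     ((\<exists>t. cutoff_at sep t) \<longleftrightarrow> filterlim (\<lambda>n. lam n 1 * EW n) at_top sequentially) \<and>
     (filterlim (\<lambda>n. lam n 1 * EW n) at_top sequentially \<longrightarrow> cutoff_at sep EW) \<and>
     (\<forall>c>0. \<forall>n. sep n ((1 + c) * EW n) \<le> 1 / (1 + c\<^sup>2 * lam n 1 * EW n)) \<and>
     (\<forall>c>0. c \<le> 1 \<longrightarrow>
        (\<forall>n. sep n ((1 - c) * EW n) \<ge> 1 - 1 / (1 + c\<^sup>2 * lam n 1 * EW n)))"
proof -
  define ll where "ll n j = lam n (Suc j)" for n j
  have ll_mono: "strict_mono (ll n)" for n
    using lam_mono[of n] unfolding strict_mono_on_def strict_mono_def ll_def by simp
  have ll_range: "range (ll n) = {x. 0 < x \<and> is_eigenvalue (r n) (a n) (b n) x}" for n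
  proof -
    have "range (ll n) = lam n ` range Suc" by (auto simp: ll_def[abs_def])
    also have "range Suc = {1..}"
    proof (intro equalityI subsetI)
      fix x :: nat assume "x \<in> {1..}"
      then have "x = Suc (x - 1)" by simp
      then show "x \<in> range Suc" by (rule range_eqI)
    qed auto
    finally show ?thesis using lam_eigen by simp
  qed
  have DD: "dual_diffusion (r n) (a n) (b n) (P n) (X n) (Pd n) (Xd n)" for n
  proof -
    note R = diffusion[of n, unfolded regular_diffusion_def] and D = dual[of n, unfolded strong_stationary_dual_def]
    show ?thesis
    proof (unfold_locales)
      show "diffusion_coeffs (r n) (a n) (b n)" using R by (rule conjunct1)
      then show "0 < r n" by (simp add: diffusion_coeffs_def)
      \<comment> \<open>Both alternatives for the left boundary contain this condition.\<close>
      show "N_left (r n) (a n) (b n) < \<infinity>"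
        using left[of n] unfolding reflecting_left_def regular_left_def entrance_left_def by (elim disjE conjE)
      show "regular_right (r n) (a n) (b n)" using right[of n] unfolding reflecting_right_def by (rule conjunct1)
      show "feller_diffusion (r n) (P n) (X n)" using R by (elim conjE)
      show "feller_diffusion (r n) (Pd n) (Xd n)" using D by (rule conjunct1)
      show "diffusion_graph (r n) (a n) (b n) (reflecting_left (r n) (a n) (b n) (P n) (X n))
          (reflecting_right (r n) (a n) (b n) (P n) (X n)) f g" if "inf_generator (r n) (P n) (X n) f g" for f g
        using R that by simp
      show "inf_generator (r n) (Pd n) (Xd n) (dual_link (r n) (a n) (b n) f) (dual_link (r n) (a n) (b n) g)"
        if "inf_generator (r n) (P n) (X n) f g" for f g
        using D that by simp
    qed (use left[of n] right[of n] in simp_all)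
  qed
  have ES: "exponential_series (Q n) (\<lambda>j. W n (Suc j)) (ll n)" for n
  proof -
    interpret dual_diffusion "r n" "a n" "b n" "P n" "X n" "Pd n" "Xd n" by (rule DD)
    interpret Qn: prob_space "Q n" by (rule Q_prob)
    show ?thesis
    proof unfold_locales
      show "Qn.indep_vars (\<lambda>_. borel) (\<lambda>j. W n (Suc j)) UNIV" by (rule Qn.indep_vars_shift[OF W_indep])
      show "distributed (Q n) lborel (W n (Suc j)) (exponential_density (ll n j))" for j
        unfolding ll_def by (rule W_exp) simp
      show "0 < ll n j" for j using ll_range[of n] by blast
      show "ll n 0 \<le> ll n j" for j using strict_mono_less_eq[OF ll_mono, of n 0 j] by simp
      show "summable (\<lambda>j. 1 / ll n j)" by (rule eigenvalue_summable[OF ll_mono ll_range])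
    qed
  qed
  have SP: "separation_profile (Q n) (\<lambda>j. W n (Suc j)) (ll n) (dual_diffusion.Fd (r n) (Pd n) (Xd n)) (sep n)" for n
  proof -
    interpret D: dual_diffusion "r n" "a n" "b n" "P n" "X n" "Pd n" "Xd n" by (rule DD)
    interpret E: exponential_series "Q n" "\<lambda>j. W n (Suc j)" "ll n" by (rule ES)
    \<comment> \<open>The product over the eigenvalues is the characteristic function on one side
      and the reciprocal Laplace transform of the exponential series on the other; this is where
      diffusion and series meet.\<close>
    have eq: "(\<integral>t. D.Fd t \<partial>exp_law \<mu>) = (\<integral>t. E.cdfS t \<partial>exp_law \<mu>)" if \<mu>: "0 < \<mu>" for \<mu>
    proof -
      have "1 \<le> Re (D.string.Dfun (of_real \<mu>))" by (rule D.string.Dfun_pos) (use \<mu> in simp)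
      then have "(\<lambda>k. inverse (\<Prod>j<k. 1 + \<mu> / ll n j)) \<longlonglongrightarrow> inverse (Re (D.string.Dfun (of_real \<mu>)))"
        by (intro tendsto_inverse D.eigenvalue_product[OF ll_mono ll_range]) simp
      then have "(\<lambda>k. \<Prod>j<k. 1 / (1 + \<mu> / ll n j)) \<longlonglongrightarrow> inverse (Re (D.string.Dfun (of_real \<mu>)))"
        by (simp add: inverse_eq_divide prod_dividef)
      then have "E.expectation (\<lambda>\<omega>. exp (- (\<mu> * E.S \<omega>))) = inverse (Re (D.string.Dfun (of_real \<mu>)))"
        by (rule LIMSEQ_unique[OF E.laplace_S[OF \<mu>]])
      then show ?thesis unfolding D.laplace_Fd[OF \<mu>] E.laplace_cdfS[OF \<mu>] by (simp add: inverse_eq_divide)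
    qed
    have Fm: "D.Fd s \<le> D.Fd t" if "0 \<le> s" "s \<le> t" for s t using D.Fd_mono[of s "t - s"] that by simp
    have Gb: "0 \<le> E.cdfS t \<and> E.cdfS t \<le> 1" for t by (simp add: E.cdfS_def)
    have Fb: "0 \<le> D.Fd t \<and> D.Fd t \<le> 1" for t using D.Fd_bounds by simp
    show ?thesis
    proof unfold_locales
      show "0 \<le> D.Fd t" "D.Fd t \<le> 1" for t using Fb by simp_all
      show "E.cdfS s \<le> D.Fd t" if "0 \<le> s" "s < t" for s t
        by (rule laplace_monotone_sandwich[OF D.Fd_meas E.cdfS_meas Fb Gb Fm E.cdfS_mono eq that])
      show "D.Fd s \<le> E.cdfS t" if "0 \<le> s" "s < t" for s t
        by (rule laplace_monotone_sandwich[OF E.cdfS_meas D.Fd_meas Gb Fb E.cdfS_mono Fm eq[symmetric] that])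
      show "sep n 0 = 1" unfolding sep_def by (rule D.separation_0)
      show "sep n t = 1 - D.Fd t" if "0 < t" for t unfolding sep_def by (rule D.separation_eq[OF that])
    qed
  qed
  note E = exponential_series.V_summable[OF ES] exponential_series.S_integral[OF ES]
  have S_eq: "exponential_series.S (\<lambda>j. W n (Suc j)) = series_sum (W n)" for n
    unfolding exponential_series.S_def[OF ES, abs_def] series_sum_def[abs_def] ..
  have ES_eq: "exponential_series.ES (ll n) = EW n" for n
    unfolding E(3)[symmetric] S_eq EW_def ..
  have sums: "(\<lambda>j. 1 / lam n (Suc j)) sums EW n" for n
    using summable_sums[OF exponential_series.l_sum[OF ES[of n]]]
    unfolding ES_eq[symmetric] exponential_series.ES_def[OF ES] by (simp only: ll_def)
  have l0: "ll n 0 = lam n 1" for n by (simp add: ll_def)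
  note rw = ES_eq l0
  have upper: "sep n ((1 + c) * EW n) \<le> 1 / (1 + c\<^sup>2 * lam n 1 * EW n)" if "0 < c" for n c
    using separation_profile.sp_upper[OF SP that] unfolding rw .
  have lower: "1 - 1 / (1 + c\<^sup>2 * lam n 1 * EW n) \<le> sep n ((1 - c) * EW n)" if "0 < c" "c \<le> 1" for n c
    using separation_profile.sp_lower[OF SP that] unfolding rw .
  have pos: "0 < lam n 1" "0 < EW n" for n
    using exponential_series.l_pos[OF ES, of n 0] exponential_series.ES_pos[OF ES, of n] unfolding rw by simp_all
  have cutoff_if: "filterlim (\<lambda>n. lam n 1 * EW n) at_top sequentially \<Longrightarrow> cutoff_at sep EW"
    and cutoff_only_if: "cutoff_at sep t \<Longrightarrow> filterlim (\<lambda>n. lam n 1 * EW n) at_top sequentially" for t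
    by ((rule cutoff_iff; (assumption | rule pos separation_profile.sp_bounds[OF SP] upper lower
        separation_profile.sp_ge_exp[OF SP, unfolded rw] separation_profile.sp_le_markov[OF SP, unfolded rw])+)+)
  show ?thesis
  proof (intro conjI allI impI)
    fix n
    show "AE \<omega> in Q n. summable (\<lambda>j. W n (Suc j) \<omega>)" by (rule E(1))
    show "integrable (Q n) (series_sum (W n))" using E(2)[of n] by (simp only: S_eq)
    show "(\<lambda>j. 1 / lam n (Suc j)) sums EW n" by (rule sums)
  next
    show "(\<exists>t. cutoff_at sep t) \<longleftrightarrow> filterlim (\<lambda>n. lam n 1 * EW n) at_top sequentially"
      using cutoff_if cutoff_only_if by blast
    show "cutoff_at sep EW" if "filterlim (\<lambda>n. lam n 1 * EW n) at_top sequentially" using that by (rule cutoff_if)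
    show "sep n ((1 + c) * EW n) \<le> 1 / (1 + c\<^sup>2 * lam n 1 * EW n)" if "0 < c" for c n using that by (rule upper)
    show "1 - 1 / (1 + c\<^sup>2 * lam n 1 * EW n) \<le> sep n ((1 - c) * EW n)" if "0 < c" "c \<le> 1" for c n using that by (rule lower)
  qed
qed

end
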